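(* Let $F$ be a non-archimedean local field of characteristic zero, $\mathrm{G}=\mathrm{GL}_{2n}$, $\mathrm{H}=\mathrm{GL}_n\times\mathrm{GL}_n$ (block diagonal), and $\mathrm{X}=\mathrm{G}/\mathrm{H}$, so that $\mathrm{X}(F)=\mathrm{G}(F)/\mathrm{H}(F)$ with base point $1$ (the image of the identity). Suppose $f\in C_c^\infty(\mathrm{X}(F))$ satisfies $f(1)\neq0$. Then there exists an $\mathrm{H}$-regular elliptic $y\in\mathrm{X}(F)$ such that $\mathrm{Orb}^{\mathrm{H}}(f,y)\neq0$.
   Context: $\mathrm{H}$ acts on $\mathrm{X}$ by left multiplication. $y\in\mathrm{X}(F)$ is $\mathrm{H}$-regular semisimple if the fibre through $y$ of the categorical quotient $\mathrm{X}\to\mathrm{X}/\!\!/\mathrm{H}$ consists of a single $\mathrm{H}(\overline F)$-orbit; it is $\mathrm{H}$-regular elliptic if moreover its stabilizer $\mathrm{H}_y$ (a torus) is anisotropic modulo the center of $\mathrm{G}$. The orbital integral is $\mathrm{Orb}^{\mathrm{H}}(f,y)=\int_{\mathrm{H}_y(F)\backslash\mathrm{H}(F)}f(h^{-1}\cdot y)\,dh$ for fixed Haar measures. *)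

theory Defs
  imports
    "HOL-Analysis.Analysis"
    "HOL-Algebra.Algebraic_Closure_Type"
    "HOL-Algebra.Left_Coset"
    "HOL-Algebra.Group_Action"
begin

section \<open>Non-archimedean local fields\<close>

text \<open>
  The metric is the one induced by an absolute value; it only serves to give the topology.
  Completeness, discreteness of the valuation and finiteness of the residue field follow from
  local compactness.
\<close>

class nonarch_local_field = field + metric_space +
  fixes absval :: "'a \<Rightarrow> real"
  assumes dist_absval: "dist x y = absval (x - y)"
    and absval_mult: "absval (x * y) = absval x * absval y"
    and absval_ultrametric: "absval (x + y) \<le> max (absval x) (absval y)"
    and absval_nontrivial: "\<exists>x. x \<noteq> 0 \<and> absval x \<noteq> 1"
    and locally_compact_0: "\<exists>e>0. compact {x. absval x \<le> e}"


section \<open>The groups and the symmetric space\<close>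

text \<open>
  Everything here is polymorphic in the field, so that the same constants give the points over
  \<open>F\<close> and over its algebraic closure. Matrices of size \<open>2n\<close> are indexed by \<open>'n + 'n\<close>,
  where \<open>n\<close> is the cardinality of \<open>'n\<close>.
\<close>

type_synonym ('k, 'n) mat2n = "'k ^ ('n + 'n) ^ ('n + 'n)"

definition GL :: "('k::field ^ 'm::finite ^ 'm) monoid" where
  "GL = \<lparr>carrier = {g. invertible g}, monoid.mult = (**), one = mat 1\<rparr>"

definition block_diag :: "'k::field ^ 'n::finite ^ 'n \<Rightarrow> 'k ^ 'n ^ 'n \<Rightarrow> ('k, 'n) mat2n" where
  "block_diag A B = (\<chi> i j. case (i, j) of
      (Inl a, Inl b) \<Rightarrow> A $ a $ b
    | (Inr a, Inr b) \<Rightarrow> B $ a $ b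
    | _ \<Rightarrow> 0)"

definition H_points :: "('k::field, 'n::finite) mat2n set" where
  "H_points = {block_diag A B | A B. invertible A \<and> invertible B}"

definition H_group :: "('k::field, 'n::finite) mat2n monoid" where
  "H_group = GL\<lparr>carrier := H_points\<rparr>"

lemma group_GL: "group GL"
proof (rule groupI)
  fix g :: "'a::field ^ 'b::finite ^ 'b"
  assume "g \<in> carrier GL"
  then show "\<exists>h\<in>carrier GL. h \<otimes>\<^bsub>GL\<^esub> g = \<one>\<^bsub>GL\<^esub>"
    unfolding GL_def invertible_def by auto
qed (auto simp: GL_def matrix_mul_assoc intro: invertible_mult exI[of _ "mat 1"]
    simp: invertible_def[of "mat 1"])

lemma block_diag_mult: "block_diag A B ** block_diag C D = block_diag (A ** C) (B ** D)"
  by (auto simp: vec_eq_iff matrix_matrix_mult_def block_diag_def UNIV_Plus_UNIV[symmetric]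
      sum.Plus simp del: UNIV_Plus_UNIV split: sum.split)

lemma block_diag_one: "block_diag (mat 1) (mat 1) = mat 1"
  by (auto simp: vec_eq_iff mat_def block_diag_def split: sum.split)

lemma subgroup_H_points: "subgroup H_points GL"
proof (rule group.subgroupI[OF group_GL])
  have inv: "block_diag A B ** block_diag A' B' = mat 1"
    if "A ** A' = mat 1" "B ** B' = mat 1" for A A' B B' :: "'a ^ 'b ^ 'b"
    using that by (simp add: block_diag_mult block_diag_one)
  show sub: "H_points \<subseteq> carrier (GL :: ('a, 'b) mat2n monoid)"
    unfolding H_points_def GL_def invertible_def using inv by fastforce
  show "H_points \<noteq> ({} :: ('a, 'b) mat2n set)"
    unfolding H_points_def by (auto simp: invertible_def intro!: exI[of _ "mat 1"])
  fix a b :: "('a, 'b) mat2n"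
  assume a: "a \<in> H_points"
  then obtain A B A' B' where AB: "a = block_diag A B" "A ** A' = mat 1" "A' ** A = mat 1"
      "B ** B' = mat 1" "B' ** B = mat 1"
    unfolding H_points_def invertible_def by blast
  have b: "block_diag A' B' \<in> H_points"
    unfolding H_points_def invertible_def using AB by blast
  have "inv\<^bsub>GL\<^esub> a = block_diag A' B'"
    using group.inv_equality[OF group_GL, of "block_diag A' B'" a] a b sub inv AB
    by (auto simp: GL_def)
  with b show "inv\<^bsub>GL\<^esub> a \<in> H_points"
    by simp
  assume "b \<in> H_points"
  with a show "a \<otimes>\<^bsub>GL\<^esub> b \<in> H_points"
    unfolding H_points_def GL_def by (simp add: block_diag_mult) (metis block_diag_mult invertible_mult)
qed

definition X_points :: "('k::field, 'n::finite) mat2n set set" where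
  "X_points = lcosets\<^bsub>GL\<^esub> H_points"

definition X_base :: "('k::field, 'n::finite) mat2n set" where
  "X_base = mat 1 <#\<^bsub>GL\<^esub> H_points"

abbreviation X_action ::
  "('k::field, 'n::finite) mat2n \<Rightarrow> ('k, 'n) mat2n set
     \<Rightarrow> ('k, 'n) mat2n set" where
  "X_action h y \<equiv> h <#\<^bsub>GL\<^esub> y"

text \<open>The inclusion of the \<open>F\<close>-points of \<open>X\<close> into the points over the algebraic closure.\<close>

definition X_to_ac ::
  "('k::field, 'n::finite) mat2n set \<Rightarrow> ('k alg_closure, 'n) mat2n set" where
  "X_to_ac y = (map_matrix to_ac ` y) <#>\<^bsub>GL\<^esub> H_points"


section \<open>Categorical quotient, regular semisimple and elliptic points\<close>

text \<open>
  Regular functions on the general linear group with coefficients in the subfield \<open>K\<close>, as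
  functions on points: polynomials with coefficients in \<open>K\<close> in the entries and the inverse of
  the determinant. Only their restriction to invertible matrices is meaningful.
\<close>

inductive_set regular_GL :: "'k::field set \<Rightarrow> ('k ^ 'm::finite ^ 'm \<Rightarrow> 'k) set" for K where
  const: "c \<in> K \<Longrightarrow> (\<lambda>g. c) \<in> regular_GL K"
| entry: "(\<lambda>g. g $ i $ j) \<in> regular_GL K"
| inverse_det: "(\<lambda>g. inverse (det g)) \<in> regular_GL K"
| add: "p \<in> regular_GL K \<Longrightarrow> q \<in> regular_GL K \<Longrightarrow> (\<lambda>g. p g + q g) \<in> regular_GL K"
| mult: "p \<in> regular_GL K \<Longrightarrow> q \<in> regular_GL K \<Longrightarrow> (\<lambda>g. p g * q g) \<in> regular_GL K"

text \<open>
  The coordinate ring of \<open>X = G/H\<close> consists of the right \<open>H\<close>-invariant regular functions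
  on \<open>G\<close>, i.e. of the functions on \<open>X\<close> whose pullback to \<open>G\<close> is regular.
\<close>

definition regular_X :: "(('k::field, 'n::finite) mat2n set \<Rightarrow> 'k) set" where
  "regular_X = {\<phi>. \<exists>p\<in>regular_GL UNIV. \<forall>g\<in>carrier GL. \<phi> (g <#\<^bsub>GL\<^esub> H_points) = p g}"

definition invariant_regular_X :: "(('k::field, 'n::finite) mat2n set \<Rightarrow> 'k) set" where
  "invariant_regular_X =
     {\<phi> \<in> regular_X. \<forall>h\<in>H_points. \<forall>x\<in>X_points. \<phi> (X_action h x) = \<phi> x}"

text \<open>
  For an algebraically closed field, the points of the spectrum of the ring of invariants are its
  homomorphisms to the field, and the quotient map sends a point to evaluation at that point.
\<close>

definition categorical_quotient ::
  "('k::alg_closed_field, 'n::finite) mat2n set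
     \<Rightarrow> (('k, 'n) mat2n set \<Rightarrow> 'k) \<Rightarrow> 'k" where
  "categorical_quotient x = (\<lambda>\<phi>\<in>invariant_regular_X. \<phi> x)"

definition H_regular_semisimple :: "('k::field, 'n::finite) mat2n set \<Rightarrow> bool" where
  "H_regular_semisimple y \<longleftrightarrow> y \<in> X_points \<and>
     {x \<in> X_points. categorical_quotient x = categorical_quotient (X_to_ac y)}
       = Group_Action.orbit H_group X_action (X_to_ac y)"

text \<open>
  \<open>S\<close> is the set of points over the algebraic closure of a closed subgroup of the general
  linear group defined over the perfect field \<open>F\<close>; its regular functions over \<open>F\<close> are the
  restrictions of those of the ambient group.
\<close>

definition rational_character ::
  "('k::field alg_closure ^ 'm::finite ^ 'm) set
     \<Rightarrow> ('k alg_closure ^ 'm ^ 'm \<Rightarrow> 'k alg_closure) \<Rightarrow> bool"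
  where
  "rational_character S \<psi> \<longleftrightarrow>
     (\<exists>p\<in>regular_GL (range to_ac). \<forall>s\<in>S. \<psi> s = p s) \<and>
     (\<forall>s\<in>S. \<psi> s \<noteq> 0) \<and>
     (\<forall>s\<in>S. \<forall>t\<in>S. \<psi> (s ** t) = \<psi> s * \<psi> t)"

definition GL_center :: "('k::field ^ 'm::finite ^ 'm) set" where
  "GL_center = {z \<in> carrier GL. \<forall>g\<in>carrier GL. z ** g = g ** z}"

text \<open>
  A torus over \<open>F\<close> is anisotropic if it has no non-trivial character defined over \<open>F\<close>; the
  characters of \<open>S\<close> modulo the center are those of \<open>S\<close> that are trivial on the center.
\<close>

definition anisotropic_mod_center :: "('k::field alg_closure ^ 'm::finite ^ 'm) set \<Rightarrow> bool" where
  "anisotropic_mod_center S \<longleftrightarrow>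
     (\<forall>\<psi>. rational_character S \<psi> \<and> (\<forall>z\<in>GL_center. \<psi> z = 1) \<longrightarrow> (\<forall>s\<in>S. \<psi> s = 1))"

definition H_regular_elliptic :: "('k::field, 'n::finite) mat2n set \<Rightarrow> bool" where
  "H_regular_elliptic y \<longleftrightarrow> H_regular_semisimple y \<and>
     anisotropic_mod_center (stabilizer H_group X_action (X_to_ac y))"


section \<open>Quotient topologies and test functions\<close>

definition quot_topology :: "'a topology \<Rightarrow> ('a \<Rightarrow> 'b) \<Rightarrow> 'b topology" where
  "quot_topology T \<pi> =
     topology (\<lambda>U. U \<subseteq> \<pi> ` topspace T \<and> openin T {x \<in> topspace T. \<pi> x \<in> U})"

lemma openin_quot_topology:
  "openin (quot_topology T \<pi>) U \<longleftrightarrow>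
     U \<subseteq> \<pi> ` topspace T \<and> openin T {x \<in> topspace T. \<pi> x \<in> U}"
proof -
  have "istopology (\<lambda>U. U \<subseteq> \<pi> ` topspace T \<and> openin T {x \<in> topspace T. \<pi> x \<in> U})"
    unfolding istopology_def
  proof (intro conjI allI impI)
    fix U V
    assume U: "U \<subseteq> \<pi> ` topspace T \<and> openin T {x \<in> topspace T. \<pi> x \<in> U}"
      and V: "V \<subseteq> \<pi> ` topspace T \<and> openin T {x \<in> topspace T. \<pi> x \<in> V}"
    show "U \<inter> V \<subseteq> \<pi> ` topspace T"
      using U by blast
    have "{x \<in> topspace T. \<pi> x \<in> U \<inter> V} =
        {x \<in> topspace T. \<pi> x \<in> U} \<inter> {x \<in> topspace T. \<pi> x \<in> V}"
      by blast
    then show "openin T {x \<in> topspace T. \<pi> x \<in> U \<inter> V}"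
      using U V by auto
  next
    fix \<K>
    assume K: "\<forall>U\<in>\<K>. U \<subseteq> \<pi> ` topspace T \<and> openin T {x \<in> topspace T. \<pi> x \<in> U}"
    show "\<Union>\<K> \<subseteq> \<pi> ` topspace T"
      using K by blast
    have "{x \<in> topspace T. \<pi> x \<in> \<Union>\<K>} = (\<Union>U\<in>\<K>. {x \<in> topspace T. \<pi> x \<in> U})"
      by blast
    then show "openin T {x \<in> topspace T. \<pi> x \<in> \<Union>\<K>}"
      using K by auto
  qed
  then show ?thesis
    by (simp add: quot_topology_def topology_inverse')
qed

lemma topspace_quot_topology: "topspace (quot_topology T \<pi>) = \<pi> ` topspace T"
proof
  show "topspace (quot_topology T \<pi>) \<subseteq> \<pi> ` topspace T"
    using openin_quot_topology[of T \<pi> "topspace (quot_topology T \<pi>)"] by simp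
  have "{x \<in> topspace T. \<pi> x \<in> \<pi> ` topspace T} = topspace T"
    by blast
  then have "openin (quot_topology T \<pi>) (\<pi> ` topspace T)"
    by (simp add: openin_quot_topology)
  then show "\<pi> ` topspace T \<subseteq> topspace (quot_topology T \<pi>)"
    by (rule openin_subset)
qed

definition X_topology :: "('k::nonarch_local_field, 'n::finite) mat2n set topology" where
  "X_topology = quot_topology (top_of_set (carrier GL)) (\<lambda>g. g <#\<^bsub>GL\<^esub> H_points)"

text \<open>
  \<open>C\<^sub>c\<^sup>\<infinity>(X(F))\<close>: locally constant complex functions of compact support. Values
  outside \<open>X(F)\<close> are irrelevant.
\<close>

definition Cc_infty_X :: "(('k::nonarch_local_field, 'n::finite) mat2n set \<Rightarrow> complex) set"
  where
  "Cc_infty_X = {f.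
     (\<forall>x\<in>X_points. \<exists>U. openin X_topology U \<and> x \<in> U \<and> (\<forall>u\<in>U. f u = f x)) \<and>
     compactin X_topology (X_topology closure_of {x \<in> X_points. f x \<noteq> 0})}"


section \<open>Haar measures and orbital integrals\<close>

definition borel_of_top :: "'a topology \<Rightarrow> 'a measure" where
  "borel_of_top T = sigma (topspace T) {U. openin T U}"

text \<open>
  \<open>S\<close> is a locally compact second countable group of matrices, so regularity of \<open>\<mu>\<close> is
  automatic from finiteness on compact sets.
\<close>

definition haar_measure ::
  "('k::nonarch_local_field ^ 'm::finite ^ 'm) set \<Rightarrow> ('k ^ 'm ^ 'm) measure \<Rightarrow> bool" where
  "haar_measure S \<mu> \<longleftrightarrow>
     sets \<mu> = sets (borel_of_top (top_of_set S)) \<and>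
     emeasure \<mu> S \<noteq> 0 \<and>
     (\<forall>C. compact C \<and> C \<subseteq> S \<longrightarrow> emeasure \<mu> C < \<infinity>) \<and>
     (\<forall>s\<in>S. \<forall>A\<in>sets \<mu>. emeasure \<mu> ((\<lambda>x. s ** x) ` A) = emeasure \<mu> A)"

text \<open>
  For a closed subgroup \<open>T\<close> of \<open>H(F)\<close>, the quotient of the Haar measure \<open>\<mu>\<close> of \<open>H(F)\<close> by the
  Haar measure \<open>\<tau>\<close> of \<open>T\<close> is the Radon measure on the space of right cosets of \<open>T\<close>
  characterised by Weil's integration formula. It exists and is unique if \<open>T\<close> is unimodular.
  The inner integral does not depend on the chosen representative of the coset.
\<close>

definition coset_topology ::
  "('k::nonarch_local_field, 'n::finite) mat2n set
     \<Rightarrow> ('k, 'n) mat2n set topology" where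
  "coset_topology T = quot_topology (top_of_set H_points) (\<lambda>h. T #>\<^bsub>H_group\<^esub> h)"

definition is_quotient_measure ::
  "('k::nonarch_local_field, 'n::finite) mat2n measure
     \<Rightarrow> ('k, 'n) mat2n set \<Rightarrow> ('k, 'n) mat2n measure
     \<Rightarrow> ('k, 'n) mat2n set measure \<Rightarrow> bool" where
  "is_quotient_measure \<mu> T \<tau> q \<longleftrightarrow>
     sets q = sets (borel_of_top (coset_topology T)) \<and>
     (\<forall>C. compactin (coset_topology T) C \<longrightarrow> emeasure q C < \<infinity>) \<and>
     (\<forall>\<phi> :: ('k, 'n) mat2n \<Rightarrow> complex.
        continuous_on H_points \<phi> \<and>
        (\<exists>C. compact C \<and> C \<subseteq> H_points \<and> (\<forall>h\<in>H_points - C. \<phi> h = 0)) \<longrightarrow>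
        (\<integral>h. \<phi> h \<partial>\<mu>) = (\<integral>R. (\<integral>t. \<phi> (t ** (SOME h. h \<in> R)) \<partial>\<tau>) \<partial>q))"

definition quotient_measure ::
  "('k::nonarch_local_field, 'n::finite) mat2n measure
     \<Rightarrow> ('k, 'n) mat2n set \<Rightarrow> ('k, 'n) mat2n measure
     \<Rightarrow> ('k, 'n) mat2n set measure" where
  "quotient_measure \<mu> T \<tau> = (SOME q. is_quotient_measure \<mu> T \<tau> q)"

text \<open>
  \<^term>\<open>orb_stab_fun H_group X_action R y\<close> is \<open>h\<^sup>-\<^sup>1 \<cdot> y\<close> for a representative \<open>h\<close> of the
  right coset \<open>R\<close> of the stabilizer, and is independent of that representative.
\<close>

definition orbital_integral ::
  "('k::nonarch_local_field, 'n::finite) mat2n measure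
     \<Rightarrow> ('k, 'n) mat2n measure
     \<Rightarrow> (('k, 'n) mat2n set \<Rightarrow> complex)
     \<Rightarrow> ('k, 'n) mat2n set \<Rightarrow> complex" where
  "orbital_integral \<mu> \<tau> f y =
     (\<integral>R. f (orb_stab_fun H_group X_action R y)
        \<partial>(quotient_measure \<mu> (stabilizer H_group X_action y) \<tau>))"

end

theory Submission
  imports Defs
begin

text \<open>
  Let \<open>\<Pi>\<close> be the companion matrix of \<open>T\<^sup>n - \<varpi>\<close>, a uniformizer of the totally ramified field \<open>E = F[\<Pi>]\<close>,
  let \<open>c = nk + 1\<close> and let \<open>y\<^sub>k\<close> be the point of \<open>X(F)\<close> represented by the block matrix with rows \<open>(1, 1)\<close> and
  \<open>(\<Pi>\<^sup>c, 1)\<close>. It is regular elliptic with stabilizer the diagonal torus \<open>E\<^sup>\<times>\<close>. If all its orbital integrals vanish, then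
  so do the sums of \<open>f\<close> over the cosets \<open>(a, b)\<close> of a small congruence subgroup with \<open>|det a| = 1\<close>, evaluated at
  the block matrices with rows \<open>(1, a\<^sup>-\<^sup>1b)\<close> and \<open>(b\<^sup>-\<^sup>1\<Pi>\<^sup>ca, 1)\<close>. A linear functional over the rationals makes
  the values of \<open>f\<close> integral.

  Let \<open>p\<close> be the residue characteristic. The element \<open>1 + p\<Pi>\<close> permutes the cosets with orbits of \<open>p\<close>-power length, so modulo
  \<open>p\<^sup>R\<^sup>+\<^sup>1\<close> only the pairs of lattices stable under \<open>z = (1 + p\<Pi>)\<^sup>q - 1\<close>, \<open>q = p\<^sup>R\<close>, contribute. As the
  valuation of \<open>z\<close> is prime to \<open>n\<close>, such lattices of a given volume are finite in number. Their number is
  prime to \<open>p\<close>, because \<open>1 + \<Pi>\<close> permutes them with a single fixed point. The contribution of the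
  stable pairs is an affine function of \<open>k\<close> for large \<open>k\<close>, whose slope is \<open>n f(1)\<close> times
  the square of the number of stable cosets; hence \<open>p\<^sup>R\<^sup>+\<^sup>1\<close> divides a fixed nonzero multiple of \<open>f(1)\<close> for every \<open>R\<close>,
  which is absurd.
\<close>


text \<open>For a single k the sum over cosets is finite, but which lattices occur in it depends on
  k, and no positivity is available to isolate the term f(1). Working modulo p^(R+1) removes this
  dependence: the surviving lattices form a finite set that is fixed before k. The order of choices
  is therefore R, read off from the nonzero multiple of f(1); then the stable lattices; then a large
  k. Subtracting the congruences for k and k + 1 removes the constant term of the affine function.
  The exponents c move in steps of n because \<Pi>^c has to be a scalar times \<Pi> for all the
  points to have the same stabilizer; this is the factor n in the slope. The factor p in 1 + p\<Pi>
  makes the linear term dominate in every p-th power, so z is p^(R+1) \<Pi> up to a unit and has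
  valuation 1 modulo n; p is nonzero in F by characteristic zero. The field E is realised as the
  commutant of \<Pi>, so that its norm, its units and its lattices are statements about explicit
  matrices.\<close>

no_notation fps_nth (infixl "$" 75)
hide_const (open) Divisibility.prime

section \<open>Absolute values\<close>

lemma absval_zero [simp]: "absval (0::'k::nonarch_local_field) = 0"
  using dist_absval[of "0::'k" 0] by simp

lemma absval_nonneg [simp]: "0 \<le> absval (x::'k::nonarch_local_field)"
  using dist_absval[of x 0] by (metis diff_zero zero_le_dist)

lemma absval_eq_0_iff [simp]: "absval (x::'k::nonarch_local_field) = 0 \<longleftrightarrow> x = 0"
  using dist_absval[of x 0] by (metis diff_zero dist_eq_0_iff)

lemma absval_pos_iff [simp]: "0 < absval (x::'k::nonarch_local_field) \<longleftrightarrow> x \<noteq> 0"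
  using absval_nonneg[of x] absval_eq_0_iff[of x] by linarith

lemma absval_one [simp]: "absval (1::'k::nonarch_local_field) = 1"
  using absval_mult[of "1::'k" 1] absval_eq_0_iff[of "1::'k"] by simp

lemma absval_minus [simp]: "absval (- x) = absval (x::'k::nonarch_local_field)"
  using dist_absval[of 0 x] dist_absval[of x 0] by (simp add: dist_commute)

lemma absval_diff_commute: "absval (x - y) = absval (y - (x::'k::nonarch_local_field))"
  using absval_minus[of "x - y"] by simp

lemma absval_power: "absval (x ^ n) = absval (x::'k::nonarch_local_field) ^ n"
  by (induction n) (simp_all add: absval_mult)

lemma absval_inverse: "absval (inverse x) = inverse (absval (x::'k::nonarch_local_field))"
proof (cases "x = 0")
  case False
  then have "absval x * absval (inverse x) = 1"
    using absval_mult[of x "inverse x"] by simp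
  then show ?thesis
    by (simp add: inverse_unique)
qed simp

lemma absval_divide: "absval (x / y) = absval x / absval (y::'k::nonarch_local_field)"
  by (simp add: divide_inverse absval_mult absval_inverse)

lemma absval_power_int: "absval (x powi n) = absval (x::'k::nonarch_local_field) powi n"
  by (simp add: power_int_def absval_power absval_inverse)

lemma absval_prod: "absval (\<Prod>i\<in>A. f i) = (\<Prod>i\<in>A. absval (f i :: 'k::nonarch_local_field))"
  by (induction A rule: infinite_finite_induct) (simp_all add: absval_mult)

lemma absval_sum_le:
  assumes "\<And>i. i \<in> A \<Longrightarrow> absval (f i :: 'k::nonarch_local_field) \<le> b" "0 \<le> b"
  shows "absval (\<Sum>i\<in>A. f i) \<le> b"
  using assms
proof (induction A rule: infinite_finite_induct)
  case (insert x A)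
  then show ?case
    using absval_ultrametric[of "f x" "sum f A"] by fastforce
qed auto

lemma absval_add_eq:
  assumes "absval x < absval (y::'k::nonarch_local_field)"
  shows "absval (x + y) = absval y"
proof (rule antisym)
  show "absval (x + y) \<le> absval y"
    using absval_ultrametric[of x y] assms by simp
  show "absval y \<le> absval (x + y)"
    using absval_ultrametric[of "x + y" "- x"] assms by (auto simp: max_def split: if_splits)
qed

lemma absval_of_nat_le: "absval (of_nat m :: 'k::nonarch_local_field) \<le> 1"
proof (induction m)
  case (Suc m)
  then show ?case
    using absval_ultrametric[of "1::'k" "of_nat m"] by simp
qed simp

lemma isCont_absval: "isCont (absval :: 'k::nonarch_local_field \<Rightarrow> real) x"
proof -
  have "isCont (\<lambda>y::'k. dist y 0) x"
    by (intro continuous_intros)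
  then show ?thesis
    by (simp add: dist_absval)
qed

lemma continuous_on_absval: "continuous_on A (absval :: 'k::nonarch_local_field \<Rightarrow> real)"
  by (simp add: continuous_at_imp_continuous_on isCont_absval)

text \<open>Local compactness at 0 provides one compact ball. Dividing it by a high power of an
  element of absolute value below 1 gives a compact set containing the ball of radius
  \<open>b\<close>, which is closed.\<close>

lemma compact_absval_le: "compact {x::'k::nonarch_local_field. absval x \<le> b}"
proof -
  obtain e where e: "e > 0" "compact {x::'k. absval x \<le> e}"
    using locally_compact_0 by blast
  obtain a :: 'k where "a \<noteq> 0" "absval a \<noteq> 1"
    using absval_nontrivial by blast
  then obtain t :: 'k where t: "t \<noteq> 0" "absval t < 1"
  proof (cases "absval a < 1")
    case False
    then have "absval (inverse a) < 1"
      using \<open>absval a \<noteq> 1\<close> by (simp add: absval_inverse inverse_less_1_iff)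
    then show ?thesis
      using that[of "inverse a"] \<open>a \<noteq> 0\<close> by simp
  qed blast
  have "(\<lambda>m. \<bar>b\<bar> * absval t ^ m) \<longlonglongrightarrow> \<bar>b\<bar> * 0"
    using t by (intro tendsto_intros LIMSEQ_realpow_zero) auto
  then have "eventually (\<lambda>m. \<bar>b\<bar> * absval t ^ m < e) sequentially"
    using e(1) by (intro order_tendstoD) auto
  then obtain m where m: "\<bar>b\<bar> * absval t ^ m < e"
    by (auto simp: eventually_sequentially)
  let ?s = "t ^ m"
  have s: "?s \<noteq> 0"
    using t by simp
  have cont: "continuous_on UNIV (\<lambda>x::'k. x / ?s)"
  proof (rule continuous_onI)
    fix x :: 'k and \<epsilon> :: real
    assume "\<epsilon> > 0"
    have "dist (y / ?s) (x / ?s) = dist y x / absval ?s" for y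
      by (simp add: dist_absval diff_divide_distrib[symmetric] absval_divide)
    then show "\<exists>d>0. \<forall>x'\<in>UNIV. dist x' x < d \<longrightarrow> dist (x' / ?s) (x / ?s) \<le> \<epsilon>"
      using s \<open>\<epsilon> > 0\<close>
      by (intro exI[of _ "\<epsilon> * absval ?s"]) (simp add: pos_divide_le_eq)
  qed
  have closed: "closed {x::'k. absval x \<le> b}"
    by (intro closed_Collect_le continuous_on_absval continuous_on_const)
  have sub: "{x::'k. absval x \<le> b} \<subseteq> (\<lambda>x. x / ?s) ` {x. absval x \<le> e}"
  proof
    fix x :: 'k
    assume x: "x \<in> {x. absval x \<le> b}"
    have "absval (x * ?s) \<le> \<bar>b\<bar> * absval t ^ m"
      using x by (simp add: absval_mult absval_power mult_right_mono)
    then show "x \<in> (\<lambda>x. x / ?s) ` {x. absval x \<le> e}"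
      using m s by (intro image_eqI[of _ _ "x * ?s"]) auto
  qed
  have "compact ((\<lambda>x. x / ?s) ` {x::'k. absval x \<le> e})"
    using compact_continuous_image continuous_on_subset cont e(2) by blast
  then have "compact ((\<lambda>x. x / ?s) ` {x::'k. absval x \<le> e} \<inter> {x. absval x \<le> b})"
    using closed by (rule compact_Int_closed)
  then show ?thesis
    using sub by (simp add: Int_absorb1)
qed

text \<open>By the ultrametric inequality the open unit ball is also closed, hence compact, so
  \<open>absval\<close> attains its supremum there. This is the source of the discreteness of the
  valuation.\<close>

lemma uniformizer_exists:
  "\<exists>w::'k::nonarch_local_field. w \<noteq> 0 \<and> absval w < 1 \<and> (\<forall>x::'k. absval x < 1 \<longrightarrow> absval x \<le> absval w)"
proof -
  have "closed {x::'k. absval x < 1}"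
  proof -
    have "open {x::'k. absval x \<ge> 1}"
    proof (rule openI)
      fix x :: 'k
      assume x: "x \<in> {x. absval x \<ge> 1}"
      have "y \<in> {x. absval x \<ge> 1}" if "y \<in> ball x 1" for y
        using that x absval_ultrametric[of "x - y" y] by (auto simp: dist_absval)
      then show "\<exists>e>0. ball x e \<subseteq> {x. absval x \<ge> 1}"
        by (intro exI[of _ 1]) auto
    qed
    moreover have "- {x::'k. absval x < 1} = {x. absval x \<ge> 1}"
      by auto
    ultimately show ?thesis
      by (simp add: closed_def)
  qed
  then have "compact ({x::'k. absval x \<le> 1} \<inter> {x. absval x < 1})"
    by (intro compact_Int_closed compact_absval_le)
  moreover have "{x::'k. absval x \<le> 1} \<inter> {x. absval x < 1} = {x. absval x < 1}"
    by auto
  ultimately have comp: "compact {x::'k. absval x < 1}"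
    by simp
  obtain a :: 'k where a: "a \<noteq> 0" "absval a \<noteq> 1"
    using absval_nontrivial by blast
  have "absval (inverse a) < 1 \<or> absval a < 1"
    using a by (simp add: absval_inverse inverse_less_1_iff) linarith
  then obtain t :: 'k where t: "t \<noteq> 0" "absval t < 1"
    using a by (metis inverse_nonzero_iff_nonzero)
  have "{x::'k. absval x < 1} \<noteq> {}"
    using t by blast
  from continuous_attains_sup[OF comp this continuous_on_absval]
  obtain w :: 'k where w: "absval w < 1" "\<forall>x::'k. absval x < 1 \<longrightarrow> absval x \<le> absval w"
    by blast
  then have "absval w > 0"
    using t by (metis absval_pos_iff less_le_trans)
  then show ?thesis
    using w by auto
qed

definition uniformizer :: "'k::nonarch_local_field" where
  "uniformizer = (SOME w::'k. w \<noteq> 0 \<and> absval w < 1 \<and> (\<forall>x::'k. absval x < 1 \<longrightarrow> absval x \<le> absval w))"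

lemma uniformizer_nonzero [simp]: "(uniformizer :: 'k::nonarch_local_field) \<noteq> 0"
  and absval_uniformizer_less_1 [simp]: "absval (uniformizer :: 'k) < 1"
  and absval_le_uniformizer: "absval (x::'k) < 1 \<Longrightarrow> absval x \<le> absval (uniformizer :: 'k)"
  using someI_ex[OF uniformizer_exists[where 'k='k]] unfolding uniformizer_def by blast+

lemma absval_uniformizer_le_1 [simp]: "absval (uniformizer :: 'k::nonarch_local_field) \<le> 1"
  by (simp add: less_imp_le)

text \<open>Rounding the logarithm of \<open>absval x\<close> to base
  \<open>absval uniformizer\<close> gives \<open>j\<close> such that
  \<open>x * uniformizer powi (- j)\<close> has absolute value at most 1 but larger than that of the
  uniformizer; maximality of the uniformizer leaves only 1.\<close>

lemma absval_discrete:
  assumes "(x::'k::nonarch_local_field) \<noteq> 0"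
  obtains j :: int where "absval x = absval (uniformizer :: 'k) powi j"
proof -
  let ?r = "absval (uniformizer :: 'k)"
  have r: "0 < ?r" "?r < 1"
    by simp_all
  define j where "j = \<lfloor>log ?r (absval x)\<rfloor>"
  have x: "absval x = ?r powr (log ?r (absval x))"
    using powr_log_cancel[OF r(1) less_imp_neq[OF r(2)]] assms by simp
  have le: "absval x \<le> ?r powi j"
  proof -
    have "?r powr (log ?r (absval x)) \<le> ?r powr (of_int j)"
      using r by (intro powr_mono') (auto simp: j_def)
    then show ?thesis
      using x r by (simp add: powr_real_of_int')
  qed
  have gt: "?r powi (j + 1) < absval x"
  proof -
    have "?r powr (of_int (j + 1)) < ?r powr (log ?r (absval x))"
      using r by (intro powr_less_mono') (auto simp: j_def)
    moreover have "?r powr (of_int (j + 1)) = ?r powi (j + 1)"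
      by (intro powr_real_of_int') auto
    ultimately show ?thesis
      using x by simp
  qed
  let ?z = "x * uniformizer powi (- j)"
  have z: "absval ?z = absval x / ?r powi j"
    by (simp add: absval_mult absval_power_int absval_inverse power_int_minus divide_inverse)
  have "absval ?z \<ge> 1"
  proof (rule ccontr)
    assume "\<not> ?thesis"
    then have "absval x / ?r powi j \<le> ?r"
      using absval_le_uniformizer[of ?z] z by simp
    then have "absval x \<le> ?r powi (j + 1)"
      using r by (simp add: field_simps power_int_add)
    then show False
      using gt by simp
  qed
  then have "absval x \<ge> ?r powi j"
    using z r by (simp add: field_simps)
  then show ?thesis
    using le that[of j] by simp
qed

text \<open>If every positive integer had absolute value 1, the natural numbers would be infinitely
  many points at mutual distance at least 1 in the compact unit ball. The least positive integer of
  absolute value below 1 is prime by multiplicativity.\<close>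

lemma residue_char_exists:
  "\<exists>p::nat. prime p \<and> absval (of_nat p :: 'k::nonarch_local_field) < 1"
proof -
  have "\<exists>m>0. absval (of_nat m :: 'k) < 1"
  proof (rule ccontr)
    assume none: "\<not> ?thesis"
    have dist1: "dist (of_nat i :: 'k) (of_nat j) \<ge> 1" if "i \<noteq> j" for i j
    proof -
      have "absval (of_nat m - of_nat l :: 'k) \<ge> 1" if "l < m" for l m :: nat
        using none that by (metis linorder_not_less of_nat_diff less_imp_le zero_less_diff)
      then show ?thesis
        using that unfolding dist_absval by (metis absval_diff_commute linorder_neqE_nat)
    qed
    have inf: "infinite (range (of_nat :: nat \<Rightarrow> 'k))"
    proof (rule range_inj_infinite)
      show "inj (of_nat :: nat \<Rightarrow> 'k)"
        using dist1 by (metis dist_self injI not_one_le_zero)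
    qed
    have "range (of_nat :: nat \<Rightarrow> 'k) \<subseteq> {x. absval x \<le> 1}"
      by (auto simp: absval_of_nat_le)
    then obtain x where "x islimpt range (of_nat :: nat \<Rightarrow> 'k)"
      using inf compact_absval_le[of 1] unfolding compact_eq_Bolzano_Weierstrass by blast
    then have "infinite (range (of_nat :: nat \<Rightarrow> 'k) \<inter> ball x (1/2))"
      by (simp add: islimpt_eq_infinite_ball)
    then have inf2: "infinite (range (of_nat :: nat \<Rightarrow> 'k) \<inter> ball x (1/2) - {a})" for a
      by simp
    obtain a where a: "a \<in> range (of_nat :: nat \<Rightarrow> 'k) \<inter> ball x (1/2)"
      using inf2 by (metis Diff_iff ex_in_conv finite.emptyI)
    obtain b where b: "b \<in> range (of_nat :: nat \<Rightarrow> 'k) \<inter> ball x (1/2) - {a}"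
      using inf2 by (metis ex_in_conv finite.emptyI)
    obtain i j where ij: "a = of_nat i" "b = of_nat j"
      using a b by blast
    then have "i \<noteq> j" "(of_nat i :: 'k) \<in> ball x (1/2)" "(of_nat j :: 'k) \<in> ball x (1/2)"
      using a b by auto
    then have "dist (of_nat i :: 'k) (of_nat j) < 1"
      by (metis dist_commute dist_triangle_half_l mem_ball)
    then show False
      using dist1[OF \<open>i \<noteq> j\<close>] by simp
  qed
  then obtain m where m: "m > 0 \<and> absval (of_nat m :: 'k) < 1"
    by blast
  define p where "p = (LEAST m. m > 0 \<and> absval (of_nat m :: 'k) < 1)"
  have p: "p > 0" "absval (of_nat p :: 'k) < 1"
    unfolding p_def using LeastI[of "\<lambda>m. m > 0 \<and> absval (of_nat m :: 'k) < 1", OF m] by auto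
  have least: "absval (of_nat l :: 'k) = 1" if "l > 0" "l < p" for l
    using not_less_Least[of l "\<lambda>m. m > 0 \<and> absval (of_nat m :: 'k) < 1"] that absval_of_nat_le[of l, where 'k='k]
    unfolding p_def by force
  have "p \<noteq> 1"
    using p by auto
  have "prime p"
  proof (rule ccontr)
    assume "\<not> prime p"
    then obtain a b where "p = a * b" "a > 1" "b > 1"
    proof -
      obtain a where "a dvd p" "a \<noteq> 1" "a \<noteq> p"
        using \<open>\<not> prime p\<close> p(1) \<open>p \<noteq> 1\<close> by (auto simp: prime_nat_iff)
      moreover from this obtain b where "p = a * b"
        by blast
      ultimately show ?thesis
        using that[of a b] p(1) by (cases "a = 0"; cases "b = 0"; cases "b = 1") auto
    qed
    then have "absval (of_nat p :: 'k) = 1"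
      using least[of a] least[of b] by (simp add: absval_mult)
    then show False
      using p by simp
  qed
  then show ?thesis
    using p by blast
qed

section \<open>Matrices with bounded entries\<close>

text \<open>The entrywise sup norm, used as a predicate because only upper bounds occur;
  ultrametricity makes it submultiplicative without a factor for the size of the matrix.\<close>

definition mbound :: "real \<Rightarrow> 'k::nonarch_local_field ^ 'n ^ 'm \<Rightarrow> bool" where
  "mbound b A \<longleftrightarrow> (\<forall>i j. absval (A $ i $ j) \<le> b)"

lemma mboundD: "mbound b A \<Longrightarrow> absval (A $ i $ j) \<le> b"
  by (simp add: mbound_def)

lemma mbound_mono: "mbound b A \<Longrightarrow> b \<le> c \<Longrightarrow> mbound c A"
  unfolding mbound_def by (meson order_trans)

lemma mbound_nonneg: "mbound b A \<Longrightarrow> 0 \<le> b"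
  unfolding mbound_def by (meson absval_nonneg order_trans)

lemma mbound_zero [simp]: "mbound b 0 \<longleftrightarrow> 0 \<le> b"
  by (simp add: mbound_def)

lemma mbound_add: "mbound b A \<Longrightarrow> mbound b B \<Longrightarrow> mbound b (A + B)"
  unfolding mbound_def by (metis (no_types, lifting) absval_ultrametric max.bounded_iff order_trans
      vector_add_component max_def)

lemma mbound_minus [simp]: "mbound b (- A) = mbound b A"
  by (simp add: mbound_def)

lemma mbound_diff: "mbound b A \<Longrightarrow> mbound b B \<Longrightarrow> mbound b (A - B)"
  using mbound_add[of b A "- B"] by simp

lemma mbound_diff_commute: "mbound b (A - B) = mbound b (B - A)"
  using mbound_minus[of b "A - B"] by simp

lemma mbound_mat_1: "mbound 1 (mat 1)"
  by (simp add: mbound_def mat_def)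

lemma mbound_mult:
  assumes "mbound a A" "mbound b B"
  shows "mbound (a * b) (A ** B)"
proof -
  have "0 \<le> a" "0 \<le> b"
    using assms mbound_nonneg by blast+
  then show ?thesis
    using assms unfolding mbound_def matrix_matrix_mult_def
    by (auto intro!: absval_sum_le mult_mono simp: absval_mult)
qed

lemma mbound_mult_left: "mbound 1 A \<Longrightarrow> mbound b B \<Longrightarrow> mbound b (A ** B)"
  using mbound_mult[of 1 A b B] by simp

lemma mbound_mult_right: "mbound b A \<Longrightarrow> mbound 1 B \<Longrightarrow> mbound b (A ** B)"
  using mbound_mult[of b A 1 B] by simp

lemma mbound_exists:
  obtains b where "b \<ge> 1" "mbound b (A :: 'k::nonarch_local_field ^ 'n::finite ^ 'm::finite)"
proof
  let ?S = "insert 1 ((\<lambda>(i, j). absval (A $ i $ j)) ` UNIV)"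
  show "Max ?S \<ge> 1"
    by (intro Max_ge) auto
  show "mbound (Max ?S) A"
    unfolding mbound_def by (intro allI Max_ge) force+
qed

lemma mat_mult_nth [simp]: "(mat c ** (A::'a::semiring_1^'n^'m)) $ i $ j = c * A $ i $ j"
  by (simp add: matrix_matrix_mult_def mat_def if_distrib[of "\<lambda>x. x * _"] sum.delta' cong: if_cong)

lemma mult_mat_nth [simp]: "((A::'a::semiring_1^'n^'m) ** mat c) $ i $ j = A $ i $ j * c"
  by (simp add: matrix_matrix_mult_def mat_def if_distrib sum.delta cong: if_cong)

lemma mat_mult_commute: "mat c ** A = A ** mat (c::'a::comm_semiring_1)"
  by (simp add: vec_eq_iff mult.commute)

lemma matrix_diff_ldistrib: "(A::'a::ring_1^'n^'m) ** (B - C) = A ** B - A ** C"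
  by (simp add: vec_eq_iff matrix_matrix_mult_def algebra_simps sum_subtractf)

lemma matrix_diff_rdistrib: "((A::'a::ring_1^'n^'m) - B) ** C = A ** C - B ** C"
  by (simp add: vec_eq_iff matrix_matrix_mult_def algebra_simps sum_subtractf)

lemma matrix_vector_mult_axis [simp]: "((A::'a::semiring_1^'n^'m) *v axis j 1) $ i = A $ i $ j"
proof -
  have "(\<Sum>l\<in>UNIV. A $ i $ l * axis j 1 $ l) = (\<Sum>l\<in>UNIV. if l = j then A $ i $ l else 0)"
    by (intro sum.cong) (auto simp: axis_def)
  then show ?thesis
    by (simp add: matrix_vector_mult_def)
qed

lemma mbound_smult: "mbound b A \<Longrightarrow> mbound (absval c * b) (mat c ** A)"
  by (simp add: mbound_def absval_mult mult_left_mono)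

lemma absval_det_le:
  assumes "mbound b (A :: 'k::nonarch_local_field ^ 'n ^ 'n)"
  shows "absval (det A) \<le> b ^ CARD('n)"
  unfolding det_def
proof (intro absval_sum_le)
  fix p :: "'n \<Rightarrow> 'n"
  have "absval (\<Prod>i\<in>UNIV. A $ i $ p i) \<le> (\<Prod>i\<in>(UNIV::'n set). b)"
    unfolding absval_prod using assms by (intro prod_mono) (auto simp: mbound_def)
  then show "absval (of_int (sign p) * (\<Prod>i\<in>UNIV. A $ i $ p i)) \<le> b ^ CARD('n)"
    by (auto simp: absval_mult sign_def)
qed (use mbound_nonneg[OF assms] in simp)

lemma absval_prod_diff_le:
  assumes "\<And>i. i \<in> I \<Longrightarrow> absval (f i :: 'k::nonarch_local_field) \<le> 1"
    "\<And>i. i \<in> I \<Longrightarrow> absval (g i) \<le> 1" "\<And>i. i \<in> I \<Longrightarrow> absval (f i - g i) \<le> s" "0 \<le> s"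
  shows "absval ((\<Prod>i\<in>I. f i) - (\<Prod>i\<in>I. g i)) \<le> s"
  using assms
proof (induction I rule: infinite_finite_induct)
  case (insert x I)
  have eq: "(\<Prod>i\<in>insert x I. f i) - (\<Prod>i\<in>insert x I. g i)
      = (f x - g x) * (\<Prod>i\<in>I. f i) + g x * ((\<Prod>i\<in>I. f i) - (\<Prod>i\<in>I. g i))"
    using insert.hyps by (simp add: algebra_simps)
  have "absval (\<Prod>i\<in>I. f i) \<le> 1"
    unfolding absval_prod using insert.prems by (intro prod_le_1) auto
  then have 1: "absval ((f x - g x) * (\<Prod>i\<in>I. f i)) \<le> s"
    using insert.prems mult_mono[of "absval (f x - g x)" s "absval (\<Prod>i\<in>I. f i)" 1]
    by (simp add: absval_mult)
  have "absval ((\<Prod>i\<in>I. f i) - (\<Prod>i\<in>I. g i)) \<le> s"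
    using insert by simp
  then have 2: "absval (g x * ((\<Prod>i\<in>I. f i) - (\<Prod>i\<in>I. g i))) \<le> s"
    using insert.prems mult_mono[of "absval (g x)" 1 "absval ((\<Prod>i\<in>I. f i) - (\<Prod>i\<in>I. g i))" s]
    by (simp add: absval_mult)
  show ?case
    unfolding eq using absval_ultrametric 1 2 by (meson max.bounded_iff order_trans)
qed auto

text \<open>Each Leibniz term changes by at most \<open>s\<close>, since a product of integral
  factors is 1-Lipschitz in each factor. This is why matrices near 1 have a determinant of absolute
  value 1.\<close>

lemma absval_det_diff_le:
  assumes "mbound 1 (A :: 'k::nonarch_local_field ^ 'n ^ 'n)" "mbound 1 B" "mbound s (A - B)"
  shows "absval (det A - det B) \<le> s"
proof -
  have "absval (\<Sum>p | p permutes UNIV. of_int (sign p) * (\<Prod>i\<in>UNIV. A $ i $ p i)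
      - of_int (sign p) * (\<Prod>i\<in>UNIV. B $ i $ p i)) \<le> s"
  proof (intro absval_sum_le)
    fix p :: "'n \<Rightarrow> 'n"
    have "absval ((\<Prod>i\<in>UNIV. A $ i $ p i) - (\<Prod>i\<in>UNIV. B $ i $ p i)) \<le> s"
      using assms mbound_nonneg[OF assms(3)] by (intro absval_prod_diff_le) (auto simp: mbound_def)
    then show "absval (of_int (sign p) * (\<Prod>i\<in>UNIV. A $ i $ p i)
        - of_int (sign p) * (\<Prod>i\<in>UNIV. B $ i $ p i)) \<le> s"
      unfolding right_diff_distrib[symmetric] by (auto simp: absval_mult sign_def)
  qed (use mbound_nonneg[OF assms(3)] in simp)
  then show ?thesis
    by (simp add: det_def sum_subtractf)
qed

section \<open>Inverses of matrices over a field\<close>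

lemma
  assumes "invertible (A::'a::field^'n^'n)"
  shows mat_inv_left [simp]: "matrix_inv A ** A = mat 1"
    and mat_inv_right [simp]: "A ** matrix_inv A = mat 1"
proof -
  from assms have "A ** matrix_inv A = mat 1 \<and> matrix_inv A ** A = mat 1"
    unfolding invertible_def matrix_inv_def by (rule someI_ex)
  then show "matrix_inv A ** A = mat 1" "A ** matrix_inv A = mat 1"
    by auto
qed

lemma mat_inv_unique:
  fixes A B :: "'a::field^'n^'n"
  assumes "A ** B = mat 1"
  shows "matrix_inv A = B"
proof -
  have "invertible A"
    using assms invertible_right_inverse by blast
  then have "matrix_inv A ** (A ** B) = B"
    by (simp add: matrix_mul_assoc)
  then show ?thesis
    using assms by simp
qed

lemma mat_cancel_left [simp]:
  "invertible (A::'a::field^'n^'n) \<Longrightarrow> matrix_inv A ** (A ** B) = B"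
  "invertible A \<Longrightarrow> A ** (matrix_inv A ** B) = B"
  by (simp_all add: matrix_mul_assoc)

lemma mat_cancel_right [simp]:
  "invertible (A::'a::field^'n^'n) \<Longrightarrow> B ** A ** matrix_inv A = B"
  "invertible A \<Longrightarrow> B ** matrix_inv A ** A = B"
  by (simp_all add: matrix_mul_assoc[symmetric])

lemma invertible_matrix_inv [simp]: "invertible (A::'a::field^'n^'n) \<Longrightarrow> invertible (matrix_inv A)"
  unfolding invertible_def[of "matrix_inv A"] using mat_inv_left mat_inv_right by blast

lemma matrix_inv_matrix_inv [simp]: "invertible (A::'a::field^'n^'n) \<Longrightarrow> matrix_inv (matrix_inv A) = A"
  by (rule mat_inv_unique) simp

lemma invertible_mat_1 [simp]: "invertible (mat 1 :: 'a::field^'n^'n)"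
  by (auto simp: invertible_def intro: exI[of _ "mat 1"])

lemma matrix_inv_mult:
  fixes A B :: "'a::field^'n^'n"
  assumes "invertible A" "invertible B"
  shows "matrix_inv (A ** B) = matrix_inv B ** matrix_inv A"
  using assms by (intro mat_inv_unique) (simp add: matrix_mul_assoc[symmetric])

lemma matrix_inv_mat_1 [simp]: "matrix_inv (mat 1 :: 'a::field^'n^'n) = mat 1"
  by (rule mat_inv_unique) simp

lemma det_matrix_inv: "invertible (A::'a::field^'n^'n) \<Longrightarrow> det (matrix_inv A) = inverse (det A)"
  using det_mul[of A "matrix_inv A"] by (simp add: inverse_unique)

lemma invertible_mult_iff:
  fixes A B :: "'a::field^'n^'n"
  shows "invertible (A ** B) \<longleftrightarrow> invertible A \<and> invertible B"
  by (simp add: invertible_det_nz det_mul)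

text \<open>Cramer's rule: an entry of the inverse is a determinant with one column replaced by a
  basis vector, divided by a determinant of absolute value 1. The condition \<open>b \<ge> 1\<close>
  covers the replaced column.\<close>

lemma mbound_matrix_inv:
  assumes "mbound b (A :: 'k::nonarch_local_field ^ 'n ^ 'n)" "b \<ge> 1" "absval (det A) = 1"
  shows "mbound (b ^ CARD('n)) (matrix_inv A)"
  unfolding mbound_def
proof (intro allI)
  fix k j
  have d: "det A \<noteq> 0"
    using assms(3) by auto
  then have inv: "invertible A"
    by (simp add: invertible_det_nz)
  have "A *v (matrix_inv A *v axis j 1) = axis j 1"
    using inv by (simp add: matrix_vector_mul_assoc)
  then have "matrix_inv A *v axis j 1
      = (\<chi> k. det (\<chi> i l. if l = k then axis j 1 $ i else A $ i $ l) / det A)"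
    using cramer[OF d] by blast
  moreover have "(matrix_inv A *v axis j 1) $ k = matrix_inv A $ k $ j"
    by (simp add: matrix_vector_mult_axis)
  ultimately have eq: "matrix_inv A $ k $ j = det (\<chi> i l. if l = k then axis j 1 $ i else A $ i $ l) / det A"
    by simp
  have "mbound b (\<chi> i l. if l = k then axis j 1 $ i else A $ i $ l)"
    using assms by (auto simp: mbound_def axis_def)
  from absval_det_le[OF this] show "absval (matrix_inv A $ k $ j) \<le> b ^ CARD('n)"
    unfolding eq absval_divide assms(3) by simp
qed

section \<open>Topology of matrix spaces\<close>

lemma open_mbound_diff:
  assumes "0 < s"
  shows "open {B. mbound s (B - (A :: 'k::nonarch_local_field ^ 'n::finite ^ 'm::finite))}"
proof (rule openI)
  fix B
  assume B: "B \<in> {B. mbound s (B - A)}"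
  have "mbound s (C - A)" if "dist B C < s" for C
  proof -
    have "absval ((C - B) $ i $ j) \<le> s" for i j
    proof -
      have "dist (C $ i $ j) (B $ i $ j) \<le> dist C B"
        by (rule order_trans[OF dist_vec_nth_le dist_vec_nth_le])
      then show ?thesis
        using that by (simp add: dist_absval dist_commute)
    qed
    then have "mbound s (C - B)"
      by (simp add: mbound_def)
    then show ?thesis
      using mbound_add[of s "C - B" "B - A"] B by simp
  qed
  then show "\<exists>e>0. ball B e \<subseteq> {B. mbound s (B - A)}"
    using assms by (intro exI[of _ s]) auto
qed

text \<open>The metric on vectors is Euclidean in the distances of the entries, hence at most their
  sum; dividing \<open>e\<close> by twice the number of entries passes from entrywise bounds to
  metric balls.\<close>

lemma mbound_nhd:
  assumes "open U" "(A :: 'k::nonarch_local_field ^ 'n::finite ^ 'm::finite) \<in> U"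
  obtains s where "0 < s" "s < 1" "\<And>B. mbound s (B - A) \<Longrightarrow> B \<in> U"
proof -
  obtain e where e: "e > 0" "ball A e \<subseteq> U"
    using assms by (meson openE)
  define s where "s = min (1/2) (e / (2 * real CARD('n) * real CARD('m)))"
  have s: "0 < s" "s < 1" and s_le: "s \<le> e / (2 * real CARD('n) * real CARD('m))"
    using e by (auto simp: s_def)
  have "B \<in> U" if "mbound s (B - A)" for B
  proof -
    have "dist B A \<le> (\<Sum>i\<in>UNIV. dist (B $ i) (A $ i))"
      unfolding dist_vec_def[of B A] by (rule L2_set_le_sum) simp
    also have "\<dots> \<le> (\<Sum>i\<in>(UNIV::'m set). \<Sum>j\<in>(UNIV::'n set). s)"
    proof (intro sum_mono)
      fix i :: 'm
      have "dist (B $ i) (A $ i) \<le> (\<Sum>j\<in>UNIV. dist (B $ i $ j) (A $ i $ j))"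
        unfolding dist_vec_def[of "B $ i"] by (rule L2_set_le_sum) simp
      also have "\<dots> \<le> (\<Sum>j\<in>(UNIV::'n set). s)"
        using that by (intro sum_mono) (simp add: dist_absval mbound_def)
      finally show "dist (B $ i) (A $ i) \<le> (\<Sum>j\<in>(UNIV::'n set). s)" .
    qed
    also have "\<dots> = real CARD('m) * real CARD('n) * s"
      by simp
    also have "\<dots> \<le> real CARD('m) * real CARD('n) * (e / (2 * real CARD('n) * real CARD('m)))"
      using s_le by (intro mult_left_mono) auto
    also have "\<dots> = e / 2"
      by simp
    finally have "dist A B < e"
      using e(1) by (simp add: dist_commute)
    then show ?thesis
      using e(2) by auto
  qed
  then show ?thesis
    using that s by blast
qed

text \<open>Tychonoff: the set is the continuous image of a finite product of compact balls of the
  field.\<close>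

lemma compact_mbound: "compact {A :: 'k::nonarch_local_field ^ 'n::finite ^ 'm::finite. mbound b A}"
proof -
  let ?S = "PiE (UNIV :: ('m \<times> 'n) set) (\<lambda>_. {x::'k. absval x \<le> b})"
  have "compactin (product_topology (\<lambda>_. euclidean) UNIV) ?S"
    by (subst compactin_PiE) (simp add: compact_absval_le)
  then have "compact ?S"
    by (simp add: euclidean_product_topology)
  moreover have "continuous_on ?S (\<lambda>x. (\<chi> i j. x (i, j)) :: 'k ^ 'n ^ 'm)"
    by (intro continuous_intros continuous_on_subset[OF continuous_on_product_coordinates]) auto
  ultimately have "compact ((\<lambda>x. (\<chi> i j. x (i, j)) :: 'k ^ 'n ^ 'm) ` ?S)"
    by (intro compact_continuous_image)
  moreover have "(\<lambda>x. (\<chi> i j. x (i, j)) :: 'k ^ 'n ^ 'm) ` ?S = {A. mbound b A}"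
  proof (intro equalityI subsetI)
    fix A :: "'k ^ 'n ^ 'm"
    assume "A \<in> {A. mbound b A}"
    then show "A \<in> (\<lambda>x. (\<chi> i j. x (i, j)) :: 'k ^ 'n ^ 'm) ` ?S"
      by (intro image_eqI[of _ _ "\<lambda>(i, j). A $ i $ j"]) (auto simp: mbound_def vec_eq_iff)
  qed (auto simp: mbound_def)
  ultimately show ?thesis
    by simp
qed

lemma compact_mbound_diff:
  "compact {B :: 'k::nonarch_local_field ^ 'n::finite ^ 'm::finite. mbound b (B - A)}"
proof -
  obtain c where c: "mbound c A" "c \<ge> 1"
    using mbound_exists by blast
  have "closed {B. mbound b (B - A)}"
  proof -
    have "{B. mbound b (B - A)} = (\<Inter>i. \<Inter>j. {B. dist (B $ i $ j) (A $ i $ j) \<le> b})"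
      by (auto simp: mbound_def dist_absval)
    then show ?thesis
      by (auto intro!: closed_INT closed_Collect_le continuous_intros)
  qed
  moreover have "{B. mbound b (B - A)} \<subseteq> {B. mbound (max b c) B}"
  proof
    fix B
    assume "B \<in> {B. mbound b (B - A)}"
    then have "mbound (max b c) (B - A)" "mbound (max b c) A"
      using c by (auto intro: mbound_mono)
    then show "B \<in> {B. mbound (max b c) B}"
      using mbound_add by fastforce
  qed
  ultimately show ?thesis
    using compact_Int_closed[OF compact_mbound] by (metis Int_absorb1)
qed

subsection \<open>Congruence subgroups\<close>

text \<open>GL_n(O), the stabilizer of the standard lattice: for an integral matrix, a unit
  determinant is equivalent to integrality of the inverse.\<close>

definition GLO :: "('k::nonarch_local_field ^ 'n ^ 'n) set" where
  "GLO = {A. mbound 1 A \<and> absval (det A) = 1}"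

text \<open>For \<open>0 \<le> s\<close> and \<open>s < 1\<close> this is a principal congruence
  subgroup of GL_n(O).\<close>

definition cong_sub :: "real \<Rightarrow> ('k::nonarch_local_field ^ 'n ^ 'n) set" where
  "cong_sub s = {A. mbound s (A - mat 1)}"

lemma GLO_invertible [simp]: "A \<in> GLO \<Longrightarrow> invertible A"
  by (auto simp: GLO_def invertible_det_nz)

lemma GLO_mat_1 [simp]: "mat 1 \<in> GLO"
  by (simp add: GLO_def mbound_mat_1)

lemma GLO_mult: "A \<in> GLO \<Longrightarrow> B \<in> GLO \<Longrightarrow> A ** B \<in> GLO"
  using mbound_mult[of 1 A 1 B] by (simp add: GLO_def det_mul absval_mult)

lemma GLO_inv: "A \<in> GLO \<Longrightarrow> matrix_inv A \<in> GLO"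
  using mbound_matrix_inv[of 1 A] GLO_invertible[of A]
  by (simp add: GLO_def det_matrix_inv absval_inverse)

lemma GLO_mbound: "A \<in> GLO \<Longrightarrow> mbound 1 A"
  by (simp add: GLO_def)

lemma cong_sub_GLO:
  assumes "s < 1"
  shows "cong_sub s \<subseteq> GLO"
proof
  fix A :: "'a ^ 'b ^ 'b"
  assume "A \<in> cong_sub s"
  then have A: "mbound s (A - mat 1)"
    by (simp add: cong_sub_def)
  have b: "mbound 1 A"
    using mbound_add[OF mbound_mono[OF A] mbound_mat_1] assms by simp
  have "absval (det A - 1) < 1"
    using absval_det_diff_le[OF b mbound_mat_1 A] assms by simp
  then have "absval (det A) = 1"
    using absval_add_eq[of "det A - 1" 1] by simp
  with b show "A \<in> GLO"
    by (simp add: GLO_def)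
qed

lemma cong_sub_mat_1 [simp]: "0 \<le> s \<Longrightarrow> mat 1 \<in> cong_sub s"
  by (simp add: cong_sub_def)

lemma cong_sub_mult:
  assumes "s < 1" "A \<in> cong_sub s" "B \<in> cong_sub s"
  shows "A ** B \<in> cong_sub s"
proof -
  have "A ** B - mat 1 = A ** (B - mat 1) + (A - mat 1)"
    by (simp add: matrix_diff_ldistrib)
  moreover have "mbound s (A ** (B - mat 1))"
    using assms cong_sub_GLO[OF assms(1)] by (intro mbound_mult_left) (auto simp: cong_sub_def GLO_def)
  ultimately show ?thesis
    using assms mbound_add[of s "A ** (B - mat 1)" "A - mat 1"] by (simp only: cong_sub_def mem_Collect_eq)
qed

lemma cong_sub_inv:
  assumes "s < 1" "A \<in> cong_sub s"
  shows "matrix_inv A \<in> cong_sub s"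
proof -
  have A: "A \<in> GLO"
    using assms cong_sub_GLO by blast
  have "matrix_inv A - mat 1 = matrix_inv A ** (mat 1 - A)"
    using A by (simp add: matrix_diff_ldistrib)
  moreover have "mbound s (matrix_inv A ** (mat 1 - A))"
    using assms GLO_inv[OF A] mbound_diff_commute[of s A "mat 1"]
    by (intro mbound_mult_left) (auto simp: cong_sub_def GLO_def)
  ultimately show ?thesis
    by (simp add: cong_sub_def)
qed

lemma cong_sub_mono: "s \<le> t \<Longrightarrow> cong_sub s \<subseteq> cong_sub t"
  by (auto simp: cong_sub_def intro: mbound_mono)

section \<open>The totally ramified field generated by a root of the uniformizer\<close>

subsection \<open>Matrix powers\<close>

primrec mpow :: "'a::semiring_1 ^ 'n ^ 'n \<Rightarrow> nat \<Rightarrow> 'a ^ 'n ^ 'n" where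
  "mpow A 0 = mat 1"
| "mpow A (Suc m) = A ** mpow A m"

lemma mpow_add: "mpow A (l + m) = mpow A l ** mpow A m"
  by (induction l) (simp_all add: matrix_mul_assoc)

lemma mpow_commute: "A ** B = B ** A \<Longrightarrow> mpow A m ** B = B ** mpow A m"
proof (induction m)
  case (Suc m)
  have "mpow A (Suc m) ** B = A ** (mpow A m ** B)"
    by (simp add: matrix_mul_assoc)
  also have "\<dots> = (A ** B) ** mpow A m"
    using Suc by (simp add: matrix_mul_assoc)
  finally show ?case
    using Suc.prems by (simp add: matrix_mul_assoc)
qed simp

lemma mpow_mult: "mpow A (l * m) = mpow (mpow A l) m"
  by (induction m) (simp_all add: mpow_add)

lemma invertible_mpow: "invertible (A::'a::field^'n^'n) \<Longrightarrow> invertible (mpow A m)"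
  by (induction m) (simp_all add: invertible_mult)

lemma det_mpow: "det (mpow A m) = det (A::'a::field^'n^'n) ^ m"
  by (induction m) (simp_all add: det_mul)

definition mpowi :: "'a::field ^ 'n ^ 'n \<Rightarrow> int \<Rightarrow> 'a ^ 'n ^ 'n" where
  "mpowi A m = (if m \<ge> 0 then mpow A (nat m) else mpow (matrix_inv A) (nat (- m)))"

lemma mpowi_0 [simp]: "mpowi A 0 = mat 1"
  by (simp add: mpowi_def)

lemma mpowi_of_nat: "mpowi A (int m) = mpow A m"
  by (simp add: mpowi_def)

lemma mpowi_1 [simp]: "mpowi A 1 = A"
  using mpowi_of_nat[of A 1] by simp

lemma mpowi_Suc:
  assumes "invertible (A::'a::field^'n^'n)"
  shows "mpowi A (m + 1) = A ** mpowi A m"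
proof (cases "m \<ge> 0")
  case True
  then show ?thesis
    by (simp add: mpowi_def nat_add_distrib)
next
  case False
  then obtain l where l: "m = - int (Suc l)"
    by (metis int_cases nat_int linorder_not_le not_zle_0_negative of_nat_0_le_iff)
  have "mpowi A m = matrix_inv A ** mpow (matrix_inv A) l"
    by (simp add: l mpowi_def nat_add_distrib)
  moreover have "mpowi A (m + 1) = mpow (matrix_inv A) l"
    by (cases l) (simp_all add: l mpowi_def nat_add_distrib)
  ultimately show ?thesis
    using assms by simp
qed

lemma mpowi_add:
  assumes "invertible (A::'a::field^'n^'n)"
  shows "mpowi A (l + m) = mpowi A l ** mpowi A m"
proof (induction l rule: int_induct[where k = 0])
  case (step1 i)
  then show ?case
    using mpowi_Suc[OF assms, of "i + m"] mpowi_Suc[OF assms, of i]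
    by (simp add: algebra_simps matrix_mul_assoc)
next
  case (step2 i)
  have "A ** mpowi A (i - 1 + m) = A ** (mpowi A (i - 1) ** mpowi A m)"
    using step2 mpowi_Suc[OF assms, of "i - 1 + m"] mpowi_Suc[OF assms, of "i - 1"]
    by (simp add: algebra_simps matrix_mul_assoc)
  then have "matrix_inv A ** (A ** mpowi A (i - 1 + m))
      = matrix_inv A ** (A ** (mpowi A (i - 1) ** mpowi A m))"
    by simp
  then show ?case
    using assms by simp
qed simp

lemma mpowi_uminus_mult [simp]:
  "invertible (A::'a::field^'n^'n) \<Longrightarrow> mpowi A (- m) ** mpowi A m = mat 1"
  using mpowi_add[of A "- m" m] by simp

lemma invertible_mpowi: "invertible (A::'a::field^'n^'n) \<Longrightarrow> invertible (mpowi A m)"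
  by (simp add: mpowi_def invertible_mpow)

lemma matrix_inv_mpowi: "invertible (A::'a::field^'n^'n) \<Longrightarrow> matrix_inv (mpowi A m) = mpowi A (- m)"
  using mpowi_uminus_mult[of A "- m"] by (intro mat_inv_unique) simp

lemma det_mpowi: "invertible (A::'a::field^'n^'n) \<Longrightarrow> det (mpowi A m) = det A powi m"
  by (simp add: mpowi_def det_mpow power_int_def det_matrix_inv)

lemma matrix_inv_commute:
  fixes A B :: "'a::field^'n^'n"
  assumes "invertible A" "A ** B = B ** A"
  shows "matrix_inv A ** B = B ** matrix_inv A"
proof -
  have "matrix_inv A ** (A ** B) ** matrix_inv A = matrix_inv A ** (B ** A) ** matrix_inv A"
    using assms by simp
  then show ?thesis
    using assms(1) by (simp add: matrix_mul_assoc)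
qed

lemma mpowi_commute:
  fixes A B :: "'a::field^'n^'n"
  assumes "invertible A" "A ** B = B ** A"
  shows "mpowi A m ** B = B ** mpowi A m"
  using assms by (simp add: mpowi_def mpow_commute matrix_inv_commute)

subsection \<open>The cyclic matrix\<close>

text \<open>The index type carries no order; an arbitrary numbering from 0 to n - 1 is fixed so that
  a companion matrix can be written down.\<close>

definition idx :: "'n::finite \<Rightarrow> nat" where
  "idx = (SOME f. bij_betw f UNIV {..<CARD('n)})"

lemma bij_idx: "bij_betw (idx :: 'n::finite \<Rightarrow> nat) UNIV {..<CARD('n)}"
proof -
  have "\<exists>f::'n \<Rightarrow> nat. bij_betw f UNIV {..<CARD('n)}"
    using ex_bij_betw_finite_nat[of "UNIV::'n set"] by (simp add: atLeast0LessThan)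
  then show ?thesis
    unfolding idx_def by (rule someI_ex)
qed

lemma idx_less [simp]: "idx (i::'n::finite) < CARD('n)"
  using bij_betwE[OF bij_idx] by auto

lemma idx_eq_iff [simp]: "idx i = idx j \<longleftrightarrow> i = j"
  using bij_betw_imp_inj_on[OF bij_idx] by (auto simp: inj_on_def)

definition at_idx :: "nat \<Rightarrow> 'n::finite" where
  "at_idx = inv_into UNIV idx"

lemma idx_at_idx [simp]: "m < CARD('n::finite) \<Longrightarrow> idx (at_idx m :: 'n) = m"
  unfolding at_idx_def using bij_idx by (intro f_inv_into_f) (auto simp: bij_betw_def)

lemma at_idx_idx [simp]: "at_idx (idx i) = i"
  unfolding at_idx_def using bij_idx by (intro inv_into_f_f) (auto simp: bij_betw_def)

lemma eq_at_idx: "m < CARD('n::finite) \<Longrightarrow> (i::'n) = at_idx m \<longleftrightarrow> idx i = m"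
  by (metis at_idx_idx idx_at_idx)

text \<open>The companion matrix of T^n - w. The two nonzero cases exclude each other, and for n = 1
  only the entry \<open>w\<close> remains.\<close>

definition cyc :: "'a::field \<Rightarrow> 'a ^ 'n::finite ^ 'n" where
  "cyc w = (\<chi> i j. if idx i = Suc (idx j) then 1
     else if idx i = 0 \<and> Suc (idx j) = CARD('n) then w else 0)"

lemma cyc_vec_nth:
  "(cyc w *v (x::'a::field^'n::finite)) $ i =
     (if idx i = 0 then w * x $ at_idx (CARD('n) - 1) else x $ at_idx (idx i - 1))"
proof -
  let ?j = "if idx i = 0 then at_idx (CARD('n) - 1) else at_idx (idx i - 1) :: 'n"
  have n: "CARD('n) > 0"
    by simp
  have "idx i - 1 < CARD('n)"
    using idx_less[of i] by linarith
  then have idxj: "idx ?j = (if idx i = 0 then CARD('n) - 1 else idx i - 1)"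
    using n by auto
  have "(cyc w *v x) $ i = (\<Sum>j\<in>UNIV. if j = ?j then cyc w $ i $ j * x $ j else 0)"
    unfolding matrix_vector_mult_def vec_lambda_beta
  proof (intro sum.cong refl)
    fix j :: 'n
    have "cyc w $ i $ j = 0" if "j \<noteq> ?j"
    proof -
      have "idx j \<noteq> idx ?j"
        using that by simp
      then show ?thesis
        unfolding idxj using idx_less[of j] n by (auto simp: cyc_def)
    qed
    then show "cyc w $ i $ j * x $ j = (if j = ?j then cyc w $ i $ j * x $ j else 0)"
      by simp
  qed
  also have "\<dots> = cyc w $ i $ ?j * x $ ?j"
    by simp
  also have "\<dots> = (if idx i = 0 then w * x $ at_idx (CARD('n) - 1) else x $ at_idx (idx i - 1))"
    using idxj n by (auto simp: cyc_def)
  finally show ?thesis .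
qed

lemma cyc_axis:
  assumes "Suc m < CARD('n::finite)"
  shows "(cyc w :: 'a::field^'n^'n) *v axis (at_idx m) 1 = axis (at_idx (Suc m)) 1"
  unfolding vec_eq_iff matrix_vector_mult_axis
  using assms by (simp add: cyc_def axis_def eq_at_idx)

lemma cyc_axis_last:
  "(cyc w :: 'a::field^'n::finite^'n) *v axis (at_idx (CARD('n) - 1)) 1 = w *s axis (at_idx 0) 1"
proof -
  have "idx i \<noteq> CARD('n)" for i :: 'n
    using idx_less[of i] by linarith
  then show ?thesis
    unfolding vec_eq_iff matrix_vector_mult_axis
    by (simp add: cyc_def axis_def eq_at_idx)
qed

lemma mpow_cyc_axis:
  "m < CARD('n::finite) \<Longrightarrow>
     mpow (cyc w :: 'a::field^'n^'n) m *v axis (at_idx 0) 1 = axis (at_idx m) 1"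
proof (induction m)
  case (Suc m)
  then show ?case
    by (simp add: matrix_vector_mul_assoc[symmetric] cyc_axis)
qed simp

lemma matrix_eq_axis:
  fixes A B :: "'a::field^'n::finite^'m::finite"
  assumes "\<And>j. A *v axis j 1 = B *v axis j 1"
  shows "A = B"
proof -
  have "A $ i $ j = B $ i $ j" for i j
    using assms[of j] matrix_vector_mult_axis[of A j i] matrix_vector_mult_axis[of B j i] by simp
  then show ?thesis
    by (simp add: vec_eq_iff)
qed

lemma mat_vec_mult [simp]: "mat c *v (x::'a::field^'n::finite) = c *s x"
proof -
  have "(\<Sum>j\<in>UNIV. mat c $ i $ j * x $ j) = (\<Sum>j\<in>UNIV. if j = i then c * x $ j else 0)" for i
    by (intro sum.cong) (auto simp: mat_def)
  then show ?thesis
    by (simp add: vec_eq_iff matrix_vector_mult_def)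
qed

text \<open>The zeroth basis vector runs through the whole basis and comes back multiplied by
  \<open>w\<close>; every basis vector is a power of the matrix applied to it, and powers
  commute.\<close>

lemma mpow_cyc_card: "mpow (cyc w :: 'a::field^'n::finite^'n) CARD('n) = mat w"
proof (rule matrix_eq_axis)
  fix j :: 'n
  let ?P = "cyc w :: 'a^'n^'n" and ?e = "axis (at_idx 0) 1 :: 'a^'n"
  have n: "CARD('n) = Suc (CARD('n) - 1)"
    by simp
  have 1: "mpow ?P CARD('n) *v ?e = w *s ?e"
  proof -
    have "mpow ?P (Suc (CARD('n) - 1)) *v ?e = ?P *v (mpow ?P (CARD('n) - 1) *v ?e)"
      by (simp only: mpow.simps matrix_vector_mul_assoc)
    also have "\<dots> = w *s ?e"
      using cyc_axis_last[of w, where 'n='n] by (simp add: mpow_cyc_axis)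
    finally show ?thesis
      using n by metis
  qed
  have ej: "axis j 1 = mpow ?P (idx j) *v ?e"
    by (simp add: mpow_cyc_axis)
  have "mpow ?P CARD('n) *v axis j 1 = mpow ?P (idx j) *v (mpow ?P CARD('n) *v ?e)"
    unfolding ej matrix_vector_mul_assoc mpow_add[symmetric] by (simp add: add.commute)
  also have "\<dots> = w *s axis j 1"
    unfolding 1 ej by (simp add: vector_scalar_commute)
  finally show "mpow ?P CARD('n) *v axis j 1 = mat w *v axis j 1"
    by simp
qed

lemma invertible_mat_scalar: "invertible (mat c :: 'a::field^'n^'n) \<longleftrightarrow> c \<noteq> 0"
  by (simp add: invertible_det_nz det_diagonal mat_def)

lemma invertible_cyc: "w \<noteq> 0 \<Longrightarrow> invertible (cyc w :: 'a::field^'n::finite^'n)"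
proof -
  assume "w \<noteq> 0"
  then have "det (cyc w :: 'a^'n^'n) ^ CARD('n) \<noteq> 0"
    unfolding det_mpow[symmetric] mpow_cyc_card using invertible_mat_scalar invertible_det_nz by blast
  then show ?thesis
    by (simp add: invertible_det_nz)
qed

text \<open>The zeroth basis vector is cyclic, so its image determines an element of the commutant.
  This embeds the commutant into the space of vectors.\<close>

lemma cyc_commute_eqI:
  fixes A B :: "'a::field^'n::finite^'n"
  assumes "A ** cyc w = cyc w ** A" "B ** cyc w = cyc w ** B"
    "A *v axis (at_idx 0) 1 = B *v axis (at_idx 0) 1"
  shows "A = B"
proof (rule matrix_eq_axis)
  fix j :: 'n
  have *: "C *v axis j 1 = mpow (cyc w) (idx j) *v (C *v axis (at_idx 0) 1)"
    if "C ** cyc w = cyc w ** C" for C :: "'a^'n^'n"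
  proof -
    have "axis j 1 = mpow (cyc w) (idx j) *v axis (at_idx 0) (1::'a)"
      by (simp add: mpow_cyc_axis)
    then show ?thesis
      using mpow_commute[of "cyc w" C] that by (simp add: matrix_vector_mul_assoc)
  qed
  show "A *v axis j 1 = B *v axis j 1"
    using assms *[of A] *[of B] by simp
qed

subsection \<open>The norm of the ramified extension\<close>

abbreviation rabs :: "'k::nonarch_local_field itself \<Rightarrow> real" where
  "rabs _ \<equiv> absval (uniformizer :: 'k)"

lemma rabs_powi_le_iff [simp]:
  "rabs TYPE('k::nonarch_local_field) powi a \<le> rabs TYPE('k) powi b \<longleftrightarrow> b \<le> a"
proof -
  have lt: "rabs TYPE('k) powi a < rabs TYPE('k) powi b" if "b < a" for a b
    using that power_int_strict_decreasing[of b a "rabs TYPE('k)"] by simp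
  show ?thesis
    using lt[of a b] lt[of b a] by (cases a b rule: linorder_cases) auto
qed

lemma rabs_powi_less_iff [simp]:
  "rabs TYPE('k::nonarch_local_field) powi a < rabs TYPE('k) powi b \<longleftrightarrow> b < a"
  by (metis rabs_powi_le_iff not_le)

lemma rabs_powi_eq_iff [simp]:
  "rabs TYPE('k::nonarch_local_field) powi a = rabs TYPE('k) powi b \<longleftrightarrow> a = b"
  by (metis rabs_powi_le_iff order_antisym order_refl)

lemma rabs_powi_pos [simp]: "0 < rabs TYPE('k::nonarch_local_field) powi a"
  by simp

text \<open>
  The \<open>n\<close>-th power of the norm of the extension generated by an \<open>n\<close>-th root of the uniformizer,
  in the basis of the powers of that root; the powers avoid \<open>n\<close>-th roots of real numbers.
\<close>

definition wt :: "'k::nonarch_local_field ^ 'n::finite \<Rightarrow> 'n \<Rightarrow> real" where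
  "wt x i = absval (x $ i) ^ CARD('n) * rabs TYPE('k) ^ idx i"

definition vnorm :: "'k::nonarch_local_field ^ 'n::finite \<Rightarrow> real" where
  "vnorm x = Max (range (wt x))"

lemma vnorm_le_iff: "vnorm x \<le> b \<longleftrightarrow> (\<forall>i. wt x i \<le> b)"
  unfolding vnorm_def by (subst Max_le_iff) auto

lemma wt_le_vnorm: "wt x i \<le> vnorm x"
  using vnorm_le_iff by blast

lemma vnorm_attained: obtains i where "vnorm x = wt x i"
proof -
  have "vnorm x \<in> range (wt x)"
    unfolding vnorm_def by (intro Max_in) auto
  then show ?thesis
    using that by blast
qed

lemma wt_nonneg [simp]: "0 \<le> wt x i"
  by (simp add: wt_def)

lemma vnorm_nonneg [simp]: "0 \<le> vnorm x"
  by (rule order_trans[OF wt_nonneg wt_le_vnorm])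

lemma wt_eq_0_iff [simp]: "wt x i = 0 \<longleftrightarrow> x $ i = 0"
  by (simp add: wt_def)

lemma vnorm_zero [simp]: "vnorm 0 = 0"
  by (rule antisym) (simp_all add: vnorm_le_iff wt_def power_0_left)

lemma vnorm_eq_0_iff [simp]: "vnorm x = 0 \<longleftrightarrow> x = 0"
proof
  assume "vnorm x = 0"
  then have "wt x i = 0" for i
    using wt_le_vnorm[of x i] wt_nonneg[of x i] by simp
  then show "x = 0"
    by (simp add: vec_eq_iff)
qed simp

lemma vnorm_pos_iff [simp]: "0 < vnorm x \<longleftrightarrow> x \<noteq> 0"
  using vnorm_nonneg[of x] vnorm_eq_0_iff[of x] by linarith

lemma wt_powi:
  fixes x :: "'k::nonarch_local_field ^ 'n::finite"
  assumes "x $ i \<noteq> 0"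
  obtains m where "wt x i = rabs TYPE('k) powi m" "m mod int CARD('n) = int (idx i)"
proof -
  obtain j where j: "absval (x $ i) = rabs TYPE('k) powi j"
    using absval_discrete assms by blast
  have "wt x i = rabs TYPE('k) powi (j * int CARD('n) + int (idx i))"
    unfolding wt_def j by (simp add: power_int_add power_int_mult)
  then show ?thesis
    using that[of "j * int CARD('n) + int (idx i)"] by simp
qed

text \<open>The exponent of the weight of a nonzero coordinate is congruent to its position modulo
  n. Hence distinct positions never tie, which is total ramification in coordinates.\<close>

lemma wt_inj:
  fixes x y :: "'k::nonarch_local_field ^ 'n::finite"
  assumes "wt x i = wt y j" "x $ i \<noteq> 0" "y $ j \<noteq> 0"
  shows "i = j"
proof -
  obtain m where "wt x i = rabs TYPE('k) powi m" "m mod int CARD('n) = int (idx i)"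
    using wt_powi[OF assms(2)] by blast
  moreover obtain l where "wt y j = rabs TYPE('k) powi l" "l mod int CARD('n) = int (idx j)"
    using wt_powi[OF assms(3)] by blast
  ultimately show ?thesis
    using assms(1) by simp
qed

lemma vnorm_powi:
  fixes x :: "'k::nonarch_local_field ^ 'n::finite"
  assumes "x \<noteq> 0"
  obtains m where "vnorm x = rabs TYPE('k) powi m"
proof -
  obtain i where i: "vnorm x = wt x i"
    using vnorm_attained by blast
  then have "x $ i \<noteq> 0"
    using assms by (metis vnorm_eq_0_iff wt_eq_0_iff)
  then show ?thesis
    using that i wt_powi by metis
qed

lemma vnorm_add: "vnorm (x + y) \<le> max (vnorm x) (vnorm (y::'k::nonarch_local_field ^ 'n::finite))"
  unfolding vnorm_le_iff
proof
  fix i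
  have "wt (x + y) i \<le> max (wt x i) (wt y i)"
  proof (cases "absval (x $ i) \<le> absval (y $ i)")
    case True
    then have "absval ((x + y) $ i) \<le> absval (y $ i)"
      using absval_ultrametric[of "x $ i" "y $ i"] by simp
    then have "wt (x + y) i \<le> wt y i"
      unfolding wt_def by (intro mult_right_mono power_mono) auto
    then show ?thesis
      by simp
  next
    case False
    then have "absval ((x + y) $ i) \<le> absval (x $ i)"
      using absval_ultrametric[of "x $ i" "y $ i"] by simp
    then have "wt (x + y) i \<le> wt x i"
      unfolding wt_def by (intro mult_right_mono power_mono) auto
    then show ?thesis
      by simp
  qed
  then show "wt (x + y) i \<le> max (vnorm x) (vnorm y)"
    using wt_le_vnorm[of x i] wt_le_vnorm[of y i] by linarith
qed

lemma wt_smult: "wt (c *s x) i = absval c ^ CARD('n) * wt (x::'k::nonarch_local_field ^ 'n::finite) i"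
  by (simp add: wt_def absval_mult power_mult_distrib)

lemma vnorm_smult: "vnorm (c *s x) = absval c ^ CARD('n) * vnorm (x::'k::nonarch_local_field ^ 'n::finite)"
proof (rule antisym)
  show "vnorm (c *s x) \<le> absval c ^ CARD('n) * vnorm x"
    unfolding vnorm_le_iff wt_smult by (simp add: wt_le_vnorm mult_left_mono)
  obtain i where "vnorm x = wt x i"
    using vnorm_attained by blast
  then show "absval c ^ CARD('n) * vnorm x \<le> vnorm (c *s x)"
    using wt_le_vnorm[of "c *s x" i] by (simp add: wt_smult)
qed

lemma vnorm_minus [simp]: "vnorm (- x) = vnorm x"
  by (simp add: vnorm_def wt_def)

lemma vnorm_diff: "vnorm (x - y) \<le> max (vnorm x) (vnorm y)"
  using vnorm_add[of x "- y"] by simp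

lemma vnorm_add_eq:
  assumes "vnorm x < vnorm y"
  shows "vnorm (x + y) = vnorm y"
proof (rule antisym)
  show "vnorm (x + y) \<le> vnorm y"
    using vnorm_add[of x y] assms by simp
  show "vnorm y \<le> vnorm (x + y)"
    using vnorm_diff[of "x + y" x] assms by (auto simp: max_def split: if_splits)
qed

lemma vnorm_sum_less:
  assumes "\<And>i. i \<in> I \<Longrightarrow> vnorm (v i) < b" "0 < b"
  shows "vnorm (\<Sum>i\<in>I. v i) < b"
  using assms
proof (induction I rule: infinite_finite_induct)
  case (insert i I)
  have "vnorm (v i) < b" "vnorm (\<Sum>i\<in>I. v i) < b"
    using insert by auto
  then show ?case
    using insert.hyps vnorm_add[of "v i" "\<Sum>i\<in>I. v i"] by simp
qed auto

text \<open>Moving a coordinate one position on multiplies its weight by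
  \<open>absval uniformizer\<close>; at the wrap-around the entry \<open>uniformizer\<close>
  contributes the n-th power of this factor while the position drops by n - 1.\<close>

lemma vnorm_cyc:
  "vnorm (cyc uniformizer *v x) = rabs TYPE('k) * vnorm (x::'k::nonarch_local_field ^ 'n::finite)"
proof -
  let ?P = "cyc uniformizer :: 'k ^ 'n ^ 'n" and ?n = "CARD('n)"
  have n: "?n > 0"
    by simp
  have wt: "wt (?P *v x) i = rabs TYPE('k) * wt x (at_idx (if idx i = 0 then ?n - 1 else idx i - 1))" for i
  proof (cases "idx i = 0")
    case True
    have "rabs TYPE('k) ^ ?n = rabs TYPE('k) * rabs TYPE('k) ^ (?n - 1)"
      using n by (metis power_eq_if less_not_refl)
    then show ?thesis
      using True n by (simp add: wt_def cyc_vec_nth absval_mult power_mult_distrib)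
  next
    case False
    have "idx i - 1 < ?n"
      using idx_less[of i] by linarith
    moreover have "rabs TYPE('k) ^ idx i = rabs TYPE('k) * rabs TYPE('k) ^ (idx i - 1)"
      using False by (metis power_eq_if)
    ultimately show ?thesis
      using False by (simp add: wt_def cyc_vec_nth)
  qed
  show ?thesis
  proof (rule antisym)
    show "vnorm (?P *v x) \<le> rabs TYPE('k) * vnorm x"
      unfolding vnorm_le_iff wt by (simp add: wt_le_vnorm)
    obtain i where i: "vnorm x = wt x i"
      using vnorm_attained by blast
    have "\<exists>j. wt (?P *v x) j = rabs TYPE('k) * wt x i"
    proof (cases "Suc (idx i) = ?n")
      case True
      then have "at_idx (?n - 1) = i"
        by (metis at_idx_idx diff_Suc_1)
      then show ?thesis
        using wt[of "at_idx 0"] by (intro exI[of _ "at_idx 0"]) simp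
    next
      case False
      then have "Suc (idx i) < ?n"
        using Suc_lessI[OF idx_less[of i]] by auto
      then show ?thesis
        using wt[of "at_idx (Suc (idx i))"] by (intro exI[of _ "at_idx (Suc (idx i))"]) simp
    qed
    then obtain j where "wt (?P *v x) j = rabs TYPE('k) * wt x i"
      by blast
    then show "rabs TYPE('k) * vnorm x \<le> vnorm (?P *v x)"
      using wt_le_vnorm[of "?P *v x" j] i by simp
  qed
qed

lemma vnorm_mpow_cyc:
  "vnorm (mpow (cyc uniformizer) m *v x) = rabs TYPE('k) ^ m * vnorm (x::'k::nonarch_local_field ^ 'n::finite)"
  by (induction m) (simp_all add: matrix_vector_mul_assoc[symmetric] vnorm_cyc)

lemma invertible_cyc_uniformizer [simp]:
  "invertible (cyc uniformizer :: 'k::nonarch_local_field ^ 'n::finite ^ 'n)"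
  by (simp add: invertible_cyc)

lemma vnorm_mpowi_cyc:
  "vnorm (mpowi (cyc uniformizer) m *v x) = rabs TYPE('k) powi m * vnorm (x::'k::nonarch_local_field ^ 'n::finite)"
proof (cases "m \<ge> 0")
  case True
  then show ?thesis
    by (simp add: mpowi_def vnorm_mpow_cyc power_int_def)
next
  case False
  let ?P = "cyc uniformizer :: 'k ^ 'n ^ 'n"
  define l where "l = nat (- m)"
  have l: "m = - int l"
    using False by (simp add: l_def)
  have "mpow ?P l ** mpowi ?P m = mat 1"
    using mpowi_uminus_mult[of ?P m] by (simp add: l mpowi_of_nat)
  then have "vnorm x = vnorm (mpow ?P l *v (mpowi ?P m *v x))"
    by (simp add: matrix_vector_mul_assoc)
  also have "\<dots> = rabs TYPE('k) ^ l * vnorm (mpowi ?P m *v x)"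
    by (rule vnorm_mpow_cyc)
  finally show ?thesis
    by (simp add: l power_int_minus field_simps)
qed

lemma vec_expand_cyc:
  "x = (\<Sum>i\<in>UNIV. x $ i *s (mpow (cyc w) (idx i) *v axis (at_idx 0) (1::'a::field) :: 'a ^ 'n::finite))"
proof -
  have "(\<Sum>i\<in>UNIV. x $ i *s axis i (1::'a)) = x"
    by (rule basis_expansion)
  then show ?thesis
    by (simp add: mpow_cyc_axis)
qed

text \<open>Elements of the commutant are identified with their image of the cyclic vector, and
  \<open>vnorm\<close> is carried over. Like \<open>vnorm\<close>, this is the n-th power of the
  norm of E extending \<open>absval\<close>.\<close>

definition enorm :: "'k::nonarch_local_field ^ 'n::finite ^ 'n \<Rightarrow> real" where
  "enorm A = vnorm (A *v axis (at_idx 0) 1)"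

text \<open>The field E = F[\<Pi>] as the commutant of \<Pi>: commutativity will follow from the
  expansion in powers of \<Pi>, invertibility of nonzero elements from multiplicativity of the
  norm.\<close>

definition EE :: "('k::nonarch_local_field ^ 'n::finite ^ 'n) set" where
  "EE = {A. A ** cyc uniformizer = cyc uniformizer ** A}"

lemma vnorm_axis_0: "vnorm (axis (at_idx 0) 1 :: 'k::nonarch_local_field ^ 'n::finite) = 1"
proof (rule antisym)
  show "vnorm (axis (at_idx 0) 1 :: 'k ^ 'n) \<le> 1"
    unfolding vnorm_le_iff by (auto simp: wt_def axis_def power_0_left)
  show "1 \<le> vnorm (axis (at_idx 0) 1 :: 'k ^ 'n)"
    using wt_le_vnorm[of "axis (at_idx 0) 1 :: 'k ^ 'n" "at_idx 0"] by (simp add: wt_def)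
qed

text \<open>Expanding \<open>x\<close> in powers of \<Pi> applied to the cyclic vector turns
  \<open>A *v x\<close> into a sum of terms of norms \<open>wt x i * enorm A\<close>. The nonzero
  ones among these are pairwise distinct, so the largest term dominates.\<close>

lemma vnorm_EE_mult:
  fixes x :: "'k::nonarch_local_field ^ 'n::finite"
  assumes "A \<in> EE"
  shows "vnorm (A *v x) = enorm A * vnorm x"
proof (cases "x = 0 \<or> enorm A = 0")
  case True
  let ?e = "axis (at_idx 0) 1 :: 'k ^ 'n"
  have "A = 0" if "enorm A = 0"
    using that assms cyc_commute_eqI[of A uniformizer 0] by (simp add: enorm_def EE_def)
  then show ?thesis
    using True by auto
next
  case False
  let ?e = "axis (at_idx 0) 1 :: 'k ^ 'n" and ?P = "cyc uniformizer :: 'k ^ 'n ^ 'n"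
  define v where "v = (\<lambda>i. x $ i *s (mpow ?P (idx i) *v (A *v ?e)))"
  have sum: "A *v x = (\<Sum>i\<in>UNIV. v i)"
  proof -
    have "A *v x = A *v (\<Sum>i\<in>UNIV. x $ i *s (mpow ?P (idx i) *v ?e))"
      using vec_expand_cyc[of x uniformizer] by simp
    also have "\<dots> = (\<Sum>i\<in>UNIV. x $ i *s (A *v (mpow ?P (idx i) *v ?e)))"
      by (simp add: vec.linear_sum[OF matrix_vector_mul_linear_gen] vector_scalar_commute)
    also have "\<dots> = (\<Sum>i\<in>UNIV. v i)"
      using assms mpow_commute[of ?P A] by (simp add: v_def matrix_vector_mul_assoc EE_def)
    finally show ?thesis .
  qed
  have norm: "vnorm (v i) = wt x i * enorm A" for i
    by (simp add: v_def vnorm_smult vnorm_mpow_cyc wt_def enorm_def)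
  obtain i where i: "vnorm x = wt x i"
    using vnorm_attained by blast
  have xi: "x $ i \<noteq> 0"
    using False i by (metis vnorm_eq_0_iff wt_eq_0_iff)
  have eA: "enorm A > 0"
    using False by (simp add: enorm_def)
  have "vnorm (\<Sum>j\<in>UNIV - {i}. v j) < vnorm (v i)"
  proof (rule vnorm_sum_less)
    fix j
    assume j: "j \<in> UNIV - {i}"
    have "wt x j \<le> wt x i"
      using wt_le_vnorm[of x j] i by simp
    moreover have "wt x j \<noteq> wt x i"
      using wt_inj[of x j x i] xi j by (metis DiffD2 singletonI wt_eq_0_iff)
    ultimately show "vnorm (v j) < vnorm (v i)"
      using eA by (simp add: norm)
    next
    have "wt x i > 0"
      using xi by (metis wt_eq_0_iff wt_nonneg order_less_le)
    then show "0 < vnorm (v i)"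
      unfolding norm using eA by simp
  qed
  then have "vnorm ((\<Sum>j\<in>UNIV - {i}. v j) + v i) = vnorm (v i)"
    by (rule vnorm_add_eq)
  moreover have "(\<Sum>j\<in>UNIV - {i}. v j) + v i = A *v x"
    unfolding sum by (simp add: sum.remove[of UNIV i] add.commute)
  ultimately show ?thesis
    by (simp add: norm i)
qed

lemma matrix_add_rdistrib: "((A::'a::semiring_1^'n^'m) + B) ** C = A ** C + B ** C"
  by (simp add: vec_eq_iff matrix_matrix_mult_def algebra_simps sum.distrib)

lemma EE_mult: "A \<in> EE \<Longrightarrow> B \<in> EE \<Longrightarrow> A ** B \<in> EE"
proof -
  let ?P = "cyc uniformizer :: 'a ^ 'b ^ 'b"
  assume "A \<in> EE" "B \<in> EE"
  then have AB: "A ** ?P = ?P ** A" "B ** ?P = ?P ** B"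
    by (simp_all add: EE_def)
  have "(A ** B) ** ?P = (A ** ?P) ** B"
    by (simp add: matrix_mul_assoc[symmetric] AB(2))
  also have "\<dots> = ?P ** (A ** B)"
    by (simp add: matrix_mul_assoc AB(1))
  finally show ?thesis
    by (simp add: EE_def)
qed

lemma EE_add: "A \<in> EE \<Longrightarrow> B \<in> EE \<Longrightarrow> A + B \<in> EE"
  by (simp add: EE_def matrix_add_ldistrib matrix_add_rdistrib)

lemma EE_diff: "A \<in> EE \<Longrightarrow> B \<in> EE \<Longrightarrow> A - B \<in> EE"
  by (simp add: EE_def matrix_diff_ldistrib matrix_diff_rdistrib)

lemma EE_mat [simp]: "mat c \<in> EE"
  by (simp add: EE_def mat_mult_commute)

lemma EE_cyc [simp]: "cyc uniformizer \<in> EE"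
  by (simp add: EE_def)

lemma EE_mpow: "A \<in> EE \<Longrightarrow> mpow A m \<in> EE"
  by (induction m) (simp_all add: EE_mult)

lemma EE_inv: "A \<in> EE \<Longrightarrow> invertible A \<Longrightarrow> matrix_inv A \<in> EE"
  by (simp add: EE_def matrix_inv_commute)

lemma EE_mpowi_cyc [simp]: "mpowi (cyc uniformizer) m \<in> EE"
  by (simp add: EE_def mpowi_commute)

text \<open>On the cyclic vector both products expand into the same double sum over powers of \<Pi>,
  read in the two orders. Since both factors commute with \<Pi>, agreement spreads to every basis
  vector.\<close>

lemma EE_commute:
  fixes A B :: "'k::nonarch_local_field ^ 'n::finite ^ 'n"
  assumes "A \<in> EE" "B \<in> EE"
  shows "A ** B = B ** A"
proof (rule matrix_eq_axis)
  fix j :: 'n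
  let ?P = "cyc uniformizer :: 'k ^ 'n ^ 'n" and ?e = "axis (at_idx 0) 1 :: 'k ^ 'n"
  have *: "A *v (B *v (mpow ?P m *v ?e)) = B *v (A *v (mpow ?P m *v ?e))"
    if 0: "A *v (B *v ?e) = B *v (A *v ?e)" for m
  proof -
    have "C *v (mpow ?P m *v x) = mpow ?P m *v (C *v x)" if "C \<in> EE" for C x
      using that mpow_commute[of ?P C m] by (simp add: EE_def matrix_vector_mul_assoc)
    then show ?thesis
      using assms 0 by simp
  qed
  have "A *v (B *v ?e) = B *v (A *v ?e)"
  proof -
    define x where "x = B *v ?e"
    have Bx: "B *v (mpow ?P m *v ?e) = mpow ?P m *v x" for m
      using assms mpow_commute[of ?P B m] by (simp add: x_def EE_def matrix_vector_mul_assoc)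
    have Am: "A *v (mpow ?P m *v y) = mpow ?P m *v (A *v y)" for m y
      using assms mpow_commute[of ?P A m] by (simp add: EE_def matrix_vector_mul_assoc)
    define y where "y = A *v ?e"
    have "A *v x = A *v (\<Sum>i\<in>UNIV. x $ i *s (mpow ?P (idx i) *v ?e))"
      using vec_expand_cyc[of x uniformizer] by simp
    also have "\<dots> = (\<Sum>i\<in>UNIV. x $ i *s (mpow ?P (idx i) *v y))"
      by (simp add: vec.linear_sum[OF matrix_vector_mul_linear_gen] vector_scalar_commute Am y_def)
    also have "\<dots> = (\<Sum>i\<in>UNIV. \<Sum>j\<in>UNIV. (x $ i * y $ j) *s (mpow ?P (idx i + idx j) *v ?e))"
    proof (intro sum.cong refl)
      fix i :: 'n
      have "mpow ?P (idx i) *v y = mpow ?P (idx i) *v (\<Sum>j\<in>UNIV. y $ j *s (mpow ?P (idx j) *v ?e))"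
        using vec_expand_cyc[of y uniformizer] by simp
      also have "\<dots> = (\<Sum>j\<in>UNIV. y $ j *s (mpow ?P (idx i + idx j) *v ?e))"
        by (simp add: vec.linear_sum[OF matrix_vector_mul_linear_gen] vector_scalar_commute
            mpow_add matrix_vector_mul_assoc)
      finally show "x $ i *s (mpow ?P (idx i) *v y) = (\<Sum>j\<in>UNIV. (x $ i * y $ j) *s (mpow ?P (idx i + idx j) *v ?e))"
        by (simp add: vec.scale_sum_right)
    qed
    also have "\<dots> = (\<Sum>j\<in>UNIV. \<Sum>i\<in>UNIV. (y $ j * x $ i) *s (mpow ?P (idx j + idx i) *v ?e))"
      by (subst sum.swap) (simp add: mult.commute add.commute)
    also have "\<dots> = (\<Sum>j\<in>UNIV. y $ j *s (mpow ?P (idx j) *v x))"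
    proof (intro sum.cong refl)
      fix j :: 'n
      have "mpow ?P (idx j) *v x = mpow ?P (idx j) *v (\<Sum>i\<in>UNIV. x $ i *s (mpow ?P (idx i) *v ?e))"
        using vec_expand_cyc[of x uniformizer] by simp
      also have "\<dots> = (\<Sum>i\<in>UNIV. x $ i *s (mpow ?P (idx j + idx i) *v ?e))"
        by (simp add: vec.linear_sum[OF matrix_vector_mul_linear_gen] vector_scalar_commute
            mpow_add matrix_vector_mul_assoc)
      finally show "(\<Sum>i\<in>UNIV. (y $ j * x $ i) *s (mpow ?P (idx j + idx i) *v ?e)) = y $ j *s (mpow ?P (idx j) *v x)"
        by (simp add: vec.scale_sum_right)
    qed
    also have "\<dots> = B *v (\<Sum>j\<in>UNIV. y $ j *s (mpow ?P (idx j) *v ?e))"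
      by (simp add: vec.linear_sum[OF matrix_vector_mul_linear_gen] vector_scalar_commute Bx)
    also have "\<dots> = B *v y"
      using vec_expand_cyc[of y uniformizer] by simp
    finally show ?thesis
      by (simp add: x_def y_def)
  qed
  from *[OF this, of "idx j"] show "(A ** B) *v axis j 1 = (B ** A) *v axis j 1"
    by (simp add: mpow_cyc_axis matrix_vector_mul_assoc[symmetric])
qed

lemma enorm_mult: "A \<in> EE \<Longrightarrow> enorm (A ** B) = enorm A * enorm B"
  using vnorm_EE_mult[of A "B *v axis (at_idx 0) 1"] by (simp add: enorm_def matrix_vector_mul_assoc)

lemma enorm_nonneg [simp]: "0 \<le> enorm A"
  by (simp add: enorm_def)

lemma enorm_add: "enorm (A + B) \<le> max (enorm A) (enorm B)"
  unfolding enorm_def matrix_vector_mult_add_rdistrib by (rule vnorm_add)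

lemma enorm_mat: "enorm (mat c :: 'k::nonarch_local_field ^ 'n::finite ^ 'n) = absval c ^ CARD('n)"
  by (simp add: enorm_def vnorm_smult vnorm_axis_0)

lemma enorm_cyc: "enorm (cyc uniformizer :: 'k::nonarch_local_field ^ 'n::finite ^ 'n) = rabs TYPE('k)"
  by (simp add: enorm_def vnorm_cyc vnorm_axis_0)

lemma enorm_mpowi_cyc:
  "enorm (mpowi (cyc uniformizer) m :: 'k::nonarch_local_field ^ 'n::finite ^ 'n) = rabs TYPE('k) powi m"
  by (simp add: enorm_def vnorm_mpowi_cyc vnorm_axis_0)

lemma enorm_eq_0_iff:
  fixes A :: "'k::nonarch_local_field ^ 'n::finite ^ 'n"
  assumes "A \<in> EE"
  shows "enorm A = 0 \<longleftrightarrow> A = 0"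
  using assms cyc_commute_eqI[of A uniformizer 0] by (auto simp: enorm_def EE_def)

text \<open>Multiplicativity of the norm leaves no room for a kernel.\<close>

lemma EE_invertible:
  fixes A :: "'k::nonarch_local_field ^ 'n::finite ^ 'n"
  assumes "A \<in> EE" "A \<noteq> 0"
  shows "invertible A"
proof -
  have "x = 0" if "A *v x = 0" for x
    using vnorm_EE_mult[OF assms(1), of x] that assms(2) enorm_eq_0_iff[OF assms(1)] by auto
  then show ?thesis
    unfolding invertible_left_inverse matrix_left_invertible_ker by blast
qed

lemma absval_less_inverse_uniformizer:
  assumes "absval (c::'k::nonarch_local_field) < 1 / rabs TYPE('k)"
  shows "absval c \<le> 1"
proof -
  have "absval (c * uniformizer) < 1"
    using assms by (simp add: absval_mult pos_less_divide_eq)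
  then have "absval c * rabs TYPE('k) \<le> rabs TYPE('k)"
    using absval_le_uniformizer by (metis absval_mult)
  then show ?thesis
    by simp
qed

text \<open>With r = \<open>absval uniformizer\<close>, a nonintegral coordinate has absolute value
  at least 1/r, so its n-th power is at least r^(-n), which the position factor r^i with i < n
  cannot bring down to 1. Thus the unit ball of E is the standard lattice.\<close>

lemma vnorm_le_1_iff: "vnorm (x::'k::nonarch_local_field ^ 'n::finite) \<le> 1 \<longleftrightarrow> (\<forall>i. absval (x $ i) \<le> 1)"
proof
  assume le: "vnorm x \<le> 1"
  show "\<forall>i. absval (x $ i) \<le> 1"
  proof (rule allI, rule ccontr)
    fix i
    assume "\<not> absval (x $ i) \<le> 1"
    then have "absval (x $ i) \<ge> 1 / rabs TYPE('k)"
      using absval_less_inverse_uniformizer by force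
    then have "(1 / rabs TYPE('k)) ^ CARD('n) \<le> absval (x $ i) ^ CARD('n)"
      by (intro power_mono) auto
    then have "(1 / rabs TYPE('k)) ^ CARD('n) * rabs TYPE('k) ^ idx i \<le> wt x i"
      unfolding wt_def by (intro mult_right_mono) auto
    also have "\<dots> \<le> 1"
      using le wt_le_vnorm[of x i] by simp
    finally have "CARD('n) \<le> idx i"
      by (simp add: power_divide field_simps)
    then show False
      using idx_less[of i] by simp
  qed
next
  assume "\<forall>i. absval (x $ i) \<le> 1"
  then show "vnorm x \<le> 1"
    unfolding vnorm_le_iff wt_def by (auto intro!: mult_le_one power_le_one)
qed

text \<open>Multiplication by a unit preserves the unit ball of \<open>vnorm\<close>, which is the
  standard lattice; the same applies to the inverse.\<close>

lemma EE_unit_GLO: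
  fixes A :: "'k::nonarch_local_field ^ 'n::finite ^ 'n"
  assumes "A \<in> EE" "enorm A = 1"
  shows "A \<in> GLO"
proof -
  have mb: "mbound 1 B" if "B \<in> EE" "enorm B = 1" for B :: "'k ^ 'n ^ 'n"
    unfolding mbound_def
  proof (intro allI)
    fix i j
    have "vnorm (B *v axis j 1) = vnorm (axis j 1 :: 'k ^ 'n)"
      using vnorm_EE_mult[OF that(1)] that(2) by simp
    also have "\<dots> \<le> 1"
      unfolding vnorm_le_1_iff by (simp add: axis_def)
    finally show "absval (B $ i $ j) \<le> 1"
      unfolding vnorm_le_1_iff by simp
  qed
  have inv: "invertible A"
    using assms enorm_eq_0_iff EE_invertible by fastforce
  have A': "matrix_inv A \<in> EE"
    using EE_inv assms inv by blast
  moreover have "enorm (matrix_inv A) = 1"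
    using enorm_mult[OF assms(1), of "matrix_inv A"] assms(2) inv enorm_mat[of "1::'k", where 'n='n] by simp
  ultimately have "mbound 1 (matrix_inv A)"
    by (rule mb)
  then have "absval (det (matrix_inv A)) \<le> 1"
    using absval_det_le[of 1 "matrix_inv A"] by simp
  then have "1 \<le> absval (det A)"
  proof -
    have "0 < absval (det A)"
      using inv by (simp add: invertible_det_nz)
    moreover have "inverse (absval (det A)) \<le> 1"
      using \<open>absval (det (matrix_inv A)) \<le> 1\<close> inv by (simp add: det_matrix_inv absval_inverse)
    ultimately show ?thesis
      by (simp add: inverse_eq_divide)
  qed
  moreover have mA: "mbound 1 A"
    using mb assms by blast
  moreover have "absval (det A) \<le> 1"
    using absval_det_le[OF mA] by simp
  ultimately show ?thesis
    by (simp add: GLO_def)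
qed

text \<open>The n-th power of \<Pi> is the scalar \<open>uniformizer\<close>, so comparing n-th
  powers of absolute values avoids computing the determinant and its sign.\<close>

lemma absval_det_cyc: "absval (det (cyc uniformizer :: 'k::nonarch_local_field ^ 'n::finite ^ 'n)) = rabs TYPE('k)"
proof -
  have "det (mat (uniformizer::'k) :: 'k ^ 'n ^ 'n) = uniformizer ^ CARD('n)"
    by (subst det_diagonal) (auto simp: mat_def)
  then have "absval (det (cyc uniformizer :: 'k ^ 'n ^ 'n)) ^ CARD('n) = rabs TYPE('k) ^ CARD('n)"
    using det_mpow[of "cyc uniformizer :: 'k ^ 'n ^ 'n" "CARD('n)"]
    by (simp add: mpow_cyc_card absval_power[symmetric])
  then show ?thesis
    by (simp add: power_eq_iff_eq_base)
qed

text \<open>The nonzero values of the norm are integral powers of \<open>absval uniformizer\<close>,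
  which is the norm of \<Pi>; dividing by a power of \<Pi> leaves a unit.\<close>

lemma EE_decompose:
  fixes A :: "'k::nonarch_local_field ^ 'n::finite ^ 'n"
  assumes "A \<in> EE" "A \<noteq> 0"
  obtains m U where "A = mpowi (cyc uniformizer) m ** U" "U \<in> EE" "enorm U = 1"
    "absval (det A) = rabs TYPE('k) powi m"
proof -
  let ?P = "cyc uniformizer :: 'k ^ 'n ^ 'n"
  have "A *v axis (at_idx 0) 1 \<noteq> 0"
    using assms enorm_eq_0_iff by (auto simp: enorm_def)
  then obtain m where m: "enorm A = rabs TYPE('k) powi m"
    unfolding enorm_def using vnorm_powi by blast
  define U where "U = mpowi ?P (- m) ** A"
  have 1: "A = mpowi ?P m ** U"
    using mpowi_uminus_mult[of ?P "- m"] by (simp add: U_def matrix_mul_assoc)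
  have 2: "U \<in> EE"
    using assms by (simp add: U_def EE_mult)
  have 3: "enorm U = 1"
    by (simp add: U_def enorm_mult enorm_mpowi_cyc m power_int_minus)
  have "absval (det U) = 1"
    using EE_unit_GLO[OF 2 3] by (simp add: GLO_def)
  then have "absval (det A) = rabs TYPE('k) powi m"
    by (simp add: 1 det_mul det_mpowi absval_mult absval_power_int absval_det_cyc)
  then show ?thesis
    using that 1 2 3 by blast
qed

lemma EE_unit_iff:
  fixes A :: "'k::nonarch_local_field ^ 'n::finite ^ 'n"
  assumes "A \<in> EE"
  shows "enorm A = 1 \<longleftrightarrow> absval (det A) = 1"
proof
  assume "absval (det A) = 1"
  have "det (0 :: 'k ^ 'n ^ 'n) = 0"
    using det_0[where 'n='n and 'a='k] by (simp add: mat_0)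
  then have "A \<noteq> 0"
    using \<open>absval (det A) = 1\<close> by auto
  then obtain m U where mU: "A = mpowi (cyc uniformizer) m ** U" "U \<in> EE" "enorm U = 1"
    "absval (det A) = rabs TYPE('k) powi m"
    using EE_decompose[OF assms] by blast
  then have "rabs TYPE('k) powi m = rabs TYPE('k) powi 0"
    using \<open>absval (det A) = 1\<close> by simp
  then have "m = 0"
    unfolding rabs_powi_eq_iff .
  then show "enorm A = 1"
    using mU by simp
qed (use EE_unit_GLO[OF assms] in \<open>simp add: GLO_def\<close>)

subsection \<open>Powers of principal units\<close>

lemma enorm_add_eq: "enorm A < enorm B \<Longrightarrow> enorm (A + B) = enorm B"
  unfolding enorm_def matrix_vector_mult_add_rdistrib by (rule vnorm_add_eq)

text \<open>Binomial expansion to second order with an integral remainder; the recursion q' = m + q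
  + zq of the remainder replaces binomial coefficients.\<close>

lemma one_plus_mpow:
  fixes z :: "'k::nonarch_local_field ^ 'n::finite ^ 'n"
  assumes z: "z \<in> EE" "enorm z \<le> 1"
  shows "\<exists>q\<in>EE. enorm q \<le> 1 \<and> mpow (mat 1 + z) m = mat 1 + mat (of_nat m) ** z + z ** z ** q"
proof (induction m)
  case 0
  show ?case
    by (intro bexI[of _ 0]) (auto simp: EE_def enorm_def mat_0 matrix_vector_mult_0)
next
  case (Suc m)
  then obtain q where q: "q \<in> EE" "enorm q \<le> 1"
    and eq: "mpow (mat 1 + z) m = mat 1 + mat (of_nat m) ** z + z ** z ** q"
    by blast
  let ?m = "mat (of_nat m) :: 'k ^ 'n ^ 'n"
  define q' where "q' = ?m + q + z ** q"
  have comm: "z ** (?m ** z) = z ** z ** ?m"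
    using mat_mult_commute[of "of_nat m" z] by (simp add: matrix_mul_assoc)
  have suc: "mat (of_nat (Suc m)) ** z = z + ?m ** z"
    by (simp add: vec_eq_iff algebra_simps)
  have "mpow (mat 1 + z) (Suc m) = mat 1 + (z + ?m ** z) + (z ** (?m ** z) + z ** z ** q + z ** (z ** z ** q))"
    unfolding mpow.simps eq by (simp add: matrix_add_ldistrib matrix_add_rdistrib add_ac)
  also have "z ** (?m ** z) + z ** z ** q + z ** (z ** z ** q) = z ** z ** q'"
    unfolding comm q'_def by (simp add: matrix_add_ldistrib matrix_mul_assoc)
  finally have "mpow (mat 1 + z) (Suc m) = mat 1 + mat (of_nat (Suc m)) ** z + z ** z ** q'"
    unfolding suc .
  moreover have "q' \<in> EE"
    unfolding q'_def using z q by (intro EE_add EE_mult EE_mat)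
  moreover have "enorm q' \<le> 1"
  proof -
    have "enorm ?m \<le> 1"
      by (simp add: enorm_mat absval_of_nat_le power_le_one)
    moreover have "enorm (z ** q) \<le> 1"
      using z q by (simp add: enorm_mult mult_le_one)
    ultimately show ?thesis
      unfolding q'_def using q(2) enorm_add[of "?m + q" "z ** q"] enorm_add[of ?m q] by linarith
  qed
  ultimately show ?case
    by blast
qed

lemma enorm_one_plus_mpow_le:
  fixes z :: "'k::nonarch_local_field ^ 'n::finite ^ 'n"
  assumes z: "z \<in> EE" "enorm z \<le> 1"
  shows "enorm (mpow (mat 1 + z) m - mat 1) \<le> max (absval (of_nat m :: 'k) ^ CARD('n)) (enorm z) * enorm z"
proof -
  obtain q where q: "q \<in> EE" "enorm q \<le> 1"
    and eq: "mpow (mat 1 + z) m = mat 1 + mat (of_nat m) ** z + z ** z ** q"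
    using one_plus_mpow[OF z] by blast
  have "enorm (z ** z ** q) \<le> enorm z * enorm z"
    using z q mult_left_mono[of "enorm q" 1 "enorm z * enorm z"] by (simp add: enorm_mult EE_mult)
  also have "\<dots> \<le> max (absval (of_nat m :: 'k) ^ CARD('n)) (enorm z) * enorm z"
    by (intro mult_right_mono) auto
  finally have 1: "enorm (z ** z ** q) \<le> max (absval (of_nat m :: 'k) ^ CARD('n)) (enorm z) * enorm z" .
  have 2: "enorm (mat (of_nat m) ** z) \<le> max (absval (of_nat m :: 'k) ^ CARD('n)) (enorm z) * enorm z"
    unfolding enorm_mult[OF EE_mat] enorm_mat by (intro mult_right_mono) auto
  have "mpow (mat 1 + z) m - mat 1 = mat (of_nat m) ** z + z ** z ** q"
    by (simp add: eq)
  then show ?thesis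
    using enorm_add[of "mat (of_nat m) ** z" "z ** z ** q"] 1 2 by simp
qed

text \<open>In the range \<open>enorm z < absval (of_nat m) ^ CARD('n)\<close> the linear term is
  strictly larger than the quadratic remainder.\<close>

lemma enorm_one_plus_mpow_eq:
  fixes z :: "'k::nonarch_local_field ^ 'n::finite ^ 'n"
  assumes z: "z \<in> EE" "0 < enorm z" "enorm z < absval (of_nat m :: 'k) ^ CARD('n)"
  shows "enorm (mpow (mat 1 + z) m - mat 1) = absval (of_nat m :: 'k) ^ CARD('n) * enorm z"
proof -
  have "enorm z \<le> 1"
    using z(3) absval_of_nat_le[of m, where 'k='k] by (smt (verit) absval_nonneg power_le_one)
  then obtain q where q: "q \<in> EE" "enorm q \<le> 1"
    and eq: "mpow (mat 1 + z) m = mat 1 + mat (of_nat m) ** z + z ** z ** q"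
    using one_plus_mpow[OF z(1)] by blast
  have 2: "enorm (mat (of_nat m) ** z) = absval (of_nat m :: 'k) ^ CARD('n) * enorm z"
    unfolding enorm_mult[OF EE_mat] enorm_mat ..
  have "enorm (z ** z ** q) \<le> enorm z * enorm z"
    using z q mult_left_mono[of "enorm q" 1 "enorm z * enorm z"] by (simp add: enorm_mult EE_mult)
  also have "\<dots> < enorm (mat (of_nat m) ** z)"
    unfolding 2 using z by simp
  finally have "enorm (z ** z ** q + mat (of_nat m) ** z) = enorm (mat (of_nat m) ** z)"
    by (rule enorm_add_eq)
  moreover have "mpow (mat 1 + z) m - mat 1 = z ** z ** q + mat (of_nat m) ** z"
    unfolding eq by (simp add: algebra_simps)
  ultimately show ?thesis
    using 2 by simp
qed

text \<open>Each p-th power contracts the distance to 1 by a fixed factor, which is below 1 when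
  \<open>p\<close> is the residue characteristic and \<open>enorm z < 1\<close>. So the powers with
  exponents p^N tend to 1.\<close>

lemma enorm_mpow_prime_power_le:
  fixes z :: "'k::nonarch_local_field ^ 'n::finite ^ 'n"
  assumes z: "z \<in> EE" "enorm z \<le> 1"
  shows "enorm (mpow (mat 1 + z) (p ^ N) - mat 1)
    \<le> max (absval (of_nat p :: 'k) ^ CARD('n)) (enorm z) ^ N * enorm z"
proof (induction N)
  case (Suc N)
  define K where "K = max (absval (of_nat p :: 'k) ^ CARD('n)) (enorm z)"
  have K: "0 \<le> K" "K \<le> 1"
    using z absval_of_nat_le[of p, where 'k='k] by (auto simp: K_def power_le_one le_max_iff_disj)
  define y where "y = mpow (mat 1 + z) (p ^ N) - mat 1"
  have y: "y \<in> EE" "enorm y \<le> K ^ N * enorm z"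
    using Suc z unfolding y_def K_def by (auto intro!: EE_diff EE_mpow EE_add)
  have "K ^ N * enorm z \<le> enorm z"
    using K by (simp add: mult_left_le_one_le power_le_one)
  then have yz: "enorm y \<le> enorm z"
    using y by simp
  have "mpow (mat 1 + z) (p ^ Suc N) = mpow (mat 1 + y) p"
    by (simp add: y_def mpow_mult[symmetric] mult.commute)
  then have "enorm (mpow (mat 1 + z) (p ^ Suc N) - mat 1)
      \<le> max (absval (of_nat p :: 'k) ^ CARD('n)) (enorm y) * enorm y"
    using enorm_one_plus_mpow_le[of y p] y(1) yz z(2) by simp
  also have "\<dots> \<le> K * (K ^ N * enorm z)"
    using yz y(2) K by (intro mult_mono) (auto simp: K_def)
  finally show ?case
    by (simp add: K_def mult_ac)
qed simp

text \<open>The range in which the linear term dominates is preserved, so each p-th power multiplies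
  the distance to 1 by exactly the norm of \<open>p\<close>. This later fixes the valuation of the
  element defining stability modulo n.\<close>

lemma enorm_mpow_prime_power_eq:
  fixes z :: "'k::nonarch_local_field ^ 'n::finite ^ 'n"
  assumes z: "z \<in> EE" "0 < enorm z" "enorm z < absval (of_nat p :: 'k) ^ CARD('n)"
  shows "enorm (mpow (mat 1 + z) (p ^ N) - mat 1) = absval (of_nat p :: 'k) ^ (CARD('n) * N) * enorm z"
proof (induction N)
  case (Suc N)
  define y where "y = mpow (mat 1 + z) (p ^ N) - mat 1"
  define K where "K = absval (of_nat p :: 'k) ^ CARD('n)"
  have K: "0 < K" "K \<le> 1"
    using z absval_of_nat_le[of p, where 'k='k] by (auto simp: K_def power_le_one)
  have y: "y \<in> EE" "enorm y = K ^ N * enorm z"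
    using Suc z unfolding y_def K_def by (auto intro!: EE_diff EE_mpow EE_add simp: power_mult)
  have "K ^ N * enorm z \<le> enorm z"
    using K by (simp add: mult_left_le_one_le power_le_one)
  then have "enorm y < K"
    using y(2) z(3) unfolding K_def[symmetric] by linarith
  moreover have "0 < enorm y"
    using y(2) z(2) K by simp
  ultimately have "enorm (mpow (mat 1 + y) p - mat 1) = K * enorm y"
    unfolding K_def by (intro enorm_one_plus_mpow_eq y(1))
  moreover have "mpow (mat 1 + z) (p ^ Suc N) = mpow (mat 1 + y) p"
    by (simp add: y_def mpow_mult[symmetric] mult.commute)
  ultimately show ?case
    by (simp add: y K_def power_mult power_add)
qed simp

subsection \<open>Lattices stable under an element of the extension\<close>

text \<open>The scalar \<open>c\<close> cancels the coordinate of \<open>y\<close> at the leading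
  position of \<open>v\<close>. Weights at other positions cannot equal the common bound, so the
  norm drops by a full step.\<close>

lemma vnorm_lead:
  fixes y v :: "'k::nonarch_local_field ^ 'n::finite"
  assumes "vnorm y \<le> rabs TYPE('k) powi m" "vnorm v = rabs TYPE('k) powi m"
  shows "\<exists>c. absval c \<le> 1 \<and> vnorm (y - c *s v) \<le> rabs TYPE('k) powi (m + 1)"
proof -
  obtain s where s: "vnorm v = wt v s"
    using vnorm_attained by blast
  have vs: "v $ s \<noteq> 0"
    using s assms(2) rabs_powi_pos[of m, where 'k='k] by (metis less_irrefl wt_eq_0_iff)
  define c where "c = y $ s / v $ s"
  have "wt y s \<le> wt v s"
    using wt_le_vnorm[of y s] assms s by simp
  then have "absval (y $ s) ^ CARD('n) \<le> absval (v $ s) ^ CARD('n)"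
    by (simp add: wt_def)
  then have le: "absval (y $ s) \<le> absval (v $ s)"
    by simp
  then have c: "absval c \<le> 1"
    using vs by (simp add: c_def absval_divide)
  have "vnorm (c *s v) \<le> rabs TYPE('k) powi m"
    unfolding vnorm_smult using assms(2) c by (simp add: power_le_one mult_left_le_one_le)
  then have d: "vnorm (y - c *s v) \<le> rabs TYPE('k) powi m"
    using vnorm_diff[of y "c *s v"] assms(1) by simp
  have "wt (y - c *s v) i \<le> rabs TYPE('k) powi (m + 1)" for i
  proof (cases "(y - c *s v) $ i = 0")
    case True
    then have "wt (y - c *s v) i = 0"
      by simp
    then show ?thesis
      using rabs_powi_pos[of "m + 1", where 'k='k] by linarith
  next
    case False
    then have "i \<noteq> s"
      using vs by (auto simp: c_def)
    then have "wt (y - c *s v) i \<noteq> wt v s"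
      using wt_inj[of "y - c *s v" i v s] False vs by blast
    obtain l where l: "wt (y - c *s v) i = rabs TYPE('k) powi l"
      using wt_powi[OF False] by blast
    then have "rabs TYPE('k) powi l \<le> rabs TYPE('k) powi m"
      using wt_le_vnorm[of "y - c *s v" i] d by linarith
    moreover have "l \<noteq> m"
      using \<open>wt (y - c *s v) i \<noteq> wt v s\<close> l s assms(2) by auto
    ultimately show ?thesis
      unfolding l by simp
  qed
  then show ?thesis
    using c by (auto simp: vnorm_le_iff)
qed

text \<open>For invertible \<open>h\<close> this is the lattice h O^n spanned by the columns of
  \<open>h\<close> over the ring of integers.\<close>

definition lat :: "'k::nonarch_local_field ^ 'n::finite ^ 'n \<Rightarrow> ('k ^ 'n) set" where
  "lat h = {x. \<forall>i. absval ((matrix_inv h *v x) $ i) \<le> 1}"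

lemma lat_add: "x \<in> lat h \<Longrightarrow> y \<in> lat h \<Longrightarrow> x + y \<in> lat h"
  unfolding lat_def
  by (auto simp: matrix_vector_right_distrib intro: order_trans[OF absval_ultrametric])

lemma lat_smult: "absval c \<le> 1 \<Longrightarrow> x \<in> lat h \<Longrightarrow> c *s x \<in> lat h"
  unfolding lat_def by (simp add: vector_scalar_commute absval_mult mult_le_one)

lemma absval_matrix_vector_le_1:
  assumes "mbound 1 A" "\<forall>i. absval ((x::'k::nonarch_local_field ^ 'n::finite) $ i) \<le> 1"
  shows "absval ((A *v x) $ i) \<le> 1"
  unfolding matrix_vector_mult_def vec_lambda_beta
  using assms by (intro absval_sum_le) (auto simp: absval_mult mbound_def intro!: mult_le_one)

text \<open>Integrality of the conjugate h^(-1) z h expresses that \<open>z\<close> maps the lattice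
  of \<open>h\<close> into itself; stability is encoded in this form from here on.\<close>

lemma lat_stable:
  assumes "invertible h" "mbound 1 (matrix_inv h ** z ** h)" "x \<in> lat h"
  shows "z *v x \<in> lat h"
proof -
  have "matrix_inv h *v (z *v x) = (matrix_inv h ** z ** h) *v (matrix_inv h *v x)"
    using assms(1) by (simp add: matrix_vector_mul_assoc)
  then show ?thesis
    using absval_matrix_vector_le_1[OF assms(2)] assms(3) by (simp add: lat_def)
qed

lemma lat_contains_small:
  fixes h :: "'k::nonarch_local_field ^ 'n::finite ^ 'n"
  shows "\<exists>M. \<forall>y. vnorm y \<le> rabs TYPE('k) powi M \<longrightarrow> y \<in> lat h"
proof -
  obtain b where b: "b \<ge> 1" "mbound b (matrix_inv h)"
    using mbound_exists by blast
  have "(\<lambda>t. rabs TYPE('k) ^ t * b) \<longlonglongrightarrow> 0 * b"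
    by (intro tendsto_intros LIMSEQ_realpow_zero) auto
  then have "eventually (\<lambda>t. rabs TYPE('k) ^ t * b < 1) sequentially"
    by (intro order_tendstoD) auto
  then obtain t where t: "rabs TYPE('k) ^ t * b < 1"
    by (auto simp: eventually_sequentially)
  have mb: "mbound 1 (mat (uniformizer ^ t) ** matrix_inv h)"
    using mbound_smult[OF b(2), of "uniformizer ^ t"] t by (simp add: absval_power mbound_mono)
  \<comment> \<open>The exponent carries a factor n because \<open>vnorm\<close> is an n-th power:
    dividing by \<open>uniformizer ^ t\<close> shifts it by t * n.\<close>
  have "y \<in> lat h" if y: "vnorm y \<le> rabs TYPE('k) powi (int t * int CARD('n))" for y
  proof -
    let ?x = "inverse (uniformizer ^ t) *s y"
    have "vnorm ?x \<le> inverse (rabs TYPE('k) ^ t) ^ CARD('n) * rabs TYPE('k) powi (int t * int CARD('n))"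
      unfolding vnorm_smult absval_inverse absval_power using y by (intro mult_left_mono) auto
    also have "\<dots> = 1"
      by (simp add: power_int_mult power_inverse)
    finally have "vnorm ?x \<le> 1" .
    then have "absval (((mat (uniformizer ^ t) ** matrix_inv h) *v ?x) $ i) \<le> 1" for i
      unfolding vnorm_le_1_iff by (rule absval_matrix_vector_le_1[OF mb])
    moreover have "(mat (uniformizer ^ t) ** matrix_inv h) *v ?x = matrix_inv h *v y"
      by (simp add: matrix_vector_mul_assoc[symmetric] vector_scalar_commute vector_smult_assoc)
    ultimately show ?thesis
      by (simp add: lat_def)
  qed
  then show ?thesis
    by blast
qed

text \<open>Successive approximation: lattice vectors of every norm step cancel leading terms one
  after the other until the remainder falls into a ball known to lie in the lattice. The induction
  on \<open>m\<close> runs downwards from that ball.\<close>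

lemma lat_contains:
  fixes h :: "'k::nonarch_local_field ^ 'n::finite ^ 'n"
  assumes "\<And>m. m \<ge> m0 \<Longrightarrow> \<exists>v\<in>lat h. vnorm v = rabs TYPE('k) powi m"
    and "vnorm y \<le> rabs TYPE('k) powi m0"
  shows "y \<in> lat h"
proof -
  obtain M where M: "\<And>y. vnorm y \<le> rabs TYPE('k) powi M \<Longrightarrow> y \<in> lat h"
    using lat_contains_small by blast
  have "\<forall>y. vnorm y \<le> rabs TYPE('k) powi m \<longrightarrow> y \<in> lat h" if "m0 \<le> m" "m \<le> M" for m
    using that(2,1)
  proof (induction m rule: int_le_induct)
    case (step m)
    show ?case
    proof (intro allI impI)
      fix y :: "'k ^ 'n"
      assume y: "vnorm y \<le> rabs TYPE('k) powi (m - 1)"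
      obtain v where v: "v \<in> lat h" "vnorm v = rabs TYPE('k) powi (m - 1)"
        using assms(1) step.prems by blast
      obtain c where c: "absval c \<le> 1" "vnorm (y - c *s v) \<le> rabs TYPE('k) powi (m - 1 + 1)"
        using vnorm_lead[OF y v(2)] by blast
      have "y - c *s v \<in> lat h"
        using step c by simp
      then have "(y - c *s v) + c *s v \<in> lat h"
        using lat_smult[OF c(1) v(1)] by (rule lat_add)
      then show "y \<in> lat h"
        by simp
    qed
  qed (use M in blast)
  moreover have "y \<in> lat h" if "m0 > M"
  proof -
    have "rabs TYPE('k) powi m0 \<le> rabs TYPE('k) powi M"
      using that by simp
    then show ?thesis
      using M[of y] assms(2) by linarith
  qed
  ultimately show ?thesis
    using assms(2) by (cases "m0 \<le> M") auto
qed

lemma mbound_1_columns: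
  fixes A :: "'k::nonarch_local_field ^ 'n::finite ^ 'n"
  assumes "\<And>j. vnorm (A *v axis j 1) \<le> 1"
  shows "mbound 1 A"
  unfolding mbound_def
proof (intro allI)
  fix i j
  show "absval (A $ i $ j) \<le> 1"
    using assms[of j] unfolding vnorm_le_1_iff matrix_vector_mult_axis by blast
qed

lemma vnorm_axis_le_1: "vnorm (axis j 1 :: 'k::nonarch_local_field ^ 'n::finite) \<le> 1"
  unfolding vnorm_le_1_iff by (simp add: axis_def)

text \<open>The exponent \<open>a\<close> comes from the longest column of \<open>h\<close>. All
  columns lie in \<Pi>^a O_E, and by \<open>step\<close> the lattice contains vectors of every norm
  step from a + d on, hence \<Pi>^(a + d) O_E.\<close>

lemma lattice_sandwich:
  fixes h :: "'k::nonarch_local_field ^ 'n::finite ^ 'n"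
  assumes inv: "invertible h"
    and step: "\<And>x a m. x \<in> lat h \<Longrightarrow> vnorm x = rabs TYPE('k) powi a \<Longrightarrow> m \<ge> a + d \<Longrightarrow>
      \<exists>v\<in>lat h. vnorm v = rabs TYPE('k) powi m"
  shows "\<exists>a. mbound 1 (mpowi (cyc uniformizer) (- a) ** h) \<and>
    mbound 1 (matrix_inv h ** mpowi (cyc uniformizer) (a + d))"
proof -
  let ?P = "cyc uniformizer :: 'k ^ 'n ^ 'n"
  have "finite (range (\<lambda>j. vnorm (h *v axis j 1)))"
    by simp
  then have "Max (range (\<lambda>j. vnorm (h *v axis j 1))) \<in> range (\<lambda>j. vnorm (h *v axis j 1))"
    by (intro Max_in) auto
  then obtain j0 where j0: "Max (range (\<lambda>j. vnorm (h *v axis j 1))) = vnorm (h *v axis j0 1)"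
    by blast
  have max: "vnorm (h *v axis j 1) \<le> vnorm (h *v axis j0 1)" for j
    unfolding j0[symmetric] by (intro Max_ge) auto
  let ?x = "h *v axis j0 1"
  have ax: "matrix_inv h *v ?x = axis j0 1"
    using inv by (simp add: matrix_vector_mul_assoc)
  then have "?x \<noteq> 0"
    by (metis axis_eq_0_iff matrix_vector_mult_0_right zero_neq_one)
  then obtain a where a: "vnorm ?x = rabs TYPE('k) powi a"
    using vnorm_powi by blast
  have "absval (axis j0 (1::'k) $ i) \<le> 1" for i
    by (simp add: axis_def)
  then have x: "?x \<in> lat h"
    unfolding lat_def by (simp only: ax mem_Collect_eq) blast
  have 1: "mbound 1 (mpowi ?P (- a) ** h)"
  proof (rule mbound_1_columns)
    fix j
    have "rabs TYPE('k) powi (- a) * vnorm (h *v axis j 1) \<le> rabs TYPE('k) powi (- a) * rabs TYPE('k) powi a"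
      using max[of j] a by (intro mult_left_mono) auto
    also have "\<dots> = 1"
      by (simp add: power_int_minus)
    finally show "vnorm ((mpowi ?P (- a) ** h) *v axis j 1) \<le> 1"
      by (simp add: matrix_vector_mul_assoc[symmetric] vnorm_mpowi_cyc)
  qed
  have "mbound 1 (matrix_inv h ** mpowi ?P (a + d))"
  proof (rule mbound_1_columns)
    fix j
    have "vnorm (mpowi ?P (a + d) *v axis j 1) \<le> rabs TYPE('k) powi (a + d)"
      unfolding vnorm_mpowi_cyc using vnorm_axis_le_1[of j] by (intro mult_left_le) auto
    then have "mpowi ?P (a + d) *v axis j 1 \<in> lat h"
      using step[OF x a] by (intro lat_contains[of "a + d"])
    then show "vnorm ((matrix_inv h ** mpowi ?P (a + d)) *v axis j 1) \<le> 1"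
      unfolding vnorm_le_1_iff by (simp add: lat_def matrix_vector_mul_assoc)
  qed
  with 1 show ?thesis
    by blast
qed

text \<open>For \<Pi> itself the sandwich holds with gap 0, so the lattice is \<Pi>^a O_E, and the
  unit determinant forces a = 0. This yields the single fixed point in the lattice count.\<close>

lemma cyc_stable_lattice:
  fixes h :: "'k::nonarch_local_field ^ 'n::finite ^ 'n"
  assumes det: "absval (det h) = 1" and stable: "mbound 1 (matrix_inv h ** cyc uniformizer ** h)"
  shows "h \<in> GLO"
proof -
  let ?P = "cyc uniformizer :: 'k ^ 'n ^ 'n"
  have inv: "invertible h"
    using det by (auto simp: invertible_det_nz)
  have stab: "mpow ?P l *v x \<in> lat h" if "x \<in> lat h" for x l
    using that lat_stable[OF inv stable]
    by (induction l) (auto simp: matrix_vector_mul_assoc[symmetric])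
  have "\<exists>a. mbound 1 (mpowi ?P (- a) ** h) \<and> mbound 1 (matrix_inv h ** mpowi ?P (a + 0))"
  proof (rule lattice_sandwich[OF inv])
    fix x a m
    assume x: "x \<in> lat h" "vnorm x = rabs TYPE('k) powi a" and m: "a + 0 \<le> m"
    have "vnorm (mpow ?P (nat (m - a)) *v x) = rabs TYPE('k) powi m"
    proof -
      have "rabs TYPE('k) ^ nat (m - a) = rabs TYPE('k) powi (m - a)"
        using m by (simp add: power_int_def)
      then show ?thesis
        unfolding vnorm_mpow_cyc x(2) by (simp add: power_int_add[symmetric])
    qed
    then show "\<exists>v\<in>lat h. vnorm v = rabs TYPE('k) powi m"
      using stab[OF x(1)] by blast
  qed
  then obtain a where a: "mbound 1 (mpowi ?P (- a) ** h)" "mbound 1 (matrix_inv h ** mpowi ?P a)"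
    by auto
  have "absval (det (mpowi ?P (- a) ** h)) \<le> 1" "absval (det (matrix_inv h ** mpowi ?P a)) \<le> 1"
    using a absval_det_le by fastforce+
  then have "rabs TYPE('k) powi (- a) \<le> rabs TYPE('k) powi 0" "rabs TYPE('k) powi a \<le> rabs TYPE('k) powi 0"
    using det inv by (simp_all add: det_mul det_mpowi absval_mult absval_power_int absval_det_cyc
        det_matrix_inv absval_inverse)
  then have "a = 0"
    unfolding rabs_powi_le_iff by simp
  then show ?thesis
    using a det by (simp add: GLO_def)
qed

lemma mbound_cyc: "mbound 1 (cyc uniformizer :: 'k::nonarch_local_field ^ 'n::finite ^ 'n)"
  by (simp add: mbound_def cyc_def)

lemma mbound_mpow: "mbound 1 A \<Longrightarrow> mbound 1 (mpow A m)"
  by (induction m) (simp_all add: mbound_mat_1 mbound_mult_left)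

lemma mbound_mpowi_cyc:
  "mbound ((1 / rabs TYPE('k)) ^ nat \<bar>m\<bar>) (mpowi (cyc uniformizer :: 'k::nonarch_local_field ^ 'n::finite ^ 'n) m)"
proof (cases "m \<ge> 0")
  case True
  have "mbound 1 (mpowi (cyc uniformizer :: 'k ^ 'n ^ 'n) m)"
    using True by (simp add: mpowi_def mbound_mpow mbound_cyc)
  then show ?thesis
    by (rule mbound_mono) (simp add: one_le_power)
next
  case False
  let ?P = "cyc uniformizer :: 'k ^ 'n ^ 'n"
  \<comment> \<open>The inverse of \<Pi> is \<Pi>^(n-1) divided by the uniformizer, since \<Pi>^n is
    scalar.\<close>
  have "?P ** (mat (inverse uniformizer) ** mpow ?P (CARD('n) - 1)) = mat 1"
  proof -
    have "?P ** (mat (inverse uniformizer) ** mpow ?P (CARD('n) - 1))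
        = mat (inverse uniformizer) ** mpow ?P (Suc (CARD('n) - 1))"
      by (simp only: mat_mult_commute[of "inverse uniformizer" ?P, symmetric] matrix_mul_assoc mpow.simps)
    also have "mpow ?P (Suc (CARD('n) - 1)) = mat uniformizer"
      using mpow_cyc_card[of uniformizer, where 'n='n] by (simp del: mpow.simps)
    also have "mat (inverse uniformizer) ** mat uniformizer = (mat 1 :: 'k ^ 'n ^ 'n)"
      by (auto simp: vec_eq_iff) (simp add: mat_def)
    finally show ?thesis .
  qed
  then have "matrix_inv ?P = mat (inverse uniformizer) ** mpow ?P (CARD('n) - 1)"
    by (rule mat_inv_unique)
  then have 1: "mbound (1 / rabs TYPE('k)) (matrix_inv ?P)"
    using mbound_smult[OF mbound_mpow[OF mbound_cyc], of "inverse uniformizer"]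
    by (simp add: absval_divide inverse_eq_divide)
  have "mbound ((1 / rabs TYPE('k)) ^ l) (mpow (matrix_inv ?P) l)" for l
  proof (induction l)
    case (Suc l)
    then show ?case
      using mbound_mult[OF 1 Suc] by (simp add: mult.commute)
  qed (simp add: mbound_mat_1)
  then show ?thesis
    using False by (simp add: mpowi_def)
qed

text \<open>As \<open>b\<close> is 1 modulo n, the powers z^i with i < n move a vector through all
  residue classes of norm steps, and the uniformizer moves it by n. The lattice is thus squeezed
  between two powers of \<Pi> at bounded distance, and the unit determinant bounds their
  exponents.\<close>

lemma stable_lattice_bounded:
  fixes z :: "'k::nonarch_local_field ^ 'n::finite ^ 'n"
  assumes z: "z \<in> EE" "enorm z = rabs TYPE('k) powi b" "b mod int CARD('n) = 1 mod int CARD('n)" "b \<ge> 0"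
  shows "\<exists>c\<ge>1. \<forall>h. absval (det h) = 1 \<longrightarrow> mbound 1 (matrix_inv h ** z ** h) \<longrightarrow>
    mbound c h \<and> mbound c (matrix_inv h)"
proof -
  let ?P = "cyc uniformizer :: 'k ^ 'n ^ 'n" and ?n = "int CARD('n)"
  \<comment> \<open>The cost of reaching a prescribed residue class is i * b with i < n, hence at
    most this.\<close>
  define d where "d = ?n * b"
  have n: "?n > 0"
    by simp
  define c where "c = (1 / rabs TYPE('k)) ^ nat d"
  have "mbound c h \<and> mbound c (matrix_inv h)"
    if det: "absval (det h) = 1" and stable: "mbound 1 (matrix_inv h ** z ** h)" for h
  proof -
    have inv: "invertible h"
      using det by (auto simp: invertible_det_nz)
    have stab: "mpow z l *v x \<in> lat h" if "x \<in> lat h" for x l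
      using that lat_stable[OF inv stable]
      by (induction l) (auto simp: matrix_vector_mul_assoc[symmetric])
    have normz: "vnorm (mpow z l *v x) = (rabs TYPE('k) powi b) ^ l * vnorm x" for l x
      by (induction l) (simp_all add: matrix_vector_mul_assoc[symmetric] vnorm_EE_mult[OF z(1)] z(2))
    have "\<exists>a. mbound 1 (mpowi ?P (- a) ** h) \<and> mbound 1 (matrix_inv h ** mpowi ?P (a + d))"
    proof (rule lattice_sandwich[OF inv])
      fix x a m
      assume x: "x \<in> lat h" "vnorm x = rabs TYPE('k) powi a" and m: "a + d \<le> m"
      \<comment> \<open>Since \<open>b\<close> is 1 modulo n, this many factors \<open>z\<close>
        leave a multiple of n, which powers of the uniformizer cover.\<close>
      define i where "i = (m - a) mod ?n"
      have i: "0 \<le> i" "i < ?n"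
        using n by (auto simp: i_def)
      have "(i * b) mod ?n = (i * 1) mod ?n"
        using z(3) by (metis mod_mult_right_eq)
      then have "(m - a - i * b) mod ?n = 0"
        by (metis i_def mod_diff_cong mod_mod_trivial mult.right_neutral diff_self mod_0)
      then obtain j where j: "m - a - i * b = ?n * j"
        by (auto simp: mod_eq_0_iff_dvd)
      have "i * b \<le> ?n * b"
        using i z(4) by (intro mult_right_mono) auto
      then have "0 \<le> ?n * j"
        using j m by (simp add: d_def)
      then have "j \<ge> 0"
        using n by (simp add: zero_le_mult_iff)
      define v where "v = (uniformizer ^ nat j) *s (mpow z (nat i) *v x)"
      have "absval (uniformizer ^ nat j :: 'k) \<le> 1"
        by (simp add: absval_power power_le_one)
      then have "v \<in> lat h"
        unfolding v_def using stab[OF x(1)] by (rule lat_smult)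
      moreover have "vnorm v = rabs TYPE('k) powi m"
      proof -
        have "(rabs TYPE('k) powi b) ^ nat i = rabs TYPE('k) powi (b * i)"
          using i(1) by (metis power_int_mult power_int_of_nat int_nat_eq)
        moreover have "absval (uniformizer ^ nat j :: 'k) ^ CARD('n) = rabs TYPE('k) powi (?n * j)"
          using \<open>j \<ge> 0\<close>
          by (metis absval_power power_mult mult.commute power_int_of_nat int_nat_eq of_nat_mult)
        ultimately have "vnorm v = rabs TYPE('k) powi (?n * j + b * i + a)"
          by (simp add: v_def vnorm_smult normz x(2) power_int_add)
        then show ?thesis
          using j by (simp add: algebra_simps)
      qed
      ultimately show "\<exists>v\<in>lat h. vnorm v = rabs TYPE('k) powi m"
        by blast
    qed
    then obtain a where a: "mbound 1 (mpowi ?P (- a) ** h)" "mbound 1 (matrix_inv h ** mpowi ?P (a + d))"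
      by auto
    \<comment> \<open>Both matrices are integral, so their determinants give -d \<le> a \<le> 0,
      uniformly in \<open>h\<close>.\<close>
    have "absval (det (mpowi ?P (- a) ** h)) \<le> 1" "absval (det (matrix_inv h ** mpowi ?P (a + d))) \<le> 1"
      using a absval_det_le by fastforce+
    then have "rabs TYPE('k) powi (- a) \<le> rabs TYPE('k) powi 0" "rabs TYPE('k) powi (a + d) \<le> rabs TYPE('k) powi 0"
      using det inv by (simp_all add: det_mul det_mpowi absval_mult absval_power_int absval_det_cyc
          det_matrix_inv absval_inverse)
    then have ad: "a \<le> 0" "a + d \<ge> 0"
      unfolding rabs_powi_le_iff by simp_all
    have P: "invertible ?P"
      by simp
    have mono: "(1 / rabs TYPE('k)) ^ nat \<bar>e\<bar> \<le> c" if "\<bar>e\<bar> \<le> d" for e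
      unfolding c_def using that by (intro power_increasing) auto
    have "h = mpowi ?P a ** (mpowi ?P (- a) ** h)"
      using mpowi_uminus_mult[OF P, of "- a"] by (simp add: matrix_mul_assoc)
    then have 1: "mbound c h"
      using mbound_mult_right[OF mbound_mpowi_cyc[of a] a(1)] mono[of a] ad mbound_mono by fastforce
    have "matrix_inv h = (matrix_inv h ** mpowi ?P (a + d)) ** mpowi ?P (- (a + d))"
      using mpowi_uminus_mult[OF P, of "- (a + d)"] unfolding minus_minus
      by (simp only: matrix_mul_assoc[symmetric] matrix_mul_rid)
    then have "mbound c (matrix_inv h)"
      using mbound_mult_left[OF a(2) mbound_mpowi_cyc[of "- (a + d)"]] mono[of "- (a + d)"] ad mbound_mono by fastforce
    with 1 show ?thesis ..
  qed
  moreover have "c \<ge> 1"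
    unfolding c_def by (intro one_le_power) simp
  ultimately show ?thesis
    by blast
qed

section \<open>Block matrices and the symmetric space\<close>

definition blk :: "'a ^ 'n ^ 'n \<Rightarrow> 'a ^ 'n ^ 'n \<Rightarrow> 'a ^ 'n ^ 'n \<Rightarrow> 'a ^ 'n ^ 'n \<Rightarrow> ('a, 'n::finite) mat2n" where
  "blk A B C D = (\<chi> i j. case (i, j) of
      (Inl a, Inl b) \<Rightarrow> A $ a $ b
    | (Inl a, Inr b) \<Rightarrow> B $ a $ b
    | (Inr a, Inl b) \<Rightarrow> C $ a $ b
    | (Inr a, Inr b) \<Rightarrow> D $ a $ b)"

lemma blk_nth [simp]:
  "blk A B C D $ Inl a $ Inl b = A $ a $ b" "blk A B C D $ Inl a $ Inr b = B $ a $ b"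
  "blk A B C D $ Inr a $ Inl b = C $ a $ b" "blk A B C D $ Inr a $ Inr b = D $ a $ b"
  by (simp_all add: blk_def)

lemma mat2n_eqI:
  assumes "\<And>a b. M $ Inl a $ Inl b = N $ Inl a $ Inl b" "\<And>a b. M $ Inl a $ Inr b = N $ Inl a $ Inr b"
    "\<And>a b. M $ Inr a $ Inl b = N $ Inr a $ Inl b" "\<And>a b. M $ Inr a $ Inr b = N $ Inr a $ Inr b"
  shows "(M :: ('a, 'n::finite) mat2n) = N"
proof -
  have "M $ i $ j = N $ i $ j" for i j
    using assms by (cases i; cases j) auto
  then show ?thesis
    by (simp add: vec_eq_iff)
qed

lemma blk_eq_iff [simp]: "blk A B C D = blk A' B' C' D' \<longleftrightarrow> A = A' \<and> B = B' \<and> C = C' \<and> D = D'"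
proof
  assume "blk A B C D = blk A' B' C' D'"
  then have "blk A B C D $ i $ j = blk A' B' C' D' $ i $ j" for i j
    by simp
  from this[of "Inl _" "Inl _"] this[of "Inl _" "Inr _"] this[of "Inr _" "Inl _"] this[of "Inr _" "Inr _"]
  show "A = A' \<and> B = B' \<and> C = C' \<and> D = D'"
    by (simp add: vec_eq_iff)
qed simp

lemma blk_surj: obtains A B C D where "M = blk A B C D"
proof
  show "M = blk (\<chi> a b. M $ Inl a $ Inl b) (\<chi> a b. M $ Inl a $ Inr b)
      (\<chi> a b. M $ Inr a $ Inl b) (\<chi> a b. M $ Inr a $ Inr b)"
    by (rule mat2n_eqI) simp_all
qed

lemma sum_UNIV_Plus: "(\<Sum>i\<in>(UNIV::('n::finite + 'n) set). f i) = (\<Sum>a\<in>UNIV. f (Inl a)) + (\<Sum>a\<in>UNIV. f (Inr a))"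
  by (simp add: UNIV_Plus_UNIV[symmetric] sum.Plus del: UNIV_Plus_UNIV)

lemma prod_UNIV_Plus:
  "(\<Prod>i\<in>(UNIV::('n::finite + 'n) set). f i) = (\<Prod>a\<in>UNIV. f (Inl a)) * (\<Prod>a\<in>UNIV. f (Inr a))"
  by (simp add: UNIV_Plus_UNIV[symmetric] prod.Plus del: UNIV_Plus_UNIV)

lemma blk_mult:
  fixes A :: "'a::semiring_1 ^ 'n::finite ^ 'n"
  shows "blk A B C D ** blk A' B' C' D' =
    blk (A ** A' + B ** C') (A ** B' + B ** D') (C ** A' + D ** C') (C ** B' + D ** D')"
  by (rule mat2n_eqI) (simp_all add: matrix_matrix_mult_def sum_UNIV_Plus)

lemma block_diag_blk: "block_diag A B = blk A 0 0 B"
  by (rule mat2n_eqI) (simp_all add: block_diag_def)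

lemma mat_blk: "mat c = blk (mat c) 0 0 (mat c)"
  by (rule mat2n_eqI) (simp_all add: mat_def)

lemma block_diag_eq_iff [simp]: "block_diag A B = block_diag A' B' \<longleftrightarrow> A = A' \<and> B = B'"
  by (simp add: block_diag_blk)

lemma map_matrix_blk: "map_matrix f (blk A B C D) = blk (map_matrix f A) (map_matrix f B) (map_matrix f C) (map_matrix f D)"
  by (rule mat2n_eqI) simp_all

lemma block_diag_inverse:
  fixes A B :: "'a::field ^ 'n::finite ^ 'n"
  assumes "invertible A" "invertible B"
  shows "invertible (block_diag A B)" "matrix_inv (block_diag A B) = block_diag (matrix_inv A) (matrix_inv B)"
proof -
  have eq: "block_diag A B ** block_diag (matrix_inv A) (matrix_inv B) = mat 1"
    using assms by (simp add: block_diag_mult block_diag_one)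
  then show "invertible (block_diag A B)"
    using invertible_right_inverse by blast
  show "matrix_inv (block_diag A B) = block_diag (matrix_inv A) (matrix_inv B)"
    using eq by (rule mat_inv_unique)
qed

lemma H_points_invertible: "h \<in> H_points \<Longrightarrow> invertible h"
  unfolding H_points_def using block_diag_inverse by blast

lemma H_points_mult: "h \<in> H_points \<Longrightarrow> h' \<in> H_points \<Longrightarrow> h ** h' \<in> H_points"
  unfolding H_points_def by (auto simp: block_diag_mult invertible_mult_iff)

lemma H_points_inv: "h \<in> H_points \<Longrightarrow> matrix_inv h \<in> H_points"
  unfolding H_points_def using block_diag_inverse invertible_matrix_inv by blast

lemma H_points_one [simp]: "mat 1 \<in> H_points"
  unfolding H_points_def using block_diag_one invertible_mat_1 by (metis (mono_tags, lifting) mem_Collect_eq)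

lemma l_coset_GL: "g <#\<^bsub>GL\<^esub> S = (\<lambda>h. g ** h) ` S"
  by (auto simp: l_coset_def GL_def)

lemma carrier_GL [simp]: "g \<in> carrier GL \<longleftrightarrow> invertible g"
  by (simp add: GL_def)

abbreviation coset :: "('a::field, 'n::finite) mat2n \<Rightarrow> ('a, 'n) mat2n set" where
  "coset g \<equiv> g <#\<^bsub>GL\<^esub> H_points"

lemma X_points_iff: "x \<in> X_points \<longleftrightarrow> (\<exists>g. invertible g \<and> x = coset g)"
  by (auto simp: X_points_def LCOSETS_def)

lemma coset_in_X_points: "invertible g \<Longrightarrow> coset g \<in> X_points"
  using X_points_iff by blast

lemma X_action_coset: "X_action h (coset g) = coset (h ** g)"
  by (simp add: l_coset_GL image_image matrix_mul_assoc)

lemma coset_mult_H: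
  fixes g h :: "('a::field, 'n::finite) mat2n"
  assumes h: "h \<in> H_points"
  shows "coset (g ** h) = coset g"
proof -
  have "(\<lambda>k. h ** k) ` H_points = H_points"
  proof (intro equalityI subsetI)
    fix k :: "('a, 'n) mat2n"
    assume "k \<in> H_points"
    then show "k \<in> (\<lambda>k. h ** k) ` H_points"
      using h H_points_invertible[OF h]
      by (intro image_eqI[of _ _ "matrix_inv h ** k"]) (simp_all add: H_points_mult H_points_inv)
  qed (auto intro: H_points_mult h)
  moreover have "(\<lambda>k. g ** h ** k) ` H_points = (\<lambda>k. g ** k) ` ((\<lambda>k. h ** k) ` H_points)"
    by (simp add: image_image matrix_mul_assoc)
  ultimately show ?thesis
    by (simp add: l_coset_GL)
qed

lemma coset_eq_iff:
  assumes "invertible g" "invertible g'"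
  shows "coset g = coset g' \<longleftrightarrow> (\<exists>h\<in>H_points. g' = g ** h)"
proof
  assume "coset g = coset g'"
  moreover have "g' \<in> coset g'"
    unfolding l_coset_GL by (intro image_eqI[of _ _ "mat 1"]) auto
  ultimately show "\<exists>h\<in>H_points. g' = g ** h"
    unfolding l_coset_GL by blast
qed (auto simp: coset_mult_H)

text \<open>Coordinates on the part of X where a representative has invertible diagonal blocks: such
  a point has exactly one representative of this form, and (a, b) in H acts by a A b^(-1) and b B
  a^(-1).\<close>

definition gmat :: "'a::field ^ 'n::finite ^ 'n \<Rightarrow> 'a ^ 'n ^ 'n \<Rightarrow> ('a, 'n) mat2n" where
  "gmat A B = blk (mat 1) A B (mat 1)"

text \<open>Block elimination with the Schur complement \<open>mat 1 - A ** B\<close>.\<close>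

lemma gmat_inverse:
  assumes "invertible (mat 1 - A ** B :: 'a::field ^ 'n::finite ^ 'n)"
  shows "invertible (gmat A B)"
    and "matrix_inv (gmat A B) = blk (matrix_inv (mat 1 - A ** B)) (- (matrix_inv (mat 1 - A ** B) ** A))
      (- (B ** matrix_inv (mat 1 - A ** B))) (mat 1 + B ** matrix_inv (mat 1 - A ** B) ** A)"
proof -
  define S where "S = matrix_inv (mat 1 - A ** B)"
  have "(mat 1 - A ** B) ** S = mat 1"
    using assms by (simp add: S_def)
  then have S: "A ** B ** S = S - mat 1"
    by (simp add: matrix_diff_rdistrib algebra_simps)
  have neg: "C ** (- D) = - (C ** D)" for C D :: "'a ^ 'n ^ 'n"
    by (simp add: vec_eq_iff matrix_matrix_mult_def sum_negf)
  have SA: "A ** (B ** S ** A) = S ** A - A"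
    using S by (simp add: matrix_mul_assoc matrix_diff_rdistrib)
  have "gmat A B ** blk S (- (S ** A)) (- (B ** S)) (mat 1 + B ** S ** A) = mat 1"
    unfolding gmat_def blk_mult mat_blk[of 1] using S SA
    by (simp add: neg matrix_add_ldistrib matrix_mul_assoc)
  then show "invertible (gmat A B)"
    "matrix_inv (gmat A B) = blk (matrix_inv (mat 1 - A ** B)) (- (matrix_inv (mat 1 - A ** B) ** A))
      (- (B ** matrix_inv (mat 1 - A ** B))) (mat 1 + B ** matrix_inv (mat 1 - A ** B) ** A)"
    unfolding S_def[symmetric] using invertible_right_inverse mat_inv_unique by blast+
qed

lemma invertible_gmatD:
  fixes A B :: "'a::field ^ 'n::finite ^ 'n"
  assumes "invertible (gmat A B)"
  shows "invertible (mat 1 - A ** B)"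
proof -
  obtain a b c d where g: "matrix_inv (gmat A B) = blk a b c d"
    using blk_surj by blast
  have "gmat A B ** blk a b c d = mat 1"
    using assms unfolding g[symmetric] by simp
  then have "a + A ** c = mat 1" "B ** a + c = 0"
    unfolding gmat_def blk_mult mat_blk[of "1::'a", where 'b='n] by simp_all
  then have "(mat 1 - A ** B) ** a = mat 1"
  proof -
    assume 1: "a + A ** c = mat 1" "B ** a + c = 0"
    have "c = 0 - B ** a"
      using 1(2) by (simp add: algebra_simps add_eq_0_iff)
    then have "A ** c = - (A ** B ** a)"
      using matrix_diff_ldistrib[of A 0 "B ** a"] by (simp add: matrix_mul_assoc)
    then show ?thesis
      using 1(1) by (simp add: matrix_diff_rdistrib)
  qed
  then show ?thesis
    using invertible_right_inverse by blast
qed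

lemma H_act_gmat:
  fixes A B :: "'a::field ^ 'n::finite ^ 'n"
  assumes "invertible a" "invertible b"
  shows "X_action (block_diag a b) (coset (gmat A B)) = coset (gmat (a ** A ** matrix_inv b) (b ** B ** matrix_inv a))"
proof -
  have "block_diag a b ** gmat A B = gmat (a ** A ** matrix_inv b) (b ** B ** matrix_inv a) ** block_diag a b"
    using assms by (simp add: gmat_def block_diag_blk blk_mult)
  moreover have "block_diag a b \<in> H_points"
    using assms unfolding H_points_def by blast
  ultimately show ?thesis
    by (simp add: X_action_coset coset_mult_H)
qed

lemma coset_gmat_eq_iff:
  assumes "invertible (gmat A B)" "invertible (gmat A' B')"
  shows "coset (gmat A B) = coset (gmat A' B') \<longleftrightarrow> A = A' \<and> B = B'"
proof
  assume "coset (gmat A B) = coset (gmat A' B')"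
  then obtain h where "h \<in> H_points" "gmat A' B' = gmat A B ** h"
    unfolding coset_eq_iff[OF assms] by blast
  then obtain a b where "gmat A' B' = gmat A B ** block_diag a b"
    unfolding H_points_def by blast
  then show "A = A' \<and> B = B'"
    by (auto simp: gmat_def block_diag_blk blk_mult)
qed auto

text \<open>The first coordinate becomes a b^(-1) and is fixed only for a = b; the second is then
  fixed when \<open>a\<close> commutes with \<open>X0\<close>.\<close>

lemma stabilizer_gmat:
  fixes X0 :: "'a::field ^ 'n::finite ^ 'n"
  assumes "invertible (mat 1 - X0)"
  shows "stabilizer H_group X_action (coset (gmat (mat 1) X0))
    = {block_diag h h | h. invertible h \<and> h ** X0 = X0 ** h}"
proof -
  have inv: "invertible (gmat (mat 1) X0)"
    using gmat_inverse[of "mat 1" X0] assms by simp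
  have key: "X_action (block_diag a b) (coset (gmat (mat 1) X0)) = coset (gmat (mat 1) X0) \<longleftrightarrow>
      a = b \<and> a ** X0 = X0 ** a" if ab: "invertible a" "invertible b" for a b :: "'a ^ 'n ^ 'n"
  proof -
    have inv': "invertible (gmat (a ** mat 1 ** matrix_inv b) (b ** X0 ** matrix_inv a))"
    proof -
      have "gmat (a ** mat 1 ** matrix_inv b) (b ** X0 ** matrix_inv a)
          = block_diag a b ** gmat (mat 1) X0 ** block_diag (matrix_inv a) (matrix_inv b)"
        using ab by (simp add: gmat_def block_diag_blk blk_mult)
      then show ?thesis
        using ab inv by (simp add: invertible_mult_iff block_diag_inverse)
    qed
    have "X_action (block_diag a b) (coset (gmat (mat 1) X0)) = coset (gmat (mat 1) X0) \<longleftrightarrow>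
        a ** matrix_inv b = mat 1 \<and> b ** X0 ** matrix_inv a = X0"
      using coset_gmat_eq_iff[OF inv' inv] H_act_gmat[OF ab, of "mat 1" X0] by simp
    also have "a ** matrix_inv b = mat 1 \<longleftrightarrow> a = b"
    proof
      assume "a ** matrix_inv b = mat 1"
      then have "a ** matrix_inv b ** b = mat 1 ** b"
        by simp
      then show "a = b"
        using ab by simp
    qed (use ab in simp)
    also have "a = b \<and> b ** X0 ** matrix_inv a = X0 \<longleftrightarrow> a = b \<and> a ** X0 = X0 ** a"
    proof (intro conj_cong refl iffI)
      assume "a = b" "b ** X0 ** matrix_inv a = X0"
      then have "a ** X0 ** matrix_inv a ** a = X0 ** a"
        by simp
      then show "a ** X0 = X0 ** a"
        using ab by simp
    next
      assume "a = b" "a ** X0 = X0 ** a"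
      then have "b ** X0 ** matrix_inv a = X0 ** a ** matrix_inv a"
        by simp
      then show "b ** X0 ** matrix_inv a = X0"
        using ab by simp
    qed
    finally show ?thesis .
  qed
  show ?thesis
  proof (intro equalityI subsetI)
    fix s
    assume "s \<in> stabilizer H_group X_action (coset (gmat (mat 1) X0))"
    then obtain a b where ab: "s = block_diag a b" "invertible a" "invertible b"
      "X_action s (coset (gmat (mat 1) X0)) = coset (gmat (mat 1) X0)"
      unfolding stabilizer_def H_group_def H_points_def by auto
    then show "s \<in> {block_diag h h | h. invertible h \<and> h ** X0 = X0 ** h}"
      using key[of a b] by auto
  next
    fix s
    assume "s \<in> {block_diag h h | h. invertible h \<and> h ** X0 = X0 ** h}"
    then obtain h where "s = block_diag h h" "invertible h" "h ** X0 = X0 ** h"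
      by blast
    then show "s \<in> stabilizer H_group X_action (coset (gmat (mat 1) X0))"
      using key[of h h] unfolding stabilizer_def H_group_def H_points_def by auto
  qed
qed

section \<open>Diagonalization\<close>

lemma invertible_ker:
  assumes "invertible (A :: 'a::field ^ 'n::finite ^ 'n)" "A *v v = 0"
  shows "v = 0"
proof -
  have "v = matrix_inv A *v (A *v v)"
    using assms(1) by (simp add: matrix_vector_mul_assoc)
  then show ?thesis
    unfolding assms(2) by simp
qed

definition dg :: "('n \<Rightarrow> 'a::zero) \<Rightarrow> 'a ^ 'n ^ 'n" where
  "dg x = (\<chi> i j. if i = j then x i else 0)"

lemma mult_dg_nth [simp]: "((Q::'a::semiring_1^'n^'m) ** dg x) $ i $ j = Q $ i $ j * x j"
proof -
  have "(\<Sum>k\<in>UNIV. Q $ i $ k * dg x $ k $ j) = (\<Sum>k\<in>UNIV. if k = j then Q $ i $ k * x k else 0)"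
    by (intro sum.cong) (auto simp: dg_def)
  then show ?thesis
    by (simp add: matrix_matrix_mult_def)
qed

lemma dg_mult_nth [simp]: "(dg x ** (Q::'a::semiring_1^'m^'n)) $ i $ j = x i * Q $ i $ j"
proof -
  have "(\<Sum>k\<in>UNIV. dg x $ i $ k * Q $ k $ j) = (\<Sum>k\<in>UNIV. if k = i then x k * Q $ k $ j else 0)"
    by (intro sum.cong) (auto simp: dg_def)
  then show ?thesis
    by (simp add: matrix_matrix_mult_def)
qed

lemma dg_nth: "dg x $ i $ j = (if i = j then x i else 0)"
  by (simp add: dg_def)

lemma dg_mult: "dg x ** dg y = dg (\<lambda>i. x i * y i :: 'a::semiring_1)"
  by (auto simp: vec_eq_iff dg_nth)

lemma dg_const: "dg (\<lambda>_. c) = mat c"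
  by (simp add: dg_def mat_def)

lemma det_dg: "det (dg x :: 'a::comm_ring_1^'n^'n) = (\<Prod>i\<in>UNIV. x i)"
  by (subst det_diagonal) (auto simp: dg_def)

text \<open>Subtracting \<open>l x\<close> times a vanishing combination of columns from its image
  under \<open>M\<close> removes one term, and distinct eigenvalues keep the other coefficients
  detectable.\<close>

lemma eigenvectors_independent:
  fixes M Q :: "'a::field ^ 'n::finite ^ 'n"
  assumes eig: "M ** Q = Q ** dg l" and inj: "inj l" and nz: "\<And>i. column i Q \<noteq> 0"
  shows "invertible Q"
proof -
  have Mc: "M *v column i Q = l i *s column i Q" for i
  proof -
    have "(M *v column i Q) $ k = (M ** Q) $ k $ i" for k
      by (simp add: matrix_vector_mult_def matrix_matrix_mult_def column_def)
    then show ?thesis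
      by (simp add: vec_eq_iff eig column_def mult.commute)
  qed
  have indep: "\<forall>i\<in>S. c i = 0" if "finite S" "(\<Sum>i\<in>S. c i *s column i Q) = 0" for S and c :: "'n \<Rightarrow> 'a"
    using that
  proof (induction S arbitrary: c rule: finite_induct)
    case (insert x S)
    have z: "c x *s column x Q + (\<Sum>i\<in>S. c i *s column i Q) = 0"
      using insert by simp
    have "M *v (c x *s column x Q + (\<Sum>i\<in>S. c i *s column i Q)) - l x *s (c x *s column x Q + (\<Sum>i\<in>S. c i *s column i Q)) = 0"
      unfolding z by simp
    moreover have "M *v (c x *s column x Q + (\<Sum>i\<in>S. c i *s column i Q))
        = (c x * l x) *s column x Q + (\<Sum>i\<in>S. (c i * l i) *s column i Q)"
      by (simp add: matrix_vector_right_distrib vec.linear_sum[OF matrix_vector_mul_linear_gen]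
          vector_scalar_commute Mc vector_smult_assoc)
    moreover have "l x *s (c x *s column x Q + (\<Sum>i\<in>S. c i *s column i Q))
        = (c x * l x) *s column x Q + (\<Sum>i\<in>S. (c i * l x) *s column i Q)"
      by (simp add: vector_add_ldistrib vec.scale_sum_right vector_smult_assoc mult.commute)
    ultimately have "(\<Sum>i\<in>S. (c i * l i) *s column i Q) - (\<Sum>i\<in>S. (c i * l x) *s column i Q) = 0"
      by simp
    then have "(\<Sum>i\<in>S. (c i * (l i - l x)) *s column i Q) = 0"
      by (simp add: sum_subtractf[symmetric] right_diff_distrib vec.scale_left_diff_distrib)
    then have "\<forall>i\<in>S. c i * (l i - l x) = 0"
      by (rule insert.IH)
    then have S: "\<forall>i\<in>S. c i = 0"
      using inj insert.hyps by (auto simp: inj_def)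
    then have "c x *s column x Q = 0"
      using z by simp
    then have "c x = 0"
      using nz[of x] by (auto simp: vec_eq_iff)
    with S show ?case
      by simp
  qed simp
  have "c = 0" if "Q *v c = 0" for c
  proof -
    have "Q *v c = (\<Sum>i\<in>UNIV. c $ i *s column i Q)"
      by (rule matrix_mult_sum)
    then have "(\<Sum>i\<in>UNIV. c $ i *s column i Q) = 0"
      using that by simp
    from indep[OF finite this] show ?thesis
      unfolding vec_eq_iff by simp
  qed
  then show ?thesis
    unfolding invertible_left_inverse matrix_left_invertible_ker by blast
qed

lemma eigenvector_exists:
  fixes M :: "'a::field ^ 'n::finite ^ 'n"
  assumes "det (mat t - M) = 0"
  shows "\<exists>v. v \<noteq> 0 \<and> M *v v = t *s v"
proof -
  have "\<not> invertible (mat t - M)"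
    using assms by (simp add: invertible_det_nz)
  then obtain v where "v \<noteq> 0" "(mat t - M) *v v = 0"
    unfolding invertible_left_inverse matrix_left_invertible_ker by blast
  then show ?thesis
    by (intro exI[of _ v]) (simp add: matrix_vector_mult_diff_rdistrib)
qed

lemma diagonalizable:
  fixes M :: "'a::field ^ 'n::finite ^ 'n" and l :: "'n \<Rightarrow> 'a"
  assumes "inj l" "\<And>i. \<exists>v. v \<noteq> 0 \<and> M *v v = l i *s v"
  shows "\<exists>Q. invertible Q \<and> M ** Q = Q ** dg l"
proof -
  obtain v where v: "\<And>i. v i \<noteq> 0" "\<And>i. M *v v i = l i *s v i"
    using assms(2) by metis
  define Q where "Q = (\<chi> a i. v i $ a)"
  have col: "column i Q = v i" for i
    by (simp add: Q_def column_def vec_eq_iff)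
  have "M ** Q = Q ** dg l"
  proof -
    have "(M ** Q) $ a $ i = (M *v v i) $ a" for a i
      by (simp add: matrix_vector_mult_def matrix_matrix_mult_def Q_def)
    then show ?thesis
      by (simp add: vec_eq_iff v(2) Q_def mult.commute)
  qed
  moreover have "invertible Q"
    by (rule eigenvectors_independent[OF \<open>M ** Q = Q ** dg l\<close> assms(1)]) (simp add: col v(1))
  ultimately show ?thesis
    by blast
qed

section \<open>Regular semisimple points\<close>

lemma matrix_inv_nth:
  fixes A :: "'a::field ^ 'n ^ 'n"
  assumes inv: "invertible A"
  shows "matrix_inv A $ k $ j = det (\<chi> i l. if l = k then axis j 1 $ i else A $ i $ l) / det A"
proof -
  have "A *v (matrix_inv A *v axis j 1) = axis j 1"
    using inv by (simp add: matrix_vector_mul_assoc)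
  then have "matrix_inv A *v axis j 1
      = (\<chi> k. det (\<chi> i l. if l = k then axis j 1 $ i else A $ i $ l) / det A)"
    using cramer[of A] inv by (simp add: invertible_det_nz)
  moreover have "(matrix_inv A *v axis j 1) $ k = matrix_inv A $ k $ j"
    by (rule matrix_vector_mult_axis)
  ultimately show ?thesis
    by simp
qed

lemma regular_GL_sum: "(\<And>i. i \<in> I \<Longrightarrow> f i \<in> regular_GL UNIV) \<Longrightarrow> (\<lambda>g. \<Sum>i\<in>I. f i g) \<in> regular_GL UNIV"
  by (induction I rule: infinite_finite_induct) (auto intro: regular_GL.intros)

lemma regular_GL_prod: "(\<And>i. i \<in> I \<Longrightarrow> f i \<in> regular_GL UNIV) \<Longrightarrow> (\<lambda>g. \<Prod>i\<in>I. f i g) \<in> regular_GL UNIV"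
  by (induction I rule: infinite_finite_induct) (auto intro: regular_GL.intros)

lemma regular_GL_det:
  fixes M :: "'a::field ^ 'm::finite ^ 'm \<Rightarrow> 'a ^ 'n::finite ^ 'n"
  assumes "\<And>i j. (\<lambda>g. M g $ i $ j) \<in> regular_GL UNIV"
  shows "(\<lambda>g. det (M g)) \<in> regular_GL UNIV"
  unfolding det_def by (intro regular_GL_sum regular_GL.mult regular_GL.const regular_GL_prod assms UNIV_I)

text \<open>The idempotent g diag(1, 0) g^(-1). It depends only on the coset of \<open>g\<close> and
  identifies X with a conjugacy class of idempotents of rank n, from which both invariants and
  boundedness are read off.\<close>

definition pproj :: "('a::field, 'n::finite) mat2n \<Rightarrow> ('a, 'n) mat2n" where
  "pproj g = g ** blk (mat 1) 0 0 0 ** matrix_inv g"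

definition tl_blk :: "('a, 'n::finite) mat2n \<Rightarrow> 'a ^ 'n ^ 'n" where
  "tl_blk M = (\<chi> a b. M $ Inl a $ Inl b)"

lemma tl_blk_blk [simp]: "tl_blk (blk A B C D) = A"
  by (simp add: tl_blk_def vec_eq_iff)

lemma pproj_mult_H:
  assumes "invertible g" "h \<in> H_points"
  shows "pproj (g ** h) = pproj g"
proof -
  obtain a b where h: "h = block_diag a b" "invertible a" "invertible b"
    using assms(2) unfolding H_points_def by blast
  have "h ** blk (mat 1) 0 0 0 = blk (mat 1) 0 0 0 ** h"
    by (simp add: h block_diag_blk blk_mult)
  moreover have "pproj (g ** h) = g ** (h ** blk (mat 1) 0 0 0) ** (matrix_inv h ** matrix_inv g)"
    using assms H_points_invertible[OF assms(2)] by (simp add: pproj_def matrix_inv_mult matrix_mul_assoc)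
  ultimately show ?thesis
    using H_points_invertible[OF assms(2)] by (simp add: pproj_def matrix_mul_assoc)
qed

lemma pproj_H_mult:
  assumes "invertible g" "h \<in> H_points"
  shows "pproj (h ** g) = h ** pproj g ** matrix_inv h"
  using assms H_points_invertible[OF assms(2)] by (simp add: pproj_def matrix_inv_mult matrix_mul_assoc)

lemma pproj_gmat:
  assumes "invertible (mat 1 - A ** B)"
  shows "pproj (gmat A B) = blk (matrix_inv (mat 1 - A ** B)) (- (matrix_inv (mat 1 - A ** B) ** A))
      (B ** matrix_inv (mat 1 - A ** B)) (- (B ** matrix_inv (mat 1 - A ** B) ** A))"
proof -
  have neg: "C ** (- D) = - (C ** D)" for C D :: "'a ^ 'b ^ 'b"
    by (simp add: vec_eq_iff matrix_matrix_mult_def sum_negf)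
  show ?thesis
    unfolding pproj_def gmat_inverse(2)[OF assms] unfolding gmat_def blk_mult
    by (simp add: neg matrix_mul_assoc)
qed

text \<open>The value at \<open>t\<close> of the characteristic polynomial of the upper left block
  of the idempotent. H conjugates this block, and the choice of representative does not affect
  it.\<close>

definition inv_fun :: "'a::field \<Rightarrow> ('a, 'n::finite) mat2n set \<Rightarrow> 'a" where
  "inv_fun t x = det (mat t - tl_blk (pproj (SOME g. g \<in> x)))"

lemma inv_fun_coset:
  assumes "invertible g"
  shows "inv_fun t (coset g) = det (mat t - tl_blk (pproj g))"
proof -
  have "g \<in> coset g"
    unfolding l_coset_GL by (intro image_eqI[of _ _ "mat 1"]) auto
  then have "(SOME g'. g' \<in> coset g) \<in> coset g"
    by (metis someI)
  then obtain h where "h \<in> H_points" "(SOME g'. g' \<in> coset g) = g ** h"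
    unfolding l_coset_GL by auto
  then show ?thesis
    using pproj_mult_H[OF assms] by (simp add: inv_fun_def)
qed

lemma inv_fun_invariant: "inv_fun t \<in> (invariant_regular_X :: (('a::field, 'n::finite) mat2n set \<Rightarrow> 'a) set)"
proof -
  \<comment> \<open>The adjugate formula: its entries are regular functions, and it agrees with the
    inverse on invertible matrices.\<close>
  define I where "I = (\<lambda>g :: ('a, 'n) mat2n.
    (\<chi> k j. inverse (det g) * det (\<chi> i l. if l = k then axis j 1 $ i else g $ i $ l)) :: ('a, 'n) mat2n)"
  let ?E = "blk (mat 1) 0 0 0 :: ('a, 'n) mat2n"
  have r1: "(\<lambda>g. I g $ k $ j) \<in> regular_GL UNIV" for k j
  proof -
    have "(\<lambda>g :: ('a, 'n) mat2n. (\<chi> i l. if l = k then axis j 1 $ i else g $ i $ l) $ i $ l) \<in> regular_GL UNIV" for i l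
      by (cases "l = k") (simp_all add: regular_GL.intros)
    then have "(\<lambda>g :: ('a, 'n) mat2n. det (\<chi> i l. if l = k then axis j 1 $ i else g $ i $ l)) \<in> regular_GL UNIV"
      by (rule regular_GL_det)
    then show ?thesis
      by (simp add: I_def regular_GL.mult regular_GL.inverse_det)
  qed
  have r2: "(\<lambda>g. (g ** ?E ** I g) $ k $ j) \<in> regular_GL UNIV" for k j
    unfolding matrix_matrix_mult_def
    by (simp only: vec_lambda_beta) (intro regular_GL_sum regular_GL.mult regular_GL.entry regular_GL.const UNIV_I r1)
  have "(\<lambda>g :: ('a, 'n) mat2n. (mat t - tl_blk (g ** ?E ** I g)) $ a $ b) \<in> regular_GL UNIV" for a b
  proof -
    have "(\<lambda>g :: ('a, 'n) mat2n. mat t $ a $ b + (- 1) * (g ** ?E ** I g) $ Inl a $ Inl b) \<in> regular_GL UNIV"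
      by (intro regular_GL.add regular_GL.mult regular_GL.const UNIV_I r2)
    then show ?thesis
      by (simp add: tl_blk_def)
  qed
  then have freg: "(\<lambda>g :: ('a, 'n) mat2n. det (mat t - tl_blk (g ** ?E ** I g))) \<in> regular_GL UNIV"
    by (rule regular_GL_det)
  have val: "inv_fun t (coset g) = det (mat t - tl_blk (g ** ?E ** I g))" if g: "g \<in> carrier GL" for g :: "('a, 'n) mat2n"
  proof -
    have "invertible g"
      using g by simp
    then have "I g = matrix_inv g"
      by (simp add: I_def vec_eq_iff matrix_inv_nth divide_inverse mult.commute)
    then show ?thesis
      using inv_fun_coset[OF \<open>invertible g\<close>] by (simp add: pproj_def)
  qed
  have reg: "inv_fun t \<in> (regular_X :: (('a, 'n) mat2n set \<Rightarrow> 'a) set)"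
    unfolding regular_X_def mem_Collect_eq by (rule bexI[OF _ freg], intro ballI, rule val)
  have act: "inv_fun t (X_action h x) = inv_fun t x" if h: "h \<in> H_points" and x: "x \<in> X_points" for h and x :: "('a, 'n) mat2n set"
  proof -
    obtain g where g: "invertible g" "x = coset g"
      using x X_points_iff by blast
    obtain a b where ab: "h = block_diag a b" "invertible a" "invertible b"
      using h unfolding H_points_def by blast
    obtain P Q R S where p: "pproj g = blk P Q R S"
      using blk_surj by blast
    have "tl_blk (pproj (h ** g)) = a ** P ** matrix_inv a"
      unfolding pproj_H_mult[OF g(1) h] p using ab by (simp add: block_diag_inverse) (simp add: block_diag_blk blk_mult)
    moreover have "mat t - a ** P ** matrix_inv a = a ** (mat t - P) ** matrix_inv a"
    proof -
      have "a ** mat t ** matrix_inv a = mat t ** (a ** matrix_inv a)"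
        by (simp add: mat_mult_commute[symmetric] matrix_mul_assoc)
      then show ?thesis
        using ab by (simp add: matrix_diff_ldistrib matrix_diff_rdistrib)
    qed
    moreover have "det (a ** (mat t - P) ** matrix_inv a) = det (mat t - P)"
      using ab by (simp add: det_mul det_matrix_inv invertible_det_nz)
    moreover have "invertible (h ** g)"
      using g(1) H_points_invertible[OF h] by (simp add: invertible_mult_iff)
    ultimately show ?thesis
      using g by (simp add: X_action_coset inv_fun_coset p)
  qed
  show ?thesis
    unfolding invariant_regular_X_def mem_Collect_eq using reg act by (intro conjI ballI)
qed

lemma det_mat_0_diff: "det (mat 0 - M) \<noteq> 0 \<longleftrightarrow> det (M :: 'a::field ^ 'n::finite ^ 'n) \<noteq> 0"
proof -
  have "mat 0 - M = mat (- 1) ** M"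
    by (simp add: vec_eq_iff)
  then have "det (mat 0 - M) = det (mat (- 1) :: 'a ^ 'n ^ 'n) * det M"
    by (simp add: det_mul)
  moreover have "det (mat (- 1) :: 'a ^ 'n ^ 'n) \<noteq> 0"
    unfolding invertible_det_nz[symmetric] invertible_mat_scalar by simp
  ultimately show ?thesis
    by simp
qed

lemma matrix_inv_eigen:
  fixes M :: "'a::field ^ 'n::finite ^ 'n"
  assumes "invertible M" "v \<noteq> 0"
  shows "matrix_inv M *v v = c *s v \<longleftrightarrow> c \<noteq> 0 \<and> M *v v = inverse c *s v"
proof
  assume *: "matrix_inv M *v v = c *s v"
  have v: "v = M *v (c *s v)"
    using assms(1) by (simp add: *[symmetric] matrix_vector_mul_assoc)
  then have "c \<noteq> 0"
    using assms(2) by auto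
  moreover have "inverse c *s v = inverse c *s (c *s (M *v v))"
    using v by (simp add: vector_scalar_commute)
  ultimately show "c \<noteq> 0 \<and> M *v v = inverse c *s v"
    by (simp add: vector_smult_assoc)
next
  assume *: "c \<noteq> 0 \<and> M *v v = inverse c *s v"
  have "v = matrix_inv M *v (M *v v)"
    using assms(1) by (simp add: matrix_vector_mul_assoc)
  then have "c *s v = c *s (inverse c *s (matrix_inv M *v v))"
    using * by (simp add: vector_scalar_commute)
  then show "matrix_inv M *v v = c *s v"
    using * by (simp add: vector_smult_assoc)
qed

text \<open>The value at t = 0 forces invertible diagonal blocks, so \<open>x\<close> has
  coordinates (A, B). The other values equate the characteristic polynomials of (1 - AB)^(-1) and (1
  - X0)^(-1); as the eigenvalues \<open>l i\<close> are distinct, AB is conjugate to X0.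
  Invertibility of X0 then makes A invertible, and H can move A to 1.\<close>

lemma same_invariants_imp_orbit:
  fixes X0 Q :: "'a::field ^ 'n::finite ^ 'n" and l :: "'n \<Rightarrow> 'a"
  assumes inv: "invertible (mat 1 - X0)" "invertible X0"
    and Q: "invertible Q" "X0 ** Q = Q ** dg l" "inj l"
    and x: "x \<in> X_points" "\<And>t. inv_fun t x = inv_fun t (coset (gmat (mat 1) X0))"
  shows "\<exists>h\<in>H_points. x = X_action h (coset (gmat (mat 1) X0))"
proof -
  have inv0: "invertible (gmat (mat 1) X0)"
    using gmat_inverse[of "mat 1" X0] inv by simp
  obtain g where g: "invertible g" "x = coset g"
    using x X_points_iff by blast
  obtain a b c d where gb: "g = blk a b c d"
    using blk_surj by blast
  obtain a' b' c' d' where gb': "matrix_inv g = blk a' b' c' d'"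
    using blk_surj by blast
  have "tl_blk (pproj g) = a ** a'"
    unfolding pproj_def gb' unfolding gb blk_mult by simp
  then have "det (mat 0 - a ** a') = inv_fun 0 (coset (gmat (mat 1) X0))"
    using x(2)[of 0] inv_fun_coset[OF g(1), of 0] g(2) by simp
  also have "\<dots> = det (mat 0 - matrix_inv (mat 1 - X0))"
    using pproj_gmat[of "mat 1" X0] inv by (simp add: inv_fun_coset[OF inv0])
  also have "\<dots> \<noteq> 0"
    using invertible_matrix_inv[OF inv(1)] unfolding invertible_det_nz det_mat_0_diff .
  finally have "det (a ** a') \<noteq> 0"
    unfolding det_mat_0_diff .
  then have aa: "invertible a" "invertible a'"
    by (simp_all add: invertible_det_nz det_mul)
  \<comment> \<open>For an invertible block matrix, the lower right block is invertible together
    with the upper left block of the inverse.\<close>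
  have "invertible d"
  proof -
    have "blk a' b' c' d' ** blk a b c d = mat 1"
      unfolding gb'[symmetric] gb[symmetric] using g(1) by simp
    then have 1: "a' ** b + b' ** d = 0" "c' ** b + d' ** d = mat 1"
      unfolding blk_mult mat_blk[of "1::'a", where 'b='n] by simp_all
    have "b = (matrix_inv a' ** (0 - b')) ** d"
    proof -
      have "a' ** b = (0 - b') ** d"
        unfolding matrix_diff_rdistrib using 1(1) by (simp add: eq_neg_iff_add_eq_0)
      then have "matrix_inv a' ** (a' ** b) = matrix_inv a' ** ((0 - b') ** d)"
        by simp
      then show ?thesis
        using aa(2) by (simp add: matrix_mul_assoc)
    qed
    then have "(c' ** (matrix_inv a' ** (0 - b')) + d') ** d = mat 1"
      using 1(2) by (simp add: matrix_add_rdistrib matrix_mul_assoc)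
    then show ?thesis
      using invertible_left_inverse by blast
  qed
  define A where "A = b ** matrix_inv d"
  define B where "B = c ** matrix_inv a"
  have gAB: "g = gmat A B ** block_diag a d"
    using aa \<open>invertible d\<close> by (simp add: gb A_def B_def gmat_def block_diag_blk blk_mult)
  have adH: "block_diag a d \<in> H_points"
    using aa \<open>invertible d\<close> unfolding H_points_def by blast
  have xAB: "x = coset (gmat A B)"
    using g(2) gAB adH coset_mult_H by metis
  have invAB: "invertible (gmat A B)"
    using g(1) unfolding gAB by (simp add: invertible_mult_iff)
  then have inv1: "invertible (mat 1 - A ** B)"
    by (rule invertible_gmatD)
  have deteq: "det (mat t - matrix_inv (mat 1 - A ** B)) = det (mat t - matrix_inv (mat 1 - X0))" for t
    using x(2)[of t] pproj_gmat[of "mat 1" X0] inv pproj_gmat[OF inv1]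
    by (simp add: xAB inv_fun_coset[OF inv0] inv_fun_coset[OF invAB])
  have colQ: "column i Q \<noteq> 0" for i
  proof
    assume "column i Q = 0"
    then have "Q *v axis i 1 = 0"
      by (simp add: vec_eq_iff column_def)
    then have "axis i (1::'a) = 0"
      by (rule invertible_ker[OF Q(1)])
    then show False
      by (simp add: axis_eq_0_iff)
  qed
  have eigX: "X0 *v column i Q = l i *s column i Q" for i
  proof -
    have "(X0 *v column i Q) $ k = (X0 ** Q) $ k $ i" for k
      by (simp add: matrix_vector_mult_def matrix_matrix_mult_def column_def)
    then show ?thesis
      by (simp add: vec_eq_iff Q(2) column_def mult.commute)
  qed
  have "\<exists>v. v \<noteq> 0 \<and> (A ** B) *v v = l i *s v" for i
  proof -
    have e1: "(mat 1 - X0) *v column i Q = (1 - l i) *s column i Q"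
      by (simp add: matrix_vector_mult_diff_rdistrib eigX vec.scale_left_diff_distrib)
    have l1: "1 - l i \<noteq> 0"
    proof
      assume "1 - l i = 0"
      then have "(mat 1 - X0) *v column i Q = 0"
        using e1 by simp
      then have "column i Q = 0"
        by (rule invertible_ker[OF inv(1)])
      then show False
        using colQ by blast
    qed
    let ?s = "inverse (1 - l i)"
    have "matrix_inv (mat 1 - X0) *v column i Q = ?s *s column i Q"
      using matrix_inv_eigen[OF inv(1) colQ] e1 l1 by simp
    then have "(mat ?s - matrix_inv (mat 1 - X0)) *v column i Q = 0"
      by (simp add: matrix_vector_mult_diff_rdistrib)
    then have "\<not> invertible (mat ?s - matrix_inv (mat 1 - X0))"
      using colQ[of i] unfolding invertible_left_inverse matrix_left_invertible_ker by blast
    then have "det (mat ?s - matrix_inv (mat 1 - A ** B)) = 0"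
      unfolding deteq by (simp add: invertible_det_nz)
    then obtain v where v: "v \<noteq> 0" "matrix_inv (mat 1 - A ** B) *v v = ?s *s v"
      using eigenvector_exists by blast
    then have "(mat 1 - A ** B) *v v = (1 - l i) *s v"
      using matrix_inv_eigen[OF inv1 v(1)] by simp
    then have "(A ** B) *v v = l i *s v"
      by (simp add: matrix_vector_mult_diff_rdistrib vec.scale_left_diff_distrib)
    with v(1) show ?thesis
      by blast
  qed
  then obtain Q' where Q': "invertible Q'" "(A ** B) ** Q' = Q' ** dg l"
    using diagonalizable[OF Q(3)] by blast
  \<comment> \<open>\<open>R\<close> conjugates X0 into AB; the pair (R, A^(-1) R) in H then carries
    (1, X0) to (A, B).\<close>
  define R where "R = Q' ** matrix_inv Q"
  have R: "invertible R"
    using Q(1) Q'(1) by (simp add: R_def invertible_mult)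
  have AB: "A ** B = R ** X0 ** matrix_inv R"
  proof -
    have "R ** X0 ** matrix_inv R = Q' ** matrix_inv Q ** (X0 ** Q) ** matrix_inv Q'"
      using Q(1) Q'(1) by (simp add: R_def matrix_inv_mult matrix_mul_assoc)
    also have "\<dots> = Q' ** dg l ** matrix_inv Q'"
      unfolding Q(2) using Q(1) by (simp add: matrix_mul_assoc)
    also have "\<dots> = A ** B"
      unfolding Q'(2)[symmetric] using Q'(1) by simp
    finally show ?thesis ..
  qed
  then have "invertible (A ** B)"
    using R inv(2) by (simp add: invertible_mult)
  then have A: "invertible A"
    by (simp add: invertible_mult_iff)
  have AR: "invertible (matrix_inv A ** R)"
    using A R by (simp add: invertible_mult)
  have "R ** mat 1 ** matrix_inv (matrix_inv A ** R) = A"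
    using A R by (simp add: matrix_inv_mult matrix_mul_assoc)
  moreover have "matrix_inv A ** R ** X0 ** matrix_inv R = B"
  proof -
    have "matrix_inv A ** R ** X0 ** matrix_inv R = matrix_inv A ** (R ** X0 ** matrix_inv R)"
      by (simp add: matrix_mul_assoc)
    then show ?thesis
      unfolding AB[symmetric] using A by simp
  qed
  ultimately have "X_action (block_diag R (matrix_inv A ** R)) (coset (gmat (mat 1) X0)) = x"
    using H_act_gmat[OF R AR, of "mat 1" X0] xAB by simp
  moreover have "block_diag R (matrix_inv A ** R) \<in> H_points"
    using R AR unfolding H_points_def by blast
  ultimately show ?thesis
    by metis
qed

hide_const (open) up_ring.monom up_ring.coeff Polynomials.degree Polynomials.lead_coeff

section \<open>Elliptic points\<close>

lemma degree_monom_minus_const: "m > 0 \<Longrightarrow> degree (monom 1 m - [:w::'a::idom:]) = m"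
  by (subst diff_conv_add_uminus, subst degree_add_eq_left) (auto simp: degree_monom_eq)

text \<open>In characteristic 0 the polynomial T^n - w with nonzero w is separable: a double root
  would be a root of the derivative n T^(n-1), hence 0.\<close>

lemma distinct_roots_exist:
  assumes "(w::'a::{alg_closed_field,field_char_0}) \<noteq> 0"
  shows "\<exists>l::'n::finite \<Rightarrow> 'a. inj l \<and> (\<forall>i. l i ^ CARD('n) = w)"
proof -
  let ?n = "CARD('n)" and ?p = "monom 1 CARD('n) - [:w:]"
  have n: "?n > 0"
    by simp
  have deg: "degree ?p = ?n"
    using n by (rule degree_monom_minus_const)
  have lc: "lead_coeff ?p = 1"
    unfolding deg using n by (simp add: coeff_pCons split: nat.split)
  have "?p \<noteq> 0"
    using deg n by auto
  then obtain A where A: "size A = ?n" "?p = (\<Prod>x\<in>#A. [:-x, 1:])"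
    using alg_closed_imp_factorization[of ?p] deg lc by auto
  have root: "poly ?p x = x ^ ?n - w" for x
    by (simp add: poly_monom)
  have "count A x \<le> 1" for x
  proof (rule ccontr)
    assume "\<not> count A x \<le> 1"
    then have "{#x, x#} \<subseteq># A"
      by (auto simp: subseteq_mset_def)
    then obtain B where "A = {#x, x#} + B"
      by (metis mset_subset_eq_exists_conv)
    then have eq: "?p = [:-x, 1:] * ([:-x, 1:] * (\<Prod>x\<in>#B. [:-x, 1:]))"
      using A(2) by simp
    have "poly ?p x = 0"
      unfolding eq by simp
    then have xw: "x ^ ?n = w"
      using root by simp
    have "poly (pderiv ?p) x = 0"
      unfolding eq pderiv_mult[of "[:- x, 1:]"] poly_add poly_mult by simp
    then have "of_nat ?n * x ^ (?n - 1) = 0"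
      by (simp add: pderiv_diff pderiv_monom poly_monom pderiv_pCons)
    then have "x = 0"
      by simp
    then show False
      using xw assms n by (simp add: power_0_left)
  qed
  then have "card (set_mset A) = ?n"
  proof -
    assume c: "\<And>x. count A x \<le> 1"
    have "size A = (\<Sum>x\<in>set_mset A. count A x)"
      by (simp add: size_multiset_overloaded_eq)
    also have "\<dots> = (\<Sum>x\<in>set_mset A. 1)"
    proof (intro sum.cong refl)
      fix x
      assume "x \<in># A"
      then have "count A x > 0"
        by simp
      then show "count A x = 1"
        using c[of x] by linarith
    qed
    finally show ?thesis
      using A(1) by simp
  qed
  then obtain l :: "'n \<Rightarrow> 'a" where l: "bij_betw l UNIV (set_mset A)"
    using finite_same_card_bij[of "UNIV :: 'n set" "set_mset A"] by auto
  have "l i ^ ?n = w" for i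
  proof -
    have "l i \<in># A"
      using l by (auto simp: bij_betw_def)
    then have "poly ?p (l i) = 0"
      unfolding A(2) poly_prod_mset by (auto intro!: prod_mset_zero_iff[THEN iffD2])
    then show ?thesis
      using root by simp
  qed
  then show ?thesis
    using l by (auto simp: bij_betw_def)
qed

lemma cyc_eigenvector:
  assumes "l ^ CARD('n::finite) = (w::'a::field)" "w \<noteq> 0"
  shows "\<exists>v :: 'a ^ 'n. v \<noteq> 0 \<and> cyc w *v v = l *s v"
proof -
  have l: "l \<noteq> 0"
    using assms by (auto simp: power_0_left)
  \<comment> \<open>A geometric progression solves the shift equation; the wrap-around condition is
    \<open>l ^ CARD('n) = w\<close>.\<close>
  define v :: "'a ^ 'n" where "v = (\<chi> i. inverse l ^ idx i)"
  have "v \<noteq> 0"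
    using l by (auto simp: v_def vec_eq_iff)
  moreover have "(cyc w *v v) $ i = (l *s v) $ i" for i
  proof (cases "idx i = 0")
    case True
    have "l ^ Suc m * inverse l ^ m = l" for m
      using l by (simp add: power_inverse)
    from this[of "CARD('n) - 1"] have "w * inverse l ^ (CARD('n) - 1) = l"
      using assms(1) by simp
    then show ?thesis
      using True by (simp add: cyc_vec_nth v_def)
  next
    case False
    have "inverse l ^ (idx i - 1) = l * inverse l ^ Suc (idx i - 1)"
      using l by simp
    moreover have "idx i - 1 < CARD('n)"
      using idx_less[of i] by linarith
    ultimately show ?thesis
      using False by (simp add: cyc_vec_nth v_def)
  qed
  ultimately show ?thesis
    by (intro exI[of _ v]) (simp add: vec_eq_iff)
qed

section \<open>Base change to the algebraic closure\<close>

lemma map_matrix_to_ac_mult: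
  "map_matrix to_ac (A ** B) = map_matrix to_ac A ** map_matrix to_ac B"
  by (simp add: vec_eq_iff matrix_matrix_mult_def to_ac_sum)

lemma map_matrix_to_ac_mat [simp]: "map_matrix to_ac (mat c) = mat (to_ac c)"
  by (simp add: vec_eq_iff mat_def)

lemma map_matrix_to_ac_zero [simp]: "map_matrix to_ac 0 = 0"
  by (simp add: vec_eq_iff)

lemma map_matrix_to_ac_diff: "map_matrix to_ac (A - B) = map_matrix to_ac A - map_matrix to_ac B"
  by (simp add: vec_eq_iff)

lemma map_matrix_to_ac_sum: "map_matrix to_ac (\<Sum>i\<in>I. f i) = (\<Sum>i\<in>I. map_matrix to_ac (f i))"
  by (simp add: vec_eq_iff to_ac_sum)

lemma map_matrix_to_ac_cyc [simp]: "map_matrix to_ac (cyc w) = cyc (to_ac w)"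
  by (simp add: vec_eq_iff cyc_def)

lemma map_matrix_to_ac_mpow: "map_matrix to_ac (mpow A m) = mpow (map_matrix to_ac A) m"
  by (induction m) (simp_all add: map_matrix_to_ac_mult)

lemma invertible_map_matrix_to_ac:
  assumes "invertible (A :: 'a::field ^ 'n::finite ^ 'n)"
  shows "invertible (map_matrix to_ac A)"
proof -
  have "map_matrix to_ac A ** map_matrix to_ac (matrix_inv A) = mat 1"
    using assms by (simp add: map_matrix_to_ac_mult[symmetric])
  then show ?thesis
    using invertible_right_inverse by blast
qed

lemma map_matrix_H_points: "h \<in> H_points \<Longrightarrow> map_matrix to_ac h \<in> H_points"
proof -
  assume "h \<in> H_points"
  then obtain A B where AB: "h = block_diag A B" "invertible A" "invertible B"
    unfolding H_points_def by blast
  then have "map_matrix to_ac h = block_diag (map_matrix to_ac A) (map_matrix to_ac B)"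
    by (simp add: block_diag_blk map_matrix_blk)
  then show ?thesis
    using invertible_map_matrix_to_ac[OF AB(2)] invertible_map_matrix_to_ac[OF AB(3)]
    unfolding H_points_def by blast
qed

lemma set_mult_GL: "S <#>\<^bsub>GL\<^esub> T = (\<Union>a\<in>S. \<Union>b\<in>T. {a ** b})"
  by (simp add: set_mult_def GL_def)

lemma X_to_ac_coset: "X_to_ac (coset g) = coset (map_matrix to_ac g)"
proof (intro equalityI subsetI)
  fix x
  assume "x \<in> X_to_ac (coset g)"
  then obtain h h' where h: "h \<in> H_points" "h' \<in> H_points" "x = map_matrix to_ac (g ** h) ** h'"
    unfolding X_to_ac_def set_mult_GL l_coset_GL by auto
  then have "x = map_matrix to_ac g ** (map_matrix to_ac h ** h')"
    by (simp add: map_matrix_to_ac_mult matrix_mul_assoc)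
  moreover have "map_matrix to_ac h ** h' \<in> H_points"
    using h by (intro H_points_mult map_matrix_H_points)
  ultimately show "x \<in> coset (map_matrix to_ac g)"
    unfolding l_coset_GL by blast
next
  fix x
  assume "x \<in> coset (map_matrix to_ac g)"
  then obtain h where h: "h \<in> H_points" "x = map_matrix to_ac g ** h"
    unfolding l_coset_GL by blast
  have "g \<in> coset g"
    unfolding l_coset_GL by (intro image_eqI[of _ _ "mat 1"]) auto
  then show "x \<in> X_to_ac (coset g)"
    unfolding X_to_ac_def set_mult_GL using h by auto
qed

lemma smult_cyc_eigen:
  fixes Q :: "'a::field ^ 'n::finite ^ 'n"
  assumes "cyc w ** Q = Q ** dg l"
  shows "(mat c ** cyc w) ** Q = Q ** dg (\<lambda>i. c * l i)"
proof -
  have "(mat c ** cyc w) ** Q = mat c ** (Q ** dg l)"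
    using assms by (simp add: matrix_mul_assoc[symmetric])
  then show ?thesis
    by (simp add: vec_eq_iff mult_ac)
qed

lemma cyc_diagonalizable:
  fixes w :: "'a::{alg_closed_field,field_char_0}"
  assumes "w \<noteq> 0"
  shows "\<exists>(l :: 'n::finite \<Rightarrow> 'a) (Q :: 'a ^ 'n ^ 'n).
    inj l \<and> (\<forall>i. l i ^ CARD('n) = w) \<and> invertible Q \<and> cyc w ** Q = Q ** dg l"
proof -
  obtain l :: "'n \<Rightarrow> 'a" where l: "inj l" "\<forall>i. l i ^ CARD('n) = w"
    using distinct_roots_exist[OF assms] by blast
  have "\<exists>Q :: 'a ^ 'n ^ 'n. invertible Q \<and> cyc w ** Q = Q ** dg l"
    by (rule diagonalizable[OF l(1)]) (rule cyc_eigenvector[OF l(2)[rule_format] assms])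
  then show ?thesis
    using l by blast
qed

text \<open>Over the algebraic closure the matrix has the distinct eigenvalues c l_i, so the
  functions \<open>inv_fun t\<close> already separate its orbit from all other points; the converse
  inclusion is invariance of the functions defining the quotient map.\<close>

lemma H_regular_semisimple_cyc:
  fixes w c :: "'k::field_char_0"
  assumes "w \<noteq> 0" "c \<noteq> 0" "invertible (mat 1 - mat c ** cyc w :: 'k ^ 'n::finite ^ 'n)"
  shows "H_regular_semisimple (coset (gmat (mat 1) (mat c ** cyc w :: 'k ^ 'n ^ 'n)))"
proof -
  let ?X = "mat c ** cyc w :: 'k ^ 'n ^ 'n"
  let ?w = "to_ac w" and ?c = "to_ac c"
  let ?X' = "mat ?c ** cyc ?w :: 'k alg_closure ^ 'n ^ 'n"
  let ?y = "coset (gmat (mat 1) ?X)" and ?y' = "coset (gmat (mat 1) ?X')"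
  have inv: "invertible (gmat (mat 1) ?X)"
    using gmat_inverse[of "mat 1" ?X] assms by simp
  have y': "X_to_ac ?y = ?y'"
    by (simp add: X_to_ac_coset gmat_def map_matrix_blk map_matrix_to_ac_mult)
  have inv1: "invertible (mat 1 - ?X')"
    using invertible_map_matrix_to_ac[OF assms(3)] by (simp add: map_matrix_to_ac_diff map_matrix_to_ac_mult)
  have inv': "invertible (gmat (mat 1) ?X')"
    using gmat_inverse[of "mat 1" ?X'] inv1 by simp
  have y'X: "?y' \<in> X_points"
    using inv' by (rule coset_in_X_points)
  have wz: "?w \<noteq> 0"
    using assms(1) by simp
  obtain l :: "'n \<Rightarrow> 'k alg_closure" and Q :: "'k alg_closure ^ 'n ^ 'n" where l: "inj l" "\<And>i. l i ^ CARD('n) = ?w"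
    and Q: "invertible Q" "cyc ?w ** Q = Q ** dg l"
    using cyc_diagonalizable[OF wz, where 'n='n] by auto
  have inj: "inj (\<lambda>i. ?c * l i)"
    using l(1) assms(2) by (auto simp: inj_def)
  have invX: "invertible ?X'"
    using assms by (simp add: invertible_mult_iff invertible_mat_scalar invertible_cyc)
  have "{x \<in> X_points. categorical_quotient x = categorical_quotient ?y'} = Group_Action.orbit H_group X_action ?y'"
  proof (intro equalityI subsetI)
    fix x
    assume x: "x \<in> {x \<in> X_points. categorical_quotient x = categorical_quotient ?y'}"
    have "inv_fun t x = inv_fun t ?y'" for t
    proof -
      have "categorical_quotient x (inv_fun t) = categorical_quotient ?y' (inv_fun t)"
        using x by simp
      then show ?thesis
        unfolding categorical_quotient_def restrict_apply by (simp add: inv_fun_invariant)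
    qed
    then obtain h where "h \<in> H_points" "x = X_action h ?y'"
      using same_invariants_imp_orbit[OF inv1 invX Q(1) smult_cyc_eigen[OF Q(2)] inj, of x] x by auto
    then show "x \<in> Group_Action.orbit H_group X_action ?y'"
      unfolding orbit_def H_group_def by auto
  next
    fix x
    assume "x \<in> Group_Action.orbit H_group X_action ?y'"
    then obtain h where h: "h \<in> H_points" "x = X_action h ?y'"
      unfolding orbit_def H_group_def by auto
    have "x \<in> X_points"
      unfolding h(2) X_action_coset using H_points_invertible[OF h(1)] inv'
      by (intro coset_in_X_points) (simp add: invertible_mult_iff)
    moreover have "categorical_quotient x = categorical_quotient ?y'"
    proof
      fix \<phi> :: "('k alg_closure, 'n) mat2n set \<Rightarrow> 'k alg_closure"
      show "categorical_quotient x \<phi> = categorical_quotient ?y' \<phi>"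
        using h y'X by (auto simp: categorical_quotient_def invariant_regular_X_def restrict_def)
    qed
    ultimately show "x \<in> {x \<in> X_points. categorical_quotient x = categorical_quotient ?y'}"
      by blast
  qed
  then show ?thesis
    unfolding H_regular_semisimple_def y' using coset_in_X_points[OF inv] by blast
qed

subsection \<open>Anisotropy of the stabilizer\<close>

text \<open>In an eigenbasis, comparing entries multiplies the (i, j) entry of a commuting matrix by
  l_j - l_i, which kills it off the diagonal.\<close>

lemma commuting_with_dg:
  fixes h Q :: "'a::field ^ 'n::finite ^ 'n" and l :: "'n \<Rightarrow> 'a"
  assumes "invertible Q" "M ** Q = Q ** dg l" "inj l" "h ** M = M ** h"
  shows "\<exists>x. h = Q ** dg x ** matrix_inv Q"
proof -
  define N where "N = matrix_inv Q ** h ** Q"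
  have hN: "h = Q ** N ** matrix_inv Q"
    using assms(1) by (simp add: N_def matrix_mul_assoc)
  have "N ** dg l = matrix_inv Q ** h ** (Q ** dg l)"
    by (simp add: N_def matrix_mul_assoc)
  also have "\<dots> = matrix_inv Q ** (h ** M) ** Q"
    unfolding assms(2)[symmetric] by (simp add: matrix_mul_assoc)
  also have "\<dots> = matrix_inv Q ** (M ** (Q ** matrix_inv Q) ** h) ** Q"
    unfolding assms(4) using assms(1) by simp
  also have "\<dots> = matrix_inv Q ** (M ** Q) ** N"
    by (simp add: N_def matrix_mul_assoc)
  also have "\<dots> = dg l ** N"
    unfolding assms(2) using assms(1) by (simp add: matrix_mul_assoc)
  finally have comm: "N ** dg l = dg l ** N" .
  have "N $ i $ j = 0" if "i \<noteq> j" for i j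
  proof -
    have "N $ i $ j * l j = l i * N $ i $ j"
      using comm by (metis mult_dg_nth dg_mult_nth)
    then have "N $ i $ j * (l j - l i) = 0"
      by (simp add: algebra_simps)
    then show ?thesis
      using assms(3) that by (auto simp: inj_def)
  qed
  then have "N = dg (\<lambda>i. N $ i $ i)"
    by (simp add: vec_eq_iff dg_nth)
  then show ?thesis
    using hN by metis
qed

text \<open>The stabilizer over the algebraic closure in coordinates that diagonalize \<Pi>; the
  block is repeated because the stabilizer sits diagonally in H.\<close>

definition torus :: "'a::field ^ 'n::finite ^ 'n \<Rightarrow> ('n \<Rightarrow> 'a) \<Rightarrow> ('a, 'n) mat2n" where
  "torus Q x = block_diag (Q ** dg x ** matrix_inv Q) (Q ** dg x ** matrix_inv Q)"

lemma torus_mult: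
  assumes "invertible Q"
  shows "torus Q x ** torus Q y = torus Q (\<lambda>i. x i * y i)"
proof -
  have "Q ** dg x ** matrix_inv Q ** (Q ** dg y ** matrix_inv Q) = Q ** (dg x ** dg y) ** matrix_inv Q"
    using assms by (simp add: matrix_mul_assoc)
  then show ?thesis
    by (simp add: torus_def block_diag_mult dg_mult)
qed

lemma torus_const:
  assumes "invertible Q"
  shows "torus Q (\<lambda>_. c) = mat c"
proof -
  have "Q ** mat c ** matrix_inv Q = mat c ** (Q ** matrix_inv Q)"
    by (simp add: mat_mult_commute[symmetric] matrix_mul_assoc)
  then show ?thesis
    using assms by (simp add: torus_def dg_const block_diag_blk mat_blk[of c])
qed

lemma det_torus:
  fixes Q :: "'a::field ^ 'n::finite ^ 'n"
  assumes "invertible Q"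
  shows "det (torus Q x) = (\<Prod>i\<in>UNIV. x i)\<^sup>2"
proof -
  let ?D = "block_diag (dg x) (dg x) :: ('a, 'n) mat2n"
  have "torus Q x = block_diag Q Q ** ?D ** block_diag (matrix_inv Q) (matrix_inv Q)"
    by (simp add: torus_def block_diag_mult)
  then have "det (torus Q x) = det ?D * (det (block_diag Q Q) * det (block_diag (matrix_inv Q) (matrix_inv Q)))"
    by (simp add: det_mul)
  also have "det (block_diag Q Q) * det (block_diag (matrix_inv Q) (matrix_inv Q)) = 1"
    using assms by (simp add: det_mul[symmetric] block_diag_mult block_diag_one)
  also have "det ?D = (\<Prod>i\<in>UNIV. ?D $ i $ i)"
  proof (rule det_diagonal)
    fix i j :: "'n + 'n"
    assume "i \<noteq> j"
    then show "?D $ i $ j = 0"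
      by (cases i; cases j) (auto simp: block_diag_blk dg_nth)
  qed
  also have "\<dots> = (\<Prod>i\<in>UNIV. x i)\<^sup>2"
    by (simp add: prod_UNIV_Plus block_diag_blk dg_nth power2_eq_square)
  finally show ?thesis
    by simp
qed

lemma torus_nth:
  "(Q ** dg x ** R) $ a $ b = (\<Sum>j\<in>UNIV. Q $ a $ j * x j * (R::'a::semiring_1^'n^'n) $ j $ b)"
  by (subst matrix_matrix_mult_def) simp

text \<open>Entries are polynomials in \<open>t\<close> and the determinant is t^2, so the only
  denominators are powers of \<open>t\<close>. The square is there because a torus element carries
  its block twice.\<close>

lemma regular_curve_laurent:
  fixes g :: "'a::field \<Rightarrow> 'a ^ 'm::finite ^ 'm"
  assumes entries: "\<And>a b. \<exists>P. \<forall>t. g t $ a $ b = poly P t" and det: "\<And>t. det (g t) = t\<^sup>2"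
    and p: "p \<in> regular_GL K"
  shows "\<exists>P N. \<forall>t. t \<noteq> 0 \<longrightarrow> p (g t) = poly P t / t ^ N"
  using p
proof induction
  case (const c)
  show ?case
    by (intro exI[of _ "[:c:]"] exI[of _ 0]) simp
next
  case (entry a b)
  obtain P where "\<And>t. g t $ a $ b = poly P t"
    using entries by blast
  then show ?case
    by (intro exI[of _ P] exI[of _ 0]) simp
next
  case inverse_det
  show ?case
    by (intro exI[of _ 1] exI[of _ 2]) (simp add: det divide_inverse)
next
  case (add p q)
  from add.IH(1) obtain P1 N1 where
    1: "\<forall>t. t \<noteq> 0 \<longrightarrow> p (g t) = poly P1 t / t ^ N1"
    by blast
  from add.IH(2) obtain P2 N2 where
    2: "\<forall>t. t \<noteq> 0 \<longrightarrow> q (g t) = poly P2 t / t ^ N2"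
    by blast
  from 1 2 show ?case
    by (intro exI[of _ "P1 * monom 1 N2 + P2 * monom 1 N1"] exI[of _ "N1 + N2"])
      (simp add: poly_monom power_add add_frac_eq)
next
  case (mult p q)
  from mult.IH(1) obtain P1 N1 where
    1: "\<forall>t. t \<noteq> 0 \<longrightarrow> p (g t) = poly P1 t / t ^ N1"
    by blast
  from mult.IH(2) obtain P2 N2 where
    2: "\<forall>t. t \<noteq> 0 \<longrightarrow> q (g t) = poly P2 t / t ^ N2"
    by blast
  from 1 2 show ?case
    by (intro exI[of _ "P1 * P2"] exI[of _ "N1 + N2"]) (simp add: power_add)
qed

lemma regular_torus_laurent:
  fixes Q :: "'a::field ^ 'n::finite ^ 'n"
  assumes Q: "invertible Q" and p: "p \<in> regular_GL K"
  shows "\<exists>P N. \<forall>t. t \<noteq> 0 \<longrightarrow> p (torus Q ((\<lambda>_. 1)(i := t))) = poly P t / t ^ N"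
proof (rule regular_curve_laurent[OF _ _ p])
  fix a b
  have "\<exists>P. \<forall>t. (Q ** dg ((\<lambda>_. 1)(i := t)) ** matrix_inv Q) $ a $ b = poly P t" for a b
  proof -
    let ?c = "\<lambda>j. Q $ a $ j * matrix_inv Q $ j $ b"
    let ?P = "\<Sum>j\<in>UNIV. (if j = i then [:0, ?c j:] else [:?c j:])"
    have "(Q ** dg ((\<lambda>_. 1)(i := t)) ** matrix_inv Q) $ a $ b = poly ?P t" for t
      unfolding torus_nth poly_sum by (intro sum.cong) (auto simp: mult_ac)
    then show ?thesis
      by blast
  qed
  then obtain P where P: "\<And>a b t. (Q ** dg ((\<lambda>_. 1)(i := t)) ** matrix_inv Q) $ a $ b = poly (P a b) t"
    by metis
  show "\<exists>P. \<forall>t. torus Q ((\<lambda>_. 1)(i := t)) $ a $ b = poly P t"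
  proof (cases a; cases b)
    fix a' b'
    assume "a = Inl a'" "b = Inl b'"
    then show ?thesis
      by (intro exI[of _ "P a' b'"]) (simp only: torus_def block_diag_blk blk_nth P simp_thms)
  next
    fix a' b'
    assume "a = Inr a'" "b = Inr b'"
    then show ?thesis
      by (intro exI[of _ "P a' b'"]) (simp only: torus_def block_diag_blk blk_nth P simp_thms)
  qed (auto simp: torus_def block_diag_blk intro!: exI[of _ 0])
next
  fix t
  show "det (torus Q ((\<lambda>_. 1)(i := t))) = t\<^sup>2"
    unfolding det_torus[OF Q] by (simp add: fun_upd_def prod.delta)
qed

text \<open>Over an algebraically closed field, splitting off the zero at 0 leaves a factor without
  roots, which is constant. A nowhere vanishing Laurent polynomial in one torus coordinate is
  therefore a power of it up to a constant.\<close>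

lemma no_nonzero_roots_monom:
  fixes P :: "'a::alg_closed_field poly"
  assumes "\<And>t. t \<noteq> 0 \<Longrightarrow> poly P t \<noteq> 0"
  shows "\<exists>c e. \<forall>t. poly P t = c * t ^ e"
proof -
  have "P \<noteq> 0"
    using assms[of 1] by auto
  then obtain R where R: "P = [:- 0, 1:] ^ Polynomial.order 0 P * R" "\<not> [:- 0, 1:] dvd R"
    using order_decomp by blast
  have "poly R t \<noteq> 0" for t
  proof (cases "t = 0")
    case True
    then show ?thesis
      using R(2) by (simp add: dvd_iff_poly_eq_0)
  next
    case False
    then have "poly ([:- 0, 1:] ^ Polynomial.order 0 P * R) t \<noteq> 0"
      using assms[of t] R(1) by simp
    then show ?thesis
      unfolding poly_mult by simp
  qed
  then have "degree R = 0"
    using alg_closed_imp_poly_has_root[of R] by blast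
  then obtain c where "R = [:c:]"
    by (rule degree_eq_zeroE)
  then have "poly P t = c * t ^ Polynomial.order 0 P" for t
    by (subst R(1)) (simp add: poly_power mult.commute)
  then show ?thesis
    by blast
qed

lemma map_poly_to_ac_add: "map_poly to_ac (P + R) = map_poly to_ac P + map_poly to_ac R"
  by (intro poly_eqI) (simp add: coeff_map_poly)

lemma map_poly_to_ac_mult: "map_poly to_ac (P * R) = map_poly to_ac P * map_poly to_ac R"
  by (intro poly_eqI) (simp add: coeff_map_poly coeff_mult to_ac_sum)

lemma map_poly_to_ac_power: "map_poly to_ac (P ^ m) = map_poly to_ac P ^ m"
  by (induction m) (simp_all add: map_poly_to_ac_mult)

lemma prod_linear_roots:
  fixes l :: "'n::finite \<Rightarrow> 'a::field"
  assumes "inj l" "\<And>i. l i ^ CARD('n) = w"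
  shows "(\<Prod>i\<in>UNIV. [:- l i, 1:]) = monom 1 CARD('n) - [:w:]"
proof (rule poly_eqI_degree_lead_coeff[of _ "CARD('n)" _ "range l"])
  have n: "CARD('n) > 0"
    by simp
  have deg: "degree (\<Prod>i\<in>UNIV. [:- l i, 1:]) = CARD('n)"
    by (subst degree_prod_eq_sum_degree) auto
  then show "degree (\<Prod>i\<in>UNIV. [:- l i, 1:]) \<le> CARD('n)"
    by simp
  have "lead_coeff (\<Prod>i\<in>(UNIV::'n set). [:- l i, 1:]) = 1"
    by (simp add: lead_coeff_prod)
  then show "coeff (\<Prod>i\<in>UNIV. [:- l i, 1:]) CARD('n) = coeff (monom 1 CARD('n) - [:w:]) CARD('n)"
    using n deg by (simp add: coeff_pCons split: nat.split)
  show "CARD('n) \<le> card (range l)"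
    using assms(1) by (simp add: card_image)
  show "degree (monom 1 CARD('n) - [:w:]) \<le> CARD('n)"
    by (intro degree_diff_le) (auto simp: degree_monom_le)
  fix z
  assume "z \<in> range l"
  then obtain i where "z = l i"
    by blast
  then have "poly (\<Prod>i\<in>UNIV. [:- l i, 1:]) z = 0"
    unfolding poly_prod by (intro prod_zero bexI[of _ i]) simp_all
  then show "poly (\<Prod>i\<in>UNIV. [:- l i, 1:]) z = poly (monom 1 CARD('n) - [:w:]) z"
    using assms(2)[of i] \<open>z = l i\<close> by (simp add: poly_monom)
qed

text \<open>The torus element with coordinates t - l_i is t - \<Pi> in each block, a line defined
  over F. Functions with coefficients in F therefore restrict to it with coefficients in F;
  denominators come from the determinant, the square of t^n - w.\<close>

lemma regular_line:
  fixes Q :: "'k::field alg_closure ^ 'n::finite ^ 'n" and l :: "'n \<Rightarrow> 'k alg_closure"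
  assumes Q: "invertible Q" "cyc (to_ac w) ** Q = Q ** dg l"
    and l: "inj l" "\<And>i. l i ^ CARD('n) = to_ac w"
    and p: "p \<in> regular_GL (range to_ac)"
  shows "\<exists>R M. \<forall>t. t ^ CARD('n) \<noteq> to_ac w \<longrightarrow>
    p (torus Q (\<lambda>i. t - l i)) = poly (map_poly to_ac R) t / (t ^ CARD('n) - to_ac w) ^ M"
proof -
  let ?n = "CARD('n)" and ?D = "monom 1 CARD('n) - [:w:] :: 'k poly"
  have D: "poly (map_poly to_ac ?D) t = t ^ ?n - to_ac w" for t
  proof -
    have "map_poly to_ac ?D = monom 1 ?n - [:to_ac w:]"
      by (intro poly_eqI) (simp add: coeff_map_poly coeff_pCons split: nat.split)
    then show ?thesis
      by (simp add: poly_monom)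
  qed
  have conj: "Q ** dg (\<lambda>i. t - l i) ** matrix_inv Q = mat t - cyc (to_ac w)" for t
  proof -
    have "dg (\<lambda>i. t - l i) = mat t - dg l"
      by (simp add: vec_eq_iff dg_nth mat_def)
    then have "Q ** dg (\<lambda>i. t - l i) ** matrix_inv Q = Q ** mat t ** matrix_inv Q - Q ** dg l ** matrix_inv Q"
      by (simp add: matrix_diff_ldistrib matrix_diff_rdistrib)
    also have "Q ** mat t ** matrix_inv Q = mat t ** (Q ** matrix_inv Q)"
      by (simp add: mat_mult_commute[symmetric] matrix_mul_assoc)
    also have "Q ** dg l ** matrix_inv Q = cyc (to_ac w)"
      unfolding Q(2)[symmetric] using Q(1) by simp
    finally show ?thesis
      using Q(1) by simp
  qed
  have tor: "torus Q (\<lambda>i. t - l i) = block_diag (mat t - cyc (to_ac w)) (mat t - cyc (to_ac w))" for t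
    unfolding torus_def conj ..
  have prod: "(\<Prod>i\<in>UNIV. t - l i) = t ^ ?n - to_ac w" for t
  proof -
    have "(\<Prod>i\<in>UNIV. t - l i) = poly (\<Prod>i\<in>UNIV. [:- l i, 1:]) t"
      by (simp add: poly_prod)
    also have "\<dots> = t ^ ?n - to_ac w"
      unfolding prod_linear_roots[OF l] by (simp add: poly_monom)
    finally show ?thesis .
  qed
  from p show ?thesis
  proof induction
    case (const c)
    then obtain c0 where "c = to_ac c0"
      by blast
    then show ?case
      by (intro exI[of _ "[:c0:]"] exI[of _ 0]) (simp add: map_poly_pCons)
  next
    case (entry a b)
    have e: "\<exists>R. \<forall>t. (mat t - cyc (to_ac w) :: 'k alg_closure ^ 'n ^ 'n) $ a $ b = poly (map_poly to_ac R) t" for a b :: 'n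
      by (rule exI[of _ "[:- (cyc w $ a $ b), if a = b then 1 else 0:]"])
        (auto simp: map_poly_pCons mat_def cyc_def)
    have "\<exists>R. \<forall>t. torus Q (\<lambda>i. t - l i) $ a $ b = poly (map_poly to_ac R) t"
    proof (cases a; cases b)
      fix a' b'
      assume "a = Inl a'" "b = Inl b'"
      then show ?thesis
        using e[of a' b'] unfolding tor block_diag_blk by simp
    next
      fix a' b'
      assume "a = Inr a'" "b = Inr b'"
      then show ?thesis
        using e[of a' b'] unfolding tor block_diag_blk by simp
    qed (auto simp: tor block_diag_blk intro!: exI[of _ 0])
    then obtain R where "\<And>t. torus Q (\<lambda>i. t - l i) $ a $ b = poly (map_poly to_ac R) t"
      by blast
    then show ?case
      by (intro exI[of _ R] exI[of _ 0]) (simp only: power_0 div_by_1 simp_thms)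
  next
    case inverse_det
    have "det (torus Q (\<lambda>i. t - l i)) = (t ^ ?n - to_ac w)\<^sup>2" for t
      unfolding det_torus[OF Q(1)] prod ..
    then show ?case
      by (intro exI[of _ 1] exI[of _ 2]) (simp add: divide_inverse)
  next
    case (add p q)
    from add.IH(1) obtain R1 M1 where
      1: "\<forall>t. t ^ ?n \<noteq> to_ac w \<longrightarrow> p (torus Q (\<lambda>i. t - l i)) = poly (map_poly to_ac R1) t / (t ^ ?n - to_ac w) ^ M1"
      by blast
    from add.IH(2) obtain R2 M2 where
      2: "\<forall>t. t ^ ?n \<noteq> to_ac w \<longrightarrow> q (torus Q (\<lambda>i. t - l i)) = poly (map_poly to_ac R2) t / (t ^ ?n - to_ac w) ^ M2"
      by blast
    from 1 2 show ?case
      by (intro exI[of _ "R1 * ?D ^ M2 + R2 * ?D ^ M1"] exI[of _ "M1 + M2"])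
        (simp add: map_poly_to_ac_add map_poly_to_ac_mult map_poly_to_ac_power D power_add add_frac_eq)
  next
    case (mult p q)
    from mult.IH(1) obtain R1 M1 where
      1: "\<forall>t. t ^ ?n \<noteq> to_ac w \<longrightarrow> p (torus Q (\<lambda>i. t - l i)) = poly (map_poly to_ac R1) t / (t ^ ?n - to_ac w) ^ M1"
      by blast
    from mult.IH(2) obtain R2 M2 where
      2: "\<forall>t. t ^ ?n \<noteq> to_ac w \<longrightarrow> q (torus Q (\<lambda>i. t - l i)) = poly (map_poly to_ac R2) t / (t ^ ?n - to_ac w) ^ M2"
      by blast
    from 1 2 show ?case
      by (intro exI[of _ "R1 * R2"] exI[of _ "M1 + M2"]) (simp add: map_poly_to_ac_mult power_add)
  qed
qed

text \<open>Irreducibility of T^n - \<open>uniformizer\<close> read off from the field E: a nonzero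
  remainder \<open>B\<close> of degree below n gives a nonzero, hence invertible, element B(\<Pi>),
  while the root \<open>t\<close> is an eigenvalue of \<Pi> and makes B(\<Pi>) singular.\<close>

lemma uniformizer_poly_dvd:
  fixes R :: "'k::nonarch_local_field poly" and t :: "'k alg_closure"
  assumes t: "t ^ CARD('n::finite) = to_ac uniformizer" and root: "poly (map_poly to_ac R) t = 0"
  shows "monom 1 CARD('n) - [:uniformizer:] dvd R"
proof (rule ccontr)
  let ?n = "CARD('n)" and ?D = "monom 1 CARD('n) - [:uniformizer:] :: 'k poly" and ?w = "to_ac (uniformizer :: 'k)"
  assume nd: "\<not> ?D dvd R"
  have n: "?n > 0"
    by simp
  have degD: "degree ?D = ?n"
    using n by (rule degree_monom_minus_const)
  then have "?D \<noteq> 0"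
    using n by auto
  define B where "B = R mod ?D"
  have degB: "degree B < ?n"
    unfolding B_def using degree_mod_less_degree[OF \<open>?D \<noteq> 0\<close> nd] degD by simp
  have "B \<noteq> 0"
    unfolding B_def using nd by (simp add: mod_eq_0_iff_dvd)
  have "map_poly to_ac ?D = monom 1 ?n - [:?w:]"
    by (intro poly_eqI) (simp add: coeff_map_poly coeff_pCons split: nat.split)
  then have D0: "poly (map_poly to_ac ?D) t = 0"
    using t by (simp add: poly_monom)
  have "R = ?D * (R div ?D) + B"
    unfolding B_def by (simp add: mult_div_mod_eq)
  then have "map_poly to_ac R = map_poly to_ac ?D * map_poly to_ac (R div ?D) + map_poly to_ac B"
    by (metis map_poly_to_ac_add map_poly_to_ac_mult)
  then have B0: "poly (map_poly to_ac B) t = 0"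
    using root D0 by simp
  let ?P = "cyc uniformizer :: 'k ^ 'n ^ 'n" and ?e = "axis (at_idx 0) 1 :: 'k ^ 'n"
  define M where "M = (\<Sum>j<?n. mat (coeff B j) ** mpow ?P j)"
  have EEsum: "(\<Sum>j\<in>J. f j) \<in> EE" if "\<And>j. f j \<in> EE" for J :: "nat set" and f :: "nat \<Rightarrow> 'k ^ 'n ^ 'n"
    using that by (induction J rule: infinite_finite_induct) (auto intro: EE_add simp: mat_0[symmetric] simp del: mat_0)
  have ME: "M \<in> EE"
    unfolding M_def by (intro EEsum EE_mult EE_mat EE_mpow EE_cyc)
  have sumv: "(\<Sum>j\<in>J. f j) *v v = (\<Sum>j\<in>J. f j *v v)" for J :: "nat set" and f :: "nat \<Rightarrow> 'a::field ^ 'n ^ 'n" and v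
    by (induction J rule: infinite_finite_induct) (auto simp: matrix_vector_mult_add_rdistrib)
  \<comment> \<open>The image of the cyclic vector under B(\<Pi>) lists the coefficients of
    \<open>B\<close>, so B(\<Pi>) is nonzero.\<close>
  have "M *v ?e = (\<Sum>j<?n. coeff B j *s axis (at_idx j) 1)"
    unfolding M_def sumv by (intro sum.cong) (simp_all add: matrix_vector_mul_assoc[symmetric] mpow_cyc_axis)
  then have "(M *v ?e) $ at_idx (degree B) = (\<Sum>j<?n. coeff B j * (axis (at_idx j) 1 :: 'k ^ 'n) $ at_idx (degree B))"
    by (simp only: sum_component vector_smult_component)
  also have "\<dots> = (\<Sum>j<?n. if j = degree B then coeff B j else 0)"
    using degB by (intro sum.cong refl) (auto simp: axis_def eq_at_idx)
  finally have "(M *v ?e) $ at_idx (degree B) = lead_coeff B"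
    using degB by simp
  then have "M \<noteq> 0"
    using \<open>B \<noteq> 0\<close> by auto
  then have inv: "invertible (map_matrix to_ac M)"
    using ME by (intro invertible_map_matrix_to_ac EE_invertible)
  have wz: "?w \<noteq> 0"
    by simp
  obtain v :: "'k alg_closure ^ 'n" where v: "v \<noteq> 0" "cyc ?w *v v = t *s v"
    using cyc_eigenvector[OF t wz] by blast
  have vp: "mpow (cyc ?w) j *v v = t ^ j *s v" for j
    by (induction j) (simp_all add: matrix_vector_mul_assoc[symmetric] v(2) vector_scalar_commute vector_smult_assoc mult.commute)
  have "map_matrix to_ac M *v v = (\<Sum>j<?n. (to_ac (coeff B j) * t ^ j) *s v)"
    unfolding M_def map_matrix_to_ac_sum sumv
    by (intro sum.cong) (simp_all add: map_matrix_to_ac_mult map_matrix_to_ac_mpow matrix_vector_mul_assoc[symmetric] vp vector_smult_assoc)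
  also have "\<dots> = (\<Sum>j<?n. to_ac (coeff B j) * t ^ j) *s v"
    by (simp add: vec.scale_sum_left)
  also have "(\<Sum>j<?n. to_ac (coeff B j) * t ^ j) = poly (map_poly to_ac B) t"
  proof -
    have deg: "degree (map_poly to_ac B) = degree B"
      using \<open>B \<noteq> 0\<close> by (intro map_poly_degree_eq) simp
    have "(\<Sum>j<?n. to_ac (coeff B j) * t ^ j) = (\<Sum>j\<le>degree B. to_ac (coeff B j) * t ^ j)"
      using degB by (intro sum.mono_neutral_right) (auto simp: coeff_eq_0)
    then show ?thesis
      by (simp add: poly_altdef deg coeff_map_poly)
  qed
  finally have "map_matrix to_ac M *v v = 0"
    using B0 by simp
  then show False
    using invertible_ker[OF inv] v(1) by blast
qed

text \<open>If one exponent is positive, irreducibility makes T^n - \<open>uniformizer\<close>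
  divide \<open>R\<close>, so all exponents are positive; dividing it out reduces the total degree.
  This is Galois invariance expressed through divisibility.\<close>

lemma rational_exponents_equal:
  fixes l :: "'n::finite \<Rightarrow> 'k::nonarch_local_field alg_closure"
  assumes l: "inj l" "\<And>i. l i ^ CARD('n) = to_ac uniformizer"
    and R: "map_poly to_ac R = (\<Prod>i\<in>UNIV. [:- l i, 1:] ^ e i)"
  shows "e i = e j"
  using R
proof (induction "\<Sum>i\<in>UNIV. e i" arbitrary: R e rule: less_induct)
  case less
  let ?D = "monom 1 CARD('n) - [:uniformizer:] :: 'k poly"
  have mD: "map_poly to_ac ?D = (\<Prod>i\<in>UNIV. [:- l i, 1:])"
    unfolding prod_linear_roots[OF l] by (intro poly_eqI) (simp add: coeff_map_poly coeff_pCons split: nat.split)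
  have root: "poly (map_poly to_ac R) (l m) = 0 \<longleftrightarrow> e m > 0" for m
  proof -
    have "poly (map_poly to_ac R) (l m) = 0 \<longleftrightarrow> (\<exists>i. (l m - l i) ^ e i = 0)"
      unfolding less.prems poly_prod poly_power by (auto simp: prod_zero_iff)
    also have "\<dots> \<longleftrightarrow> e m > 0"
      using l(1) by (auto simp: inj_def)
    finally show ?thesis .
  qed
  show ?case
  proof (cases "\<exists>m. e m > 0")
    case True
    then obtain m where "e m > 0"
      by blast
    then have "?D dvd R"
      using uniformizer_poly_dvd[OF l(2)[of m]] root by blast
    then obtain A where A: "R = ?D * A"
      by blast
    have "poly (map_poly to_ac R) (l i) = 0" for i
      unfolding A map_poly_to_ac_mult mD poly_mult poly_prod by (simp add: prod_zero_iff) blast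
    then have e: "e i > 0" for i
      using root by blast
    have "(\<Prod>i\<in>UNIV. [:- l i, 1:]) * map_poly to_ac A = (\<Prod>i\<in>UNIV. [:- l i, 1:]) * (\<Prod>i\<in>UNIV. [:- l i, 1:] ^ (e i - 1))"
    proof -
      have "(\<Prod>i\<in>UNIV. [:- l i, 1:]) * map_poly to_ac A = (\<Prod>i\<in>UNIV. [:- l i, 1:] ^ e i)"
        using less.prems unfolding A map_poly_to_ac_mult mD .
      also have "\<dots> = (\<Prod>i\<in>UNIV. [:- l i, 1:] * [:- l i, 1:] ^ (e i - 1))"
      proof (intro prod.cong refl)
        fix i
        have "[:- l i, 1:] ^ e i = [:- l i, 1:] ^ Suc (e i - 1)"
          using e[of i] by simp
        then show "[:- l i, 1:] ^ e i = [:- l i, 1:] * [:- l i, 1:] ^ (e i - 1)"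
          by simp
      qed
      finally show ?thesis
        unfolding prod.distrib .
    qed
    moreover have "(\<Prod>i\<in>UNIV. [:- l i, 1:]) \<noteq> 0"
      by (simp add: prod_zero_iff)
    ultimately have "map_poly to_ac A = (\<Prod>i\<in>UNIV. [:- l i, 1:] ^ (e i - 1))"
      by (simp only: mult_cancel_left) simp
    moreover have "(\<Sum>i\<in>UNIV. e i - 1) < (\<Sum>i\<in>UNIV. e i)"
      using e by (intro sum_strict_mono) auto
    ultimately have "e i - 1 = e j - 1"
      using less.hyps by blast
    then show ?thesis
      using e[of i] e[of j] by linarith
  qed simp
qed

text \<open>A character is a monomial in the torus coordinates. On the line t - \<Pi>, rationality
  makes the product of the (t - l_i)^(m_i), up to powers of t^n - \<open>uniformizer\<close>, a
  polynomial over F, so all m_i agree; triviality on scalars makes the common exponent 0.\<close>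

lemma anisotropic_torus:
  fixes S :: "('k::{nonarch_local_field,field_char_0} alg_closure, 'n::finite) mat2n set"
  assumes S: "S = {block_diag h h | h. invertible h \<and> h ** cyc (to_ac uniformizer) = cyc (to_ac uniformizer) ** h}"
  shows "anisotropic_mod_center S"
  unfolding anisotropic_mod_center_def
proof (intro allI impI ballI)
  fix \<psi> s
  assume "rational_character S \<psi> \<and> (\<forall>z\<in>GL_center. \<psi> z = 1)" and s: "s \<in> S"
  then obtain p where p: "p \<in> regular_GL (range to_ac)" "\<And>s. s \<in> S \<Longrightarrow> \<psi> s = p s"
    and nz: "\<And>s. s \<in> S \<Longrightarrow> \<psi> s \<noteq> 0" and hom: "\<And>s t. s \<in> S \<Longrightarrow> t \<in> S \<Longrightarrow> \<psi> (s ** t) = \<psi> s * \<psi> t"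
    and center: "\<And>z. z \<in> GL_center \<Longrightarrow> \<psi> z = 1"
    unfolding rational_character_def by blast
  let ?w = "to_ac (uniformizer :: 'k)" and ?n = "CARD('n)"
  have wz: "?w \<noteq> 0"
    by simp
  obtain l :: "'n \<Rightarrow> 'k alg_closure" and Q :: "'k alg_closure ^ 'n ^ 'n"
    where l: "inj l" "\<And>i. l i ^ ?n = ?w" and Q: "invertible Q" "cyc ?w ** Q = Q ** dg l"
    using cyc_diagonalizable[OF wz, where 'n='n] by auto
  have torS: "torus Q x \<in> S" if x: "\<And>i. x i \<noteq> 0" for x
  proof -
    let ?h = "Q ** dg x ** matrix_inv Q"
    have "invertible (dg x)"
      unfolding invertible_det_nz det_dg using x by (simp add: prod_zero_iff)
    then have "invertible ?h"
      using Q(1) by (simp add: invertible_mult)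
    moreover have "?h ** cyc ?w = cyc ?w ** ?h"
    proof -
      have c: "cyc ?w = Q ** dg l ** matrix_inv Q"
        unfolding Q(2)[symmetric] using Q(1) by simp
      have "?h ** cyc ?w = Q ** (dg x ** dg l) ** matrix_inv Q"
        unfolding c using Q(1) by (simp add: matrix_mul_assoc)
      also have "dg x ** dg l = dg l ** dg x"
        by (simp add: dg_mult mult.commute)
      also have "Q ** (dg l ** dg x) ** matrix_inv Q = cyc ?w ** ?h"
        unfolding c using Q(1) by (simp add: matrix_mul_assoc)
      finally show ?thesis .
    qed
    ultimately show ?thesis
      unfolding S torus_def by blast
  qed
  have one: "\<psi> (torus Q (\<lambda>_. 1)) = 1"
  proof -
    have "mat 1 \<in> (GL_center :: ('k alg_closure, 'n) mat2n set)"
      unfolding GL_center_def by simp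
    then show ?thesis
      using center unfolding torus_const[OF Q(1)] by blast
  qed
  have "\<exists>m::int. \<forall>t. t \<noteq> 0 \<longrightarrow> \<psi> (torus Q ((\<lambda>_. 1)(i := t))) = t powi m" for i
  proof -
    obtain P N where PN: "\<And>t. t \<noteq> 0 \<Longrightarrow> p (torus Q ((\<lambda>_. 1)(i := t))) = poly P t / t ^ N"
      using regular_torus_laurent[OF Q(1) p(1), of i] by blast
    have in_S: "torus Q ((\<lambda>_. 1)(i := t)) \<in> S" if "t \<noteq> 0" for t
      using that by (intro torS) simp
    have PN': "\<psi> (torus Q ((\<lambda>_. 1)(i := t))) = poly P t / t ^ N" if "t \<noteq> 0" for t
      using PN[OF that] p(2)[OF in_S[OF that]] by simp
    have "poly P t \<noteq> 0" if "t \<noteq> 0" for t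
      using PN'[OF that] nz[OF in_S[OF that]] by auto
    then obtain c e where ce: "\<And>t. poly P t = c * t ^ e"
      using no_nonzero_roots_monom[of P] by blast
    have "(\<lambda>_. 1)(i := 1) = (\<lambda>_::'n. 1 :: 'k alg_closure)"
      by auto
    then have "c = 1"
      using PN'[of 1] one ce[of 1] by simp
    have "\<psi> (torus Q ((\<lambda>_. 1)(i := t))) = t powi (int e - int N)" if "t \<noteq> 0" for t
      using PN'[OF that] that unfolding ce \<open>c = 1\<close> by (simp add: power_int_diff)
    then show ?thesis
      by blast
  qed
  then obtain m :: "'n \<Rightarrow> int" where m: "\<And>i t. t \<noteq> 0 \<Longrightarrow> \<psi> (torus Q ((\<lambda>_. 1)(i := t))) = t powi m i"
    by metis
  have psi_prod: "\<psi> (torus Q x) = (\<Prod>i\<in>UNIV. x i powi m i)" if x: "\<And>i. x i \<noteq> 0" for x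
  proof -
    have "\<psi> (torus Q (\<lambda>i. if i \<in> I then x i else 1)) = (\<Prod>i\<in>I. x i powi m i)" if "finite I" for I
      using that
    proof (induction I rule: finite_induct)
      case (insert a I)
      have "torus Q (\<lambda>i. if i \<in> insert a I then x i else 1)
          = torus Q ((\<lambda>_. 1)(a := x a)) ** torus Q (\<lambda>i. if i \<in> I then x i else 1)"
        unfolding torus_mult[OF Q(1)] using insert.hyps by (intro arg_cong[of _ _ "torus Q"]) auto
      moreover have "torus Q ((\<lambda>_. 1)(a := x a)) \<in> S" "torus Q (\<lambda>i. if i \<in> I then x i else 1) \<in> S"
        by (rule torS, simp add: x)+
      ultimately show ?case
        using insert hom m[OF x[of a], of a] by simp
    qed (simp add: one)
    from this[of UNIV] show ?thesis
      by simp
  qed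
  obtain R M where RM: "\<And>t. t ^ ?n \<noteq> ?w \<Longrightarrow>
      p (torus Q (\<lambda>i. t - l i)) = poly (map_poly to_ac R) t / (t ^ ?n - ?w) ^ M"
    using regular_line[OF Q l p(1)] by blast
  \<comment> \<open>A shift that makes all exponents nonnegative. It costs the factor (t^n -
    \<open>uniformizer\<close>)^N, which is rational over F and raises all exponents
    equally.\<close>
  define N where "N = (\<Sum>i\<in>UNIV. nat \<bar>m i\<bar>)"
  define e where "e = (\<lambda>i. nat (m i + int M + int N))"
  have e_eq: "int (e i) = m i + int M + int N" for i
  proof -
    have "nat \<bar>m i\<bar> \<le> N"
      unfolding N_def by (intro member_le_sum) auto
    then show ?thesis
      by (simp add: e_def)
  qed
  let ?D = "monom 1 ?n - [:uniformizer:] :: 'k poly"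
  have D: "poly (map_poly to_ac ?D) t = t ^ ?n - ?w" for t
  proof -
    have "map_poly to_ac ?D = monom 1 ?n - [:?w:]"
      by (intro poly_eqI) (simp add: coeff_map_poly coeff_pCons split: nat.split)
    then show ?thesis
      by (simp add: poly_monom)
  qed
  have prod: "(\<Prod>i\<in>UNIV. t - l i) = t ^ ?n - ?w" for t
  proof -
    have "(\<Prod>i\<in>UNIV. t - l i) = poly (\<Prod>i\<in>UNIV. [:- l i, 1:]) t"
      by (simp add: poly_prod)
    also have "\<dots> = t ^ ?n - ?w"
      unfolding prod_linear_roots[OF l] by (simp add: poly_monom)
    finally show ?thesis .
  qed
  let ?L = "map_poly to_ac (R * ?D ^ N)" and ?R = "\<Prod>i\<in>UNIV. [:- l i, 1:] ^ e i"
  have LR: "poly ?L t = poly ?R t" if t: "t ^ ?n \<noteq> ?w" for t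
  proof -
    have tl: "t - l i \<noteq> 0" for i
      using t l(2)[of i] by auto
    have d: "t ^ ?n - ?w \<noteq> 0"
      using t by simp
    have "poly (map_poly to_ac R) t = p (torus Q (\<lambda>i. t - l i)) * (t ^ ?n - ?w) ^ M"
      using RM[OF t] d by simp
    also have "p (torus Q (\<lambda>i. t - l i)) = (\<Prod>i\<in>UNIV. (t - l i) powi m i)"
      using psi_prod[of "\<lambda>i. t - l i"] p(2)[OF torS[of "\<lambda>i. t - l i"]] tl by simp
    finally have "poly ?L t = (\<Prod>i\<in>UNIV. (t - l i) powi m i) * (t ^ ?n - ?w) ^ M * (t ^ ?n - ?w) ^ N"
      by (simp add: map_poly_to_ac_mult map_poly_to_ac_power D)
    also have "\<dots> = (\<Prod>i\<in>UNIV. (t - l i) powi m i * (t - l i) ^ M * (t - l i) ^ N)"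
      unfolding prod[symmetric] by (simp add: prod.distrib prod_power_distrib)
    also have "\<dots> = (\<Prod>i\<in>UNIV. (t - l i) ^ e i)"
    proof (intro prod.cong refl)
      fix i
      have "(t - l i) powi m i * (t - l i) ^ M * (t - l i) ^ N = (t - l i) powi (m i + int M + int N)"
        using tl[of i] by (simp add: power_int_add)
      then show "(t - l i) powi m i * (t - l i) ^ M * (t - l i) ^ N = (t - l i) ^ e i"
        unfolding e_eq[symmetric] by simp
    qed
    also have "\<dots> = poly ?R t"
      by (simp add: poly_prod poly_power)
    finally show ?thesis .
  qed
  \<comment> \<open>Equality is known only where t^n differs from the uniformizer; the extra factor
    extends it to every t and is cancelled afterwards.\<close>
  have "(?L - ?R) * map_poly to_ac ?D = 0"
  proof -
    have "poly ((?L - ?R) * map_poly to_ac ?D) t = 0" for t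
    proof (cases "t ^ ?n = ?w")
      case True
      then show ?thesis
        unfolding poly_mult D by simp
    next
      case False
      show ?thesis
        unfolding poly_mult poly_diff LR[OF False] by simp
    qed
    then show ?thesis
      using poly_all_0_iff_0 by blast
  qed
  moreover have "map_poly to_ac ?D \<noteq> 0"
    using D[of 0] wz by (auto simp: power_0_left)
  ultimately have "?L = ?R"
    by simp
  then have ee: "e i = e j" for i j
    by (rule rational_exponents_equal[OF l])
  have mm: "m i = m j" for i j
    using e_eq[of i] e_eq[of j] ee[of i j] by simp
  define m0 where "m0 = m undefined"
  have m0: "m i = m0" for i
    unfolding m0_def by (rule mm)
  have "m0 = 0"
  proof -
    \<comment> \<open>The scalar 2 suffices: in characteristic 0 no positive power of 2 equals
      1.\<close>
    have "mat 2 \<in> (GL_center :: ('k alg_closure, 'n) mat2n set)"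
      unfolding GL_center_def by (simp add: invertible_mat_scalar mat_mult_commute)
    then have "\<psi> (torus Q (\<lambda>_. 2)) = 1"
      using center unfolding torus_const[OF Q(1)] by blast
    then have "((2 :: 'k alg_closure) powi m0) ^ ?n = 1"
      using psi_prod[of "\<lambda>_. 2"] by (simp add: m0)
    then have pw: "(2 :: 'k alg_closure) powi (m0 * int ?n) = 1"
      by (simp add: power_int_mult)
    have two: "a = 0" if "(2 :: 'k alg_closure) ^ a = 1" for a
    proof -
      have "of_nat (2 ^ a) = (of_nat 1 :: 'k alg_closure)"
        using that by simp
      then have "(2::nat) ^ a = 1"
        unfolding of_nat_eq_iff .
      then show ?thesis
        by simp
    qed
    have "nat \<bar>m0 * int ?n\<bar> = 0"
    proof (rule two)
      show "(2 :: 'k alg_closure) ^ nat \<bar>m0 * int ?n\<bar> = 1"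
        using pw by (auto simp: power_int_def power_inverse power_divide split: if_splits)
    qed
    then show ?thesis
      by simp
  qed
  obtain h where h: "s = block_diag h h" "invertible h" "h ** cyc ?w = cyc ?w ** h"
    using s unfolding S by blast
  obtain x where x: "h = Q ** dg x ** matrix_inv Q"
    using commuting_with_dg[OF Q l(1) h(3)] by blast
  have "x i \<noteq> 0" for i
  proof -
    have "invertible (dg x)"
      using h(2) Q(1) unfolding x by (simp add: invertible_mult_iff)
    then show ?thesis
      unfolding invertible_det_nz det_dg by (simp add: prod_zero_iff)
  qed
  then have "\<psi> (torus Q x) = 1"
    using psi_prod[of x] by (simp add: m0 \<open>m0 = 0\<close>)
  then show "\<psi> s = 1"
    using h(1) x by (simp add: torus_def)
qed

lemma H_regular_elliptic_cyc:
  fixes c :: "'k::{nonarch_local_field,field_char_0}"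
  assumes c: "c \<noteq> 0" and inv: "invertible (mat 1 - mat c ** cyc uniformizer :: 'k ^ 'n::finite ^ 'n)"
  shows "H_regular_elliptic (coset (gmat (mat 1) (mat c ** cyc uniformizer :: 'k ^ 'n ^ 'n)))"
proof -
  let ?X = "mat c ** cyc uniformizer :: 'k ^ 'n ^ 'n" and ?w = "to_ac (uniformizer :: 'k)"
  let ?X' = "mat (to_ac c) ** cyc ?w :: 'k alg_closure ^ 'n ^ 'n"
  have y': "X_to_ac (coset (gmat (mat 1) ?X)) = coset (gmat (mat 1) ?X')"
    by (simp add: X_to_ac_coset gmat_def map_matrix_blk map_matrix_to_ac_mult)
  have inv1: "invertible (mat 1 - ?X')"
    using invertible_map_matrix_to_ac[OF inv] by (simp add: map_matrix_to_ac_diff map_matrix_to_ac_mult)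
  have comm: "h ** ?X' = ?X' ** h \<longleftrightarrow> h ** cyc ?w = cyc ?w ** h" for h
  proof -
    have "h ** ?X' = mat (to_ac c) ** (h ** cyc ?w)"
      using mat_mult_commute[of "to_ac c" h] by (simp add: matrix_mul_assoc)
    moreover have "mat (to_ac c) ** A = mat (to_ac c) ** B \<longleftrightarrow> A = B" for A B :: "'k alg_closure ^ 'n ^ 'n"
      using c by (simp add: vec_eq_iff)
    ultimately show ?thesis
      by (simp add: matrix_mul_assoc[symmetric])
  qed
  have "anisotropic_mod_center (stabilizer H_group X_action (coset (gmat (mat 1) ?X')))"
    by (rule anisotropic_torus) (simp only: stabilizer_gmat[OF inv1] comm)
  then show ?thesis
    unfolding H_regular_elliptic_def y'
    using H_regular_semisimple_cyc[OF uniformizer_nonzero c inv] by blast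
qed

section \<open>Matrix groups and their cosets\<close>

text \<open>Groups of matrices as bare sets, so that the same facts serve H(F), GL_n(F) and the
  torus.\<close>

definition mat_group :: "('a::field ^ 'm::finite ^ 'm) set \<Rightarrow> bool" where
  "mat_group G \<longleftrightarrow> mat 1 \<in> G \<and> (\<forall>a\<in>G. \<forall>b\<in>G. a ** b \<in> G) \<and> (\<forall>a\<in>G. invertible a \<and> matrix_inv a \<in> G)"

lemma mat_groupD:
  assumes "mat_group G"
  shows "mat 1 \<in> G" "a \<in> G \<Longrightarrow> b \<in> G \<Longrightarrow> a ** b \<in> G" "a \<in> G \<Longrightarrow> invertible a" "a \<in> G \<Longrightarrow> matrix_inv a \<in> G"
  using assms by (auto simp: mat_group_def)

lemma mat_group_H_points: "mat_group H_points"
  by (auto simp: mat_group_def H_points_mult H_points_inv H_points_invertible)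

lemma mat_group_invertible: "mat_group {a :: 'a::field ^ 'm::finite ^ 'm. invertible a}"
  by (auto simp: mat_group_def invertible_mult)

text \<open>For \<open>h\<close> in a matrix group \<open>G\<close> and \<open>0 < s < 1\<close>,
  this is the left coset of \<open>h\<close> modulo the congruence subgroup of
  \<open>G\<close>.\<close>

definition gcos :: "('k::nonarch_local_field ^ 'm::finite ^ 'm) set \<Rightarrow> real \<Rightarrow> 'k ^ 'm ^ 'm \<Rightarrow> ('k ^ 'm ^ 'm) set" where
  "gcos G s h = {x \<in> G. mbound s (matrix_inv h ** x - mat 1)}"

context
  fixes G :: "('k::nonarch_local_field ^ 'm::finite ^ 'm) set" and s :: real
  assumes G: "mat_group G" and s: "0 < s" "s < 1"
begin

lemma gcos_iff_cong: "h \<in> G \<Longrightarrow> x \<in> gcos G s h \<longleftrightarrow> x \<in> G \<and> matrix_inv h ** x \<in> cong_sub s"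
  by (simp add: gcos_def cong_sub_def)

lemma gcos_self: "h \<in> G \<Longrightarrow> h \<in> gcos G s h"
  using s mat_groupD[OF G] by (simp add: gcos_def)

lemma gcos_subset: "gcos G s h \<subseteq> G"
  by (auto simp: gcos_def)

lemma gcos_sym:
  assumes "h \<in> G" "x \<in> gcos G s h"
  shows "h \<in> gcos G s x"
proof -
  have x: "x \<in> G" "matrix_inv h ** x \<in> cong_sub s"
    using assms gcos_iff_cong by auto
  have "matrix_inv (matrix_inv h ** x) \<in> cong_sub s"
    using cong_sub_inv[OF s(2) x(2)] .
  moreover have "matrix_inv (matrix_inv h ** x) = matrix_inv x ** h"
    using mat_groupD[OF G] assms(1) x(1) by (simp add: matrix_inv_mult)
  ultimately show ?thesis
    using assms(1) x(1) by (simp add: gcos_iff_cong)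
qed

lemma gcos_trans:
  assumes "h \<in> G" "x \<in> gcos G s h" "z \<in> gcos G s x"
  shows "z \<in> gcos G s h"
proof -
  have x: "x \<in> G" "matrix_inv h ** x \<in> cong_sub s" and z: "z \<in> G" "matrix_inv x ** z \<in> cong_sub s"
    using assms gcos_iff_cong by (auto simp: gcos_def cong_sub_def)
  have "(matrix_inv h ** x) ** (matrix_inv x ** z) \<in> cong_sub s"
    by (rule cong_sub_mult[OF s(2) x(2) z(2)])
  moreover have "(matrix_inv h ** x) ** (matrix_inv x ** z) = matrix_inv h ** z"
    using mat_groupD[OF G] x(1) by (simp add: matrix_mul_assoc)
  ultimately show ?thesis
    using assms(1) z(1) by (simp add: gcos_iff_cong)
qed

lemma gcos_eq_iff:
  assumes "h \<in> G" "x \<in> G"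
  shows "gcos G s x = gcos G s h \<longleftrightarrow> x \<in> gcos G s h"
proof
  assume x: "x \<in> gcos G s h"
  show "gcos G s x = gcos G s h"
    using gcos_trans[OF assms(1) x] gcos_trans[OF assms(2) gcos_sym[OF assms(1) x]] by blast
qed (use gcos_self assms in blast)

lemma gcos_disjoint:
  assumes "h \<in> G" "x \<in> G" "gcos G s x \<noteq> gcos G s h"
  shows "gcos G s x \<inter> gcos G s h = {}"
proof (rule ccontr)
  assume "gcos G s x \<inter> gcos G s h \<noteq> {}"
  then obtain z where z: "z \<in> gcos G s x" "z \<in> gcos G s h"
    by blast
  then have "x \<in> gcos G s h"
    using gcos_trans[OF assms(1) z(2)] gcos_sym[OF assms(2) z(1)] by blast
  then show False
    using assms gcos_eq_iff by blast
qed

lemma gcos_mult_left: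
  assumes "a \<in> G" "h \<in> G"
  shows "(\<lambda>x. a ** x) ` gcos G s h = gcos G s (a ** h)"
proof (intro equalityI subsetI)
  fix z
  assume "z \<in> (\<lambda>x. a ** x) ` gcos G s h"
  then show "z \<in> gcos G s (a ** h)"
    using assms mat_groupD[OF G] by (auto simp: gcos_def matrix_inv_mult matrix_mul_assoc)
next
  fix z
  assume "z \<in> gcos G s (a ** h)"
  then show "z \<in> (\<lambda>x. a ** x) ` gcos G s h"
    using assms mat_groupD[OF G]
    by (intro image_eqI[of _ _ "matrix_inv a ** z"]) (auto simp: gcos_def matrix_inv_mult matrix_mul_assoc)
qed

lemma gcos_openin:
  assumes h: "h \<in> G"
  shows "openin (top_of_set G) (gcos G s h)"
proof -
  obtain b where b: "b \<ge> 1" "mbound b (matrix_inv h)"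
    using mbound_exists by blast
  let ?U = "\<Union>x\<in>gcos G s h. {z. mbound (s / b) (z - x)}"
  have "open ?U"
    using s b by (intro open_UN ballI open_mbound_diff) simp
  moreover have "gcos G s h = G \<inter> ?U"
  proof (intro equalityI subsetI)
    fix x
    assume "x \<in> gcos G s h"
    moreover have "mbound (s / b) (x - x)"
      using s b by simp
    ultimately show "x \<in> G \<inter> ?U"
      using gcos_subset by blast
  next
    fix z
    assume "z \<in> G \<inter> ?U"
    then obtain x where x: "x \<in> gcos G s h" "mbound (s / b) (z - x)" and z: "z \<in> G"
      by blast
    have "mbound (b * (s / b)) (matrix_inv h ** (z - x))"
      using b(2) x(2) by (rule mbound_mult)
    then have "mbound s (matrix_inv h ** z - matrix_inv h ** x)"
      using b by (simp add: matrix_diff_ldistrib)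
    moreover have "mbound s (matrix_inv h ** x - mat 1)"
      using x by (simp add: gcos_def)
    ultimately have "mbound s (matrix_inv h ** z - mat 1)"
      using mbound_add by fastforce
    then show "z \<in> gcos G s h"
      using z by (simp add: gcos_def)
  qed
  ultimately show ?thesis
    by (auto simp: openin_open)
qed

text \<open>The compact set of matrices bounded by \<open>b\<close> is covered by finitely many
  balls of radius s / b; two elements of \<open>S\<close> in one ball differ by a factor in the
  congruence subgroup, because inverses are bounded by \<open>b\<close>.\<close>

lemma finite_gcos:
  assumes S: "S \<subseteq> G" and b: "b \<ge> 1" "\<And>h. h \<in> S \<Longrightarrow> mbound b h \<and> mbound b (matrix_inv h)"
  shows "finite (gcos G s ` S)"
proof -
  have "compact {A :: 'k ^ 'm ^ 'm. mbound b A}"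
    by (rule compact_mbound)
  moreover have "\<And>A. A \<in> UNIV \<Longrightarrow> open {B :: 'k ^ 'm ^ 'm. mbound (s / b) (B - A)}"
    using s b by (intro open_mbound_diff) simp
  moreover have "{A :: 'k ^ 'm ^ 'm. mbound b A} \<subseteq> (\<Union>A\<in>UNIV. {B. mbound (s / b) (B - A)})"
  proof
    fix A :: "'k ^ 'm ^ 'm"
    have "A \<in> {B. mbound (s / b) (B - A)}"
      using s b by simp
    then show "A \<in> (\<Union>A\<in>UNIV. {B. mbound (s / b) (B - A)})"
      by blast
  qed
  ultimately obtain F where F: "finite F" "{A :: 'k ^ 'm ^ 'm. mbound b A} \<subseteq> (\<Union>A\<in>F. {B. mbound (s / b) (B - A)})"
    by (rule compactE_image)
  have "gcos G s ` S \<subseteq> (\<Union>A\<in>F. gcos G s ` {h \<in> S. mbound (s / b) (h - A)})"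
    using F(2) b(2) by fastforce
  moreover have "finite (gcos G s ` {h \<in> S. mbound (s / b) (h - A)})" for A
  proof (cases "{h \<in> S. mbound (s / b) (h - A)} = {}")
    case False
    then obtain h0 where h0: "h0 \<in> S" "mbound (s / b) (h0 - A)"
      by blast
    have "gcos G s h = gcos G s h0" if h: "h \<in> S" "mbound (s / b) (h - A)" for h
    proof -
      have "mbound (s / b) ((h - A) - (h0 - A))"
        using h(2) h0(2) by (rule mbound_diff)
      then have "mbound (b * (s / b)) (matrix_inv h0 ** (h - h0))"
        using b(2)[OF h0(1)] by (intro mbound_mult) auto
      then have "mbound s (matrix_inv h0 ** h - mat 1)"
        using b(1) h0(1) S mat_groupD(3)[OF G] by (auto simp: matrix_diff_ldistrib)
      then have "h \<in> gcos G s h0"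
        using h(1) S by (auto simp: gcos_def)
      then show ?thesis
        using h h0 S by (subst gcos_eq_iff) auto
    qed
    then have "gcos G s ` {h \<in> S. mbound (s / b) (h - A)} \<subseteq> {gcos G s h0}"
      by blast
    then show ?thesis
      by (rule finite_subset) simp
  next
    case True
    show ?thesis
      unfolding True by simp
  qed
  ultimately show ?thesis
    using F(1) by (meson finite_UN_I finite_subset)
qed

text \<open>The group is exhausted by its elements that are bounded together with their inverses.
  Countability is what gives open cosets positive Haar measure.\<close>

lemma countable_gcos: "countable (gcos G s ` G)"
proof -
  let ?S = "\<lambda>N::nat. {h \<in> G. mbound (real (Suc N)) h \<and> mbound (real (Suc N)) (matrix_inv h)}"
  have "h \<in> (\<Union>N. ?S N)" if "h \<in> G" for h
  proof -
    obtain b where b: "b \<ge> 1" "mbound b h"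
      using mbound_exists by blast
    obtain c where c: "c \<ge> 1" "mbound c (matrix_inv h)"
      using mbound_exists by blast
    obtain N :: nat where "max b c \<le> real N"
      using real_arch_simple by blast
    then show ?thesis
      using that b c by (auto intro!: exI[of _ N] elim!: mbound_mono)
  qed
  then have "gcos G s ` G \<subseteq> (\<Union>N. gcos G s ` ?S N)"
    by blast
  moreover have "finite (gcos G s ` ?S N)" for N
    by (rule finite_gcos[of _ "real (Suc N)"]) auto
  ultimately show ?thesis
    by (meson countable_UN countable_finite countable_subset countableI_type)
qed

lemma gcos_card_eq:
  assumes "K \<subseteq> G" "\<And>a b. a \<in> K \<Longrightarrow> b \<in> K \<Longrightarrow> a ** b \<in> K" "\<And>a. a \<in> K \<Longrightarrow> matrix_inv a \<in> K" "h \<in> G"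
  shows "card (gcos G s ` ((\<lambda>k. h ** k) ` K)) = card (gcos G s ` K)"
proof -
  have "gcos G s ` ((\<lambda>k. h ** k) ` K) = (\<lambda>c. (\<lambda>x. h ** x) ` c) ` (gcos G s ` K)"
  proof -
    have "gcos G s (h ** k) = (\<lambda>x. h ** x) ` gcos G s k" if "k \<in> K" for k
      using gcos_mult_left[OF assms(4)] assms(1) that by blast
    then show ?thesis
      by (simp add: image_image)
  qed
  moreover have "inj (\<lambda>c :: ('k ^ 'm ^ 'm) set. (\<lambda>x. h ** x) ` c)"
  proof -
    have "inj (\<lambda>x :: 'k ^ 'm ^ 'm. h ** x)"
      using mat_cancel_left(1)[OF mat_groupD(3)[OF G assms(4)]] by (metis injI)
    then show ?thesis
      by (simp add: inj_def inj_image_eq_iff)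
  qed
  ultimately show ?thesis
    by (simp add: card_image inj_on_subset)
qed

end

section \<open>Continuity of matrix operations\<close>

text \<open>Continuity from entrywise Lipschitz bounds, which avoids estimates in the Euclidean
  metric of vectors.\<close>

lemma mlipschitz_continuous:
  fixes f :: "'k::nonarch_local_field ^ 'n::finite ^ 'm::finite \<Rightarrow> 'k ^ 'p::finite ^ 'q::finite"
  assumes "b > 0" "\<And>x x' e. mbound e (x - x') \<Longrightarrow> mbound (b * e) (f x - f x')"
  shows "continuous_on A f"
proof -
  have "continuous_on UNIV f"
  proof (rule continuous_on_open_vimage[OF open_UNIV, THEN iffD2], intro allI impI)
    fix U :: "('k ^ 'p ^ 'q) set"
    assume U: "open U"
    have "open (f -` U)"
    proof (subst open_subopen, intro ballI)
      fix x
      assume "x \<in> f -` U"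
      then obtain s where s: "0 < s" "s < 1" "\<And>B. mbound s (B - f x) \<Longrightarrow> B \<in> U"
        using mbound_nhd[OF U] by blast
      have "open {z. mbound (s / b) (z - x)}"
        using s assms(1) by (intro open_mbound_diff) simp
      moreover have "x \<in> {z. mbound (s / b) (z - x)}"
        using s assms(1) by simp
      moreover have "{z. mbound (s / b) (z - x)} \<subseteq> f -` U"
      proof
        fix z
        assume "z \<in> {z. mbound (s / b) (z - x)}"
        then have "mbound (b * (s / b)) (f z - f x)"
          using assms(2) by blast
        then show "z \<in> f -` U"
          using s(3) assms(1) by simp
      qed
      ultimately show "\<exists>T. open T \<and> x \<in> T \<and> T \<subseteq> f -` U"
        by blast
    qed
    then show "open (f -` U \<inter> UNIV)"
      by simp
  qed
  then show ?thesis
    by (rule continuous_on_subset) simp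
qed

lemma continuous_on_matrix_mult_left:
  "continuous_on A (\<lambda>x :: 'k::nonarch_local_field ^ 'n::finite ^ 'm::finite. (h :: 'k ^ 'm ^ 'p::finite) ** x)"
proof -
  obtain b where b: "b \<ge> 1" "mbound b h"
    using mbound_exists by blast
  then show ?thesis
    using mbound_mult[OF b(2)] by (intro mlipschitz_continuous[of b]) (auto simp: matrix_diff_ldistrib[symmetric])
qed

lemma continuous_on_matrix_mult_right:
  "continuous_on A (\<lambda>x :: 'k::nonarch_local_field ^ 'm::finite ^ 'p::finite. x ** (h :: 'k ^ 'n::finite ^ 'm))"
proof -
  obtain b where b: "b \<ge> 1" "mbound b h"
    using mbound_exists by blast
  then show ?thesis
    using mbound_mult[OF _ b(2)]
    by (intro mlipschitz_continuous[of b]) (auto simp: matrix_diff_rdistrib[symmetric] mult.commute)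
qed

lemma mbound_blk: "mbound b (blk A B C D) \<longleftrightarrow> mbound b A \<and> mbound b B \<and> mbound b C \<and> mbound b D"
proof
  assume "mbound b (blk A B C D)"
  then show "mbound b A \<and> mbound b B \<and> mbound b C \<and> mbound b D"
    unfolding mbound_def by (metis blk_nth)
next
  assume *: "mbound b A \<and> mbound b B \<and> mbound b C \<and> mbound b D"
  have "absval (blk A B C D $ i $ j) \<le> b" for i j
    using * by (cases i; cases j) (simp_all add: mbound_def)
  then show "mbound b (blk A B C D)"
    by (simp add: mbound_def)
qed

lemma blk_diff: "blk A B C D - blk A' B' C' D' = blk (A - A') (B - B') (C - C') (D - D')"
  by (rule mat2n_eqI) simp_all

lemma block_diag_diff: "block_diag A B - block_diag A' B' = block_diag (A - A') (B - B')"
  by (simp add: block_diag_blk blk_diff)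

lemma mbound_block_diag: "mbound b (block_diag A B) \<longleftrightarrow> mbound b A \<and> mbound b B"
  by (auto simp: block_diag_blk mbound_blk intro: mbound_nonneg)

lemma H_points_cases:
  assumes "h \<in> H_points"
  obtains a b where "h = block_diag a b" "invertible a" "invertible b"
  using assms unfolding H_points_def by blast

lemma block_diag_in_H: "block_diag a b \<in> H_points \<longleftrightarrow> invertible a \<and> invertible b"
  unfolding H_points_def by auto

lemma gcos_H_iff:
  assumes "invertible a" "invertible b" "invertible a'" "invertible b'"
  shows "block_diag a' b' \<in> gcos H_points s (block_diag a b) \<longleftrightarrow>
    a' \<in> gcos {a. invertible a} s a \<and> b' \<in> gcos {a. invertible a} s b"
  using assms block_diag_one[symmetric]
  by (simp add: gcos_def block_diag_in_H block_diag_inverse block_diag_mult block_diag_one[symmetric]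
      block_diag_diff mbound_block_diag)

text \<open>For \<open>s < 1\<close> closeness to 1 implies invertibility, so the coset of 1 is cut
  out of a compact ball by the closed condition that the off-diagonal blocks vanish; the other
  cosets are its translates.\<close>

lemma compact_gcos_H:
  fixes h :: "('k::nonarch_local_field, 'n::finite) mat2n"
  assumes h: "h \<in> H_points" and s: "0 < s" "s < 1"
  shows "compact (gcos H_points s h)"
proof -
  let ?C = "{M :: ('k, 'n) mat2n. mbound s (M - mat 1)} \<inter> (\<Inter>a. \<Inter>b. {M. M $ Inl a $ Inr b = 0} \<inter> {M. M $ Inr a $ Inl b = 0})"
  have "compact ?C"
    by (intro compact_Int_closed compact_mbound_diff closed_INT ballI closed_Int closed_Collect_eq continuous_intros)
  moreover have "?C = gcos H_points s (mat 1 :: ('k, 'n) mat2n)"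
  proof (intro equalityI subsetI)
    fix M :: "('k, 'n) mat2n"
    assume M: "M \<in> ?C"
    obtain A B C D where blk: "M = blk A B C D"
      using blk_surj by blast
    have "B = 0" "C = 0"
      using M unfolding blk by (simp_all add: vec_eq_iff)
    then have Mbd: "M = block_diag A D"
      by (simp add: blk block_diag_blk)
    have mb: "mbound s (M - mat 1)"
      using M by blast
    have "mbound s (A - mat 1)" "mbound s (D - mat 1)"
      using mb unfolding Mbd block_diag_one[symmetric] block_diag_diff mbound_block_diag by blast+
    then have "invertible A" "invertible D"
      using cong_sub_GLO[OF s(2)] GLO_invertible unfolding cong_sub_def by blast+
    then show "M \<in> gcos H_points s (mat 1)"
      using mb by (simp add: gcos_def Mbd block_diag_in_H)
  next
    fix M :: "('k, 'n) mat2n"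
    assume "M \<in> gcos H_points s (mat 1)"
    then have "M \<in> H_points" "mbound s (M - mat 1)"
      by (simp_all add: gcos_def)
    then show "M \<in> ?C"
      by (auto elim!: H_points_cases simp: block_diag_blk)
  qed
  ultimately have "compact (gcos H_points s (mat 1 :: ('k, 'n) mat2n))"
    by simp
  then have "compact ((\<lambda>x. h ** x) ` gcos H_points s (mat 1))"
    by (intro compact_continuous_image continuous_on_matrix_mult_left)
  then show ?thesis
    using gcos_mult_left[OF mat_group_H_points s h H_points_one] by simp
qed

section \<open>The elliptic torus and its fundamental domain\<close>

text \<open>The multiplicative group of E, embedded diagonally in H(F): the common stabilizer of all
  the points y_k.\<close>

definition TT :: "('k::nonarch_local_field, 'n::finite) mat2n set" where
  "TT = {block_diag h h | h. h \<in> EE \<and> h \<noteq> 0}"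

text \<open>The units of O_E, the maximal compact subgroup of the torus.\<close>

definition OT :: "('k::nonarch_local_field, 'n::finite) mat2n set" where
  "OT = {block_diag h h | h. h \<in> EE \<and> enorm h = 1}"

text \<open>Translation by \<Pi> multiplies the determinant of the first block by a generator of the
  value group, so exactly one of the translates of a point of H(F) by powers of \<Pi> lies here.
  Restricting to this set replaces the noncompact torus by its units.\<close>

definition DD :: "('k::nonarch_local_field, 'n::finite) mat2n set" where
  "DD = {block_diag a b | a b. absval (det a) = 1 \<and> invertible b}"

definition PP :: "int \<Rightarrow> ('k::nonarch_local_field, 'n::finite) mat2n" where
  "PP j = block_diag (mpowi (cyc uniformizer) j) (mpowi (cyc uniformizer) j)"

lemma block_diag_in_DD: "block_diag a b \<in> DD \<longleftrightarrow> absval (det a) = 1 \<and> invertible b"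
  unfolding DD_def by auto

lemma absval_det_1_invertible: "absval (det (a :: 'k::nonarch_local_field ^ 'n::finite ^ 'n)) = 1 \<Longrightarrow> invertible a"
  by (auto simp: invertible_det_nz)

lemma DD_sub: "DD \<subseteq> H_points"
  unfolding DD_def H_points_def using absval_det_1_invertible by blast

lemma TT_sub: "TT \<subseteq> H_points"
  unfolding TT_def H_points_def using EE_invertible by blast

lemma EE_one [simp]: "mat 1 \<in> EE"
  by simp

lemma EE_nonzero: "h \<in> EE \<Longrightarrow> enorm h = 1 \<Longrightarrow> h \<noteq> 0"
  using enorm_eq_0_iff[of h] by auto

lemma OT_sub: "OT \<subseteq> TT"
  unfolding OT_def TT_def using EE_nonzero by blast

lemma mat_1_nonzero: "(mat 1 :: 'a::field ^ 'n::finite ^ 'n) \<noteq> 0"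
proof
  assume "(mat 1 :: 'a ^ 'n ^ 'n) = 0"
  then have "(mat 1 :: 'a ^ 'n ^ 'n) $ i $ i = 0" for i
    by simp
  then show False
    by (simp add: mat_def)
qed

lemma mat_group_TT: "mat_group (TT :: ('k::nonarch_local_field, 'n::finite) mat2n set)"
  unfolding mat_group_def
proof (intro conjI ballI)
  have "(mat 1 :: 'k ^ 'n ^ 'n) \<noteq> 0"
    by (rule mat_1_nonzero)
  then show "mat 1 \<in> (TT :: ('k, 'n) mat2n set)"
    unfolding TT_def block_diag_one[symmetric] using EE_one by blast
next
  fix a b :: "('k, 'n) mat2n"
  assume a: "a \<in> TT" and b: "b \<in> TT"
  obtain h k where h: "a = block_diag h h" "h \<in> EE" "h \<noteq> 0" and k: "b = block_diag k k" "k \<in> EE" "k \<noteq> 0"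
    using a b unfolding TT_def by blast
  have "h ** k \<noteq> 0"
    using h k enorm_mult[of h k] enorm_eq_0_iff[of h] enorm_eq_0_iff[of k] enorm_eq_0_iff[of "h ** k"] EE_mult[of h k]
    by auto
  then show "a ** b \<in> TT"
    unfolding TT_def h(1) k(1) block_diag_mult using EE_mult[OF h(2) k(2)] by blast
next
  fix a :: "('k, 'n) mat2n"
  assume a: "a \<in> TT"
  then show "invertible a"
    using TT_sub H_points_invertible by blast
  obtain h where h: "a = block_diag h h" "h \<in> EE" "h \<noteq> 0"
    using a unfolding TT_def by blast
  have inv: "invertible h"
    using EE_invertible h by blast
  have "matrix_inv h \<noteq> 0"
  proof
    assume "matrix_inv h = 0"
    then have "h ** 0 = mat 1"
      using mat_inv_right[OF inv] by simp
    then show False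
      using mat_1_nonzero[where 'a='k and 'n='n] by simp
  qed
  then show "matrix_inv a \<in> TT"
    unfolding TT_def h(1) block_diag_inverse(2)[OF inv inv] using EE_inv[OF h(2) inv] by blast
qed

lemma TT_commute: "a \<in> TT \<Longrightarrow> b \<in> TT \<Longrightarrow> a ** b = b ** a"
  unfolding TT_def using EE_commute by (auto simp: block_diag_mult)

lemma PP_TT [simp]: "PP j \<in> TT"
proof -
  have "mpowi (cyc uniformizer) j \<noteq> (0 :: 'a ^ 'b ^ 'b)"
    using enorm_mpowi_cyc[of j, where 'k='a and 'n='b] enorm_eq_0_iff[of "mpowi (cyc uniformizer) j :: 'a ^ 'b ^ 'b"] by auto
  then show ?thesis
    unfolding TT_def PP_def using EE_mpowi_cyc by blast
qed

lemma PP_0 [simp]: "PP 0 = mat 1"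
  by (simp add: PP_def block_diag_one)

lemma TT_decompose:
  assumes "t \<in> TT"
  obtains j u where "t = PP j ** u" "u \<in> OT"
proof -
  obtain h where h: "t = block_diag h h" "h \<in> EE" "h \<noteq> 0"
    using assms unfolding TT_def by blast
  obtain m U where "h = mpowi (cyc uniformizer) m ** U" "U \<in> EE" "enorm U = 1"
    using EE_decompose[OF h(2,3)] by blast
  then show ?thesis
    using that[of m "block_diag U U"] h(1) unfolding OT_def PP_def block_diag_mult by blast
qed

text \<open>The determinant of the first block is multiplied by that of an element of E, whose
  absolute value is 1 only for units.\<close>

lemma TT_mult_DD:
  assumes "t \<in> TT" "h \<in> DD"
  shows "t ** h \<in> DD \<longleftrightarrow> t \<in> OT"
proof -
  obtain k where k: "t = block_diag k k" "k \<in> EE" "k \<noteq> 0"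
    using assms(1) unfolding TT_def by blast
  obtain a b where ab: "h = block_diag a b" "absval (det a) = 1" "invertible b"
    using assms(2) unfolding DD_def by blast
  have "t ** h \<in> DD \<longleftrightarrow> absval (det k) = 1"
    using ab EE_invertible[OF k(2,3)] by (simp add: k(1) block_diag_mult block_diag_in_DD det_mul absval_mult invertible_mult)
  also have "\<dots> \<longleftrightarrow> enorm k = 1"
    using EE_unit_iff[OF k(2)] by simp
  also have "\<dots> \<longleftrightarrow> t \<in> OT"
    unfolding OT_def k(1) using k(2) by auto
  finally show ?thesis .
qed

lemma PP_into_DD:
  assumes "h \<in> H_points"
  obtains j where "PP j ** h \<in> DD"
proof -
  obtain a b where ab: "h = block_diag a b" "invertible a" "invertible b"
    using assms H_points_cases by blast
  have "det a \<noteq> 0"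
    using ab by (simp add: invertible_det_nz)
  then obtain m where "absval (det a) = rabs TYPE('a) powi m"
    using absval_discrete by blast
  then have "PP (- m) ** h \<in> DD"
    using ab by (simp add: PP_def block_diag_mult block_diag_in_DD det_mul det_mpowi absval_mult absval_power_int
        absval_inverse absval_det_cyc power_int_minus invertible_mult invertible_mpowi)
  then show ?thesis
    by (rule that)
qed

lemma gcos_DD:
  assumes "s < 1" "h \<in> DD" "x \<in> gcos H_points s h"
  shows "x \<in> DD"
proof -
  obtain a b where ab: "h = block_diag a b" "absval (det a) = 1" "invertible b"
    using assms(2) unfolding DD_def by blast
  have a: "invertible a"
    using ab absval_det_1_invertible by blast
  have "x \<in> H_points"
    using assms(3) by (simp add: gcos_def)
  then obtain a' b' where x: "x = block_diag a' b'" "invertible a'" "invertible b'"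
    using H_points_cases by blast
  have "matrix_inv a ** a' \<in> cong_sub s"
    using assms(3) gcos_H_iff[OF a ab(3) x(2,3)] unfolding ab(1) x(1) by (simp add: gcos_def cong_sub_def)
  then have "absval (det (matrix_inv a ** a')) = 1"
    using cong_sub_GLO[OF assms(1)] by (auto simp: GLO_def)
  then have "absval (det a') = 1"
    using ab a by (simp add: det_mul det_matrix_inv absval_mult absval_inverse)
  then show ?thesis
    using x by (simp add: block_diag_in_DD)
qed

lemma openin_DD: "openin (top_of_set H_points) (DD :: ('a::nonarch_local_field, 'b::finite) mat2n set)"
proof -
  have "(DD :: ('a, 'b) mat2n set) = (\<Union>h\<in>DD. gcos H_points (1/2) h)"
    using gcos_DD[of "1/2"] gcos_self[OF mat_group_H_points, of "1/2"] DD_sub by fastforce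
  moreover have "openin (top_of_set H_points) (\<Union>h\<in>(DD :: ('a, 'b) mat2n set). gcos H_points (1/2) h)"
    using DD_sub by (intro openin_Union) (auto intro!: gcos_openin mat_group_H_points)
  ultimately show ?thesis
    by simp
qed

lemma OT_eq: "OT = TT \<inter> DD"
proof -
  have "mat 1 \<in> DD"
    unfolding block_diag_one[symmetric] block_diag_in_DD by simp
  then show ?thesis
    using TT_mult_DD[of _ "mat 1"] OT_sub by auto
qed

text \<open>Since \<open>vnorm\<close> is a maximum, norm at least 1 is a finite union of closed
  conditions, one for each coordinate; norm at most 1 and commuting with \<Pi> cut out a closed
  subset of a compact ball.\<close>

lemma compact_OT: "compact (OT :: ('k::nonarch_local_field, 'n::finite) mat2n set)"
proof -
  let ?P = "cyc uniformizer :: 'k ^ 'n ^ 'n"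
  let ?C = "{h :: 'k ^ 'n ^ 'n. mbound 1 h} \<inter> {h. h ** ?P = ?P ** h} \<inter> (\<Union>i. {h. 1 \<le> wt (h *v axis (at_idx 0) 1) i})"
  have "closed {h :: 'k ^ 'n ^ 'n. h ** ?P = ?P ** h}"
    by (intro closed_Collect_eq continuous_on_matrix_mult_left continuous_on_matrix_mult_right)
  moreover have "closed {h :: 'k ^ 'n ^ 'n. 1 \<le> wt (h *v axis (at_idx 0) 1) i}" for i
    unfolding wt_def matrix_vector_mult_axis
    by (intro closed_Collect_le continuous_intros continuous_on_compose2[OF continuous_on_absval[of UNIV]]) auto
  ultimately have "compact ?C"
    by (intro compact_Int_closed closed_UN compact_mbound) auto
  moreover have "?C = {h. h \<in> EE \<and> enorm h = 1}"
  proof (intro equalityI subsetI)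
    fix h :: "'k ^ 'n ^ 'n"
    assume h: "h \<in> ?C"
    then have hE: "h \<in> EE"
      by (simp add: EE_def)
    have "enorm h \<le> 1"
      unfolding enorm_def vnorm_le_1_iff using h by (simp add: mbound_def)
    moreover have "1 \<le> enorm h"
    proof -
      obtain i where "1 \<le> wt (h *v axis (at_idx 0) 1) i"
        using h by blast
      then show ?thesis
        unfolding enorm_def using wt_le_vnorm order_trans by blast
    qed
    ultimately show "h \<in> {h. h \<in> EE \<and> enorm h = 1}"
      using hE by simp
  next
    fix h :: "'k ^ 'n ^ 'n"
    assume h: "h \<in> {h. h \<in> EE \<and> enorm h = 1}"
    then have "mbound 1 h"
      using EE_unit_GLO GLO_mbound by blast
    moreover obtain i where "vnorm (h *v axis (at_idx 0) 1) = wt (h *v axis (at_idx 0) 1) i"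
      using vnorm_attained by blast
    ultimately show "h \<in> ?C"
      using h by (auto simp: EE_def enorm_def intro!: exI[of _ i])
  qed
  ultimately have "compact {h :: 'k ^ 'n ^ 'n. h \<in> EE \<and> enorm h = 1}"
    by simp
  moreover have "continuous_on {h :: 'k ^ 'n ^ 'n. h \<in> EE \<and> enorm h = 1} (\<lambda>h. block_diag h h)"
    by (rule mlipschitz_continuous[of 1]) (auto simp: block_diag_diff mbound_block_diag)
  ultimately have "compact ((\<lambda>h. block_diag h h) ` {h :: 'k ^ 'n ^ 'n. h \<in> EE \<and> enorm h = 1})"
    using compact_continuous_image by blast
  moreover have "(\<lambda>h. block_diag h h) ` {h :: 'k ^ 'n ^ 'n. h \<in> EE \<and> enorm h = 1} = OT"
    unfolding OT_def by blast
  ultimately show ?thesis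
    by simp
qed

lemma finite_OT_gcos:
  fixes h :: "('k::nonarch_local_field, 'n::finite) mat2n"
  assumes h: "h \<in> H_points" and s: "0 < s" "s < 1"
  shows "finite (gcos H_points s ` ((\<lambda>t. t ** h) ` OT))"
proof -
  obtain b where b: "b \<ge> 1" "mbound b h"
    using mbound_exists by blast
  obtain c where c: "c \<ge> 1" "mbound c (matrix_inv h)"
    using mbound_exists by blast
  have inv: "invertible h"
    using h H_points_invertible by blast
  show ?thesis
  proof (rule finite_gcos[OF mat_group_H_points s, of _ "max b c"])
    show "(\<lambda>t. t ** h) ` OT \<subseteq> H_points"
      using OT_sub TT_sub h H_points_mult by blast
    show "max b c \<ge> 1"
      using b by simp
    fix x
    assume "x \<in> (\<lambda>t. t ** h) ` OT"
    then obtain k where k: "k \<in> EE" "enorm k = 1" and x: "x = block_diag k k ** h"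
      unfolding OT_def by blast
    have kG: "k \<in> GLO"
      using k EE_unit_GLO by blast
    have "mbound 1 (block_diag k k)" "mbound 1 (matrix_inv (block_diag k k))"
      using kG GLO_inv[OF kG] GLO_mbound by (auto simp: block_diag_inverse mbound_block_diag)
    moreover have "matrix_inv x = matrix_inv h ** matrix_inv (block_diag k k)"
      unfolding x using inv kG by (intro matrix_inv_mult) (auto simp: block_diag_inverse)
    ultimately have "mbound b x" "mbound c (matrix_inv x)"
      using b c x mbound_mult_left mbound_mult_right by auto
    then show "mbound (max b c) x \<and> mbound (max b c) (matrix_inv x)"
      by (auto intro: mbound_mono)
  qed
qed

section \<open>Haar measures\<close>

lemma sets_borel_of_top: "openin T U \<Longrightarrow> U \<in> sets (borel_of_top T)"
  unfolding borel_of_top_def by (subst sets_measure_of) (auto dest: openin_subset)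

lemma space_borel_of_top: "space (borel_of_top T) = topspace T"
  unfolding borel_of_top_def by (rule space_measure_of) (auto dest: openin_subset)

lemma haar_sets:
  assumes "haar_measure S \<mu>"
  shows "openin (top_of_set S) U \<Longrightarrow> U \<in> sets \<mu>" "space \<mu> = S"
proof -
  have eq: "sets \<mu> = sets (borel_of_top (top_of_set S))"
    using assms by (simp add: haar_measure_def)
  show "openin (top_of_set S) U \<Longrightarrow> U \<in> sets \<mu>"
    unfolding eq by (rule sets_borel_of_top)
  show "space \<mu> = S"
    using sets_eq_imp_space_eq[OF eq] by (simp add: space_borel_of_top)
qed

lemma haar_translate:
  "haar_measure S \<mu> \<Longrightarrow> a \<in> S \<Longrightarrow> A \<in> sets \<mu> \<Longrightarrow> emeasure \<mu> ((\<lambda>x. a ** x) ` A) = emeasure \<mu> A"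
  by (simp add: haar_measure_def)

text \<open>Otherwise countable subadditivity would make the whole group a null set.\<close>

lemma haar_positive:
  assumes haar: "haar_measure S \<mu>" and "countable I" "\<And>i. i \<in> I \<Longrightarrow> A i \<in> sets \<mu>" "S \<subseteq> (\<Union>i\<in>I. A i)"
    and eq: "\<And>i. i \<in> I \<Longrightarrow> emeasure \<mu> (A i) = m"
  shows "m \<noteq> 0"
proof
  assume "m = 0"
  then have "(\<Union>i\<in>I. A i) \<in> null_sets \<mu>"
    using assms by (intro null_sets_UN') (auto simp: null_sets_def)
  then have "emeasure \<mu> (\<Union>i\<in>I. A i) = 0"
    by (simp add: null_sets_def)
  moreover have "emeasure \<mu> S \<le> emeasure \<mu> (\<Union>i\<in>I. A i)"
    using assms by (intro emeasure_mono sets.countable_UN') auto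
  ultimately show False
    using haar by (simp add: haar_measure_def)
qed

lemma haar_gcos:
  fixes \<mu> :: "('k::nonarch_local_field, 'n::finite) mat2n measure"
  assumes mu: "haar_measure H_points \<mu>" and s: "0 < s" "s < 1"
  shows "h \<in> H_points \<Longrightarrow> gcos H_points s h \<in> sets \<mu>"
    "h \<in> H_points \<Longrightarrow> emeasure \<mu> (gcos H_points s h) = emeasure \<mu> (gcos H_points s (mat 1))"
    "emeasure \<mu> (gcos H_points s (mat 1)) < \<infinity>" "emeasure \<mu> (gcos H_points s (mat 1)) \<noteq> 0"
proof -
  show meas: "gcos H_points s h \<in> sets \<mu>" if "h \<in> H_points" for h
    using haar_sets(1)[OF mu] gcos_openin[OF mat_group_H_points s that] by blast
  show eq: "emeasure \<mu> (gcos H_points s h) = emeasure \<mu> (gcos H_points s (mat 1))" if "h \<in> H_points" for h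
    using haar_translate[OF mu that meas[OF H_points_one]] gcos_mult_left[OF mat_group_H_points s that H_points_one]
    by simp
  show "emeasure \<mu> (gcos H_points s (mat 1)) < \<infinity>"
    using mu compact_gcos_H[OF H_points_one s] gcos_subset[OF mat_group_H_points s] unfolding haar_measure_def by blast
  show "emeasure \<mu> (gcos H_points s (mat 1)) \<noteq> 0"
  proof (rule haar_positive[OF mu countable_gcos[OF mat_group_H_points s], of "\<lambda>c. c"])
    fix c :: "('k, 'n) mat2n set"
    assume "c \<in> gcos H_points s ` H_points"
    then show "c \<in> sets \<mu>" "emeasure \<mu> c = emeasure \<mu> (gcos H_points s (mat 1))"
      using meas eq by blast+
  next
    show "(H_points :: ('k, 'n) mat2n set) \<subseteq> (\<Union>i\<in>gcos H_points s ` H_points. i)"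
      using gcos_self[OF mat_group_H_points s] by blast
  qed
qed

lemma TT_preimage_sets:
  assumes tau: "haar_measure TT \<tau>" and s: "0 < s" "s < 1" and "h \<in> H_points" "x \<in> H_points"
  shows "{t \<in> TT. t ** x \<in> gcos H_points s h} \<in> sets \<tau>"
proof -
  obtain U where U: "open U" "gcos H_points s h = H_points \<inter> U"
    using gcos_openin[OF mat_group_H_points s assms(4)] by (auto simp: openin_open)
  have "open ((\<lambda>t. t ** x) -` U)"
    using continuous_on_open_vimage[OF open_UNIV, of "\<lambda>t. t ** x"] continuous_on_matrix_mult_right[of UNIV x] U(1) by auto
  moreover have "{t \<in> TT. t ** x \<in> gcos H_points s h} = TT \<inter> (\<lambda>t. t ** x) -` U"
    unfolding U(2) using assms(5) TT_sub H_points_mult by blast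
  ultimately show ?thesis
    using haar_sets(1)[OF tau] by (simp add: openin_open_Int)
qed

text \<open>The units are compact and open in the torus, and the countably many translates by
  \<open>PP j\<close> cover it.\<close>

lemma haar_OT:
  fixes \<tau> :: "('k::nonarch_local_field, 'n::finite) mat2n measure"
  assumes tau: "haar_measure TT \<tau>"
  shows "OT \<in> sets \<tau>" "emeasure \<tau> OT < \<infinity>" "emeasure \<tau> OT \<noteq> 0"
proof -
  obtain U where U: "open U" "(DD :: ('k, 'n) mat2n set) = H_points \<inter> U"
    using openin_DD by (auto simp: openin_open)
  have OTU: "(OT :: ('k, 'n) mat2n set) = TT \<inter> U"
    unfolding OT_eq U(2) using TT_sub by blast
  show meas: "OT \<in> sets \<tau>"
    unfolding OTU using haar_sets(1)[OF tau] U(1) by (simp add: openin_open_Int)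
  show "emeasure \<tau> OT < \<infinity>"
    using tau compact_OT OT_sub unfolding haar_measure_def by blast
  have conv: "(\<lambda>x. PP j ** x) ` OT \<in> sets \<tau>" for j
  proof -
    have "open ((\<lambda>x. PP (- j) ** x) -` U)"
      using continuous_on_open_vimage[OF open_UNIV, of "\<lambda>x. PP (- j) ** x"] continuous_on_matrix_mult_left[of UNIV "PP (- j)"] U(1) by auto
    moreover have "(\<lambda>x. PP j ** x) ` OT = TT \<inter> (\<lambda>x. PP (- j) ** x) -` U"
    proof -
      have inv: "PP (- j) ** (PP j ** x) = x" "PP j ** (PP (- j) ** x) = x" for x :: "('k, 'n) mat2n"
        unfolding matrix_mul_assoc PP_def block_diag_mult
        using mpowi_uminus_mult[of "cyc uniformizer :: 'k ^ 'n ^ 'n" j]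
          mpowi_uminus_mult[of "cyc uniformizer :: 'k ^ 'n ^ 'n" "- j"]
        by (simp_all add: block_diag_one)
      show ?thesis
        unfolding OTU
      proof (intro equalityI subsetI)
        fix x :: "('k, 'n) mat2n"
        assume "x \<in> TT \<inter> (\<lambda>x. PP (- j) ** x) -` U"
        moreover from this have "PP (- j) ** x \<in> TT"
          by (intro mat_groupD(2)[OF mat_group_TT PP_TT]) blast
        ultimately have "PP (- j) ** x \<in> TT \<inter> U"
          by blast
        then show "x \<in> (\<lambda>x. PP j ** x) ` (TT \<inter> U)"
          using inv(2)[of x] by (metis image_eqI)
      next
        fix x :: "('k, 'n) mat2n"
        assume "x \<in> (\<lambda>x. PP j ** x) ` (TT \<inter> U)"
        then obtain z where z: "z \<in> TT" "z \<in> U" "x = PP j ** z"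
          by blast
        have "x \<in> TT"
          unfolding z(3) by (rule mat_groupD(2)[OF mat_group_TT PP_TT z(1)])
        then show "x \<in> TT \<inter> (\<lambda>x. PP (- j) ** x) -` U"
          using z(2) inv(1)[of z] z(3) by simp
      qed
    qed
    ultimately show ?thesis
      using haar_sets(1)[OF tau] by (simp add: openin_open_Int)
  qed
  show "emeasure \<tau> OT \<noteq> 0"
  proof (rule haar_positive[OF tau, of UNIV "\<lambda>j::int. (\<lambda>x. PP j ** x) ` OT"])
    show "(TT :: ('k, 'n) mat2n set) \<subseteq> (\<Union>j. (\<lambda>x. PP j ** x) ` OT)"
    proof
      fix t :: "('k, 'n) mat2n"
      assume "t \<in> TT"
      then obtain j u where "t = PP j ** u" "u \<in> OT"
        by (rule TT_decompose)
      then show "t \<in> (\<Union>j. (\<lambda>x. PP j ** x) ` OT)"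
        by blast
    qed
    show "emeasure \<tau> ((\<lambda>x. PP j ** x) ` OT) = emeasure \<tau> OT" for j
      using haar_translate[OF tau PP_TT meas] .
  qed (auto simp: conv)
qed

section \<open>The quotient measure\<close>

abbreviation Rc :: "('k::nonarch_local_field, 'n::finite) mat2n \<Rightarrow> ('k, 'n) mat2n set" where
  "Rc x \<equiv> TT #>\<^bsub>H_group\<^esub> x"

lemma Rc_eq: "Rc x = (\<lambda>t. t ** x) ` TT"
  by (auto simp: r_coset_def H_group_def GL_def)

lemma Rc_eq_iff:
  fixes x z :: "('k::nonarch_local_field, 'n::finite) mat2n"
  assumes "x \<in> H_points"
  shows "Rc x = Rc z \<longleftrightarrow> (\<exists>t\<in>TT. t ** x = z)"
proof
  assume "Rc x = Rc z"
  moreover have "z \<in> Rc z"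
    unfolding Rc_eq using mat_groupD(1)[OF mat_group_TT] by (intro image_eqI[of _ _ "mat 1"]) auto
  ultimately have "z \<in> (\<lambda>t. t ** x) ` TT"
    unfolding Rc_eq by simp
  then show "\<exists>t\<in>TT. t ** x = z"
    by auto
next
  assume "\<exists>t\<in>TT. t ** x = z"
  then obtain t where t: "t \<in> TT" "t ** x = z"
    by blast
  show "Rc x = Rc z"
    unfolding Rc_eq
  proof (intro equalityI subsetI)
    fix y
    assume "y \<in> (\<lambda>t. t ** x) ` TT"
    then obtain t' where t': "t' \<in> TT" "y = t' ** x"
      by blast
    have "y = (t' ** matrix_inv t) ** z"
      unfolding t(2)[symmetric] t'(2) using mat_groupD(3)[OF mat_group_TT t(1)] by (simp add: matrix_mul_assoc)
    then show "y \<in> (\<lambda>t. t ** z) ` TT"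
      using t' t mat_groupD[OF mat_group_TT] by blast
  next
    fix y
    assume "y \<in> (\<lambda>t. t ** z) ` TT"
    then obtain t' where t': "t' \<in> TT" "y = t' ** z"
      by blast
    have "y = (t' ** t) ** x"
      unfolding t'(2) t(2)[symmetric] by (simp add: matrix_mul_assoc)
    then show "y \<in> (\<lambda>t. t ** x) ` TT"
      using t' t mat_groupD(2)[OF mat_group_TT] by blast
  qed
qed

lemma Rc_some:
  obtains t where "t \<in> TT" "(SOME h. h \<in> Rc x) = t ** x"
proof -
  have "x \<in> Rc x"
    unfolding Rc_eq using mat_groupD(1)[OF mat_group_TT] by (intro image_eqI[of _ _ "mat 1"]) auto
  then have "(SOME h. h \<in> Rc x) \<in> Rc x"
    by (rule someI)
  then show ?thesis
    using that unfolding Rc_eq by blast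
qed

lemma topspace_coset_topology: "topspace (coset_topology TT) = Rc ` H_points"
  by (simp add: coset_topology_def topspace_quot_topology)

lemma gcos_TT_mult:
  assumes s: "0 < s" "s < 1" and "t \<in> TT" "h \<in> H_points" "x \<in> H_points"
  shows "t ** x \<in> gcos H_points s h \<longleftrightarrow> x \<in> gcos H_points s (matrix_inv t ** h)"
proof -
  have t: "t \<in> H_points" "invertible t"
    using assms(3) TT_sub H_points_invertible by blast+
  then have "gcos H_points s (matrix_inv t ** h) = (\<lambda>x. matrix_inv t ** x) ` gcos H_points s h"
    using gcos_mult_left[OF mat_group_H_points s H_points_inv assms(4)] by simp
  moreover have "x \<in> (\<lambda>x. matrix_inv t ** x) ` gcos H_points s h \<longleftrightarrow> t ** x \<in> gcos H_points s h"
  proof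
    assume "t ** x \<in> gcos H_points s h"
    then show "x \<in> (\<lambda>x. matrix_inv t ** x) ` gcos H_points s h"
      using t by (intro image_eqI[of _ _ "t ** x"]) simp_all
  qed (use t in auto)
  ultimately show ?thesis
    by simp
qed

definition Wc :: "('k::nonarch_local_field, 'n::finite) mat2n set \<Rightarrow> ('k, 'n) mat2n set set" where
  "Wc c = Rc ` c"

lemma Rc_in_Wc:
  assumes "x \<in> H_points"
  shows "Rc x \<in> Wc c \<longleftrightarrow> (\<exists>t\<in>TT. t ** x \<in> c)"
proof -
  have "Rc x \<in> Wc c \<longleftrightarrow> (\<exists>z\<in>c. Rc x = Rc z)"
    unfolding Wc_def by (auto simp: image_iff)
  also have "\<dots> \<longleftrightarrow> (\<exists>t\<in>TT. t ** x \<in> c)"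
    unfolding Rc_eq_iff[OF assms] by blast
  finally show ?thesis .
qed

lemma openin_Wc:
  fixes h :: "('k::nonarch_local_field, 'n::finite) mat2n"
  assumes s: "0 < s" "s < 1" and h: "h \<in> H_points"
  shows "openin (coset_topology TT) (Wc (gcos H_points s h))"
proof -
  have "{x \<in> H_points. Rc x \<in> Wc (gcos H_points s h)} = (\<Union>t\<in>TT. gcos H_points s (matrix_inv t ** h))"
    (is "?L = ?R")
  proof (intro equalityI subsetI)
    fix x :: "('k, 'n) mat2n"
    assume x: "x \<in> ?L"
    then have xH: "x \<in> H_points"
      by blast
    obtain t where t: "t \<in> TT" "t ** x \<in> gcos H_points s h"
      using x Rc_in_Wc[OF xH] by blast
    then have "x \<in> gcos H_points s (matrix_inv t ** h)"
      using gcos_TT_mult[OF s t(1) h xH] by simp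
    then show "x \<in> ?R"
      using t(1) by blast
  next
    fix x
    assume "x \<in> ?R"
    then obtain t where t: "t \<in> TT" "x \<in> gcos H_points s (matrix_inv t ** h)"
      by blast
    then have xH: "x \<in> H_points"
      by (simp add: gcos_def)
    then have "t ** x \<in> gcos H_points s h"
      using gcos_TT_mult[OF s t(1) h xH] t(2) by simp
    then show "x \<in> ?L"
      using Rc_in_Wc[OF xH] t(1) xH by blast
  qed
  moreover have "openin (top_of_set H_points) ?R"
  proof (rule openin_Union)
    fix S
    assume "S \<in> (\<lambda>t. gcos H_points s (matrix_inv t ** h)) ` TT"
    then obtain t where t: "t \<in> TT" "S = gcos H_points s (matrix_inv t ** h)"
      by blast
    have "matrix_inv t ** h \<in> H_points"
      using t TT_sub H_points_inv H_points_mult h by blast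
    then show "openin (top_of_set H_points) S"
      unfolding t(2) by (rule gcos_openin[OF mat_group_H_points s])
  qed
  moreover have "Wc (gcos H_points s h) \<subseteq> Rc ` H_points"
    unfolding Wc_def using gcos_subset[OF mat_group_H_points s] by blast
  ultimately show ?thesis
    unfolding coset_topology_def openin_quot_topology by simp
qed

lemma measurable_Rc:
  fixes \<mu> :: "('k::nonarch_local_field, 'n::finite) mat2n measure"
  assumes "haar_measure H_points \<mu>"
  shows "Rc \<in> measurable \<mu> (borel_of_top (coset_topology TT))"
  unfolding borel_of_top_def
proof (rule measurable_measure_of)
  show "{U. openin (coset_topology TT) U} \<subseteq> Pow (topspace (coset_topology TT))"
    by (auto dest: openin_subset)
  show "Rc \<in> space \<mu> \<rightarrow> topspace (coset_topology TT)"
    using haar_sets(2)[OF assms] by (auto simp: topspace_coset_topology)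
  fix U :: "('k, 'n) mat2n set set"
  assume "U \<in> {U. openin (coset_topology TT) U}"
  then have "openin (top_of_set H_points) {x \<in> H_points. Rc x \<in> U}"
    by (simp add: coset_topology_def openin_quot_topology)
  moreover have "{x \<in> H_points. Rc x \<in> U} = Rc -` U \<inter> space \<mu>"
    using haar_sets(2)[OF assms] by blast
  ultimately show "Rc -` U \<inter> space \<mu> \<in> sets \<mu>"
    using haar_sets(1)[OF assms] by simp
qed

context
  fixes \<mu> \<tau> :: "('k::nonarch_local_field, 'n::finite) mat2n measure"
  assumes mu: "haar_measure H_points \<mu>" and tau: "haar_measure TT \<tau>"
begin

text \<open>An explicit model of the quotient measure: each coset of the torus meets
  \<open>DD\<close> in an orbit of \<open>OT\<close>, so pushing forward the Haar measure from
  \<open>DD\<close> counts with the volume of \<open>OT\<close>, which is divided out.\<close>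

definition q0 :: "('k, 'n) mat2n set measure" where
  "q0 = scale_measure (1 / emeasure \<tau> OT) (distr (restrict_space \<mu> DD) (borel_of_top (coset_topology TT)) Rc)"

lemma sets_q0: "sets q0 = sets (borel_of_top (coset_topology TT))"
  by (simp add: q0_def)

lemma space_q0: "space q0 = Rc ` H_points"
  by (simp add: q0_def space_scale_measure space_borel_of_top topspace_coset_topology)

lemma DD_sets: "DD \<in> sets \<mu>"
  using haar_sets(1)[OF mu openin_DD] .

lemma emeasure_q0:
  assumes "W \<in> sets (borel_of_top (coset_topology TT))"
  shows "emeasure q0 W = emeasure \<mu> {x \<in> DD. Rc x \<in> W} / emeasure \<tau> OT"
proof -
  have DDsp: "DD \<inter> space \<mu> = DD"
    using haar_sets(2)[OF mu] DD_sub by blast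
  have "emeasure (distr (restrict_space \<mu> DD) (borel_of_top (coset_topology TT)) Rc) W
      = emeasure (restrict_space \<mu> DD) (Rc -` W \<inter> space (restrict_space \<mu> DD))"
    using assms measurable_restrict_space1[OF measurable_Rc[OF mu]] by (intro emeasure_distr) auto
  also have "Rc -` W \<inter> space (restrict_space \<mu> DD) = {x \<in> DD. Rc x \<in> W}"
    using DDsp by (auto simp: space_restrict_space)
  also have "emeasure (restrict_space \<mu> DD) {x \<in> DD. Rc x \<in> W} = emeasure \<mu> {x \<in> DD. Rc x \<in> W}"
    using DDsp DD_sets by (intro emeasure_restrict_space) auto
  finally show ?thesis
    unfolding q0_def emeasure_scale_measure by (subst mult.commute) (simp add: ennreal_times_divide)
qed

text \<open>The set on the left is \<open>t1\<close> times the set on the right. Haar measures are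
  left invariant by definition, and commutativity of the torus brings \<open>t1\<close> to the
  left.\<close>

lemma Tc_translate:
  assumes s: "0 < s" "s < 1" and h: "h \<in> H_points" and x: "x \<in> H_points" and t1: "t1 \<in> TT" "t1 ** x \<in> gcos H_points s h"
  shows "emeasure \<tau> {t \<in> TT. t ** x \<in> gcos H_points s h} = emeasure \<tau> {t \<in> TT. t ** h \<in> gcos H_points s h}"
proof -
  let ?c = "gcos H_points s h" and ?T = "{t \<in> TT. t ** h \<in> gcos H_points s h}"
  note G = mat_groupD[OF mat_group_TT]
  have stab: "t ** (t1 ** x) \<in> ?c \<longleftrightarrow> t ** h \<in> ?c" if t: "t \<in> TT" for t
  proof -
    have tH: "t \<in> H_points" and xH: "t1 ** x \<in> H_points"
      using t t1 x TT_sub H_points_mult by blast+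
    have eq: "gcos H_points s (t1 ** x) = ?c"
      using t1(2) gcos_eq_iff[OF mat_group_H_points s h xH] by blast
    have "gcos H_points s (t ** (t1 ** x)) = gcos H_points s (t ** h)"
      using gcos_mult_left[OF mat_group_H_points s tH xH] gcos_mult_left[OF mat_group_H_points s tH h] eq by simp
    moreover have "t ** (t1 ** x) \<in> ?c \<longleftrightarrow> gcos H_points s (t ** (t1 ** x)) = ?c"
      using gcos_eq_iff[OF mat_group_H_points s h H_points_mult[OF tH xH]] by simp
    moreover have "t ** h \<in> ?c \<longleftrightarrow> gcos H_points s (t ** h) = ?c"
      using gcos_eq_iff[OF mat_group_H_points s h H_points_mult[OF tH h]] by simp
    ultimately show ?thesis
      by simp
  qed
  have "{t \<in> TT. t ** x \<in> ?c} = (\<lambda>t. t1 ** t) ` ?T"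
  proof (intro equalityI subsetI)
    fix t :: "('k, 'n) mat2n"
    assume t: "t \<in> {t \<in> TT. t ** x \<in> ?c}"
    let ?t = "matrix_inv t1 ** t"
    have T: "?t \<in> TT"
      using t t1 G by blast
    have "t1 ** ?t = t"
      using G(3)[OF t1(1)] by simp
    moreover have "?t ** t1 = t"
      using TT_commute[OF T t1(1)] calculation by simp
    ultimately have "?t ** (t1 ** x) \<in> ?c"
      using t by (simp add: matrix_mul_assoc)
    then show "t \<in> (\<lambda>t. t1 ** t) ` ?T"
      using stab[OF T] T \<open>t1 ** ?t = t\<close> by (intro image_eqI[of _ _ ?t]) simp_all
  next
    fix t :: "('k, 'n) mat2n"
    assume "t \<in> (\<lambda>t. t1 ** t) ` ?T"
    then obtain t' where t': "t' \<in> TT" "t' ** h \<in> ?c" "t = t1 ** t'"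
      by blast
    have "t' ** (t1 ** x) \<in> ?c"
      using stab[OF t'(1)] t'(2) by simp
    moreover have "t' ** (t1 ** x) = t ** x"
      unfolding t'(3) TT_commute[OF t1(1) t'(1)] by (simp add: matrix_mul_assoc)
    ultimately show "t \<in> {t \<in> TT. t ** x \<in> ?c}"
      using G(2)[OF t1(1) t'(1)] t'(3) by simp
  qed
  then show ?thesis
    using haar_translate[OF tau t1(1) TT_preimage_sets[OF tau s h h]] by simp
qed

text \<open>With \<open>Q\<close> the finite set of \<open>OT\<close>-translates of the coset, the
  part of \<open>DD\<close> over its image splits into the members of \<open>Q\<close>, and
  \<open>OT\<close> splits into \<open>card Q\<close> translates of the set of \<open>t\<close> that
  keep \<open>h\<close> in its coset. Both sides become the same product with
  \<open>card Q\<close>.\<close>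

lemma coset_measure_DD:
  assumes s: "0 < s" "s < 1" and h: "h \<in> DD"
  shows "emeasure \<tau> {t \<in> TT. t ** h \<in> gcos H_points s h} * emeasure \<mu> {x \<in> DD. Rc x \<in> Wc (gcos H_points s h)}
    = emeasure \<tau> OT * emeasure \<mu> (gcos H_points s (mat 1))"
proof -
  let ?c = "gcos H_points s h" and ?T = "{t \<in> TT. t ** h \<in> gcos H_points s h}"
  note G = mat_groupD[OF mat_group_TT]
  have hH: "h \<in> H_points"
    using h DD_sub by blast
  define Q where "Q = gcos H_points s ` ((\<lambda>t. t ** h) ` OT)"
  have finQ: "finite Q"
    unfolding Q_def by (rule finite_OT_gcos[OF hH s])
  have OTH: "t \<in> H_points" if "t \<in> OT" for t :: "('k, 'n) mat2n"
    using that OT_sub TT_sub by blast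
  have disj: "disjoint_family_on (\<lambda>q. q) Q"
    unfolding disjoint_family_on_def Q_def
    using gcos_disjoint[OF mat_group_H_points s] H_points_mult[OF OTH hH] by blast
  have eq1: "{x \<in> DD. Rc x \<in> Wc ?c} = (\<Union>q\<in>Q. q)"
  proof (intro equalityI subsetI)
    fix x :: "('k, 'n) mat2n"
    assume x: "x \<in> {x \<in> DD. Rc x \<in> Wc ?c}"
    have xH: "x \<in> H_points"
      using x DD_sub by blast
    then obtain t where t: "t \<in> TT" "t ** x \<in> ?c"
      using x Rc_in_Wc by blast
    have "t ** x \<in> DD"
      using gcos_DD[OF s(2) h t(2)] .
    then have "t \<in> OT"
      using TT_mult_DD t(1) x by blast
    then have "matrix_inv t \<in> OT"
    proof -
      have "matrix_inv t ** (t ** x) \<in> DD"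
        using x G(3)[OF t(1)] by simp
      then show ?thesis
        using TT_mult_DD[OF G(4)[OF t(1)] \<open>t ** x \<in> DD\<close>] by simp
    qed
    then show "x \<in> (\<Union>q\<in>Q. q)"
      unfolding Q_def using gcos_TT_mult[OF s t(1) hH xH] t(2) by blast
  next
    fix x :: "('k, 'n) mat2n"
    assume "x \<in> (\<Union>q\<in>Q. q)"
    then obtain t where t: "t \<in> OT" "x \<in> gcos H_points s (t ** h)"
      unfolding Q_def by blast
    have tT: "t \<in> TT"
      using t OT_sub by blast
    have "t ** h \<in> DD"
      using TT_mult_DD[OF tT h] t(1) by blast
    then have "x \<in> DD"
      using gcos_DD[OF s(2) _ t(2)] by blast
    moreover have "matrix_inv t ** x \<in> ?c"
      using gcos_TT_mult[OF s G(4)[OF tT] hH] t(2) \<open>x \<in> DD\<close> DD_sub G(3)[OF tT] by auto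
    ultimately show "x \<in> {x \<in> DD. Rc x \<in> Wc ?c}"
      using Rc_in_Wc G(4)[OF tT] DD_sub by blast
  qed
  have m1: "emeasure \<mu> {x \<in> DD. Rc x \<in> Wc ?c} = of_nat (card Q) * emeasure \<mu> (gcos H_points s (mat 1))"
  proof -
    have "q \<in> sets \<mu> \<and> emeasure \<mu> q = emeasure \<mu> (gcos H_points s (mat 1))" if "q \<in> Q" for q
      using that haar_gcos(1,2)[OF mu s] H_points_mult[OF OTH hH] unfolding Q_def by blast
    then have q: "\<And>q. q \<in> Q \<Longrightarrow> q \<in> sets \<mu>" "\<And>q. q \<in> Q \<Longrightarrow> emeasure \<mu> q = emeasure \<mu> (gcos H_points s (mat 1))"
      by blast+
    have "emeasure \<mu> (\<Union>q\<in>Q. q) = (\<Sum>q\<in>Q. emeasure \<mu> q)"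
      by (rule sum_emeasure[symmetric, OF _ disj finQ]) (use q(1) in blast)
    also have "\<dots> = (\<Sum>q\<in>Q. emeasure \<mu> (gcos H_points s (mat 1)))"
      by (rule sum.cong[OF refl q(2)])
    finally show ?thesis
      unfolding eq1 by simp
  qed
  have eq2: "OT = (\<Union>q\<in>Q. {t \<in> TT. t ** h \<in> q})"
  proof (intro equalityI subsetI)
    fix t :: "('k, 'n) mat2n"
    assume t: "t \<in> OT"
    then have "t ** h \<in> gcos H_points s (t ** h)"
      using gcos_self[OF mat_group_H_points s] H_points_mult[OF OTH hH] by blast
    then show "t \<in> (\<Union>q\<in>Q. {t \<in> TT. t ** h \<in> q})"
      using t OT_sub unfolding Q_def by blast
  next
    fix t :: "('k, 'n) mat2n"
    assume "t \<in> (\<Union>q\<in>Q. {t \<in> TT. t ** h \<in> q})"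
    then obtain t0 where t0: "t0 \<in> OT" "t \<in> TT" "t ** h \<in> gcos H_points s (t0 ** h)"
      unfolding Q_def by blast
    then have "t ** h \<in> DD"
      using gcos_DD[OF s(2)] TT_mult_DD[OF _ h] OT_sub by blast
    then show "t \<in> OT"
      using TT_mult_DD[OF t0(2) h] by blast
  qed
  have m2: "emeasure \<tau> OT = of_nat (card Q) * emeasure \<tau> ?T"
  proof -
    have each: "{t \<in> TT. t ** h \<in> q} \<in> sets \<tau> \<and> emeasure \<tau> {t \<in> TT. t ** h \<in> q} = emeasure \<tau> ?T" if q: "q \<in> Q" for q
    proof -
      obtain t0 where t0: "t0 \<in> OT" "q = gcos H_points s (t0 ** h)"
        using q unfolding Q_def by blast
      have t0T: "t0 \<in> TT"
        using t0 OT_sub by blast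
      have "{t \<in> TT. t ** h \<in> q} = (\<lambda>t. t0 ** t) ` ?T"
      proof (intro equalityI subsetI)
        fix t :: "('k, 'n) mat2n"
        assume t: "t \<in> {t \<in> TT. t ** h \<in> q}"
        have "matrix_inv (matrix_inv t0) ** h = t0 ** h"
          using G(3)[OF t0T] by simp
        then have "matrix_inv t0 ** (t ** h) \<in> ?c"
          using gcos_TT_mult[OF s G(4)[OF t0T] hH, of "t ** h"] t t0(2) TT_sub H_points_mult hH by auto
        then show "t \<in> (\<lambda>t. t0 ** t) ` ?T"
          using t G(2)[OF G(4)[OF t0T]] G(3)[OF t0T]
          by (intro image_eqI[of _ _ "matrix_inv t0 ** t"]) (auto simp: matrix_mul_assoc)
      next
        fix t :: "('k, 'n) mat2n"
        assume "t \<in> (\<lambda>t. t0 ** t) ` ?T"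
        then obtain t' where t': "t' \<in> TT" "t' ** h \<in> ?c" "t = t0 ** t'"
          by blast
        have "t0 ** (t' ** h) \<in> (\<lambda>x. t0 ** x) ` ?c"
          using t'(2) by blast
        then have "t ** h \<in> q"
          unfolding t0(2) using gcos_mult_left[OF mat_group_H_points s OTH[OF t0(1)] hH] t'(3)
          by (simp add: matrix_mul_assoc)
        then show "t \<in> {t \<in> TT. t ** h \<in> q}"
          using t' G(2)[OF t0T] by blast
      qed
      moreover have "{t \<in> TT. t ** h \<in> q} \<in> sets \<tau>"
        unfolding t0(2) by (rule TT_preimage_sets[OF tau s H_points_mult[OF OTH[OF t0(1)] hH] hH])
      ultimately show ?thesis
        using haar_translate[OF tau t0T TT_preimage_sets[OF tau s hH hH]] by simp
    qed
    have "disjoint_family_on (\<lambda>q. {t \<in> TT. t ** h \<in> q}) Q"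
      using disj unfolding disjoint_family_on_def by blast
    note disj2 = this
    have "emeasure \<tau> (\<Union>q\<in>Q. {t \<in> TT. t ** h \<in> q}) = (\<Sum>q\<in>Q. emeasure \<tau> {t \<in> TT. t ** h \<in> q})"
      by (rule sum_emeasure[symmetric, OF _ disj2 finQ]) (use each in blast)
    also have "\<dots> = (\<Sum>q\<in>Q. emeasure \<tau> ?T)"
      by (rule sum.cong[OF refl]) (use each in blast)
    finally show ?thesis
      unfolding eq2[symmetric] by simp
  qed
  show ?thesis
    unfolding m1 m2 by (simp add: mult_ac)
qed

text \<open>Weil's formula for the indicator of one coset. A translation by a power of \<Pi> moves
  the coset into \<open>DD\<close> and changes none of the three volumes.\<close>

lemma coset_measure:
  assumes s: "0 < s" "s < 1" and h: "h \<in> H_points"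
  shows "emeasure \<tau> {t \<in> TT. t ** h \<in> gcos H_points s h} * emeasure q0 (Wc (gcos H_points s h))
    = emeasure \<mu> (gcos H_points s h)"
proof -
  note G = mat_groupD[OF mat_group_TT]
  obtain j where j: "PP j ** h \<in> DD"
    using PP_into_DD[OF h] by blast
  let ?P = "PP j :: ('k, 'n) mat2n" and ?h = "PP j ** h"
  have P: "?P \<in> TT" "?P \<in> H_points" "invertible ?P"
    using PP_TT TT_sub G(3) by blast+
  have hH: "?h \<in> H_points"
    using j DD_sub by blast
  have c: "gcos H_points s ?h = (\<lambda>x. ?P ** x) ` gcos H_points s h"
    using gcos_mult_left[OF mat_group_H_points s P(2) h] by simp
  have W: "Wc (gcos H_points s ?h) = Wc (gcos H_points s h)"
  proof -
    have "Rc (?P ** x) = Rc x" if "x \<in> gcos H_points s h" for x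
      using Rc_eq_iff[of x "?P ** x"] that P(1) by (auto simp: gcos_def)
    then show ?thesis
      unfolding Wc_def c image_image by simp
  qed
  have T: "{t \<in> TT. t ** ?h \<in> gcos H_points s ?h} = {t \<in> TT. t ** h \<in> gcos H_points s h}"
  proof -
    have "t ** ?h \<in> gcos H_points s ?h \<longleftrightarrow> t ** h \<in> gcos H_points s h" if t: "t \<in> TT" for t
    proof -
      have "t ** ?h = ?P ** (t ** h)"
        using TT_commute[OF t P(1)] by (simp add: matrix_mul_assoc)
      then have "t ** ?h \<in> gcos H_points s ?h \<longleftrightarrow> ?P ** (t ** h) \<in> (\<lambda>x. ?P ** x) ` gcos H_points s h"
        unfolding c by simp
      also have "\<dots> \<longleftrightarrow> t ** h \<in> gcos H_points s h"
        using mat_cancel_left(1)[OF P(3)] by (metis (no_types, lifting) image_iff)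
      finally show ?thesis .
    qed
    then show ?thesis
      by blast
  qed
  have "emeasure \<tau> {t \<in> TT. t ** h \<in> gcos H_points s h} * emeasure q0 (Wc (gcos H_points s h))
    = (emeasure \<tau> OT * emeasure \<mu> (gcos H_points s (mat 1))) / emeasure \<tau> OT"
    using coset_measure_DD[OF s j] emeasure_q0[OF sets_borel_of_top[OF openin_Wc[OF s h]]]
    unfolding T W by (simp add: ennreal_times_divide)
  also have "\<dots> = emeasure \<mu> (gcos H_points s (mat 1))"
    using haar_OT[OF tau] by (subst mult.commute, subst ennreal_mult_divide_eq) auto
  finally show ?thesis
    using haar_gcos(2)[OF mu s h] by simp
qed

text \<open>The two factors have a product that is neither 0 nor infinite, so neither factor is
  infinite.\<close>

lemma q0_Wc_finite:
  assumes s: "0 < s" "s < 1" and h: "h \<in> H_points"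
  shows "emeasure q0 (Wc (gcos H_points s h)) < \<infinity>"
    "emeasure \<tau> {t \<in> TT. t ** h \<in> gcos H_points s h} < \<infinity>"
proof -
  have fin: "emeasure \<mu> (gcos H_points s h) < \<infinity>" "emeasure \<mu> (gcos H_points s h) \<noteq> 0"
    unfolding haar_gcos(2)[OF mu s h] by (rule haar_gcos(3)[OF mu s], rule haar_gcos(4)[OF mu s])
  have "emeasure \<tau> {t \<in> TT. t ** h \<in> gcos H_points s h} \<noteq> 0" "emeasure q0 (Wc (gcos H_points s h)) \<noteq> 0"
    using coset_measure[OF s h] fin(2) by auto
  moreover have "emeasure \<tau> {t \<in> TT. t ** h \<in> gcos H_points s h} * emeasure q0 (Wc (gcos H_points s h)) \<noteq> \<infinity>"
    using coset_measure[OF s h] fin(1) by simp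
  ultimately have "emeasure \<tau> {t \<in> TT. t ** h \<in> gcos H_points s h} \<noteq> \<infinity>" "emeasure q0 (Wc (gcos H_points s h)) \<noteq> \<infinity>"
    unfolding infinity_ennreal_def ennreal_mult_eq_top_iff by blast+
  then show "emeasure q0 (Wc (gcos H_points s h)) < \<infinity>"
    "emeasure \<tau> {t \<in> TT. t ** h \<in> gcos H_points s h} < \<infinity>"
    by (simp_all add: less_top[symmetric])
qed

text \<open>The inner integral of Weil's formula for a coset indicator: its value depends only on
  whether the torus orbit of \<open>z\<close> meets the coset.\<close>

lemma tau_indicator:
  assumes s: "0 < s" "s < 1" and h: "h \<in> H_points" and z: "z \<in> H_points"
  shows "integrable \<tau> (\<lambda>t. indicator (gcos H_points s h) (t ** z) :: real)"
    "(\<integral>t. indicator (gcos H_points s h) (t ** z) \<partial>\<tau>)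
      = measure \<tau> {t \<in> TT. t ** h \<in> gcos H_points s h} * indicator (Wc (gcos H_points s h)) (Rc z)"
proof -
  let ?c = "gcos H_points s h" and ?A = "{t \<in> TT. t ** z \<in> gcos H_points s h}"
  have sp: "space \<tau> = TT"
    using haar_sets(2)[OF tau] .
  have A: "?A \<in> sets \<tau>"
    by (rule TT_preimage_sets[OF tau s h z])
  have em: "emeasure \<tau> ?A = (if Rc z \<in> Wc ?c then emeasure \<tau> {t \<in> TT. t ** h \<in> ?c} else 0)"
  proof (cases "Rc z \<in> Wc ?c")
    case True
    then show ?thesis
      using Rc_in_Wc[OF z] Tc_translate[OF s h z] by auto
  next
    case False
    then have E: "?A = {}"
      using Rc_in_Wc[OF z] by blast
    show ?thesis
      unfolding E using False by simp
  qed
  have ind: "indicator ?c (t ** z) = (indicator ?A t :: real)" if "t \<in> space \<tau>" for t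
    using that sp by (auto simp: indicator_def)
  have "emeasure \<tau> ?A < \<infinity>"
    unfolding em using q0_Wc_finite(2)[OF s h] by simp
  then have "integrable \<tau> (indicator ?A :: _ \<Rightarrow> real)"
    using A by (intro integrable_real_indicator) auto
  then show "integrable \<tau> (\<lambda>t. indicator ?c (t ** z) :: real)"
    by (rule Bochner_Integration.integrable_cong[THEN iffD2, OF refl ind, rotated])
  have "(\<integral>t. indicator ?c (t ** z) \<partial>\<tau>) = (\<integral>t. indicator ?A t \<partial>\<tau> :: real)"
    using ind by (intro Bochner_Integration.integral_cong) auto
  also have "\<dots> = measure \<tau> (?A \<inter> space \<tau>)"
    by simp
  also have "?A \<inter> space \<tau> = ?A"
    using sp by blast
  also have "measure \<tau> ?A = measure \<tau> {t \<in> TT. t ** h \<in> ?c} * indicator (Wc ?c) (Rc z)"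
    using em by (auto simp: measure_def indicator_def)
  finally show "(\<integral>t. indicator ?c (t ** z) \<partial>\<tau>) = measure \<tau> {t \<in> TT. t ** h \<in> ?c} * indicator (Wc ?c) (Rc z)" .
qed

lemma coset_measure_real:
  assumes s: "0 < s" "s < 1" and h: "h \<in> H_points"
  shows "measure \<tau> {t \<in> TT. t ** h \<in> gcos H_points s h} * measure q0 (Wc (gcos H_points s h)) = measure \<mu> (gcos H_points s h)"
  using arg_cong[OF coset_measure[OF s h], of enn2real] by (simp add: measure_def enn2real_mult)

end

lemma finite_gcos_compact:
  fixes C :: "('k::nonarch_local_field, 'n::finite) mat2n set"
  assumes s: "0 < s" "s < 1" and C: "compact C" "C \<subseteq> H_points"
  shows "finite (gcos H_points s ` C)"
proof -
  have "\<forall>x\<in>C. \<exists>U. open U \<and> gcos H_points s x = H_points \<inter> U"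
    using gcos_openin[OF mat_group_H_points s] C(2) by (auto simp: openin_open)
  then obtain U where U: "\<And>x. x \<in> C \<Longrightarrow> open (U x)" "\<And>x. x \<in> C \<Longrightarrow> gcos H_points s x = H_points \<inter> U x"
    by metis
  have "C \<subseteq> (\<Union>x\<in>C. U x)"
    using U(2) gcos_self[OF mat_group_H_points s] C(2) by blast
  then obtain F where F: "F \<subseteq> C" "finite F" "C \<subseteq> (\<Union>x\<in>F. U x)"
    using compactE_image[OF C(1), of C U] U(1) by metis
  have "gcos H_points s ` C \<subseteq> gcos H_points s ` F"
  proof
    fix c
    assume "c \<in> gcos H_points s ` C"
    then obtain x where x: "x \<in> C" "c = gcos H_points s x"
      by blast
    obtain y where y: "y \<in> F" "x \<in> U y"
      using F(3) x(1) by blast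
    then have "x \<in> gcos H_points s y"
      using U(2)[of y] F(1) x(1) C(2) by blast
    then have "c = gcos H_points s y"
      unfolding x(2) using gcos_eq_iff[OF mat_group_H_points s] x(1) y(1) F(1) C(2) by blast
    then show "c \<in> gcos H_points s ` F"
      using y(1) by blast
  qed
  then show ?thesis
    using F(2) finite_surj by blast
qed

lemma gcos_mono: "s \<le> s' \<Longrightarrow> gcos G s h \<subseteq> gcos G s' h"
  by (auto simp: gcos_def intro: mbound_mono)

lemma gcos_some:
  assumes "0 < s" "s < 1" "x \<in> H_points"
  shows "(SOME y. y \<in> gcos H_points s x) \<in> gcos H_points s x"
  using gcos_self[OF mat_group_H_points assms] by (rule someI)

lemma gcos_tendsto:
  fixes x :: "('k::nonarch_local_field, 'n::finite) mat2n"
  assumes x: "x \<in> H_points" and s: "\<And>m. s m > 0" "s \<longlonglongrightarrow> 0" and y: "\<And>m. y m \<in> gcos H_points (s m) x"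
  shows "y \<longlonglongrightarrow> x"
proof (rule topological_tendstoI)
  fix U
  assume "open U" "x \<in> U"
  then obtain e where e: "0 < e" "e < 1" "\<And>B. mbound e (B - x) \<Longrightarrow> B \<in> U"
    using mbound_nhd by blast
  obtain b where b: "b \<ge> 1" "mbound b x"
    using mbound_exists by blast
  have inv: "invertible x"
    using x H_points_invertible by blast
  have "eventually (\<lambda>m. s m < e / b) sequentially"
    using s(2) e b by (intro order_tendstoD) auto
  then show "eventually (\<lambda>m. y m \<in> U) sequentially"
  proof eventually_elim
    case (elim m)
    have "mbound (b * s m) (x ** (matrix_inv x ** y m - mat 1))"
      using y[of m] b(2) by (intro mbound_mult) (auto simp: gcos_def)
    then have "mbound (b * s m) (y m - x)"
      using inv by (simp add: matrix_diff_ldistrib)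
    moreover have "b * s m \<le> e"
      using elim b by (simp add: pos_less_divide_eq mult.commute less_imp_le)
    ultimately show ?case
      using e(3) mbound_mono by blast
  qed
qed

context
  fixes \<mu> \<tau> :: "('k::nonarch_local_field, 'n::finite) mat2n measure"
  assumes mu: "haar_measure H_points \<mu>" and tau: "haar_measure TT \<tau>"
begin

text \<open>Linearity from single cosets. The measurability statements are the input of dominated
  convergence in \<open>weil_q0\<close>.\<close>

lemma weil_simple:
  fixes a :: "('k, 'n) mat2n set \<Rightarrow> complex"
  assumes s: "0 < s" "s < 1" and F: "finite F" "F \<subseteq> gcos H_points s ` H_points"
    and phi: "\<And>z. z \<in> H_points \<Longrightarrow> \<phi> z = (\<Sum>c\<in>F. a c * complex_of_real (indicator c z))"
  shows "(\<integral>h. \<phi> h \<partial>\<mu>) = (\<integral>R. (\<integral>t. \<phi> (t ** (SOME h. h \<in> R)) \<partial>\<tau>) \<partial>(q0 \<mu> \<tau>))"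
    and "\<phi> \<in> borel_measurable \<mu>"
    and "\<And>z. z \<in> H_points \<Longrightarrow> (\<lambda>t. \<phi> (t ** z)) \<in> borel_measurable \<tau>"
    and "(\<lambda>R. \<integral>t. \<phi> (t ** (SOME h. h \<in> R)) \<partial>\<tau>) \<in> borel_measurable (q0 \<mu> \<tau>)"
proof -
  have "\<forall>c\<in>F. \<exists>h. h \<in> H_points \<and> gcos H_points s h = c"
    using F(2) by blast
  from bchoice[OF this] obtain r where r: "\<And>c. c \<in> F \<Longrightarrow> r c \<in> H_points" "\<And>c. c \<in> F \<Longrightarrow> gcos H_points s (r c) = c"
    by blast
  define w where "w c = measure \<tau> {t \<in> TT. t ** r c \<in> c}" for c
  have spm: "space \<mu> = H_points" and spt: "space \<tau> = TT"
    using haar_sets(2)[OF mu] haar_sets(2)[OF tau] by auto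
  have cs: "c \<in> sets \<mu>" "emeasure \<mu> c < \<infinity>" if "c \<in> F" for c
    using haar_gcos(1)[OF mu s r(1)[OF that]] haar_gcos(2)[OF mu s r(1)[OF that]] haar_gcos(3)[OF mu s] r(2)[OF that] by auto
  have Ws: "Wc c \<in> sets (q0 \<mu> \<tau>)" "emeasure (q0 \<mu> \<tau>) (Wc c) < \<infinity>" if "c \<in> F" for c
    using sets_borel_of_top[OF openin_Wc[OF s r(1)[OF that]]] q0_Wc_finite(1)[OF mu tau s r(1)[OF that]] r(2)[OF that]
    by (auto simp: sets_q0[OF mu tau])
  have wW: "w c * measure (q0 \<mu> \<tau>) (Wc c) = measure \<mu> c" if "c \<in> F" for c
    using coset_measure_real[OF mu tau s r(1)[OF that]] r(2)[OF that] by (simp add: w_def)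
  have ti: "integrable \<tau> (\<lambda>t. indicator c (t ** z) :: real)"
    "(\<integral>t. indicator c (t ** z) \<partial>\<tau>) = w c * indicator (Wc c) (Rc z)" if "c \<in> F" "z \<in> H_points" for c z
    using tau_indicator[OF mu tau s r(1)[OF that(1)] that(2)] r(2)[OF that(1)] by (simp_all add: w_def)
  have inner: "(\<integral>t. \<phi> (t ** z) \<partial>\<tau>) = (\<Sum>c\<in>F. a c * complex_of_real (w c * indicator (Wc c) (Rc z)))"
    and innerm: "(\<lambda>t. \<phi> (t ** z)) \<in> borel_measurable \<tau>" if z: "z \<in> H_points" for z
  proof -
    have eq: "\<phi> (t ** z) = (\<Sum>c\<in>F. a c * complex_of_real (indicator c (t ** z)))" if "t \<in> space \<tau>" for t
      using that z TT_sub H_points_mult unfolding spt by (intro phi) blast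
    have int: "integrable \<tau> (\<lambda>t. a c * complex_of_real (indicator c (t ** z)))" if "c \<in> F" for c
      using ti(1)[OF that z] by (intro integrable_mult_right integrable_of_real)
    have "(\<integral>t. \<phi> (t ** z) \<partial>\<tau>) = (\<integral>t. (\<Sum>c\<in>F. a c * complex_of_real (indicator c (t ** z))) \<partial>\<tau>)"
      using eq by (intro Bochner_Integration.integral_cong) auto
    also have "\<dots> = (\<Sum>c\<in>F. a c * complex_of_real (\<integral>t. indicator c (t ** z) \<partial>\<tau>))"
      using int by (simp add: Bochner_Integration.integral_sum integral_complex_of_real)
    also have "\<dots> = (\<Sum>c\<in>F. a c * complex_of_real (w c * indicator (Wc c) (Rc z)))"
      by (intro sum.cong refl) (simp only: ti(2)[OF _ z])
    finally show "(\<integral>t. \<phi> (t ** z) \<partial>\<tau>) = (\<Sum>c\<in>F. a c * complex_of_real (w c * indicator (Wc c) (Rc z)))" .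
    have "(\<lambda>t. \<Sum>c\<in>F. a c * complex_of_real (indicator c (t ** z))) \<in> borel_measurable \<tau>"
      using int by (intro borel_measurable_sum) (auto simp: integrable_iff_bounded)
    then show "(\<lambda>t. \<phi> (t ** z)) \<in> borel_measurable \<tau>"
      using eq by (simp cong: measurable_cong)
  qed
  show "\<And>z. z \<in> H_points \<Longrightarrow> (\<lambda>t. \<phi> (t ** z)) \<in> borel_measurable \<tau>"
    by (rule innerm)
  have innerR: "(\<integral>t. \<phi> (t ** (SOME h. h \<in> R)) \<partial>\<tau>) = (\<Sum>c\<in>F. a c * complex_of_real (w c * indicator (Wc c) R))"
    if R: "R \<in> space (q0 \<mu> \<tau>)" for R
  proof -
    obtain x where x: "x \<in> H_points" "R = Rc x"
      using R unfolding space_q0[OF mu tau] by blast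
    obtain t where t: "t \<in> TT" "(SOME h. h \<in> Rc x) = t ** x"
      by (rule Rc_some)
    have tx: "t ** x \<in> H_points"
      using t(1) x(1) TT_sub H_points_mult by blast
    have "Rc (t ** x) = Rc x"
      using Rc_eq_iff[OF x(1), of "t ** x"] t(1) by auto
    then show ?thesis
      using inner[OF tx] unfolding x(2) t(2) by simp
  qed
  have intq: "integrable (q0 \<mu> \<tau>) (\<lambda>R. a c * complex_of_real (w c * indicator (Wc c) R))" if "c \<in> F" for c
    using Ws[OF that] by (intro integrable_mult_right integrable_of_real integrable_mult_right integrable_real_indicator) auto
  have "(\<integral>R. (\<integral>t. \<phi> (t ** (SOME h. h \<in> R)) \<partial>\<tau>) \<partial>(q0 \<mu> \<tau>))
      = (\<integral>R. (\<Sum>c\<in>F. a c * complex_of_real (w c * indicator (Wc c) R)) \<partial>(q0 \<mu> \<tau>))"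
    using innerR by (intro Bochner_Integration.integral_cong) auto
  also have "\<dots> = (\<Sum>c\<in>F. (\<integral>R. a c * complex_of_real (w c * indicator (Wc c) R) \<partial>(q0 \<mu> \<tau>)))"
    using intq by (rule Bochner_Integration.integral_sum)
  also have "\<dots> = (\<Sum>c\<in>F. a c * complex_of_real (measure \<mu> c))"
  proof (intro sum.cong refl)
    fix c
    assume c: "c \<in> F"
    have "(\<integral>R. w c * indicator (Wc c) R \<partial>(q0 \<mu> \<tau>)) = w c * measure (q0 \<mu> \<tau>) (Wc c)"
    proof -
      have "Wc c \<subseteq> space (q0 \<mu> \<tau>)"
        using Ws(1)[OF c] by (rule sets.sets_into_space)
      then show ?thesis
        by (simp add: Int_absorb2)
    qed
    then have "(\<integral>R. complex_of_real (w c * indicator (Wc c) R) \<partial>(q0 \<mu> \<tau>)) = complex_of_real (measure \<mu> c)"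
      unfolding integral_complex_of_real using wW[OF c] by simp
    then show "(\<integral>R. a c * complex_of_real (w c * indicator (Wc c) R) \<partial>(q0 \<mu> \<tau>)) = a c * complex_of_real (measure \<mu> c)"
      by (simp only: integral_mult_right_zero)
  qed
  finally have rhs: "(\<integral>R. (\<integral>t. \<phi> (t ** (SOME h. h \<in> R)) \<partial>\<tau>) \<partial>(q0 \<mu> \<tau>)) = (\<Sum>c\<in>F. a c * complex_of_real (measure \<mu> c))" .
  have intm: "integrable \<mu> (\<lambda>z. a c * complex_of_real (indicator c z))" if "c \<in> F" for c
    using cs[OF that] by (intro integrable_mult_right integrable_of_real integrable_real_indicator) auto
  have phi': "\<phi> z = (\<Sum>c\<in>F. a c * complex_of_real (indicator c z))" if "z \<in> space \<mu>" for z
    using that phi spm by simp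
  have "(\<integral>h. \<phi> h \<partial>\<mu>) = (\<integral>z. (\<Sum>c\<in>F. a c * complex_of_real (indicator c z)) \<partial>\<mu>)"
    using phi' by (intro Bochner_Integration.integral_cong) auto
  also have "\<dots> = (\<Sum>c\<in>F. (\<integral>z. a c * complex_of_real (indicator c z) \<partial>\<mu>))"
    using intm by (rule Bochner_Integration.integral_sum)
  also have "\<dots> = (\<Sum>c\<in>F. a c * complex_of_real (measure \<mu> c))"
  proof (intro sum.cong refl)
    fix c
    assume c: "c \<in> F"
    have "c \<subseteq> space \<mu>"
      using cs(1)[OF c] by (rule sets.sets_into_space)
    then show "(\<integral>z. a c * complex_of_real (indicator c z) \<partial>\<mu>) = a c * complex_of_real (measure \<mu> c)"
      by (simp add: integral_complex_of_real Int_absorb2)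
  qed
  finally show "(\<integral>h. \<phi> h \<partial>\<mu>) = (\<integral>R. (\<integral>t. \<phi> (t ** (SOME h. h \<in> R)) \<partial>\<tau>) \<partial>(q0 \<mu> \<tau>))"
    using rhs by simp
  have "(\<lambda>z. \<Sum>c\<in>F. a c * complex_of_real (indicator c z)) \<in> borel_measurable \<mu>"
    using intm by (intro borel_measurable_sum) (auto simp: integrable_iff_bounded)
  then show "\<phi> \<in> borel_measurable \<mu>"
    using phi' by (simp cong: measurable_cong)
  have "(\<lambda>R. \<Sum>c\<in>F. a c * complex_of_real (w c * indicator (Wc c) R)) \<in> borel_measurable (q0 \<mu> \<tau>)"
    using intq by (intro borel_measurable_sum) (auto simp: integrable_iff_bounded)
  then show "(\<lambda>R. \<integral>t. \<phi> (t ** (SOME h. h \<in> R)) \<partial>\<tau>) \<in> borel_measurable (q0 \<mu> \<tau>)"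
    using innerR by (simp cong: measurable_cong)
qed

text \<open>The function is replaced by its value at a chosen point of each coset of level
  \<open>m\<close>; for these step functions the formula is known. They converge pointwise by
  continuity and have a common majorant, so dominated convergence applies to both outer integrals
  and to the inner one.\<close>

lemma weil_q0:
  fixes \<phi> :: "('k, 'n) mat2n \<Rightarrow> complex"
  assumes cont: "continuous_on H_points \<phi>" and C: "compact C" "C \<subseteq> H_points" "\<And>h. h \<in> H_points - C \<Longrightarrow> \<phi> h = 0"
  shows "(\<integral>h. \<phi> h \<partial>\<mu>) = (\<integral>R. (\<integral>t. \<phi> (t ** (SOME h. h \<in> R)) \<partial>\<tau>) \<partial>(q0 \<mu> \<tau>))"
proof -
  \<comment> \<open>The exponent starts at 1 so that every level is a genuine congruence
    subgroup.\<close>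
  define s where "s m = (1 / 2 :: real) ^ Suc m" for m :: nat
  have s: "0 < s m" "s m < 1" "s m \<le> s 0" for m
    unfolding s_def by (simp, rule power_Suc_less_one, simp, simp, rule power_decreasing, simp_all)
  have slim: "s \<longlonglongrightarrow> 0"
    unfolding s_def by (intro LIMSEQ_Suc LIMSEQ_realpow_zero) auto
  define cc where "cc m x = gcos H_points (s m) x" for m and x :: "('k, 'n) mat2n"
  define F where "F m = cc m ` C" for m
  have finF: "finite (F m)" for m
    unfolding F_def cc_def by (rule finite_gcos_compact[OF s(1,2) C(1,2)])
  have Fsub: "F m \<subseteq> gcos H_points (s m) ` H_points" for m
    unfolding F_def cc_def using C(2) by blast
  define \<phi>m where "\<phi>m m z = \<phi> (SOME y. y \<in> cc m z)" for m z
  have some: "(SOME y. y \<in> cc m z) \<in> cc m z" if "z \<in> H_points" for m z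
    unfolding cc_def by (rule gcos_some[OF s(1,2) that])
  have zero: "\<phi>m m z = 0" if z: "z \<in> H_points" "cc m z \<notin> F m" for m z
  proof -
    let ?y = "SOME y. y \<in> cc m z"
    have y: "?y \<in> cc m z" "?y \<in> H_points"
      using some[OF z(1)] by (auto simp: cc_def gcos_def)
    have "?y \<notin> C"
    proof
      assume "?y \<in> C"
      moreover have "cc m ?y = cc m z"
        using y gcos_eq_iff[OF mat_group_H_points s(1,2) z(1) y(2)] unfolding cc_def by blast
      ultimately show False
        using z(2) unfolding F_def by blast
    qed
    then show ?thesis
      unfolding \<phi>m_def using C(3) y(2) by blast
  qed
  have phim: "\<phi>m m z = (\<Sum>c\<in>F m. \<phi> (SOME y. y \<in> c) * complex_of_real (indicator c z))" if z: "z \<in> H_points" for m z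
  proof -
    have ind: "indicator c z = (if c = cc m z then 1 else 0 :: real)" if c: "c \<in> F m" for c
    proof -
      obtain x where x: "x \<in> H_points" "c = cc m x"
        using c C(2) unfolding F_def by blast
      have "z \<in> c \<longleftrightarrow> cc m z = c"
        unfolding x(2) cc_def using gcos_eq_iff[OF mat_group_H_points s(1,2) x(1) z] by blast
      then show ?thesis
        by (auto simp: indicator_def)
    qed
    have "(\<Sum>c\<in>F m. \<phi> (SOME y. y \<in> c) * complex_of_real (indicator c z))
        = (\<Sum>c\<in>F m. if c = cc m z then \<phi> (SOME y. y \<in> c) else 0)"
      by (intro sum.cong refl) (simp add: ind)
    also have "\<dots> = (if cc m z \<in> F m then \<phi>m m z else 0)"
      using finF by (simp add: \<phi>m_def)
    also have "\<dots> = \<phi>m m z"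
      using zero[OF z] by simp
    finally show ?thesis ..
  qed
  note simple = weil_simple[OF s(1,2) finF Fsub phim]
  obtain B where B: "0 \<le> B" "\<And>z. z \<in> H_points \<Longrightarrow> norm (\<phi> z) \<le> B"
  proof -
    have "bounded (\<phi> ` C)"
      using compact_continuous_image[OF continuous_on_subset[OF cont C(2)] C(1)] by (rule compact_imp_bounded)
    then obtain B where "\<forall>z\<in>C. norm (\<phi> z) \<le> B" "0 < B"
      by (auto simp: bounded_pos)
    then have "norm (\<phi> z) \<le> B" if "z \<in> H_points" for z
      using that C(3)[of z] by (cases "z \<in> C") auto
    then show ?thesis
      using that[of B] \<open>0 < B\<close> by simp
  qed
  \<comment> \<open>One majorant for all levels: a nonzero value at \<open>z\<close> forces its
    coset of level \<open>m\<close> to meet \<open>C\<close>, and that coset lies in one of level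
    0.\<close>
  define D where "D z = (\<Sum>c\<in>F 0. B * indicator c z)" for z :: "('k, 'n) mat2n"
  have bound: "norm (\<phi>m m z) \<le> D z" if z: "z \<in> H_points" for m z
  proof (cases "cc m z \<in> F m")
    case True
    then obtain x where x: "x \<in> C" "cc m z = cc m x"
      unfolding F_def by blast
    have "z \<in> cc m z"
      unfolding cc_def by (rule gcos_self[OF mat_group_H_points s(1,2) z])
    then have "z \<in> cc m x"
      using x(2) by simp
    then have "z \<in> cc 0 x"
      unfolding cc_def using gcos_mono[OF s(3)] by blast
    then have "B = B * indicator (cc 0 x) z"
      by simp
    also have "\<dots> \<le> D z"
      unfolding D_def using finF[of 0] B(1) x(1) by (intro member_le_sum) (auto simp: F_def)
    finally have "B \<le> D z" .
    moreover have "norm (\<phi>m m z) \<le> B"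
      unfolding \<phi>m_def using some[OF z, of m] by (intro B(2)) (auto simp: cc_def gcos_def)
    ultimately show ?thesis
      by simp
  next
    case False
    then show ?thesis
      using zero[OF z False] B(1) by (simp add: D_def sum_nonneg)
  qed
  have lim: "(\<lambda>m. \<phi>m m z) \<longlonglongrightarrow> \<phi> z" if z: "z \<in> H_points" for z
  proof -
    have "(\<lambda>m. SOME y. y \<in> cc m z) \<longlonglongrightarrow> z"
      by (rule gcos_tendsto[OF z s(1) slim]) (use some[OF z] in \<open>simp add: cc_def\<close>)
    then show ?thesis
      unfolding \<phi>m_def using cont z some[OF z] unfolding continuous_on_sequentially comp_def
      by (auto simp: cc_def gcos_def)
  qed
  have spm: "space \<mu> = H_points" and spt: "space \<tau> = TT"
    using haar_sets(2)[OF mu] haar_sets(2)[OF tau] by auto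
  have "\<forall>c\<in>F 0. \<exists>h. h \<in> H_points \<and> gcos H_points (s 0) h = c"
    using Fsub[of 0] by blast
  from bchoice[OF this] obtain r where r: "\<And>c. c \<in> F 0 \<Longrightarrow> r c \<in> H_points" "\<And>c. c \<in> F 0 \<Longrightarrow> gcos H_points (s 0) (r c) = c"
    by blast
  have "(\<lambda>m. \<integral>h. \<phi>m m h \<partial>\<mu>) \<longlonglongrightarrow> (\<integral>h. \<phi> h \<partial>\<mu>)"
  proof (rule integral_dominated_convergence[where w = D])
    show "\<phi> \<in> borel_measurable \<mu>"
      by (rule borel_measurable_LIMSEQ_metric[where f = \<phi>m]) (auto simp: spm lim simple(2))
    show "integrable \<mu> D"
      unfolding D_def
    proof (intro Bochner_Integration.integrable_sum integrable_mult_right integrable_real_indicator)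
      fix c
      assume c: "c \<in> F 0"
      show "c \<in> sets \<mu>" "emeasure \<mu> c < \<infinity>"
        using haar_gcos(1)[OF mu s(1,2) r(1)[OF c], of 0] haar_gcos(2)[OF mu s(1,2) r(1)[OF c], of 0] haar_gcos(3)[OF mu s(1,2), of 0] r(2)[OF c]
        by simp_all
    qed
  qed (use simple(2) lim bound spm in auto)
  moreover have simple3: "(\<lambda>t. \<phi>m m (t ** z)) \<in> borel_measurable \<tau>" if "z \<in> H_points" for z m
    by (rule simple(3)) (use that in auto)
  \<comment> \<open>Besides convergence of the inner integrals, a bound uniform in \<open>m\<close>
    by a function integrable on the quotient is required.\<close>
  have J: "(\<lambda>m. \<integral>t. \<phi>m m (t ** (SOME h. h \<in> R)) \<partial>\<tau>) \<longlonglongrightarrow> (\<integral>t. \<phi> (t ** (SOME h. h \<in> R)) \<partial>\<tau>) \<and>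
      (\<forall>m. norm (\<integral>t. \<phi>m m (t ** (SOME h. h \<in> R)) \<partial>\<tau>) \<le> (\<Sum>c\<in>F 0. B * (measure \<tau> {t \<in> TT. t ** r c \<in> c} * indicator (Wc c) R)))"
    if R: "R \<in> space (q0 \<mu> \<tau>)" for R
  proof -
    obtain x where x: "x \<in> H_points" "R = Rc x"
      using R unfolding space_q0[OF mu tau] by blast
    obtain t0 where t0: "t0 \<in> TT" "(SOME h. h \<in> Rc x) = t0 ** x"
      by (rule Rc_some)
    let ?z = "t0 ** x"
    have zH: "?z \<in> H_points"
      using t0(1) x(1) TT_sub H_points_mult by blast
    have Rz: "Rc ?z = R"
      using Rc_eq_iff[OF x(1), of ?z] t0(1) x(2) by auto
    have tz: "t ** ?z \<in> H_points" if "t \<in> TT" for t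
      using that zH TT_sub H_points_mult by blast
    have ti: "integrable \<tau> (\<lambda>t. indicator c (t ** ?z) :: real)"
      "(\<integral>t. indicator c (t ** ?z) \<partial>\<tau>) = measure \<tau> {t \<in> TT. t ** r c \<in> c} * indicator (Wc c) R" if "c \<in> F 0" for c
      using tau_indicator[OF mu tau s(1)[of 0] s(2)[of 0] r(1)[OF that] zH] r(2)[OF that] Rz by simp_all
    have intD: "integrable \<tau> (\<lambda>t. D (t ** ?z))"
      unfolding D_def using ti(1) by (intro Bochner_Integration.integrable_sum integrable_mult_right)
    have "(\<lambda>m. \<integral>t. \<phi>m m (t ** ?z) \<partial>\<tau>) \<longlonglongrightarrow> (\<integral>t. \<phi> (t ** ?z) \<partial>\<tau>)"
    proof (rule integral_dominated_convergence[where w = "\<lambda>t. D (t ** ?z)"])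
      show "(\<lambda>t. \<phi> (t ** ?z)) \<in> borel_measurable \<tau>"
        by (rule borel_measurable_LIMSEQ_metric[where f = "\<lambda>m t. \<phi>m m (t ** ?z)"]) (auto simp: spt lim tz simple3[OF zH])
    qed (use simple3[OF zH] intD lim bound tz spt in auto)
    moreover have "norm (\<integral>t. \<phi>m m (t ** ?z) \<partial>\<tau>) \<le> (\<Sum>c\<in>F 0. B * (measure \<tau> {t \<in> TT. t ** r c \<in> c} * indicator (Wc c) R))" for m
    proof -
      have int: "integrable \<tau> (\<lambda>t. \<phi>m m (t ** ?z))"
        by (rule Bochner_Integration.integrable_bound[OF intD simple3[OF zH]])
          (use bound tz spt in \<open>auto intro!: AE_I2 order_trans[OF _ abs_ge_self]\<close>)
      have "norm (\<integral>t. \<phi>m m (t ** ?z) \<partial>\<tau>) \<le> (\<integral>t. norm (\<phi>m m (t ** ?z)) \<partial>\<tau>)"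
        by (rule integral_norm_bound)
      also have "\<dots> \<le> (\<integral>t. D (t ** ?z) \<partial>\<tau>)"
        using int intD bound tz spt by (intro integral_mono) auto
      also have "\<dots> = (\<Sum>c\<in>F 0. B * (\<integral>t. indicator c (t ** ?z) \<partial>\<tau>))"
        unfolding D_def using ti(1) by (simp add: Bochner_Integration.integral_sum)
      also have "\<dots> = (\<Sum>c\<in>F 0. B * (measure \<tau> {t \<in> TT. t ** r c \<in> c} * indicator (Wc c) R))"
        by (intro sum.cong refl) (simp only: ti(2))
      finally show ?thesis .
    qed
    ultimately show ?thesis
      unfolding x(2) t0(2) by blast
  qed
  have "(\<lambda>m. \<integral>R. (\<integral>t. \<phi>m m (t ** (SOME h. h \<in> R)) \<partial>\<tau>) \<partial>(q0 \<mu> \<tau>)) \<longlonglongrightarrow>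
      (\<integral>R. (\<integral>t. \<phi> (t ** (SOME h. h \<in> R)) \<partial>\<tau>) \<partial>(q0 \<mu> \<tau>))"
  proof (rule integral_dominated_convergence[where w = "\<lambda>R. \<Sum>c\<in>F 0. B * (measure \<tau> {t \<in> TT. t ** r c \<in> c} * indicator (Wc c) R)"])
    show "(\<lambda>R. \<integral>t. \<phi> (t ** (SOME h. h \<in> R)) \<partial>\<tau>) \<in> borel_measurable (q0 \<mu> \<tau>)"
      by (rule borel_measurable_LIMSEQ_metric[where f = "\<lambda>m R. \<integral>t. \<phi>m m (t ** (SOME h. h \<in> R)) \<partial>\<tau>"]) (use J simple(4) in blast)+
    show "integrable (q0 \<mu> \<tau>) (\<lambda>R. \<Sum>c\<in>F 0. B * (measure \<tau> {t \<in> TT. t ** r c \<in> c} * indicator (Wc c) R))"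
    proof (intro Bochner_Integration.integrable_sum integrable_mult_right integrable_real_indicator)
      fix c
      assume c: "c \<in> F 0"
      show "Wc c \<in> sets (q0 \<mu> \<tau>)" "emeasure (q0 \<mu> \<tau>) (Wc c) < \<infinity>"
        using sets_borel_of_top[OF openin_Wc[OF s(1)[of 0] s(2)[of 0] r(1)[OF c]]] q0_Wc_finite(1)[OF mu tau s(1)[of 0] s(2)[of 0] r(1)[OF c]] r(2)[OF c]
        by (auto simp: sets_q0[OF mu tau])
    qed
  qed (use simple(4) J in auto)
  moreover have "(\<lambda>m. \<integral>R. (\<integral>t. \<phi>m m (t ** (SOME h. h \<in> R)) \<partial>\<tau>) \<partial>(q0 \<mu> \<tau>)) = (\<lambda>m. \<integral>h. \<phi>m m h \<partial>\<mu>)"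
    using simple(1) by presburger
  ultimately show ?thesis
    using LIMSEQ_unique by metis
qed

end

text \<open>\<open>quotient_measure\<close> is an arbitrary choice, so existence must be known
  before its defining property can be used. The model \<open>q0\<close> is finite on a compact set
  because finitely many open images of cosets cover it.\<close>

lemma quotient_measure_exists:
  fixes \<mu> \<tau> :: "('k::nonarch_local_field, 'n::finite) mat2n measure"
  assumes mu: "haar_measure H_points \<mu>" and tau: "haar_measure TT \<tau>"
  shows "is_quotient_measure \<mu> TT \<tau> (quotient_measure \<mu> TT \<tau>)"
proof -
  have "emeasure (q0 \<mu> \<tau>) C < \<infinity>" if C: "compactin (coset_topology TT) C" for C
  proof -
    let ?U = "(\<lambda>h. Wc (gcos H_points (1/2) h)) ` H_points"
    have "C \<subseteq> \<Union>?U"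
    proof
      fix R
      assume "R \<in> C"
      then have "R \<in> Rc ` H_points"
        using compactin_subset_topspace[OF C] topspace_coset_topology by blast
      then obtain x where x: "x \<in> H_points" "R = Rc x"
        by blast
      then have "R \<in> Wc (gcos H_points (1/2) x)"
        unfolding Wc_def using gcos_self[OF mat_group_H_points, of "1/2" x] by simp
      then show "R \<in> \<Union>?U"
        using x(1) by blast
    qed
    moreover have "\<forall>U\<in>?U. openin (coset_topology TT) U"
      using openin_Wc[of "1/2"] by auto
    ultimately obtain V where V: "finite V" "V \<subseteq> ?U" "C \<subseteq> \<Union>V"
      using compactinD[OF C, of ?U] by auto
    have VU: "U \<in> sets (q0 \<mu> \<tau>) \<and> emeasure (q0 \<mu> \<tau>) U < \<infinity>" if UV: "U \<in> V" for U
    proof -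
      obtain h where h: "h \<in> H_points" "U = Wc (gcos H_points (1/2) h)"
        using UV V(2) by blast
      have "openin (coset_topology TT) U"
        unfolding h(2) using h(1) by (intro openin_Wc) auto
      then show ?thesis
        using sets_borel_of_top q0_Wc_finite(1)[OF mu tau _ _ h(1), of "1/2"] h(2) by (simp add: sets_q0[OF mu tau])
    qed
    have "emeasure (q0 \<mu> \<tau>) C \<le> emeasure (q0 \<mu> \<tau>) (\<Union>V)"
      using V VU by (intro emeasure_mono sets.finite_Union) auto
    also have "\<dots> \<le> (\<Sum>U\<in>V. emeasure (q0 \<mu> \<tau>) U)"
    proof -
      have "V \<subseteq> sets (q0 \<mu> \<tau>)"
        using VU by blast
      then show ?thesis
        using emeasure_subadditive_finite[OF V(1), of "\<lambda>U. U" "q0 \<mu> \<tau>"] by simp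
    qed
    also have "\<dots> < \<infinity>"
      using VU V(1) by (simp add: less_top[symmetric])
    finally show ?thesis .
  qed
  then have "is_quotient_measure \<mu> TT \<tau> (q0 \<mu> \<tau>)"
    unfolding is_quotient_measure_def using sets_q0[OF mu tau] weil_q0[OF mu tau] by blast
  then show ?thesis
    unfolding quotient_measure_def by (rule someI)
qed

text \<open>Weil's formula for \<open>F\<close> cut off to \<open>DD\<close>: the \<open>t\<close>
  moving a given point into \<open>DD\<close> form a translate of \<open>OT\<close>, so the inner
  integral is \<open>F\<close> times the volume of \<open>OT\<close>, while the integral over H(F)
  is a finite sum over cosets of equal volume.\<close>

lemma orbital_formula:
  fixes \<mu> \<tau> :: "('k::nonarch_local_field, 'n::finite) mat2n measure" and F :: "('k, 'n) mat2n \<Rightarrow> complex"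
  assumes mu: "haar_measure H_points \<mu>" and tau: "haar_measure TT \<tau>" and q: "is_quotient_measure \<mu> TT \<tau> q"
    and s: "0 < s" "s < 1"
    and FT: "\<And>t h. t \<in> TT \<Longrightarrow> h \<in> H_points \<Longrightarrow> F (t ** h) = F h"
    and FK: "\<And>h x. h \<in> H_points \<Longrightarrow> x \<in> gcos H_points s h \<Longrightarrow> F x = F h"
    and fin: "finite (gcos H_points s ` {h \<in> DD. F h \<noteq> 0})"
  shows "complex_of_real (measure \<tau> OT) * (\<integral>R. F (SOME h. h \<in> R) \<partial>q)
    = complex_of_real (measure \<mu> (gcos H_points s (mat 1))) *
      (\<Sum>c\<in>gcos H_points s ` {h \<in> DD. F h \<noteq> 0}. F (SOME h. h \<in> c))"
proof -
  define \<phi> where "\<phi> h = F h * complex_of_real (indicator DD h)" for h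
  let ?S = "gcos H_points s ` {h \<in> DD. F h \<noteq> 0}"
  note HG = mat_group_H_points
  have phiK: "\<phi> x = \<phi> h" if h: "h \<in> H_points" and x: "x \<in> gcos H_points s h" for h x
  proof -
    have xH: "x \<in> H_points"
      using x by (simp add: gcos_def)
    have "h \<in> gcos H_points s x"
      by (rule gcos_sym[OF HG s h x])
    then have "x \<in> DD \<longleftrightarrow> h \<in> DD"
      using gcos_DD[OF s(2)] x by blast
    then show ?thesis
      unfolding \<phi>_def using FK[OF h x] by (simp add: indicator_def)
  qed
  have cont: "continuous_on H_points \<phi>"
    unfolding continuous_on_topological
  proof (intro ballI allI impI)
    fix x B
    assume x: "x \<in> H_points" and B: "\<phi> x \<in> B"
    obtain U where U: "open U" "gcos H_points s x = H_points \<inter> U"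
      using gcos_openin[OF HG s x] by (auto simp: openin_open)
    have "x \<in> U"
      using U(2) gcos_self[OF HG s x] by blast
    moreover have "\<forall>y\<in>H_points. y \<in> U \<longrightarrow> \<phi> y \<in> B"
      using phiK[OF x] U(2) B by auto
    ultimately show "\<exists>A. open A \<and> x \<in> A \<and> (\<forall>y\<in>H_points. y \<in> A \<longrightarrow> \<phi> y \<in> B)"
      using U(1) by blast
  qed
  have Scomp: "compact (\<Union>?S)"
    using fin DD_sub by (intro compact_Union) (auto intro!: compact_gcos_H s)
  have Ssub: "\<Union>?S \<subseteq> H_points"
    using gcos_subset[OF HG s] by blast
  have Szero: "\<forall>h\<in>H_points - \<Union>?S. \<phi> h = 0"
  proof
    fix h
    assume h: "h \<in> H_points - \<Union>?S"
    have "h \<in> gcos H_points s h"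
      using gcos_self[OF HG s] h by blast
    then have "\<not> (h \<in> DD \<and> F h \<noteq> 0)"
      using h by blast
    then show "\<phi> h = 0"
      by (auto simp: \<phi>_def)
  qed
  have "(\<integral>h. \<phi> h \<partial>\<mu>) = (\<integral>R. (\<integral>t. \<phi> (t ** (SOME h. h \<in> R)) \<partial>\<tau>) \<partial>q)"
    using q cont Scomp Ssub Szero unfolding is_quotient_measure_def by blast
  also have "\<dots> = (\<integral>R. F (SOME h. h \<in> R) * complex_of_real (measure \<tau> OT) \<partial>q)"
  proof (rule Bochner_Integration.integral_cong[OF refl])
    fix R
    assume "R \<in> space q"
    then have "R \<in> Rc ` H_points"
      using q sets_eq_imp_space_eq[of q "borel_of_top (coset_topology TT)"]
      by (simp add: is_quotient_measure_def space_borel_of_top topspace_coset_topology)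
    then obtain x where x: "x \<in> H_points" "R = Rc x"
      by blast
    obtain t0 where t0: "t0 \<in> TT" "(SOME h. h \<in> Rc x) = t0 ** x"
      by (rule Rc_some)
    let ?z = "t0 ** x"
    have zH: "?z \<in> H_points"
      using t0(1) x(1) TT_sub H_points_mult by blast
    obtain j where j: "PP j ** ?z \<in> DD"
      using PP_into_DD[OF zH] by blast
    have PT: "(PP j :: ('k, 'n) mat2n) \<in> TT"
      by simp
    note G = mat_groupD[OF mat_group_TT]
    have set_eq: "{t \<in> TT. t ** ?z \<in> DD} = (\<lambda>t. PP j ** t) ` OT"
    proof (intro equalityI subsetI)
      fix t :: "('k, 'n) mat2n"
      assume t: "t \<in> {t \<in> TT. t ** ?z \<in> DD}"
      let ?u = "matrix_inv (PP j) ** t"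
      have u: "?u \<in> TT"
        using G(2)[OF G(4)[OF PT]] t by blast
      have t_eq: "PP j ** ?u = t"
        using G(3)[OF PT] by simp
      have "?u ** (PP j ** ?z) = t ** ?z"
        unfolding matrix_mul_assoc TT_commute[OF u PT] using t_eq by (simp add: matrix_mul_assoc)
      then have "?u \<in> OT"
        using TT_mult_DD[OF u j] t by simp
      then show "t \<in> (\<lambda>t. PP j ** t) ` OT"
        using t_eq by (metis image_eqI)
    next
      fix t :: "('k, 'n) mat2n"
      assume "t \<in> (\<lambda>t. PP j ** t) ` OT"
      then obtain u where u: "u \<in> OT" "t = PP j ** u"
        by blast
      have uT: "u \<in> TT"
        using u(1) OT_sub by blast
      have "t ** ?z = u ** (PP j ** ?z)"
        unfolding u(2) TT_commute[OF PT uT] by (simp add: matrix_mul_assoc)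
      then show "t \<in> {t \<in> TT. t ** ?z \<in> DD}"
        using TT_mult_DD[OF uT j] u G(2)[OF PT uT] by simp
    qed
    have spt: "space \<tau> = TT"
      using haar_sets(2)[OF tau] .
    have meas: "measure \<tau> {t \<in> TT. t ** ?z \<in> DD} = measure \<tau> OT"
      unfolding set_eq measure_def using haar_translate[OF tau PT haar_OT(1)[OF tau]] by simp
    have "(\<integral>t. \<phi> (t ** ?z) \<partial>\<tau>) = (\<integral>t. F ?z * complex_of_real (indicator {t \<in> TT. t ** ?z \<in> DD} t) \<partial>\<tau>)"
    proof (rule Bochner_Integration.integral_cong[OF refl])
      fix t
      assume "t \<in> space \<tau>"
      then show "\<phi> (t ** ?z) = F ?z * complex_of_real (indicator {t \<in> TT. t ** ?z \<in> DD} t)"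
        unfolding \<phi>_def spt using FT[OF _ zH, of t] by (auto simp: indicator_def)
    qed
    also have "\<dots> = F ?z * complex_of_real (\<integral>t. indicator {t \<in> TT. t ** ?z \<in> DD} t \<partial>\<tau>)"
      by (simp only: integral_mult_right_zero integral_complex_of_real)
    also have "(\<integral>t. indicator {t \<in> TT. t ** ?z \<in> DD} t \<partial>\<tau>) = measure \<tau> ({t \<in> TT. t ** ?z \<in> DD} \<inter> space \<tau>)"
      by simp
    also have "{t \<in> TT. t ** ?z \<in> DD} \<inter> space \<tau> = {t \<in> TT. t ** ?z \<in> DD}"
      using spt by blast
    finally show "(\<integral>t. \<phi> (t ** (SOME h. h \<in> R)) \<partial>\<tau>) = F (SOME h. h \<in> R) * complex_of_real (measure \<tau> OT)"
      unfolding x(2) t0(2) meas .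
  qed
  also have "\<dots> = complex_of_real (measure \<tau> OT) * (\<integral>R. F (SOME h. h \<in> R) \<partial>q)"
    by (simp add: mult.commute)
  finally have weil: "(\<integral>h. \<phi> h \<partial>\<mu>) = complex_of_real (measure \<tau> OT) * (\<integral>R. F (SOME h. h \<in> R) \<partial>q)" .
  have spm: "space \<mu> = H_points"
    using haar_sets(2)[OF mu] .
  have cs: "c \<in> sets \<mu> \<and> emeasure \<mu> c < \<infinity> \<and> measure \<mu> c = measure \<mu> (gcos H_points s (mat 1)) \<and> c \<subseteq> H_points" if "c \<in> ?S" for c
  proof -
    obtain h where h: "h \<in> H_points" "c = gcos H_points s h"
      using \<open>c \<in> ?S\<close> DD_sub by blast
    show ?thesis
      unfolding h(2) measure_def haar_gcos(2)[OF mu s h(1)]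
      using haar_gcos(1)[OF mu s h(1)] haar_gcos(3)[OF mu s] gcos_subset[OF HG s, of h] by blast
  qed
  have phi_sum: "\<phi> z = (\<Sum>c\<in>?S. F (SOME h. h \<in> c) * complex_of_real (indicator c z))" if z: "z \<in> H_points" for z
  proof -
    have ind: "F (SOME h. h \<in> c) * complex_of_real (indicator c z) = (if c = gcos H_points s z then \<phi> z else 0)" if c: "c \<in> ?S" for c
    proof -
      obtain h where h: "h \<in> DD" "c = gcos H_points s h" "h \<in> H_points"
        using c DD_sub by blast
      have iff: "z \<in> c \<longleftrightarrow> c = gcos H_points s z"
        unfolding h(2) using gcos_eq_iff[OF HG s h(3) z] by blast
      show ?thesis
      proof (cases "z \<in> c")
        case True
        have "z \<in> DD"
          using gcos_DD[OF s(2) h(1)] True h(2) by blast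
        moreover have "F (SOME h. h \<in> c) = F z"
        proof -
          have "(SOME h. h \<in> c) \<in> gcos H_points s z"
            using gcos_some[OF s z] True iff by simp
          then show ?thesis
            by (rule FK[OF z])
        qed
        ultimately show ?thesis
          using True iff by (simp add: \<phi>_def)
      qed (use iff in simp)
    qed
    have "(\<Sum>c\<in>?S. F (SOME h. h \<in> c) * complex_of_real (indicator c z)) = (\<Sum>c\<in>?S. if c = gcos H_points s z then \<phi> z else 0)"
      by (intro sum.cong refl ind)
    also have "\<dots> = (if gcos H_points s z \<in> ?S then \<phi> z else 0)"
      using fin by simp
    also have "\<dots> = \<phi> z"
    proof (cases "gcos H_points s z \<in> ?S")
      case False
      then have "\<not> (z \<in> DD \<and> F z \<noteq> 0)"
        by blast
      then show ?thesis
        using False by (auto simp: \<phi>_def)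
    qed simp
    finally show ?thesis ..
  qed
  have "(\<integral>h. \<phi> h \<partial>\<mu>) = (\<integral>z. (\<Sum>c\<in>?S. F (SOME h. h \<in> c) * complex_of_real (indicator c z)) \<partial>\<mu>)"
    using phi_sum spm by (intro Bochner_Integration.integral_cong) auto
  also have "\<dots> = (\<Sum>c\<in>?S. (\<integral>z. F (SOME h. h \<in> c) * complex_of_real (indicator c z) \<partial>\<mu>))"
    using cs by (intro Bochner_Integration.integral_sum integrable_mult_right integrable_of_real integrable_real_indicator) blast+
  also have "\<dots> = (\<Sum>c\<in>?S. F (SOME h. h \<in> c) * complex_of_real (measure \<mu> (gcos H_points s (mat 1))))"
  proof (intro sum.cong refl)
    fix c
    assume c: "c \<in> ?S"
    have "(\<integral>z. indicator c z \<partial>\<mu>) = measure \<mu> (c \<inter> space \<mu>)"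
      by simp
    also have "c \<inter> space \<mu> = c"
      using cs[OF c] spm by blast
    also have "measure \<mu> c = measure \<mu> (gcos H_points s (mat 1))"
      using cs[OF c] by blast
    finally show "(\<integral>z. F (SOME h. h \<in> c) * complex_of_real (indicator c z) \<partial>\<mu>)
        = F (SOME h. h \<in> c) * complex_of_real (measure \<mu> (gcos H_points s (mat 1)))"
      by (simp only: integral_mult_right_zero integral_complex_of_real)
  qed
  also have "\<dots> = complex_of_real (measure \<mu> (gcos H_points s (mat 1))) * (\<Sum>c\<in>?S. F (SOME h. h \<in> c))"
    by (simp add: sum_distrib_left mult.commute)
  finally show ?thesis
    using weil by simp
qed

section \<open>Test functions\<close>

lemma cong_sub_invertible: "s < 1 \<Longrightarrow> c \<in> cong_sub s \<Longrightarrow> invertible c"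
  using cong_sub_GLO GLO_invertible by blast

text \<open>A small change of a representative is left multiplication by an element of the
  congruence subgroup, so the preimage in the group contains a ball around each of its
  points.\<close>

lemma openin_X_nbhd:
  fixes g :: "('k::nonarch_local_field, 'n::finite) mat2n"
  assumes g: "invertible g" and m: "0 < m" "m < 1"
  shows "openin X_topology ((\<lambda>x. coset (x ** g)) ` cong_sub m)"
proof -
  let ?U = "(\<lambda>x. coset (x ** g)) ` cong_sub m"
  let ?P = "{x \<in> carrier GL. coset x \<in> ?U}"
  have "\<exists>T. openin (top_of_set (carrier GL)) T \<and> x \<in> T \<and> T \<subseteq> ?P" if x: "x \<in> ?P" for x
  proof -
    have xi: "invertible x"
      using x by simp
    obtain c where c: "c \<in> cong_sub m" "coset x = coset (c ** g)"
      using x by blast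
    have cg: "invertible (c ** g)"
      using cong_sub_invertible[OF m(2) c(1)] g by (rule invertible_mult)
    obtain h where h: "h \<in> H_points" "c ** g = x ** h"
      using c(2) coset_eq_iff[OF xi cg] by blast
    obtain b where b: "b \<ge> 1" "mbound b (matrix_inv x)"
      using mbound_exists by blast
    let ?T = "carrier GL \<inter> {y. mbound (m / b) (y - x)}"
    have "?T \<subseteq> ?P"
    proof
      fix y
      assume y: "y \<in> ?T"
      let ?d = "y ** matrix_inv x"
      have "?d - mat 1 = (y - x) ** matrix_inv x"
        using xi by (simp add: matrix_diff_rdistrib)
      moreover have "mbound (m / b * b) ((y - x) ** matrix_inv x)"
        using y b by (intro mbound_mult) auto
      ultimately have d: "?d \<in> cong_sub m"
        using b by (simp add: cong_sub_def)
      have "?d ** c ** g = ?d ** (x ** h)"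
        unfolding h(2)[symmetric] by (simp add: matrix_mul_assoc)
      also have "\<dots> = y ** h"
        using xi by (simp add: matrix_mul_assoc)
      finally have "coset y = coset (?d ** c ** g)"
        using coset_mult_H[OF h(1), of y] by simp
      then show "y \<in> ?P"
        using y cong_sub_mult[OF m(2) d c(1)] by blast
    qed
    moreover have "x \<in> ?T"
      using xi b m by simp
    moreover have "openin (top_of_set (carrier GL)) ?T"
      using b m by (intro openin_open_Int open_mbound_diff) simp
    ultimately show ?thesis
      by blast
  qed
  then have "openin (top_of_set (carrier GL)) ?P"
    by (subst openin_subopen) blast
  moreover have "?U \<subseteq> coset ` carrier GL"
    using cong_sub_invertible[OF m(2)] g by (auto intro!: imageI invertible_mult)
  ultimately show ?thesis
    unfolding X_topology_def openin_quot_topology by simp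
qed

lemma mbound_finite:
  fixes F :: "'i \<Rightarrow> 'k::nonarch_local_field ^ 'n::finite ^ 'm::finite"
  assumes "finite I"
  shows "\<exists>M\<ge>1. \<forall>i\<in>I. mbound M (F i)"
  using assms
proof (induction I)
  case empty
  then show ?case
    by auto
next
  case (insert i I)
  obtain M where M: "M \<ge> 1" "\<forall>i\<in>I. mbound M (F i)"
    using insert.IH by blast
  obtain b where b: "b \<ge> 1" "mbound b (F i)"
    using mbound_exists by blast
  have "mbound (max M b) (F j)" if "j \<in> insert i I" for j
    using that M(2) b(2) by (auto intro: mbound_mono)
  then show ?case
    using M(1) by (intro exI[of _ "max M b"]) auto
qed

text \<open>Compactness of the support replaces the local radii of constancy by a single
  \<open>s\<close>, the minimum over a finite cover by orbits of congruence subgroups. On such an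
  orbit \<open>pproj\<close> changes only by conjugation with integral matrices, which gives the
  uniform bound \<open>M\<close>.\<close>

lemma Cc_infty_X_uniform:
  fixes f :: "('k::nonarch_local_field, 'n::finite) mat2n set \<Rightarrow> complex"
  assumes f: "f \<in> Cc_infty_X"
  obtains s M where "0 < s" "s < 1" "M \<ge> 1"
    "\<And>c g. c \<in> cong_sub s \<Longrightarrow> invertible g \<Longrightarrow> f (coset (c ** g)) = f (coset g)"
    "\<And>g. invertible g \<Longrightarrow> f (coset g) \<noteq> 0 \<Longrightarrow> mbound M (pproj g)"
    "finite (f ` X_points)"
proof -
  let ?S = "{x \<in> X_points. f x \<noteq> 0}"
  let ?C = "X_topology closure_of ?S"
  let ?G = "{g :: ('k, 'n) mat2n. invertible g}"
  have top: "topspace X_topology = (X_points :: ('k, 'n) mat2n set set)"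
    by (auto simp: X_topology_def topspace_quot_topology X_points_iff)
  have C: "compactin X_topology ?C"
    and loc: "\<And>x. x \<in> X_points \<Longrightarrow> \<exists>U. openin X_topology U \<and> x \<in> U \<and> (\<forall>u\<in>U. f u = f x)"
    using f by (auto simp: Cc_infty_X_def)
  have supp: "x \<in> ?C" if "x \<in> X_points" "f x \<noteq> 0" for x
    using closure_of_subset[of ?S X_topology] that top by auto
  have "\<forall>g\<in>?G. \<exists>m. 0 < m \<and> m < 1 \<and> (\<forall>c\<in>cong_sub m. f (coset (c ** g)) = f (coset g))"
  proof
    fix g
    assume "g \<in> ?G"
    then have g: "invertible g"
      by simp
    obtain U where U: "openin X_topology U" "coset g \<in> U" "\<forall>u\<in>U. f u = f (coset g)"
      using loc[OF coset_in_X_points[OF g]] by blast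
    have "openin (top_of_set (carrier GL)) {x \<in> carrier GL. coset x \<in> U}"
      using U(1) by (simp add: X_topology_def openin_quot_topology)
    then obtain W where W: "open W" "{x \<in> carrier GL. coset x \<in> U} = carrier GL \<inter> W"
      unfolding openin_open by blast
    have "g \<in> W"
      using W(2) U(2) g by auto
    then obtain e where e: "0 < e" "e < 1" "\<And>B. mbound e (B - g) \<Longrightarrow> B \<in> W"
      using mbound_nhd[OF W(1)] by blast
    obtain b where b: "b \<ge> 1" "mbound b g"
      using mbound_exists by blast
    have eb: "0 < e / b" "e / b < 1"
      using e b by (auto simp: field_simps)
    have "f (coset (c ** g)) = f (coset g)" if c: "c \<in> cong_sub (e / b)" for c
    proof -
      have "c ** g - g = (c - mat 1) ** g"
        by (simp add: matrix_diff_rdistrib)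
      moreover have "mbound (e / b * b) ((c - mat 1) ** g)"
        using c b by (intro mbound_mult) (auto simp: cong_sub_def)
      ultimately have "c ** g \<in> W"
        using e(3)[of "c ** g"] b by simp
      moreover have "c ** g \<in> carrier GL"
        using cong_sub_invertible[OF eb(2) c] g by (simp add: invertible_mult)
      ultimately have "c ** g \<in> {x \<in> carrier GL. coset x \<in> U}"
        unfolding W(2) by (rule IntI[rotated])
      then have "coset (c ** g) \<in> U"
        by blast
      then show ?thesis
        using U(3) by blast
    qed
    then show "\<exists>m. 0 < m \<and> m < 1 \<and> (\<forall>c\<in>cong_sub m. f (coset (c ** g)) = f (coset g))"
      using eb by blast
  qed
  from bchoice[OF this] obtain m where m: "\<And>g. invertible g \<Longrightarrow> 0 < m g" "\<And>g. invertible g \<Longrightarrow> m g < 1"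
      "\<And>g c. invertible g \<Longrightarrow> c \<in> cong_sub (m g) \<Longrightarrow> f (coset (c ** g)) = f (coset g)"
    by blast
  let ?V = "\<lambda>g. (\<lambda>x. coset (x ** g)) ` cong_sub (m g)"
  have CX: "?C \<subseteq> X_points"
    using closure_of_subset_topspace[of X_topology ?S] top by simp
  have "?C \<subseteq> \<Union>(?V ` ?G)"
  proof
    fix x
    assume "x \<in> ?C"
    then obtain g where g: "invertible g" "x = coset g"
      using CX X_points_iff by blast
    have "mat 1 \<in> cong_sub (m g)"
      using m(1)[OF g(1)] by (simp add: less_imp_le)
    then have "coset (mat 1 ** g) \<in> ?V g"
      by (rule imageI)
    then show "x \<in> \<Union>(?V ` ?G)"
      using g by auto
  qed
  moreover have "openin X_topology U" if "U \<in> ?V ` ?G" for U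
    using that openin_X_nbhd m(1,2) by auto
  ultimately obtain V where V: "finite V" "V \<subseteq> ?V ` ?G" "?C \<subseteq> \<Union>V"
    using compactinD[OF C, of "?V ` ?G"] by blast
  obtain G0 where G0: "G0 \<subseteq> ?G" "finite G0" "V = ?V ` G0"
    using finite_subset_image[OF V(1,2)] by blast
  \<comment> \<open>The value 1/2 keeps the minimum below 1, also for an empty cover.\<close>
  define s where "s = Min (insert (1/2) (m ` G0))"
  have s: "0 < s" "s < 1" "\<And>g. g \<in> G0 \<Longrightarrow> s \<le> m g"
  proof -
    show "0 < s"
      unfolding s_def using G0(1,2) m(1) by (subst Min_gr_iff) auto
    have "s \<le> 1/2"
      unfolding s_def using G0(2) by (intro Min_le) auto
    then show "s < 1"
      by simp
    show "s \<le> m g" if "g \<in> G0" for g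
      unfolding s_def using G0(2) that by (intro Min_le) auto
  qed
  obtain M where M: "M \<ge> 1" "\<forall>g\<in>G0. mbound M (pproj g)"
    using mbound_finite[OF G0(2), of pproj] by blast
  have cover: "\<exists>g0\<in>G0. \<exists>c\<in>cong_sub (m g0). coset g = coset (c ** g0)" if "coset g \<in> ?C" for g
    using that V(3) G0(3) by blast
  have const: "f (coset (c ** g)) = f (coset g)" if c: "c \<in> cong_sub s" and g: "coset g \<in> ?C" for c g
  proof -
    obtain g0 c0 where g0: "g0 \<in> G0" "c0 \<in> cong_sub (m g0)" "coset g = coset (c0 ** g0)"
      using cover[OF g] by blast
    have gi: "invertible g0"
      using g0(1) G0(1) by blast
    have "c \<in> cong_sub (m g0)"
      using c cong_sub_mono[OF s(3)[OF g0(1)]] by blast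
    then have cc: "c ** c0 \<in> cong_sub (m g0)"
      using cong_sub_mult[OF m(2)[OF gi]] g0(2) by blast
    have "coset (c ** g) = coset ((c ** c0) ** g0)"
      unfolding X_action_coset[symmetric, of c g] g0(3) X_action_coset by (simp add: matrix_mul_assoc)
    then show ?thesis
      using m(3)[OF gi cc] m(3)[OF gi g0(2)] g0(3) by simp
  qed
  show ?thesis
  proof (rule that[OF s(1,2) M(1)])
    fix c g :: "('k, 'n) mat2n"
    assume c: "c \<in> cong_sub s" and g: "invertible g"
    have ci: "invertible c"
      by (rule cong_sub_invertible[OF s(2) c])
    \<comment> \<open>If neither point lies in the closed support, both values vanish; if only the
      translated point does, the inverse of \<open>c\<close> is applied to it.\<close>
    show "f (coset (c ** g)) = f (coset g)"
    proof (cases "coset g \<in> ?C")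
      case True
      then show ?thesis
        by (rule const[OF c])
    next
      case F: False
      show ?thesis
      proof (cases "coset (c ** g) \<in> ?C")
        case True
        from const[OF cong_sub_inv[OF s(2) c] True] show ?thesis
          unfolding mat_cancel_left(1)[OF ci] by (rule sym)
      next
        case False
        have "f (coset g) = 0" "f (coset (c ** g)) = 0"
          using supp[OF coset_in_X_points[OF g]] supp[OF coset_in_X_points[OF invertible_mult[OF ci g]]] F False by blast+
        then show ?thesis
          by simp
      qed
    qed
  next
    fix g :: "('k, 'n) mat2n"
    assume g: "invertible g" and nz: "f (coset g) \<noteq> 0"
    obtain g0 c where g0: "g0 \<in> G0" "c \<in> cong_sub (m g0)" "coset g = coset (c ** g0)"
      using cover supp[OF coset_in_X_points[OF g] nz] by blast
    have gi: "invertible g0"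
      using g0(1) G0(1) by blast
    have cO: "c \<in> GLO"
      using g0(2) cong_sub_GLO[OF m(2)[OF gi]] by blast
    then have ci: "invertible c"
      by simp
    obtain h where h: "h \<in> H_points" "c ** g0 = g ** h"
      using g0(3) coset_eq_iff[OF g invertible_mult[OF ci gi]] by blast
    have "pproj g = pproj (c ** g0)"
      unfolding h(2) by (rule pproj_mult_H[OF g h(1), symmetric])
    also have "\<dots> = c ** pproj g0 ** matrix_inv c"
      unfolding pproj_def matrix_inv_mult[OF ci gi] by (simp add: matrix_mul_assoc)
    finally show "mbound M (pproj g)"
      using M(2) g0(1) GLO_mbound[OF cO] GLO_mbound[OF GLO_inv[OF cO]]
      by (simp add: mbound_mult_left mbound_mult_right)
  next
    have "f ` X_points \<subseteq> insert 0 ((\<lambda>g. f (coset g)) ` G0)"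
    proof
      fix v
      assume "v \<in> f ` X_points"
      then obtain x where x: "x \<in> X_points" "v = f x"
        by blast
      then obtain g where g: "invertible g" "x = coset g"
        using X_points_iff by blast
      show "v \<in> insert 0 ((\<lambda>g. f (coset g)) ` G0)"
      proof (cases "v = 0")
        case False
        then obtain g0 c where g0: "g0 \<in> G0" "c \<in> cong_sub (m g0)" "coset g = coset (c ** g0)"
          using cover supp[OF x(1)] x(2) g(2) by blast
        then have "v = f (coset g0)"
          using m(3)[of g0 c] G0(1) x(2) g(2) by auto
        then show ?thesis
          using g0(1) by blast
      qed simp
    qed
    then show "finite (f ` X_points)"
      using G0(2) finite_subset by blast
  qed
qed

text \<open>The left factor is close to 1 when A and AB are small, so a function invariant under a
  congruence subgroup does not see a small A.\<close>

lemma gmat_0_left: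
  fixes B :: "'a::field ^ 'n::finite ^ 'n"
  shows "invertible (gmat 0 B)" "gmat A B = blk (mat 1 - A ** B) A 0 (mat 1) ** gmat 0 B"
  using gmat_inverse(1)[of 0 B] by (simp_all add: gmat_def blk_mult)

lemma gmat_0_right:
  fixes A :: "'a::field ^ 'n::finite ^ 'n"
  shows "invertible (gmat A 0)" "gmat A B = blk (mat 1) 0 B (mat 1 - B ** A) ** gmat A 0"
  using gmat_inverse(1)[of A 0] by (simp_all add: gmat_def blk_mult)

text \<open>In the coordinates (A, B), a bound on the idempotent bounds A and B when 1 - AB has unit
  determinant, and invariance under a congruence subgroup allows small coordinates to be replaced by
  0.\<close>

lemma test_function_gmat:
  fixes f :: "('k::nonarch_local_field, 'n::finite) mat2n set \<Rightarrow> complex"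
  assumes f: "f \<in> Cc_infty_X"
  obtains s M \<delta> where "0 < s" "s < 1" "M \<ge> 1" "\<delta> > 0"
    "\<And>k x. k \<in> cong_sub s \<Longrightarrow> x \<in> X_points \<Longrightarrow> f (X_action k x) = f x"
    "\<And>A B. absval (det (mat 1 - A ** B)) = 1 \<Longrightarrow> f (coset (gmat A B)) \<noteq> 0 \<Longrightarrow> mbound M A \<and> mbound M B"
    "\<And>A B. mbound \<delta> A \<Longrightarrow> mbound M B \<Longrightarrow> f (coset (gmat A B)) = f (coset (gmat 0 B))"
    "\<And>A B. mbound M A \<Longrightarrow> mbound \<delta> B \<Longrightarrow> f (coset (gmat A B)) = f (coset (gmat A 0))"
    "finite (f ` X_points)"
proof -
  obtain s M where s: "0 < s" "s < 1" "M \<ge> 1"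
    and inv: "\<And>c g. c \<in> cong_sub s \<Longrightarrow> invertible g \<Longrightarrow> f (coset (c ** g)) = f (coset g)"
    and bd: "\<And>g. invertible g \<Longrightarrow> f (coset g) \<noteq> 0 \<Longrightarrow> mbound M (pproj g)"
    and fin: "finite (f ` X_points)"
    by (rule Cc_infty_X_uniform[OF f]) (rule that)
  \<comment> \<open>A is 1 - AB times a block of the idempotent, up to sign, and Cramer's rule
    bounds 1 - AB by \<open>M ^ CARD('n)\<close>.\<close>
  define L where "L = M ^ CARD('n) * M"
  have L: "L \<ge> 1"
    unfolding L_def using mult_mono[of 1 "M ^ CARD('n)" 1 M] one_le_power[OF s(3), of "CARD('n)"] s(3) by simp
  \<comment> \<open>Chosen so that the product of a coordinate bounded by \<open>\<delta>\<close>
    and one bounded by \<open>L\<close> is bounded by \<open>s\<close>.\<close>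
  define \<delta> where "\<delta> = s / L"
  have d: "0 < \<delta>" "\<delta> * L = s" "\<delta> \<le> s"
    unfolding \<delta>_def using s L by (auto simp: field_simps)
  show ?thesis
  proof (rule that[OF s(1,2) L d(1) _ _ _ _ fin])
    fix k :: "('k, 'n) mat2n" and y :: "('k, 'n) mat2n set"
    assume "k \<in> cong_sub s" "y \<in> X_points"
    then show "f (X_action k y) = f y"
      using inv X_points_iff[of y] by (auto simp: X_action_coset)
  next
    fix A B :: "'k ^ 'n ^ 'n"
    let ?N = "mat 1 - A ** B"
    assume det: "absval (det ?N) = 1" and nz: "f (coset (gmat A B)) \<noteq> 0"
    have Ni: "invertible ?N"
      using det by (rule absval_det_1_invertible)
    have "mbound M (pproj (gmat A B))"
      by (rule bd[OF gmat_inverse(1)[OF Ni] nz])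
    then have P: "mbound M (matrix_inv ?N)" "mbound M (matrix_inv ?N ** A)" "mbound M (B ** matrix_inv ?N)"
      unfolding pproj_gmat[OF Ni] mbound_blk by simp_all
    have "absval (det (matrix_inv ?N)) = 1"
      using det by (simp add: det_matrix_inv[OF Ni] absval_inverse)
    then have N: "mbound (M ^ CARD('n)) ?N"
      using mbound_matrix_inv[OF P(1) s(3)] Ni by simp
    have "mbound (M ^ CARD('n) * M) (?N ** (matrix_inv ?N ** A))"
      by (rule mbound_mult[OF N P(2)])
    moreover have "mbound (M * M ^ CARD('n)) (B ** matrix_inv ?N ** ?N)"
      by (rule mbound_mult[OF P(3) N])
    ultimately show "mbound L A \<and> mbound L B"
      unfolding L_def using Ni by (simp add: mult.commute)
  next
    fix A B :: "'k ^ 'n ^ 'n"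
    assume A: "mbound \<delta> A" and B: "mbound L B"
    have "mbound s (A ** B)"
      using mbound_mult[OF A B] d(2) by simp
    moreover have "blk (mat 1 - A ** B) A 0 (mat 1) - mat 1 = blk (- (A ** B)) A 0 0"
      by (simp add: mat_blk[of 1] blk_diff)
    ultimately have "blk (mat 1 - A ** B) A 0 (mat 1) \<in> cong_sub s"
      using mbound_mono[OF A d(3)] s(1) by (simp add: cong_sub_def mbound_blk)
    from inv[OF this gmat_0_left(1)[of B]] show "f (coset (gmat A B)) = f (coset (gmat 0 B))"
      unfolding gmat_0_left(2)[of A B, symmetric] .
  next
    fix A B :: "'k ^ 'n ^ 'n"
    assume A: "mbound L A" and B: "mbound \<delta> B"
    have "mbound s (B ** A)"
      using mbound_mult[OF B A] d(2) by simp
    moreover have "blk (mat 1) 0 B (mat 1 - B ** A) - mat 1 = blk 0 0 B (- (B ** A))"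
      by (simp add: mat_blk[of 1] blk_diff)
    ultimately have "blk (mat 1) 0 B (mat 1 - B ** A) \<in> cong_sub s"
      using mbound_mono[OF B d(3)] s(1) by (simp add: cong_sub_def mbound_blk)
    from inv[OF this gmat_0_right(1)[of A]] show "f (coset (gmat A B)) = f (coset (gmat A 0))"
      unfolding gmat_0_right(2)[of A B, symmetric] .
  qed
qed

text \<open>A relation with integer coefficients between complex numbers survives any \<open>\<rat>\<close>-linear functional.\<close>

lemma integer_valued_functional:
  fixes V :: "complex set"
  assumes "finite V" "v0 \<noteq> 0"
  obtains \<Lambda> :: "complex \<Rightarrow> int" where "\<Lambda> v0 \<noteq> 0 \<or> v0 \<notin> V" "\<Lambda> 0 = 0"
    "\<And>(I :: 'i set) f. finite I \<Longrightarrow> (\<And>i. i \<in> I \<Longrightarrow> f i \<in> V) \<Longrightarrow> (\<Sum>i\<in>I. f i) = 0 \<Longrightarrow> (\<Sum>i\<in>I. \<Lambda> (f i)) = 0"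
proof -
  interpret rc: vector_space_pair "\<lambda>(q::rat) (x::complex). of_rat q * x" "\<lambda>(q::rat) x. q * x"
    by unfold_locales (auto simp: algebra_simps of_rat_add of_rat_mult)
  have "rc.vs1.independent {v0}"
    using assms(2) by simp
  from rc.linear_independent_extend[OF this, of "\<lambda>_. 1"] obtain l where
    l: "Vector_Spaces.linear (\<lambda>(q::rat) (x::complex). of_rat q * x) (\<lambda>(q::rat) x. q * x) l" "l v0 = 1"
    by auto
  have lsum: "l (sum f I) = (\<Sum>i\<in>I. l (f i))" for f and I :: "'i set"
    by (rule rc.linear_sum[OF l(1)])
  have l0: "l 0 = 0"
    by (rule rc.linear_0[OF l(1)])
  have "\<exists>d::int. d > 0 \<and> (\<forall>v\<in>V. of_int d * l v \<in> \<int>)"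
    using assms(1)
  proof (induction V)
    case empty
    then show ?case
      by (auto intro!: exI[of _ 1])
  next
    case (insert v V)
    obtain d :: int where d: "d > 0" "\<forall>v\<in>V. of_int d * l v \<in> \<int>"
      using insert.IH by blast
    obtain a b :: int where ab: "b > 0" "l v = of_int a / of_int b"
      using quotient_of_div[of "l v"] quotient_of_denom_pos[of "l v"] by (cases "quotient_of (l v)") auto
    have "of_int (b * d) * l v = of_int (d * a)"
      using ab by simp
    moreover have "of_int (b * d) * l w \<in> \<int>" if "w \<in> V" for w
      using d(2) that Ints_mult[of "of_int b" "of_int d * l w"] by (simp add: mult.assoc)
    ultimately have "\<forall>w\<in>insert v V. of_int (b * d) * l w \<in> \<int>"
      by (metis Ints_of_int insertE)
    then show ?case
      using d(1) ab(1) by (intro exI[of _ "b * d"]) simp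
  qed
  then obtain d :: int where d: "d > 0" "\<forall>v\<in>V. of_int d * l v \<in> \<int>"
    by blast
  \<comment> \<open>The floor only changes the type on \<open>V\<close>, where \<open>d\<close> has
    already cleared the denominators.\<close>
  define \<Lambda> where "\<Lambda> v = \<lfloor>of_int d * l v\<rfloor>" for v
  have \<Lambda>: "of_int (\<Lambda> v) = of_int d * l v" if "v \<in> V" for v
    using d(2) that unfolding \<Lambda>_def by (metis Ints_cases floor_of_int)
  show ?thesis
  proof (rule that)
    show "\<Lambda> v0 \<noteq> 0 \<or> v0 \<notin> V"
      using d(1) l(2) by (simp add: \<Lambda>_def)
    show "\<Lambda> 0 = 0"
      by (simp add: \<Lambda>_def l0)
    fix I :: "'i set" and f
    assume I: "finite I" "\<And>i. i \<in> I \<Longrightarrow> f i \<in> V" and sum0: "(\<Sum>i\<in>I. f i) = 0"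
    have "(of_int (\<Sum>i\<in>I. \<Lambda> (f i)) :: rat) = (\<Sum>i\<in>I. of_int d * l (f i))"
      unfolding of_int_sum by (intro sum.cong refl \<Lambda> I(2))
    also have "\<dots> = of_int d * l (\<Sum>i\<in>I. f i)"
      by (simp add: lsum sum_distrib_left)
    also have "\<dots> = 0"
      by (simp add: sum0 l0)
    finally show "(\<Sum>i\<in>I. \<Lambda> (f i)) = 0"
      by (simp only: of_int_eq_0_iff)
  qed
qed

section \<open>Counting stable lattices\<close>

text \<open>Every orbit has length p^e, a divisor of some p^N, and e > R because the p^R-th iterate
  moves the point. As \<open>F\<close> is constant on orbits, each contributes a multiple of
  p^(R+1); the induction removes one orbit at a time.\<close>

lemma prime_power_orbits_dvd_sum:
  fixes F :: "'a \<Rightarrow> int" and \<sigma> :: "'a \<Rightarrow> 'a" and p :: nat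
  assumes p: "prime p" and "finite S" "\<And>x. x \<in> S \<Longrightarrow> \<sigma> x \<in> S" "\<And>x. x \<in> S \<Longrightarrow> F (\<sigma> x) = F x"
    and "\<And>x. x \<in> S \<Longrightarrow> \<exists>N. (\<sigma> ^^ (p ^ N)) x = x" "\<And>x. x \<in> S \<Longrightarrow> (\<sigma> ^^ (p ^ R)) x \<noteq> x"
  shows "int p ^ Suc R dvd (\<Sum>x\<in>S. F x)"
  using assms(2-)
proof (induction "card S" arbitrary: S rule: less_induct)
  case less
  show ?case
  proof (cases "S = {}")
    case False
    then obtain x where x: "x \<in> S"
      by blast
    obtain N where N: "(\<sigma> ^^ (p ^ N)) x = x"
      using less.prems(4)[OF x] by blast
    define m where "m = (LEAST m. 0 < m \<and> (\<sigma> ^^ m) x = x)"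
    have ex: "0 < p ^ N \<and> (\<sigma> ^^ (p ^ N)) x = x"
      using N prime_gt_0_nat[OF p] by simp
    have m: "0 < m" "(\<sigma> ^^ m) x = x"
      using LeastI[of "\<lambda>m. 0 < m \<and> (\<sigma> ^^ m) x = x", OF ex] unfolding m_def by auto
    have least: "(\<sigma> ^^ j) x \<noteq> x" if "0 < j" "j < m" for j
      using not_less_Least[of j "\<lambda>m. 0 < m \<and> (\<sigma> ^^ m) x = x"] that unfolding m_def by blast
    have "m dvd p ^ N"
    proof -
      have "(\<sigma> ^^ (p ^ N mod m)) x = x"
        using funpow_mod_eq[OF m(2), of "p ^ N"] N by simp
      then have "p ^ N mod m = 0"
        using least[of "p ^ N mod m"] m(1) mod_less_divisor by blast
      then show ?thesis
        by auto
    qed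
    then obtain e where e: "m = p ^ e"
      using divides_primepow_nat[OF p] by blast
    have eR: "Suc R \<le> e"
    proof (rule ccontr)
      assume "\<not> Suc R \<le> e"
      then have "m dvd p ^ R"
        unfolding e by (intro le_imp_power_dvd) simp
      then have "(\<sigma> ^^ (p ^ R)) x = x"
        using funpow_mod_eq[OF m(2), of "p ^ R"] by simp
      then show False
        using less.prems(5)[OF x] by simp
    qed
    let ?O = "(\<lambda>i. (\<sigma> ^^ i) x) ` {..<m}"
    have in_O: "(\<sigma> ^^ i) x \<in> ?O" for i
    proof -
      have "(\<sigma> ^^ i) x = (\<sigma> ^^ (i mod m)) x"
        using funpow_mod_eq[OF m(2), of i] by simp
      then show ?thesis
        using m(1) by (metis imageI lessThan_iff mod_less_divisor)
    qed
    have in_S: "(\<sigma> ^^ i) x \<in> S \<and> F ((\<sigma> ^^ i) x) = F x" for i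
      by (induction i) (use x less.prems(2,3) in auto)
    have ne: "(\<sigma> ^^ i) x \<noteq> (\<sigma> ^^ j) x" if "i < j" "j < m" for i j
    proof
      assume eq: "(\<sigma> ^^ i) x = (\<sigma> ^^ j) x"
      have "(\<sigma> ^^ (m - j + i)) x = (\<sigma> ^^ (m - j)) ((\<sigma> ^^ i) x)"
        by (simp add: funpow_add)
      also have "\<dots> = (\<sigma> ^^ (m - j + j)) x"
        unfolding eq by (simp only: funpow_add comp_apply)
      also have "\<dots> = x"
        using that m(2) by simp
      finally have fx: "(\<sigma> ^^ (m - j + i)) x = x" .
      have "0 < m - j + i" "m - j + i < m"
        using that by linarith+
      from least[OF this] fx show False
        by blast
    qed
    have inj: "inj_on (\<lambda>i. (\<sigma> ^^ i) x) {..<m}"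
    proof (rule inj_onI)
      fix i j
      assume "i \<in> {..<m}" "j \<in> {..<m}" "(\<sigma> ^^ i) x = (\<sigma> ^^ j) x"
      then show "i = j"
        using ne[of i j] ne[of j i] by (cases i j rule: linorder_cases) auto
    qed
    have OS: "?O \<subseteq> S"
      using in_S by blast
    have "card (S - ?O) < card S"
      using less.prems(1) x in_O[of 0] by (intro psubset_card_mono) auto
    \<comment> \<open>Periodicity replaces injectivity: if \<open>\<sigma> y\<close> lay in the
      orbit of \<open>x\<close>, iterating until \<open>y\<close> returns would put \<open>y\<close>
      there as well.\<close>
    moreover have "\<sigma> y \<in> S - ?O" if y: "y \<in> S - ?O" for y
    proof -
      have "\<sigma> y \<notin> ?O"
      proof
        assume "\<sigma> y \<in> ?O"
        then obtain i where i: "\<sigma> y = (\<sigma> ^^ i) x"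
          by blast
        obtain K where K: "(\<sigma> ^^ (p ^ K)) y = y"
          using less.prems(4) y by blast
        have "p ^ K = (p ^ K - 1) + 1"
          using prime_gt_0_nat[OF p] by simp
        then have "y = (\<sigma> ^^ ((p ^ K - 1) + 1)) y"
          using K by simp
        also have "\<dots> = (\<sigma> ^^ (p ^ K - 1)) (\<sigma> y)"
          by (simp only: funpow_add comp_apply) simp
        also have "\<dots> = (\<sigma> ^^ (p ^ K - 1 + i)) x"
          unfolding i by (simp only: funpow_add comp_apply)
        finally show False
          using y in_O[of "p ^ K - 1 + i"] by simp
      qed
      then show ?thesis
        using y less.prems(2) by blast
    qed
    ultimately have IH: "int p ^ Suc R dvd (\<Sum>x\<in>S - ?O. F x)"
      using less.prems by (intro less.hyps) auto
    have "(\<Sum>y\<in>?O. F y) = (\<Sum>i<m. F ((\<sigma> ^^ i) x))"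
      by (simp add: sum.reindex[OF inj])
    also have "\<dots> = int p ^ e * F x"
      using in_S by (simp add: e)
    finally have "int p ^ Suc R dvd (\<Sum>y\<in>?O. F y)"
      using le_imp_power_dvd[OF eR, of "int p"] by (simp del: power_Suc)
    then show ?thesis
      using IH sum.subset_diff[OF OS less.prems(1), of F] by (simp del: power_Suc)
  qed simp
qed

text \<open>Dividing by \<open>uniformizer ^ t\<close> leaves an integral element of E, which
  preserves the standard lattice; the factor n in the exponent is there because \<open>enorm\<close>
  is an n-th power.\<close>

lemma EE_small_mbound:
  fixes z :: "'k::nonarch_local_field ^ 'n::finite ^ 'n"
  assumes z: "z \<in> EE" "enorm z \<le> rabs TYPE('k) ^ (CARD('n) * t)"
  shows "mbound (rabs TYPE('k) ^ t) z"
proof -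
  let ?w = "uniformizer ^ t :: 'k"
  let ?y = "mat (inverse ?w) ** z"
  have y: "?y \<in> EE"
    by (rule EE_mult[OF EE_mat z(1)])
  have "enorm ?y = absval (inverse ?w) ^ CARD('n) * enorm z"
    by (simp only: enorm_mult[OF EE_mat] enorm_mat)
  also have "\<dots> \<le> absval (inverse ?w) ^ CARD('n) * rabs TYPE('k) ^ (CARD('n) * t)"
    using z(2) by (intro mult_left_mono) auto
  also have "\<dots> = 1"
    by (simp add: absval_inverse absval_power power_mult[symmetric] mult.commute power_inverse)
  finally have y1: "enorm ?y \<le> 1" .
  have "mbound 1 ?y"
  proof (rule mbound_1_columns)
    fix j
    have "vnorm (?y *v axis j 1) = enorm ?y * vnorm (axis j 1 :: 'k ^ 'n)"
      by (rule vnorm_EE_mult[OF y])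
    also have "\<dots> \<le> 1"
      using y1 vnorm_axis_le_1[of j, where 'k='k] by (intro mult_le_one) auto
    finally show "vnorm (?y *v axis j 1) \<le> 1" .
  qed
  then have "mbound (absval ?w * 1) (mat ?w ** ?y)"
    by (rule mbound_smult)
  moreover have "mat ?w ** ?y = z"
    by (simp add: vec_eq_iff)
  ultimately show ?thesis
    by (simp add: absval_power)
qed

text \<open>Powers of 1 + z with exponents p^N converge to 1, and conjugation by a fixed
  \<open>a\<close> distorts entries by a bounded factor only. This is why orbits on cosets and on
  lattices have p-power length.\<close>

lemma EE_conj_small:
  fixes z a :: "'k::nonarch_local_field ^ 'n::finite ^ 'n"
  assumes z: "z \<in> EE" "enorm z < 1" and p: "absval (of_nat p :: 'k) < 1" and e: "0 < e"
  shows "\<exists>N0. \<forall>N\<ge>N0. mbound e (matrix_inv a ** (mpow (mat 1 + z) (p ^ N) - mat 1) ** a)"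
proof -
  obtain b where b: "b \<ge> 1" "mbound b (matrix_inv a)"
    using mbound_exists by blast
  obtain c where c: "c \<ge> 1" "mbound c a"
    using mbound_exists by blast
  obtain t where t: "rabs TYPE('k) ^ t < e / (b * c)"
    using real_arch_pow_inv[of "e / (b * c)" "rabs TYPE('k)"] e b c by auto
  let ?q = "max (absval (of_nat p :: 'k) ^ CARD('n)) (enorm z)"
  have "absval (of_nat p :: 'k) ^ CARD('n) \<le> absval (of_nat p :: 'k) ^ 1"
    using absval_of_nat_le by (intro power_decreasing) (auto simp: Suc_leI)
  then have q: "0 \<le> ?q" "?q < 1"
    using z(2) p by (auto simp: le_max_iff_disj)
  obtain N0 where N0: "?q ^ N0 < rabs TYPE('k) ^ (CARD('n) * t)"
    using real_arch_pow_inv[of "rabs TYPE('k) ^ (CARD('n) * t)" ?q] q by auto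
  have "mbound e (matrix_inv a ** (mpow (mat 1 + z) (p ^ N) - mat 1) ** a)" if N: "N \<ge> N0" for N
  proof -
    let ?y = "mpow (mat 1 + z) (p ^ N) - mat 1"
    have "?y \<in> EE"
      using z(1) by (intro EE_diff EE_mpow EE_add EE_mat)
    moreover have "enorm ?y \<le> rabs TYPE('k) ^ (CARD('n) * t)"
    proof -
      have "enorm ?y \<le> ?q ^ N * enorm z"
        using z by (intro enorm_mpow_prime_power_le) auto
      also have "\<dots> \<le> ?q ^ N * 1"
        using z(2) q(1) by (intro mult_left_mono zero_le_power) auto
      also have "\<dots> \<le> ?q ^ N0"
        using q N by (auto intro!: power_decreasing)
      finally show ?thesis
        using N0 by simp
    qed
    ultimately have "mbound (rabs TYPE('k) ^ t) ?y"
      by (rule EE_small_mbound)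
    then have "mbound (b * rabs TYPE('k) ^ t * c) (matrix_inv a ** ?y ** a)"
      using b c by (intro mbound_mult)
    moreover have "b * rabs TYPE('k) ^ t * c \<le> e"
      using t b c by (simp add: field_simps)
    ultimately show ?thesis
      by (rule mbound_mono)
  qed
  then show ?thesis
    by blast
qed

lemma mbound_conj_GLO:
  fixes a k z :: "'k::nonarch_local_field ^ 'n::finite ^ 'n"
  assumes "invertible a" "k \<in> GLO" "mbound 1 (matrix_inv a ** z ** a)"
  shows "mbound 1 (matrix_inv (a ** k) ** z ** (a ** k))"
proof -
  have "matrix_inv (a ** k) ** z ** (a ** k) = matrix_inv k ** (matrix_inv a ** z ** a) ** k"
    using assms(1,2) by (simp add: matrix_inv_mult matrix_mul_assoc)
  then show ?thesis
    using assms(3) GLO_mbound[OF assms(2)] GLO_mbound[OF GLO_inv[OF assms(2)]]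
    by (simp add: mbound_mult_left mbound_mult_right)
qed

lemma conj_mult_commute:
  fixes a v z :: "'a::field ^ 'n::finite ^ 'n"
  assumes "invertible a" "invertible v" "v ** z = z ** v"
  shows "matrix_inv (v ** a) ** z ** (v ** a) = matrix_inv a ** z ** a"
proof -
  have "matrix_inv (v ** a) ** z ** (v ** a) = matrix_inv a ** matrix_inv v ** (z ** v) ** a"
    using assms(1,2) by (simp add: matrix_inv_mult matrix_mul_assoc)
  also have "\<dots> = matrix_inv a ** z ** a"
    unfolding assms(3)[symmetric] using assms(2) by (simp add: matrix_mul_assoc)
  finally show ?thesis .
qed

text \<open>For invertible \<open>a\<close>, the coset a GL_n(O) stands for the lattice a
  O^n.\<close>

definition glc :: "'k::nonarch_local_field ^ 'n::finite ^ 'n \<Rightarrow> ('k ^ 'n ^ 'n) set" where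
  "glc a = (\<lambda>k. a ** k) ` GLO"

lemma glc_mult: "(\<lambda>x. v ** x) ` glc a = glc (v ** a)"
  by (simp add: glc_def image_image matrix_mul_assoc)

lemma glc_eq_iff:
  fixes a b :: "'k::nonarch_local_field ^ 'n::finite ^ 'n"
  assumes "invertible a" "invertible b"
  shows "glc a = glc b \<longleftrightarrow> matrix_inv a ** b \<in> GLO"
proof
  assume "glc a = glc b"
  moreover have "b \<in> glc b"
    unfolding glc_def using imageI[OF GLO_mat_1, of "\<lambda>k. b ** k"] by simp
  ultimately have "b \<in> glc a"
    by simp
  then obtain k where "k \<in> GLO" "b = a ** k"
    unfolding glc_def by blast
  then show "matrix_inv a ** b \<in> GLO"
    using assms(1) by simp
next
  assume k: "matrix_inv a ** b \<in> GLO"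
  have sub: "glc (y :: 'k ^ 'n ^ 'n) \<subseteq> glc x" if "invertible x" "matrix_inv x ** y \<in> GLO" for x y
  proof
    fix w
    assume "w \<in> glc y"
    then obtain l where l: "l \<in> GLO" "w = y ** l"
      unfolding glc_def by blast
    have "w = x ** (matrix_inv x ** y ** l)"
      using that(1) l(2) by (simp add: matrix_mul_assoc)
    then show "w \<in> glc x"
      unfolding glc_def using GLO_mult[OF that(2) l(1)] by blast
  qed
  have "matrix_inv b ** a = matrix_inv (matrix_inv a ** b)"
    using assms by (simp add: matrix_inv_mult)
  then show "glc a = glc b"
    using sub[OF assms(1) k] sub[OF assms(2), of a] GLO_inv[OF k] by auto
qed

lemma glc_one: "glc (mat 1) = GLO"
  by (simp add: glc_def)

text \<open>\<open>Z\<close> is a union of cosets of \<open>GLO\<close>, each containing equally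
  many congruence cosets, so \<open>N\<close> is the number of \<open>z\<close>-stable lattices of
  unit determinant. Under 1 + \<Pi> these have orbits of p-power length, and a fixed lattice is
  \<Pi>-stable, hence standard; so \<open>N\<close> is 1 modulo \<open>p\<close>.\<close>

lemma card_stable_lattices:
  fixes z :: "'k::nonarch_local_field ^ 'n::finite ^ 'n"
  assumes z: "z \<in> EE" "enorm z = rabs TYPE('k) powi b" "b mod int CARD('n) = 1 mod int CARD('n)" "b \<ge> 0"
    and p: "prime p" "absval (of_nat p :: 'k) < 1" and s: "0 < s" "s < 1"
  defines "Z \<equiv> {a. absval (det a) = 1 \<and> mbound 1 (matrix_inv a ** z ** a)}"
  shows "finite (gcos {a. invertible a} s ` Z)"
    "\<exists>N. \<not> p dvd N \<and> card (gcos {a. invertible a} s ` Z)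
       = card (gcos {a. invertible a} s ` (GLO :: ('k ^ 'n ^ 'n) set)) * N"
proof -
  let ?G = "{a :: 'k ^ 'n ^ 'n. invertible a}"
  let ?Q = "gcos ?G s"
  let ?P = "cyc uniformizer :: 'k ^ 'n ^ 'n"
  note G = mat_group_invertible[where 'a='k and 'm='n]
  obtain c where c: "c \<ge> 1" "\<forall>h. absval (det h) = 1 \<longrightarrow> mbound 1 (matrix_inv h ** z ** h) \<longrightarrow>
      mbound c h \<and> mbound c (matrix_inv h)"
    using stable_lattice_bounded[OF z] by blast
  have Zi: "invertible a" if "a \<in> Z" for a
    using that absval_det_1_invertible by (auto simp: Z_def)
  have ZG: "Z \<subseteq> ?G"
    using Zi by blast
  show fin: "finite (?Q ` Z)"
    by (rule finite_gcos[OF G s ZG c(1)]) (use c(2) in \<open>auto simp: Z_def\<close>)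
  have Zk: "a ** k \<in> Z" if "a \<in> Z" "k \<in> GLO" for a k
    using that mbound_conj_GLO[OF Zi[OF that(1)] that(2), of z]
    by (auto simp: Z_def GLO_def det_mul absval_mult)
  have Zv: "v ** a \<in> Z" if "a \<in> Z" "v \<in> EE" "enorm v = 1" for a v
  proof -
    have v: "absval (det v) = 1"
      using that EE_unit_iff by blast
    have "mbound 1 (matrix_inv (v ** a) ** z ** (v ** a))"
      using that conj_mult_commute[OF Zi[OF that(1)] absval_det_1_invertible[OF v] EE_commute[OF that(2) z(1)]]
      by (simp add: Z_def)
    then show ?thesis
      using that(1) v by (simp add: Z_def det_mul absval_mult)
  qed
  have glc_Q: "glc x = glc a" if "a \<in> ?G" "x \<in> ?Q a" for a x
  proof -
    have "invertible x" "matrix_inv a ** x \<in> GLO"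
      using that gcos_iff_cong[OF G s that(1), of x] cong_sub_GLO[OF s(2)] by auto
    then show ?thesis
      using glc_eq_iff[of a x] that(1) by simp
  qed
  have finC: "finite (glc ` Z)"
  proof (rule finite_subset[OF _ finite_imageI[OF fin]])
    show "glc ` Z \<subseteq> (\<lambda>C. glc (SOME x. x \<in> C)) ` ?Q ` Z"
    proof
      fix C
      assume "C \<in> glc ` Z"
      then obtain a where a: "a \<in> Z" "C = glc a"
        by blast
      have "(SOME x. x \<in> ?Q a) \<in> ?Q a"
        using gcos_self[OF G s, of a] Zi[OF a(1)] by (auto intro: someI)
      then have "C = glc (SOME x. x \<in> ?Q a)"
        using glc_Q[of a] Zi[OF a(1)] a(2) by simp
      then show "C \<in> (\<lambda>C. glc (SOME x. x \<in> C)) ` ?Q ` Z"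
        using a(1) by blast
    qed
  qed
  have glc_self: "a \<in> glc a" for a :: "'k ^ 'n ^ 'n"
    unfolding glc_def using imageI[OF GLO_mat_1, of "\<lambda>k. a ** k"] by simp
  have glc_Z: "glc a \<subseteq> Z" if "a \<in> Z" for a
    using Zk[OF that] by (auto simp: glc_def)
  have glc_mem: "glc x = glc a" if ai: "invertible a" and xa: "x \<in> glc a" for x a :: "'k ^ 'n ^ 'n"
  proof -
    obtain k where k: "k \<in> GLO" "x = a ** k"
      using xa unfolding glc_def by blast
    have "invertible x" "matrix_inv a ** x \<in> GLO"
      using k ai by (simp_all add: invertible_mult)
    then show ?thesis
      using glc_eq_iff[of a x] ai by simp
  qed
  have ZU: "\<Union>(glc ` Z) = Z"
  proof
    show "Z \<subseteq> \<Union>(glc ` Z)"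
      using glc_self by blast
  qed (use glc_Z in blast)
  have "?Q ` Z = (\<Union>C\<in>glc ` Z. ?Q ` C)"
    unfolding image_Union[symmetric] ZU ..
  also have "card \<dots> = (\<Sum>C\<in>glc ` Z. card (?Q ` C))"
  proof (rule card_UN_disjoint[OF finC])
    show "\<forall>C\<in>glc ` Z. finite (?Q ` C)"
      using glc_Z by (auto intro!: finite_subset[OF image_mono fin])
    show "\<forall>C\<in>glc ` Z. \<forall>D\<in>glc ` Z. C \<noteq> D \<longrightarrow> ?Q ` C \<inter> ?Q ` D = {}"
    proof (intro ballI impI)
      fix C D
      assume C: "C \<in> glc ` Z" and D: "D \<in> glc ` Z" and ne: "C \<noteq> D"
      obtain a where a: "a \<in> Z" "C = glc a"
        using C by blast
      obtain b where b: "b \<in> Z" "D = glc b"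
        using D by blast
      show "?Q ` C \<inter> ?Q ` D = {}"
      proof (rule ccontr)
        assume "?Q ` C \<inter> ?Q ` D \<noteq> {}"
        then obtain x y where xy: "x \<in> C" "y \<in> D" "?Q x = ?Q y"
          by blast
        have xi: "invertible x" "invertible y"
          using xy(1,2) a b glc_Z[OF a(1)] glc_Z[OF b(1)] Zi by auto
        have "x \<in> ?Q y"
          using gcos_eq_iff[OF G s, of y x] xi xy(3) by simp
        then have "glc x = glc y"
          using glc_Q[of y x] xi by simp
        moreover have "glc x = C" "glc y = D"
          using glc_mem[OF Zi[OF a(1)], of x] glc_mem[OF Zi[OF b(1)], of y] xy a b by auto
        ultimately show False
          using ne by simp
      qed
    qed
  qed
  also have "\<dots> = (\<Sum>C\<in>glc ` Z. card (?Q ` (GLO :: ('k ^ 'n ^ 'n) set)))"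
  proof (rule sum.cong[OF refl])
    fix C
    assume "C \<in> glc ` Z"
    then obtain a where a: "a \<in> Z" "C = glc a"
      by blast
    show "card (?Q ` C) = card (?Q ` (GLO :: ('k ^ 'n ^ 'n) set))"
      unfolding a(2) glc_def
      by (rule gcos_card_eq[OF G s]) (use Zi[OF a(1)] GLO_mult GLO_inv in auto)
  qed
  also have "\<dots> = card (?Q ` (GLO :: ('k ^ 'n ^ 'n) set)) * card (glc ` Z)"
    by simp
  finally have card: "card (?Q ` Z) = card (?Q ` (GLO :: ('k ^ 'n ^ 'n) set)) * card (glc ` Z)" .
  let ?v = "mat 1 + ?P"
  have vE: "?v \<in> EE"
    by (intro EE_add EE_mat EE_cyc)
  have "enorm ?P < enorm (mat 1 :: 'k ^ 'n ^ 'n)"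
    by (simp add: enorm_cyc enorm_mat)
  then have v1: "enorm ?v = 1"
    using enorm_add_eq[of ?P "mat 1"] by (simp add: enorm_mat add.commute)
  have vdet: "absval (det ?v) = 1"
    using EE_unit_iff[OF vE] v1 by simp
  have vi: "invertible ?v"
    by (rule absval_det_1_invertible[OF vdet])
  define \<sigma> :: "('k ^ 'n ^ 'n) set \<Rightarrow> ('k ^ 'n ^ 'n) set" where "\<sigma> = (\<lambda>C. (\<lambda>x. ?v ** x) ` C)"
  have sig: "(\<sigma> ^^ i) (glc a) = glc (mpow ?v i ** a)" for i a
    by (induction i) (simp_all add: \<sigma>_def glc_mult matrix_mul_assoc)
  let ?S = "glc ` Z - {GLO}"
  \<comment> \<open>Orbit counting with R = 0 and the constant function 1, on the lattices other
    than the standard one.\<close>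
  have "int p ^ Suc 0 dvd (\<Sum>C\<in>?S. 1)"
  proof (rule prime_power_orbits_dvd_sum[OF p(1)])
    show "finite ?S"
      using finC by simp
  next
    fix C
    assume C: "C \<in> ?S"
    then obtain a where a: "a \<in> Z" "C = glc a"
      by blast
    have ai: "invertible a"
      by (rule Zi[OF a(1)])
    have aO: "a \<notin> GLO"
    proof
      assume "a \<in> GLO"
      then have "glc (mat 1) = glc a"
        using glc_eq_iff[of "mat 1" a] ai by simp
      then show False
        using C a(2) glc_one[where 'a='k and 'b='n] by simp
    qed
    have "?v ** a \<in> Z"
      by (rule Zv[OF a(1) vE v1])
    moreover have "glc (?v ** a) \<noteq> GLO"
    proof
      assume "glc (?v ** a) = GLO"
      then have "glc (mat 1) = glc (?v ** a)"
        by (simp add: glc_one)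
      then have "?v ** a \<in> GLO"
        using glc_eq_iff[of "mat 1" "?v ** a"] invertible_mult[OF vi ai] by simp
      then have "matrix_inv ?v ** (?v ** a) \<in> GLO"
        by (rule GLO_mult[OF GLO_inv[OF EE_unit_GLO[OF vE v1]]])
      then show False
        using aO vi by simp
    qed
    ultimately show "\<sigma> C \<in> ?S"
      unfolding \<sigma>_def a(2) glc_mult by blast
    show "\<exists>N. (\<sigma> ^^ (p ^ N)) C = C"
    proof -
      have "enorm ?P < 1"
        by (simp add: enorm_cyc)
      then obtain N where N: "mbound 1 (matrix_inv a ** (mpow ?v (p ^ N) - mat 1) ** a)"
        using EE_conj_small[OF EE_cyc _ p(2), of 1 a] by auto
      have "matrix_inv a ** (mpow ?v (p ^ N) ** a) = matrix_inv a ** (mpow ?v (p ^ N) - mat 1) ** a + mat 1"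
        using ai by (simp add: matrix_diff_ldistrib matrix_diff_rdistrib matrix_mul_assoc)
      then have "mbound 1 (matrix_inv a ** (mpow ?v (p ^ N) ** a))"
        using mbound_add[OF N mbound_mat_1] by simp
      moreover have "absval (det (matrix_inv a ** (mpow ?v (p ^ N) ** a))) = 1"
        using a(1) ai vdet by (simp add: Z_def det_mul absval_mult det_matrix_inv absval_inverse det_mpow absval_power)
      ultimately have "matrix_inv a ** (mpow ?v (p ^ N) ** a) \<in> GLO"
        by (simp add: GLO_def)
      then have "glc a = glc (mpow ?v (p ^ N) ** a)"
        using glc_eq_iff[OF ai, of "mpow ?v (p ^ N) ** a"] invertible_mult[OF invertible_mpow[OF vi] ai] by blast
      then show ?thesis
        unfolding a(2) sig by metis
    qed
    show "(\<sigma> ^^ (p ^ 0)) C \<noteq> C"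
    proof
      assume "(\<sigma> ^^ (p ^ 0)) C = C"
      then have "glc a = glc (?v ** a)"
        using sig[of 1 a] a(2) by simp
      then have k: "matrix_inv a ** (?v ** a) \<in> GLO"
        using glc_eq_iff[OF ai invertible_mult[OF vi ai]] by blast
      have "matrix_inv a ** ?P ** a = matrix_inv a ** (?v ** a) - mat 1"
        using ai by (simp add: matrix_add_ldistrib matrix_add_rdistrib matrix_mul_assoc)
      then have "mbound 1 (matrix_inv a ** ?P ** a)"
        using mbound_diff[OF GLO_mbound[OF k] mbound_mat_1] by simp
      then have "a \<in> GLO"
        using cyc_stable_lattice[of a] a(1) by (simp add: Z_def)
      then show False
        using aO by blast
    qed
  qed simp
  then have pd: "int p dvd int (card ?S)"
    by simp
  \<comment> \<open>\<open>b \<ge> 0\<close> makes \<open>z\<close> integral, so the standard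
    lattice is among those counted.\<close>
  have "mat 1 \<in> Z"
  proof -
    have "enorm z \<le> rabs TYPE('k) ^ (CARD('n) * 0)"
      using z(2,4) rabs_powi_le_iff[of b 0, where 'k='k] by simp
    from EE_small_mbound[OF z(1) this] show ?thesis
      by (simp add: Z_def)
  qed
  then have "GLO \<in> glc ` Z"
    using glc_one by blast
  then have "card (glc ` Z) = Suc (card ?S)"
    using finC by (metis card_Suc_Diff1)
  then have "\<not> p dvd card (glc ` Z)"
    using pd p(1) dvd_add_right_iff[of p "card ?S" 1] by (auto simp: Suc_eq_plus1 simp del: One_nat_def)
  then show "\<exists>N. \<not> p dvd N \<and> card (?Q ` Z) = card (?Q ` (GLO :: ('k ^ 'n ^ 'n) set)) * N"
    using card by blast
qed

section \<open>Sums over cosets\<close>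

lemma absval_det_one_minus_cyc:
  fixes c :: int
  assumes "c \<ge> 1"
  shows "absval (det (mat 1 - mpowi (cyc uniformizer) c :: 'k::nonarch_local_field ^ 'n::finite ^ 'n)) = 1"
proof -
  let ?X = "mpowi (cyc uniformizer) c :: 'k ^ 'n ^ 'n"
  have E: "mat 1 - ?X \<in> EE"
    by (intro EE_diff EE_mat EE_mpowi_cyc)
  have X: "enorm ?X < 1"
    using rabs_powi_less_iff[of c 0, where 'k='k] assms by (simp add: enorm_mpowi_cyc)
  have "enorm (- ?X) = enorm ?X"
  proof -
    have "(- ?X) *v v = - (?X *v v)" for v
      by (simp add: vec_eq_iff matrix_vector_mult_def sum_negf)
    then show ?thesis
      by (simp add: enorm_def)
  qed
  then have "enorm (- ?X + mat 1) = enorm (mat 1 :: 'k ^ 'n ^ 'n)"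
    using X by (intro enorm_add_eq) (simp add: enorm_mat)
  then show ?thesis
    using EE_unit_iff[OF E] by (simp add: enorm_mat)
qed

text \<open>The product of the two coordinates is a conjugate of \<Pi>^c, whatever \<open>j\<close>
  is, and 1 - \<Pi>^c is a unit of O_E. So the support bound for test functions applies at all these
  points.\<close>

lemma absval_det_conj_cyc:
  fixes a b :: "'k::nonarch_local_field ^ 'n::finite ^ 'n"
  assumes ab: "invertible a" "invertible b" and c: "c \<ge> 1"
  shows "absval (det (mat 1 - matrix_inv a ** mpowi (cyc uniformizer) j ** b ** (matrix_inv b ** mpowi (cyc uniformizer) (c - j) ** a))) = 1"
proof -
  let ?P = "cyc uniformizer :: 'k ^ 'n ^ 'n"
  have "matrix_inv a ** mpowi ?P j ** b ** (matrix_inv b ** mpowi ?P (c - j) ** a) = matrix_inv a ** (mpowi ?P j ** mpowi ?P (c - j)) ** a"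
    using ab by (simp add: matrix_mul_assoc)
  also have "mpowi ?P j ** mpowi ?P (c - j) = mpowi ?P c"
    using mpowi_add[OF invertible_cyc_uniformizer[where 'k='k and 'n='n], of j "c - j"] by simp
  finally have "mat 1 - matrix_inv a ** mpowi ?P j ** b ** (matrix_inv b ** mpowi ?P (c - j) ** a) = matrix_inv a ** (mat 1 - mpowi ?P c) ** a"
    using ab by (simp add: matrix_diff_ldistrib matrix_diff_rdistrib)
  then have "det (mat 1 - matrix_inv a ** mpowi ?P j ** b ** (matrix_inv b ** mpowi ?P (c - j) ** a)) = inverse (det a) * det (mat 1 - mpowi ?P c) * det a"
    using ab by (simp add: det_mul det_matrix_inv)
  also have "\<dots> = det (mat 1 - mpowi ?P c)"
    using ab by (simp add: invertible_det_nz)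
  finally show ?thesis
    using absval_det_one_minus_cyc[OF c] by simp
qed

text \<open>The product of the two bounded matrices is a^(-1) \<Pi>^c a, so the lattice of
  \<open>a\<close> is stable under a scalar multiple of \<Pi>^c of valuation 1 modulo n, and
  \<open>a\<close> is bounded. Then b = a (a^(-1) b) and its inverse are bounded too.\<close>

lemma finite_bounded_cosets:
  fixes c :: nat
  assumes c: "c mod CARD('n) = 1 mod CARD('n)" and M: "M \<ge> 1" and s: "0 < s" "s < 1"
  shows "finite (gcos H_points s ` {block_diag a b :: ('k::nonarch_local_field, 'n::finite) mat2n | a b.
    absval (det a) = 1 \<and> invertible b \<and> mbound M (matrix_inv a ** b) \<and>
    mbound M (matrix_inv b ** mpowi (cyc uniformizer) (int c) ** a)})"
proof -
  let ?P = "cyc uniformizer :: 'k ^ 'n ^ 'n"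
  let ?X = "mpowi ?P (int c)"
  \<comment> \<open>Enough powers of the uniformizer to make the product integral; they change the
    valuation in E by a multiple of n.\<close>
  obtain t where t: "rabs TYPE('k) ^ t < 1 / (M * M)"
    using real_arch_pow_inv[of "1 / (M * M)" "rabs TYPE('k)"] M by auto
  let ?z = "mat (uniformizer ^ t) ** ?X"
  have zE: "?z \<in> EE"
    by (intro EE_mult EE_mat EE_mpowi_cyc)
  have "enorm ?z = rabs TYPE('k) ^ (t * CARD('n)) * rabs TYPE('k) ^ c"
    by (simp add: enorm_mult[OF EE_mat] enorm_mat enorm_mpowi_cyc absval_power power_mult)
  also have "\<dots> = rabs TYPE('k) powi int (t * CARD('n) + c)"
    by (simp add: power_add power_int_of_nat del: of_nat_add of_nat_mult)
  finally have ze: "enorm ?z = rabs TYPE('k) powi int (t * CARD('n) + c)" .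
  have zm: "int (t * CARD('n) + c) mod int CARD('n) = 1 mod int CARD('n)"
    using c by (metis mod_mult_self3 of_nat_1 zmod_int)
  obtain C where C: "C \<ge> 1" "\<And>h. absval (det h) = 1 \<Longrightarrow> mbound 1 (matrix_inv h ** ?z ** h) \<Longrightarrow>
      mbound C h \<and> mbound C (matrix_inv h)"
    using stable_lattice_bounded[OF zE ze zm] by auto
  obtain L where L: "L \<ge> 1" "mbound L (mpowi ?P (- int c))"
    using mbound_exists by blast
  let ?\<beta> = "M * C * L"
  have MC: "1 \<le> M * C" "C \<le> M * C" "M * C \<le> ?\<beta>"
    using M C(1) L(1) mult_mono[of 1 M 1 C] mult_mono[of 1 M C C] mult_mono[of "M * C" "M * C" 1 L] by auto
  show ?thesis
  proof (rule finite_gcos[OF mat_group_H_points s, where b = ?\<beta>])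
    show "{block_diag a b :: ('k, 'n) mat2n | a b.
        absval (det a) = 1 \<and> invertible b \<and> mbound M (matrix_inv a ** b) \<and>
        mbound M (matrix_inv b ** ?X ** a)} \<subseteq> H_points"
      using absval_det_1_invertible by (auto simp: block_diag_in_H)
    show "1 \<le> ?\<beta>"
      using MC by linarith
    fix h :: "('k, 'n) mat2n"
    assume "h \<in> {block_diag a b | a b.
        absval (det a) = 1 \<and> invertible b \<and> mbound M (matrix_inv a ** b) \<and>
        mbound M (matrix_inv b ** ?X ** a)}"
    then obtain a b where h: "h = block_diag a b" "absval (det a) = 1" "invertible b"
        and bd: "mbound M (matrix_inv a ** b)" "mbound M (matrix_inv b ** ?X ** a)"
      by blast
    have ai: "invertible a"
      by (rule absval_det_1_invertible[OF h(2)])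
    have "matrix_inv a ** ?z ** a = mat (uniformizer ^ t) ** (matrix_inv a ** ?X ** a)"
      unfolding matrix_mul_assoc mat_mult_commute[of _ "matrix_inv a"] ..
    also have "matrix_inv a ** ?X ** a = (matrix_inv a ** b) ** (matrix_inv b ** ?X ** a)"
      using h(3) by (simp add: matrix_mul_assoc)
    finally have eq: "matrix_inv a ** ?z ** a = mat (uniformizer ^ t) ** ((matrix_inv a ** b) ** (matrix_inv b ** ?X ** a))" .
    have "mbound (absval (uniformizer ^ t :: 'k) * (M * M)) (matrix_inv a ** ?z ** a)"
      unfolding eq by (intro mbound_smult mbound_mult bd)
    moreover have "absval (uniformizer ^ t :: 'k) * (M * M) \<le> 1"
      using t M by (simp add: absval_power field_simps)
    ultimately have ab: "mbound C a" "mbound C (matrix_inv a)"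
      using C(2)[OF h(2)] mbound_mono by blast+
    have "mbound (C * M) (a ** (matrix_inv a ** b))"
      by (rule mbound_mult[OF ab(1) bd(1)])
    then have b1: "mbound ?\<beta> b"
      using mbound_mono[of "C * M" b ?\<beta>] MC(3) ai by (simp add: mult.commute)
    have XX: "?X ** mpowi ?P (- int c) = mat 1"
      using mpowi_add[OF invertible_cyc_uniformizer[where 'k='k and 'n='n], of "int c" "- int c"] by simp
    have "mbound (M * C * L) (matrix_inv b ** ?X ** a ** matrix_inv a ** mpowi ?P (- int c))"
      by (intro mbound_mult bd ab L)
    moreover have "matrix_inv b ** ?X ** a ** matrix_inv a ** mpowi ?P (- int c) = matrix_inv b ** (?X ** mpowi ?P (- int c))"
      using ai by (simp add: matrix_mul_assoc)
    ultimately have b2: "mbound ?\<beta> (matrix_inv b)"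
      by (simp add: XX)
    show "mbound ?\<beta> h \<and> mbound ?\<beta> (matrix_inv h)"
      unfolding h(1) block_diag_inverse(2)[OF ai h(3)] mbound_block_diag
      using ab b1 b2 MC mbound_mono[of C _ ?\<beta>] by auto
  qed
qed

context
  fixes \<Phi> :: "'k::nonarch_local_field ^ 'n::finite ^ 'n \<Rightarrow> 'k ^ 'n ^ 'n \<Rightarrow> int" and M \<delta> :: real
  assumes M: "M \<ge> 1" and \<delta>: "\<delta> > 0"
    and bd: "\<And>A B. absval (det (mat 1 - A ** B)) = 1 \<Longrightarrow> \<Phi> A B \<noteq> 0 \<Longrightarrow> mbound M A \<and> mbound M B"
    and small1: "\<And>A B. mbound \<delta> A \<Longrightarrow> mbound M B \<Longrightarrow> \<Phi> A B = \<Phi> 0 B"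
    and small2: "\<And>A B. mbound M A \<Longrightarrow> mbound \<delta> B \<Longrightarrow> \<Phi> A B = \<Phi> A 0"
begin

text \<open>For j < J the second coordinate is small, its exponent c - j being large; for j \<ge> J
  the first one is; for J \<le> j \<le> c - J both are, and the term is \<open>\<Phi> 0 0\<close>.
  The two ends contribute amounts independent of \<open>c\<close>, collected in
  \<open>K\<close>.\<close>

lemma shifted_sum_affine:
  fixes Rp :: "('k ^ 'n ^ 'n) set"
  assumes fin: "finite Rp" and inv: "\<And>a. a \<in> Rp \<Longrightarrow> invertible a"
  defines "E \<equiv> \<lambda>c a j b. \<Phi> (matrix_inv a ** mpowi (cyc uniformizer) j ** b)
    (matrix_inv b ** mpowi (cyc uniformizer) (c - j) ** a)"
  obtains J K :: int where "J \<ge> 1"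
    "\<And>c a j b. c \<ge> 1 \<Longrightarrow> a \<in> Rp \<Longrightarrow> b \<in> Rp \<Longrightarrow> E c a j b \<noteq> 0 \<Longrightarrow> j \<in> {- J<..<c + J}"
    "\<And>c. c \<ge> 2 * J \<Longrightarrow> (\<Sum>a\<in>Rp. \<Sum>b\<in>Rp. \<Sum>j\<in>{- J<..<c + J}. E c a j b)
       = K + (c - 2 * J + 1) * (int (card Rp))\<^sup>2 * \<Phi> 0 0"
proof -
  let ?P = "cyc uniformizer :: 'k ^ 'n ^ 'n"
  let ?r = "rabs TYPE('k)"
  obtain c1 where c1: "c1 \<ge> 1" "\<forall>a\<in>Rp. mbound c1 (id a)"
    using mbound_finite[OF fin, of id] by blast
  obtain c2 where c2: "c2 \<ge> 1" "\<forall>a\<in>Rp. mbound c2 (matrix_inv a)"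
    using mbound_finite[OF fin, of matrix_inv] by blast
  let ?C = "c1 * c2"
  have C: "?C \<ge> 1"
    using c1(1) c2(1) mult_mono[of 1 c1 1 c2] by simp
  \<comment> \<open>One \<open>t\<close> serves both to make coordinates with large exponent
    \<open>\<delta>\<close>-small and to exclude very negative exponents.\<close>
  obtain t where t: "?r ^ t < min 1 \<delta> / (?C * M)"
    using real_arch_pow_inv[of "min 1 \<delta> / (?C * M)" ?r] C M \<delta> by auto
  have CM: "?C * M > 0" "?C \<le> ?C * M"
    using C M mult_left_mono[of 1 M ?C] by auto
  have t1: "?C * M * ?r ^ t < 1" and t2: "?C * ?r ^ t \<le> \<delta>"
  proof -
    have *: "?C * M * ?r ^ t < min 1 \<delta>"
      using t CM(1) by (simp add: field_simps)
    then show "?C * M * ?r ^ t < 1"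
      by simp
    have "?C * ?r ^ t \<le> ?C * M * ?r ^ t"
      using CM(2) by (intro mult_right_mono) auto
    then show "?C * ?r ^ t \<le> \<delta>"
      using * by simp
  qed
  \<comment> \<open>The factor n converts bounds on entries to \<open>enorm\<close>, which is an
    n-th power; the added 1 ensures \<open>J \<ge> 1\<close>.\<close>
  define J where "J = int (CARD('n) * t) + 1"
  have J: "J \<ge> 1"
    by (simp add: J_def)
  have Psmall: "mbound (?r ^ t) (mpowi ?P j)" if "j \<ge> J" for j
  proof (rule EE_small_mbound)
    have "enorm (mpowi ?P j) \<le> ?r powi int (CARD('n) * t)"
      unfolding enorm_mpowi_cyc rabs_powi_le_iff using that by (simp add: J_def)
    then show "enorm (mpowi ?P j) \<le> ?r ^ (CARD('n) * t)"
      by (simp only: power_int_of_nat)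
  qed simp
  have small: "mbound \<delta> (matrix_inv a ** mpowi ?P j ** b)" if "a \<in> Rp" "b \<in> Rp" "j \<ge> J" for a b j
  proof -
    have "mbound (c2 * ?r ^ t * c1) (matrix_inv a ** mpowi ?P j ** b)"
      using c1(2) c2(2) that Psmall[OF that(3)] by (intro mbound_mult) auto
    then show ?thesis
      using t2 by (auto intro: mbound_mono simp: algebra_simps)
  qed
  \<comment> \<open>For a very negative exponent, the tiny matrix \<Pi>^(-j) times the bounded
    matrix \<Pi>^j would make the diagonal entries of the identity smaller than 1.\<close>
  have large: "j > - J" if ab: "a \<in> Rp" "b \<in> Rp" and m: "mbound M (matrix_inv a ** mpowi ?P j ** b)" for a b j
  proof (rule ccontr)
    assume "\<not> j > - J"
    then have "mbound (?r ^ t) (mpowi ?P (- j))"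
      by (intro Psmall) simp
    moreover have "mbound (c1 * M * c2) (a ** (matrix_inv a ** mpowi ?P j ** b) ** matrix_inv b)"
      using c1(2) c2(2) ab m by (intro mbound_mult) auto
    ultimately have "mbound (?r ^ t * (c1 * M * c2)) (mpowi ?P (- j) ** (a ** (matrix_inv a ** mpowi ?P j ** b) ** matrix_inv b))"
      by (rule mbound_mult)
    moreover have "a ** (matrix_inv a ** mpowi ?P j ** b) ** matrix_inv b = mpowi ?P j"
      using inv ab by (simp add: matrix_mul_assoc)
    ultimately have "mbound (?r ^ t * (c1 * M * c2)) (mat 1 :: 'k ^ 'n ^ 'n)"
      by simp
    then have "absval ((mat 1 :: 'k ^ 'n ^ 'n) $ undefined $ undefined) \<le> ?r ^ t * (c1 * M * c2)"
      by (rule mboundD)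
    then show False
      using t1 by (simp add: mat_def algebra_simps)
  qed
  have det: "absval (det (mat 1 - matrix_inv a ** mpowi ?P j ** b ** (matrix_inv b ** mpowi ?P (c - j) ** a))) = 1"
    if "a \<in> Rp" "b \<in> Rp" "c \<ge> 1" for a b c j
    using absval_det_conj_cyc[OF inv[OF that(1)] inv[OF that(2)] that(3)] .
  \<comment> \<open>When \<open>B\<close> is not bounded by \<open>M\<close>, both values vanish by
    \<open>bd\<close>; otherwise \<open>small1\<close> applies.\<close>
  have S1: "\<Phi> A B = \<Phi> 0 B" if "absval (det (mat 1 - A ** B)) = 1" "mbound \<delta> A" for A B
  proof (cases "mbound M B")
    case False
    have "\<Phi> A B = 0"
      using bd[OF that(1)] False by blast
    moreover have "\<Phi> 0 B = 0"
      using bd[of 0 B] False by auto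
    ultimately show ?thesis
      by simp
  qed (use small1 that in blast)
  have S2: "\<Phi> A B = \<Phi> A 0" if "absval (det (mat 1 - A ** B)) = 1" "mbound \<delta> B" for A B
  proof (cases "mbound M A")
    case False
    have "\<Phi> A B = 0"
      using bd[OF that(1)] False by blast
    moreover have "\<Phi> A 0 = 0"
      using bd[of A 0] False by auto
    ultimately show ?thesis
      by simp
  qed (use small2 that in blast)
  define L where "L a b = (\<Sum>j\<in>{- J<..<J}. \<Phi> (matrix_inv a ** mpowi ?P j ** b) 0)" for a b
  define R where "R a b = (\<Sum>j\<in>{- J<..<J}. \<Phi> 0 (matrix_inv b ** mpowi ?P j ** a))" for a b
  show ?thesis
  proof (rule that[OF J])
    fix c j :: int and a b
    assume c: "c \<ge> 1" and ab: "a \<in> Rp" "b \<in> Rp" and nz: "E c a j b \<noteq> 0"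
    have "mbound M (matrix_inv a ** mpowi ?P j ** b) \<and> mbound M (matrix_inv b ** mpowi ?P (c - j) ** a)"
      by (rule bd[OF det[OF ab c]]) (use nz in \<open>simp add: E_def\<close>)
    then have "j > - J" "c - j > - J"
      using large[OF ab] large[OF ab(2,1)] by blast+
    then show "j \<in> {- J<..<c + J}"
      by simp
  next
    fix c :: int
    assume c: "c \<ge> 2 * J"
    have c1: "c \<ge> 1"
      using c J by simp
    have "(\<Sum>j\<in>{- J<..<c + J}. E c a j b) = L a b + (c - 2 * J + 1) * \<Phi> 0 0 + R a b" if ab: "a \<in> Rp" "b \<in> Rp" for a b
    proof -
      note D = det[OF ab c1]
      have e1: "E c a j b = \<Phi> (matrix_inv a ** mpowi ?P j ** b) 0" if "j < J" for j
        unfolding E_def using c that by (intro S2[OF D] small[OF ab(2,1)]) simp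
      have e2: "E c a j b = \<Phi> 0 (matrix_inv b ** mpowi ?P (c - j) ** a)" if "j \<ge> J" for j
        unfolding E_def using that by (intro S1[OF D] small[OF ab])
      have e3: "E c a j b = \<Phi> 0 0" if "j \<ge> J" "j \<le> c - J" for j
      proof -
        have "mbound \<delta> (matrix_inv b ** mpowi ?P (c - j) ** a)"
          using that by (intro small[OF ab(2,1)]) simp
        then show ?thesis
          unfolding e2[OF that(1)] by (intro S2) simp_all
      qed
      have "{- J<..<c + J} = ({- J<..<J} \<union> {J..c - J}) \<union> {c - J<..<c + J}"
        using c J by auto
      then have "(\<Sum>j\<in>{- J<..<c + J}. E c a j b) = (\<Sum>j\<in>({- J<..<J} \<union> {J..c - J}) \<union> {c - J<..<c + J}. E c a j b)"
        by simp
      also have "\<dots> = (\<Sum>j\<in>{- J<..<J} \<union> {J..c - J}. E c a j b) + (\<Sum>j\<in>{c - J<..<c + J}. E c a j b)"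
        using c by (intro sum.union_disjoint) auto
      also have "(\<Sum>j\<in>{- J<..<J} \<union> {J..c - J}. E c a j b) = (\<Sum>j\<in>{- J<..<J}. E c a j b) + (\<Sum>j\<in>{J..c - J}. E c a j b)"
        by (intro sum.union_disjoint) auto
      also have "(\<Sum>j\<in>{- J<..<J}. E c a j b) = L a b"
        unfolding L_def by (intro sum.cong refl e1) simp
      also have "(\<Sum>j\<in>{J..c - J}. E c a j b) = (\<Sum>j\<in>{J..c - J}. \<Phi> 0 0)"
        by (intro sum.cong refl e3) simp_all
      also have "\<dots> = (c - 2 * J + 1) * \<Phi> 0 0"
        using c by simp
      also have "(\<Sum>j\<in>{c - J<..<c + J}. E c a j b) = R a b"
        unfolding R_def
        by (rule sum.reindex_bij_witness[of _ "\<lambda>i. c - i" "\<lambda>i. c - i"]) (use c e2 in auto)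
      finally show ?thesis .
    qed
    then have "(\<Sum>a\<in>Rp. \<Sum>b\<in>Rp. \<Sum>j\<in>{- J<..<c + J}. E c a j b)
        = (\<Sum>a\<in>Rp. \<Sum>b\<in>Rp. L a b + (c - 2 * J + 1) * \<Phi> 0 0 + R a b)"
      by (intro sum.cong refl) auto
    also have "\<dots> = (\<Sum>a\<in>Rp. \<Sum>b\<in>Rp. L a b + R a b) + (c - 2 * J + 1) * (int (card Rp))\<^sup>2 * \<Phi> 0 0"
    proof -
      have "(\<Sum>a\<in>Rp. \<Sum>b\<in>Rp. L a b + W + R a b) = (\<Sum>a\<in>Rp. \<Sum>b\<in>Rp. L a b + R a b) + (int (card Rp))\<^sup>2 * W" for W
        by (simp add: sum.distrib power2_eq_square)
      then show ?thesis
        by (simp only: mult_ac)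
    qed
    finally show "(\<Sum>a\<in>Rp. \<Sum>b\<in>Rp. \<Sum>j\<in>{- J<..<c + J}. E c a j b)
        = (\<Sum>a\<in>Rp. \<Sum>b\<in>Rp. L a b + R a b) + (c - 2 * J + 1) * (int (card Rp))\<^sup>2 * \<Phi> 0 0" .
  qed
qed

end

lemma finite_support_cosets:
  fixes \<Phi> :: "'k::nonarch_local_field ^ 'n::finite ^ 'n \<Rightarrow> 'k ^ 'n ^ 'n \<Rightarrow> 'b::zero"
  assumes bd: "\<And>A B. absval (det (mat 1 - A ** B)) = 1 \<Longrightarrow> \<Phi> A B \<noteq> 0 \<Longrightarrow> mbound M A \<and> mbound M B"
    and M: "M \<ge> 1" and s: "0 < s" "s < 1" and c: "c mod CARD('n) = 1 mod CARD('n)" "c \<ge> 1"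
    and F: "\<And>a b. invertible a \<Longrightarrow> invertible b \<Longrightarrow>
      F (block_diag a b) = \<Phi> (matrix_inv a ** b) (matrix_inv b ** mpowi (cyc uniformizer) (int c) ** a)"
  shows "finite (gcos H_points s ` {h \<in> DD. F h \<noteq> 0})"
proof (rule finite_subset[OF image_mono finite_bounded_cosets[OF c(1) M s]])
  show "{h \<in> DD. F h \<noteq> 0} \<subseteq> {block_diag a b :: ('k, 'n) mat2n | a b.
    absval (det a) = 1 \<and> invertible b \<and> mbound M (matrix_inv a ** b) \<and>
    mbound M (matrix_inv b ** mpowi (cyc uniformizer) (int c) ** a)}"
  proof
    fix h :: "('k, 'n) mat2n"
    assume h: "h \<in> {h \<in> DD. F h \<noteq> 0}"
    then obtain a b where ab: "h = block_diag a b" "absval (det a) = 1" "invertible b"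
      unfolding DD_def by blast
    have ai: "invertible a"
      by (rule absval_det_1_invertible[OF ab(2)])
    have "absval (det (mat 1 - matrix_inv a ** b ** (matrix_inv b ** mpowi (cyc uniformizer) (int c) ** a))) = 1"
      using absval_det_conj_cyc[OF ai ab(3), of "int c" 0] c(2) by simp
    then have "mbound M (matrix_inv a ** b) \<and> mbound M (matrix_inv b ** mpowi (cyc uniformizer) (int c) ** a)"
      by (rule bd) (use h F[OF ai ab(3)] ab(1) in simp)
    then show "h \<in> {block_diag a b | a b.
      absval (det a) = 1 \<and> invertible b \<and> mbound M (matrix_inv a ** b) \<and>
      mbound M (matrix_inv b ** mpowi (cyc uniformizer) (int c) ** a)}"
      using ab by blast
  qed
qed

section \<open>Congruences for sums over cosets\<close>

lemma gcos_conj: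
  fixes a v :: "'k::nonarch_local_field ^ 'n::finite ^ 'n"
  assumes "invertible a" "invertible v"
  shows "v ** a \<in> gcos {a. invertible a} s a \<longleftrightarrow> mbound s (matrix_inv a ** (v - mat 1) ** a)"
proof -
  have "matrix_inv a ** (v - mat 1) ** a = matrix_inv a ** (v ** a) - mat 1"
    using assms(1) by (simp add: matrix_diff_ldistrib matrix_diff_rdistrib matrix_mul_assoc)
  then show ?thesis
    using assms by (simp add: gcos_def invertible_mult)
qed

lemma gcos_some_mem:
  fixes h :: "('k::nonarch_local_field, 'n::finite) mat2n"
  assumes "0 < s" "s < 1" "h \<in> H_points"
  shows "(SOME x. x \<in> gcos H_points s h) \<in> gcos H_points s h"
  by (rule someI[of "\<lambda>x. x \<in> gcos H_points s h", OF gcos_self[OF mat_group_H_points assms]])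

text \<open>Pairs of lattices stable under \<open>z\<close>; for \<open>z = w - 1\<close> these contain all fixed points of \<open>w\<close>.\<close>

definition stable_pairs :: "'k::nonarch_local_field ^ 'n::finite ^ 'n \<Rightarrow> ('k, 'n) mat2n set" where
  "stable_pairs z = {block_diag a b | a b. mbound 1 (matrix_inv a ** z ** a) \<and> mbound 1 (matrix_inv b ** z ** b)}"

lemma block_diag_stable_pairs:
  "block_diag a b \<in> stable_pairs z \<longleftrightarrow> mbound 1 (matrix_inv a ** z ** a) \<and> mbound 1 (matrix_inv b ** z ** b)"
  by (auto simp: stable_pairs_def)

text \<open>Left multiplication by the unit 1 + z, embedded diagonally, permutes the cosets in
  \<open>DD\<close> and preserves both \<open>F\<close> and stability. A coset fixed by the p^R-th
  power is stable, since a conjugate bounded by \<open>s\<close> is bounded by 1; so orbit counting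
  applies to the unstable part.\<close>

lemma unstable_sum_dvd:
  fixes F :: "('k::nonarch_local_field, 'n::finite) mat2n \<Rightarrow> int" and z :: "'k ^ 'n ^ 'n"
  assumes z: "z \<in> EE" "enorm z < 1" and p: "prime p" "absval (of_nat p :: 'k) < 1" and s: "0 < s" "s < 1"
    and FT: "\<And>t h. t \<in> TT \<Longrightarrow> h \<in> H_points \<Longrightarrow> F (t ** h) = F h"
    and FK: "\<And>h x. h \<in> H_points \<Longrightarrow> x \<in> gcos H_points s h \<Longrightarrow> F x = F h"
    and fin: "finite (gcos H_points s ` {h \<in> DD. F h \<noteq> 0})"
  shows "int p ^ Suc R dvd
    (\<Sum>C\<in>gcos H_points s ` {h \<in> DD. F h \<noteq> 0 \<and> h \<notin> stable_pairs (mpow (mat 1 + z) (p ^ R) - mat 1)}. F (SOME h. h \<in> C))"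
proof -
  let ?w = "mat 1 + z"
  let ?u = "block_diag ?w ?w"
  let ?z = "mpow ?w (p ^ R) - mat 1"
  let ?T = "stable_pairs ?z"
  let ?S = "gcos H_points s ` {h \<in> DD. F h \<noteq> 0 \<and> h \<notin> ?T}"
  note HG = mat_group_H_points[where 'a='k and 'b='n]
  have wE: "?w \<in> EE"
    using z(1) by (intro EE_add EE_mat)
  have "enorm (z + mat 1) = enorm (mat 1 :: 'k ^ 'n ^ 'n)"
    using z(2) by (intro enorm_add_eq) (simp add: enorm_mat)
  then have w1: "enorm ?w = 1"
    by (simp add: enorm_mat add.commute)
  have wi: "invertible ?w"
    using EE_unit_iff[OF wE] w1 absval_det_1_invertible by blast
  have uO: "?u \<in> OT"
    using wE w1 unfolding OT_def by blast
  have uT: "?u \<in> TT"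
    using uO OT_sub by blast
  have uH: "?u \<in> H_points"
    using uT TT_sub by blast
  define \<sigma> :: "('k, 'n) mat2n set \<Rightarrow> ('k, 'n) mat2n set" where "\<sigma> = (\<lambda>C. (\<lambda>x. ?u ** x) ` C)"
  have sig1: "\<sigma> (gcos H_points s h) = gcos H_points s (?u ** h)" if "h \<in> H_points" for h
    unfolding \<sigma>_def by (rule gcos_mult_left[OF HG s uH that])
  have powH: "block_diag (mpow ?w i) (mpow ?w i) \<in> H_points" for i
    using invertible_mpow[OF wi] by (simp add: block_diag_in_H)
  have sig: "(\<sigma> ^^ i) (gcos H_points s h) = gcos H_points s (block_diag (mpow ?w i) (mpow ?w i) ** h)" if h: "h \<in> H_points" for i h
  proof (induction i)
    case 0
    then show ?case
      by (simp add: block_diag_one)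
  next
    case (Suc i)
    have "(\<sigma> ^^ Suc i) (gcos H_points s h) = \<sigma> (gcos H_points s (block_diag (mpow ?w i) (mpow ?w i) ** h))"
      using Suc by simp
    also have "\<dots> = gcos H_points s (?u ** (block_diag (mpow ?w i) (mpow ?w i) ** h))"
      by (rule sig1[OF H_points_mult[OF powH h]])
    also have "?u ** (block_diag (mpow ?w i) (mpow ?w i) ** h) = block_diag (mpow ?w (Suc i)) (mpow ?w (Suc i)) ** h"
      by (simp add: matrix_mul_assoc block_diag_mult)
    finally show ?case .
  qed
  have fixed: "(\<sigma> ^^ i) (gcos H_points s (block_diag a b)) = gcos H_points s (block_diag a b) \<longleftrightarrow>
      mbound s (matrix_inv a ** (mpow ?w i - mat 1) ** a) \<and> mbound s (matrix_inv b ** (mpow ?w i - mat 1) ** b)"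
    if "invertible a" "invertible b" for a b i
  proof -
    have abH: "block_diag a b \<in> H_points"
      using that by (simp add: block_diag_in_H)
    have mi: "invertible (mpow ?w i)"
      by (rule invertible_mpow[OF wi])
    have "(\<sigma> ^^ i) (gcos H_points s (block_diag a b)) = gcos H_points s (block_diag (mpow ?w i ** a) (mpow ?w i ** b))"
      unfolding sig[OF abH] block_diag_mult ..
    moreover have "block_diag (mpow ?w i ** a) (mpow ?w i ** b) \<in> H_points"
      using that mi by (simp add: block_diag_in_H invertible_mult)
    ultimately show ?thesis
      using gcos_eq_iff[OF HG s abH, of "block_diag (mpow ?w i ** a) (mpow ?w i ** b)"]
        gcos_H_iff[OF that invertible_mult[OF mi that(1)] invertible_mult[OF mi that(2)], of s]
        gcos_conj[OF that(1) mi, of s] gcos_conj[OF that(2) mi, of s] by simp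
  qed
  have Fsome: "F (SOME x. x \<in> gcos H_points s h) = F h" if "h \<in> H_points" for h
    by (rule FK[OF that gcos_some_mem[OF s that]])
  show ?thesis
  proof (rule prime_power_orbits_dvd_sum[OF p(1)])
    show "finite ?S"
      by (rule finite_subset[OF image_mono fin]) blast
  next
    fix C
    assume "C \<in> ?S"
    then obtain h where h: "h \<in> DD" "F h \<noteq> 0" "h \<notin> ?T" "C = gcos H_points s h"
      by blast
    obtain a b where ab: "h = block_diag a b" "absval (det a) = 1" "invertible b"
      using h(1) unfolding DD_def by blast
    have ai: "invertible a"
      by (rule absval_det_1_invertible[OF ab(2)])
    have hH: "h \<in> H_points"
      using h(1) DD_sub by blast
    have uh: "?u ** h \<in> H_points"
      by (rule H_points_mult[OF uH hH])
    have Fu: "F (?u ** h) = F h"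
      by (rule FT[OF uT hH])
    have "?u ** h \<in> DD"
      using TT_mult_DD[OF uT h(1)] uO by blast
    moreover have "?u ** h \<notin> ?T"
    proof -
      have com: "?w ** ?z = ?z ** ?w"
        using wE by (intro EE_commute EE_diff EE_mpow EE_mat)
      show ?thesis
        using h(3) unfolding ab(1) block_diag_mult block_diag_stable_pairs
          conj_mult_commute[OF ai wi com] conj_mult_commute[OF ab(3) wi com] .
    qed
    ultimately show "\<sigma> C \<in> ?S"
      unfolding h(4) sig1[OF hH] using Fu h(2) by (intro imageI CollectI conjI) auto
    show "F (SOME h. h \<in> \<sigma> C) = F (SOME h. h \<in> C)"
      unfolding h(4) sig1[OF hH] Fsome[OF hH] Fsome[OF uh] by (rule Fu)
    show "\<exists>N. (\<sigma> ^^ (p ^ N)) C = C"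
    proof -
      obtain N1 where N1: "\<forall>N\<ge>N1. mbound s (matrix_inv a ** (mpow ?w (p ^ N) - mat 1) ** a)"
        using EE_conj_small[OF z p(2) s(1), of a] by blast
      obtain N2 where N2: "\<forall>N\<ge>N2. mbound s (matrix_inv b ** (mpow ?w (p ^ N) - mat 1) ** b)"
        using EE_conj_small[OF z p(2) s(1), of b] by blast
      have "(\<sigma> ^^ (p ^ max N1 N2)) C = C"
        unfolding h(4) ab(1) fixed[OF ai ab(3)] using N1 N2 by simp
      then show ?thesis
        by blast
    qed
    show "(\<sigma> ^^ (p ^ R)) C \<noteq> C"
    proof
      assume "(\<sigma> ^^ (p ^ R)) C = C"
      then have "mbound s (matrix_inv a ** ?z ** a) \<and> mbound s (matrix_inv b ** ?z ** b)"
        unfolding h(4) ab(1) fixed[OF ai ab(3)] .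
      then have "h \<in> ?T"
        unfolding ab(1) block_diag_stable_pairs using s(2) by (auto intro: mbound_mono)
      then show False
        using h(3) by blast
    qed
  qed
qed

text \<open>A power of \<Pi> normalises the second block to unit determinant and commutes with
  \<open>z\<close>. Hence stable cosets in \<open>DD\<close> are given by two representatives and an
  exponent \<open>j\<close>, which the determinant recovers; exponents outside \<open>I\<close>
  contribute 0.\<close>

lemma stable_sum_eq:
  fixes F :: "('k::nonarch_local_field, 'n::finite) mat2n \<Rightarrow> int" and z :: "'k ^ 'n ^ 'n" and I :: "int set"
  assumes z: "z \<in> EE" and s: "0 < s" "s < 1"
    and FK: "\<And>h x. h \<in> H_points \<Longrightarrow> x \<in> gcos H_points s h \<Longrightarrow> F x = F h"
    and Rp: "finite Rp" "\<And>a. a \<in> Rp \<Longrightarrow> absval (det a) = 1 \<and> mbound 1 (matrix_inv a ** z ** a)"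
    and rep: "\<And>a. absval (det a) = 1 \<Longrightarrow> mbound 1 (matrix_inv a ** z ** a) \<Longrightarrow> \<exists>x\<in>Rp. x \<in> gcos {a. invertible a} s a"
    and uniq: "\<And>a b. a \<in> Rp \<Longrightarrow> b \<in> Rp \<Longrightarrow> b \<in> gcos {a. invertible a} s a \<Longrightarrow> b = a"
    and I: "finite I" "\<And>a b j. a \<in> Rp \<Longrightarrow> b \<in> Rp \<Longrightarrow> F (block_diag a (mpowi (cyc uniformizer) j ** b)) \<noteq> 0 \<Longrightarrow> j \<in> I"
  shows "(\<Sum>C\<in>gcos H_points s ` {h \<in> DD. F h \<noteq> 0 \<and> h \<in> stable_pairs z}. F (SOME h. h \<in> C))
    = (\<Sum>a\<in>Rp. \<Sum>b\<in>Rp. \<Sum>j\<in>I. F (block_diag a (mpowi (cyc uniformizer) j ** b)))"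
proof -
  let ?P = "cyc uniformizer :: 'k ^ 'n ^ 'n"
  let ?G = "{a :: 'k ^ 'n ^ 'n. invertible a}"
  let ?S = "gcos H_points s ` {h \<in> DD. F h \<noteq> 0 \<and> h \<in> stable_pairs z}"
  note HG = mat_group_H_points[where 'a='k and 'b='n]
  note G = mat_group_invertible[where 'a='k and 'm='n]
  define E where "E = (Rp \<times> Rp) \<times> I"
  define m0 where "m0 = (\<lambda>e :: (('k ^ 'n ^ 'n) \<times> ('k ^ 'n ^ 'n)) \<times> int. block_diag (fst (fst e)) (mpowi ?P (snd e) ** snd (fst e)))"
  define m where "m e = gcos H_points s (m0 e)" for e
  have Pi: "invertible (mpowi ?P j)" for j
    by (rule invertible_mpowi[OF invertible_cyc_uniformizer])
  have Ri: "invertible a" if "a \<in> Rp" for a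
    using Rp(2)[OF that] absval_det_1_invertible by blast
  have m0H: "m0 e \<in> H_points" and m0D: "m0 e \<in> DD" and m0T: "m0 e \<in> stable_pairs z" if eE: "e \<in> E" for e
  proof -
    obtain a b j where e: "e = ((a, b), j)" "a \<in> Rp" "b \<in> Rp"
      using eE unfolding E_def by auto
    show "m0 e \<in> DD"
      unfolding e(1) m0_def using Rp(2)[OF e(2)] Ri[OF e(3)] Pi by (simp add: block_diag_in_DD invertible_mult)
    then show "m0 e \<in> H_points"
      using DD_sub by blast
    have "mbound 1 (matrix_inv (mpowi ?P j ** b) ** z ** (mpowi ?P j ** b))"
      using Rp(2)[OF e(3)] conj_mult_commute[OF Ri[OF e(3)] Pi EE_commute[OF EE_mpowi_cyc z], of j] by simp
    then show "m0 e \<in> stable_pairs z"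
      unfolding e(1) m0_def using Rp(2)[OF e(2)] by (simp add: block_diag_stable_pairs)
  qed
  have Fsome: "F (SOME x. x \<in> gcos H_points s h) = F h" if "h \<in> H_points" for h
    by (rule FK[OF that gcos_some_mem[OF s that]])
  have shift: "mpowi ?P j ** b' \<in> gcos ?G s (mpowi ?P j ** b) \<longleftrightarrow> b' \<in> gcos ?G s b" if "invertible b" "invertible b'" for b b' j
  proof -
    have "matrix_inv (mpowi ?P j ** b) ** (mpowi ?P j ** b') = matrix_inv b ** b'"
      unfolding matrix_inv_mult[OF Pi that(1)] using Pi[of j] by (simp add: matrix_mul_assoc[symmetric])
    then show ?thesis
      using that Pi by (simp add: gcos_def invertible_mult)
  qed
  have gdet: "absval (det x) = absval (det a)" if xa: "x \<in> gcos ?G s a" and ai: "invertible a" for x a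
  proof -
    have "matrix_inv a ** x \<in> GLO"
      using xa cong_sub_GLO[OF s(2)] gcos_iff_cong[OF G s, of a x] ai by auto
    then have "absval (inverse (det a) * det x) = 1"
      using ai by (simp add: GLO_def det_mul det_matrix_inv)
    then show ?thesis
      using ai by (simp add: absval_mult absval_inverse absval_divide invertible_det_nz inverse_eq_divide)
  qed
  have inj: "inj_on m E"
  proof (rule inj_onI)
    fix e e'
    assume e: "e \<in> E" and e': "e' \<in> E" and eq: "m e = m e'"
    obtain a b j where ab: "e = ((a, b), j)" "a \<in> Rp" "b \<in> Rp"
      using e unfolding E_def by auto
    obtain a' b' j' where ab': "e' = ((a', b'), j')" "a' \<in> Rp" "b' \<in> Rp"
      using e' unfolding E_def by auto
    have "m0 e' \<in> gcos H_points s (m0 e)"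
      using eq gcos_eq_iff[OF HG s m0H[OF e] m0H[OF e']] unfolding m_def by simp
    then have mem: "a' \<in> gcos ?G s a" "mpowi ?P j' ** b' \<in> gcos ?G s (mpowi ?P j ** b)"
      using gcos_H_iff[OF Ri[OF ab(2)] invertible_mult[OF Pi[of j] Ri[OF ab(3)]] Ri[OF ab'(2)] invertible_mult[OF Pi[of j'] Ri[OF ab'(3)]], of s]
      unfolding ab(1) ab'(1) m0_def by simp_all
    have "absval (det (mpowi ?P j' ** b')) = absval (det (mpowi ?P j ** b))"
      by (rule gdet[OF mem(2) invertible_mult[OF Pi Ri[OF ab(3)]]])
    then have "rabs TYPE('k) powi j' = rabs TYPE('k) powi j"
      using Rp(2)[OF ab(3)] Rp(2)[OF ab'(3)]
      by (simp add: det_mul absval_mult det_mpowi absval_power_int absval_det_cyc)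
    then have jj: "j' = j"
      by (simp only: rabs_powi_eq_iff)
    have "b' = b"
      using mem(2) uniq[OF ab(3) ab'(3)] shift[OF Ri[OF ab(3)] Ri[OF ab'(3)]] unfolding jj by blast
    moreover have "a' = a"
      by (rule uniq[OF ab(2) ab'(2) mem(1)])
    ultimately show "e = e'"
      unfolding ab(1) ab'(1) jj by simp
  qed
  have sub: "?S \<subseteq> m ` E"
  proof
    fix C
    assume "C \<in> ?S"
    then obtain h where h: "h \<in> DD" "F h \<noteq> 0" "h \<in> stable_pairs z" "C = gcos H_points s h"
      by blast
    obtain a b where ab: "h = block_diag a b" "absval (det a) = 1" "invertible b"
      using h(1) unfolding DD_def by blast
    have ai: "invertible a"
      by (rule absval_det_1_invertible[OF ab(2)])
    have st: "mbound 1 (matrix_inv a ** z ** a)" "mbound 1 (matrix_inv b ** z ** b)"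
      using h(3) unfolding ab(1) block_diag_stable_pairs by blast+
    obtain x where x: "x \<in> Rp" "x \<in> gcos ?G s a"
      using rep[OF ab(2) st(1)] by blast
    have "det b \<noteq> 0"
      using ab(3) by (simp add: invertible_det_nz)
    then obtain j where j: "absval (det b) = rabs TYPE('k) powi j"
      by (rule absval_discrete)
    let ?b = "mpowi ?P (- j) ** b"
    have bi: "invertible ?b"
      by (rule invertible_mult[OF Pi ab(3)])
    have "absval (det ?b) = rabs TYPE('k) powi (- j) * rabs TYPE('k) powi j"
      by (simp add: det_mul absval_mult det_mpowi absval_power_int absval_det_cyc j)
    also have "\<dots> = 1"
      by (simp add: power_int_minus)
    finally have "absval (det ?b) = 1" .
    moreover have "mbound 1 (matrix_inv ?b ** z ** ?b)"
      using st(2) conj_mult_commute[OF ab(3) Pi EE_commute[OF EE_mpowi_cyc z], of "- j"] by simp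
    ultimately obtain y where y: "y \<in> Rp" "y \<in> gcos ?G s ?b"
      using rep by blast
    have "mpowi ?P j ** mpowi ?P (- j) = mat 1"
      using mpowi_add[OF invertible_cyc_uniformizer[where 'k='k and 'n='n], of j "- j"] by simp
    then have b_eq: "mpowi ?P j ** ?b = b"
      by (simp add: matrix_mul_assoc)
    have "mpowi ?P j ** y \<in> gcos ?G s (mpowi ?P j ** ?b)"
      unfolding shift[OF bi Ri[OF y(1)]] by (rule y(2))
    then have mem: "block_diag x (mpowi ?P j ** y) \<in> gcos H_points s h"
      using gcos_H_iff[OF ai ab(3) Ri[OF x(1)] invertible_mult[OF Pi[of j] Ri[OF y(1)]], of s] x(2)
      unfolding ab(1) b_eq by blast
    have hH: "h \<in> H_points"
      using h(1) DD_sub by blast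
    have "F (block_diag x (mpowi ?P j ** y)) \<noteq> 0"
      using FK[OF hH mem] h(2) by simp
    then have e: "((x, y), j) \<in> E"
      using I(2)[OF x(1) y(1)] x(1) y(1) unfolding E_def by blast
    have mem': "m0 ((x, y), j) \<in> gcos H_points s h"
      using mem unfolding m0_def by simp
    have "m ((x, y), j) = C"
      unfolding m_def h(4) gcos_eq_iff[OF HG s hH m0H[OF e]] by (rule mem')
    then show "C \<in> m ` E"
      using e by blast
  qed
  have "(\<Sum>C\<in>?S. F (SOME h. h \<in> C)) = (\<Sum>C\<in>m ` E. F (SOME h. h \<in> C))"
  proof (rule sum.mono_neutral_left[OF _ sub])
    show "finite (m ` E)"
      unfolding E_def using Rp(1) I(1) by blast
    show "\<forall>C\<in>m ` E - ?S. F (SOME h. h \<in> C) = 0"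
    proof
      fix C
      assume C: "C \<in> m ` E - ?S"
      then obtain e where e: "e \<in> E" "C = gcos H_points s (m0 e)"
        unfolding m_def by blast
      have "F (m0 e) = 0"
        using C e m0D[OF e(1)] m0T[OF e(1)] by blast
      then show "F (SOME h. h \<in> C) = 0"
        unfolding e(2) Fsome[OF m0H[OF e(1)]] .
    qed
  qed
  also have "\<dots> = (\<Sum>e\<in>E. F (SOME h. h \<in> m e))"
    by (simp add: sum.reindex[OF inj])
  also have "\<dots> = (\<Sum>e\<in>E. F (m0 e))"
    unfolding m_def by (intro sum.cong refl Fsome m0H)
  also have "\<dots> = (\<Sum>a\<in>Rp. \<Sum>b\<in>Rp. \<Sum>j\<in>I. F (block_diag a (mpowi ?P j ** b)))"
  proof -
    have c1: "(\<Sum>a\<in>Rp. \<Sum>b\<in>Rp. g a b) = (\<Sum>x\<in>Rp \<times> Rp. g (fst x) (snd x))" for g :: "_ \<Rightarrow> _ \<Rightarrow> int"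
      by (simp add: sum.cartesian_product case_prod_beta)
    have c2: "(\<Sum>x\<in>Rp \<times> Rp. \<Sum>j\<in>I. g x j) = (\<Sum>e\<in>(Rp \<times> Rp) \<times> I. g (fst e) (snd e))" for g :: "_ \<Rightarrow> _ \<Rightarrow> int"
      by (simp add: sum.cartesian_product case_prod_beta)
    show ?thesis
      unfolding E_def m0_def c1 c2 ..
  qed
  finally show ?thesis .
qed

lemma matrix_inv_mult_cancel:
  fixes a b e :: "'a::field ^ 'n::finite ^ 'n"
  assumes "invertible e" "invertible a"
  shows "matrix_inv (e ** a) ** (e ** b) = matrix_inv a ** b"
  unfolding matrix_inv_mult[OF assms] using assms(1) by (simp add: matrix_mul_assoc[symmetric])

text \<open>A torus element commutes with \<open>X0\<close> and cancels in both coordinates.\<close>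

lemma torus_invariant:
  fixes F :: "('k::nonarch_local_field, 'n::finite) mat2n \<Rightarrow> 'b"
  assumes F: "\<And>a b. invertible a \<Longrightarrow> invertible b \<Longrightarrow> F (block_diag a b) = \<Phi> (matrix_inv a ** b) (matrix_inv b ** X0 ** a)"
    and X0: "X0 \<in> EE" and t: "t \<in> TT" and h: "h \<in> H_points"
  shows "F (t ** h) = F h"
proof -
  obtain e where e: "t = block_diag e e" "e \<in> EE" "e \<noteq> 0"
    using t unfolding TT_def by blast
  have ei: "invertible e"
    by (rule EE_invertible[OF e(2,3)])
  obtain a b where ab: "h = block_diag a b" "invertible a" "invertible b"
    using h H_points_cases by blast
  have "matrix_inv (e ** b) ** X0 ** (e ** a) = matrix_inv (e ** b) ** (e ** (X0 ** a))"
  proof -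
    have "X0 ** (e ** a) = e ** (X0 ** a)"
      by (simp add: matrix_mul_assoc EE_commute[OF X0 e(2)])
    then show ?thesis
      by (simp only: matrix_mul_assoc[symmetric])
  qed
  also have "\<dots> = matrix_inv b ** X0 ** a"
    unfolding matrix_inv_mult_cancel[OF ei ab(3)] by (simp add: matrix_mul_assoc)
  finally show ?thesis
    unfolding e(1) ab(1) block_diag_mult F[OF ab(2,3)] F[OF invertible_mult[OF ei ab(2)] invertible_mult[OF ei ab(3)]]
      matrix_inv_mult_cancel[OF ei ab(2)] by simp
qed

text \<open>The difference of the congruences for \<open>k + 1\<close> and \<open>k\<close> is D N^2
  with \<open>N\<close> prime to \<open>p\<close>, so p^(R+1) divides the nonzero integer
  \<open>D\<close>. As \<open>D\<close> does not depend on \<open>R\<close>, choosing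
  \<open>R\<close> from \<open>D\<close> makes this impossible.\<close>

lemma vanishing_sums_imp_zero:
  fixes \<Phi> :: "'k::{nonarch_local_field, field_char_0} ^ 'n::finite ^ 'n \<Rightarrow> 'k ^ 'n ^ 'n \<Rightarrow> int"
    and F :: "nat \<Rightarrow> ('k, 'n) mat2n \<Rightarrow> int"
  assumes M: "M \<ge> 1" and \<delta>: "\<delta> > 0"
    and bd: "\<And>A B. absval (det (mat 1 - A ** B)) = 1 \<Longrightarrow> \<Phi> A B \<noteq> 0 \<Longrightarrow> mbound M A \<and> mbound M B"
    and small1: "\<And>A B. mbound \<delta> A \<Longrightarrow> mbound M B \<Longrightarrow> \<Phi> A B = \<Phi> 0 B"
    and small2: "\<And>A B. mbound M A \<Longrightarrow> mbound \<delta> B \<Longrightarrow> \<Phi> A B = \<Phi> A 0"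
    and s: "0 < s" "s < 1"
    and F: "\<And>k a b. invertible a \<Longrightarrow> invertible b \<Longrightarrow>
      F k (block_diag a b) = \<Phi> (matrix_inv a ** b) (matrix_inv b ** mpowi (cyc uniformizer) (int (CARD('n) * k + 1)) ** a)"
    and FK: "\<And>k h x. h \<in> H_points \<Longrightarrow> x \<in> gcos H_points s h \<Longrightarrow> F k x = F k h"
    and zero: "\<And>k. (\<Sum>C\<in>gcos H_points s ` {h \<in> DD. F k h \<noteq> 0}. F k (SOME h. h \<in> C)) = 0"
  shows "\<Phi> 0 0 = 0"
proof (rule ccontr)
  assume nz: "\<Phi> 0 0 \<noteq> 0"
  let ?P = "cyc uniformizer :: 'k ^ 'n ^ 'n"
  let ?G = "{a :: 'k ^ 'n ^ 'n. invertible a}"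
  let ?Q = "gcos ?G s"
  let ?n = "CARD('n)"
  note HG = mat_group_H_points[where 'a='k and 'b='n]
  note G = mat_group_invertible[where 'a='k and 'm='n]
  obtain p :: nat where p: "prime p" "absval (of_nat p :: 'k) < 1"
    using residue_char_exists by blast
  have p0: "of_nat p \<noteq> (0::'k)"
    using p(1) by auto
  define q where "q = card (?Q ` (GLO :: ('k ^ 'n ^ 'n) set))"
  have "finite (?Q ` (GLO :: ('k ^ 'n ^ 'n) set))"
    by (rule finite_gcos[OF G s, where b = 1]) (auto simp: GLO_mbound GLO_mbound[OF GLO_inv])
  then have q: "q \<noteq> 0"
    unfolding q_def by (auto simp: card_eq_0_iff intro: GLO_mat_1)
  \<comment> \<open>The slope of the affine function per step of \<open>k\<close>, without the
    number \<open>N\<close> of stable lattices, the only part that depends on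
    \<open>R\<close>.\<close>
  define D where "D = int ?n * (int q)\<^sup>2 * \<Phi> 0 0"
  have D: "D \<noteq> 0"
    unfolding D_def using q nz by simp
  \<comment> \<open>Large enough because p^R > R.\<close>
  define R where "R = nat \<bar>D\<bar>"
  \<comment> \<open>The factor \<open>p\<close> brings the norm below that of \<open>p\<close>,
    where p-th powers scale exactly; the factor \<Pi> makes the valuation 1 modulo n.\<close>
  let ?z0 = "mat (of_nat p) ** ?P"
  have z0E: "?z0 \<in> EE"
    by (intro EE_mult EE_mat EE_cyc)
  have z0n: "enorm ?z0 = absval (of_nat p :: 'k) ^ ?n * rabs TYPE('k)"
    by (simp add: enorm_mult[OF EE_mat] enorm_mat enorm_cyc)
  have pn: "0 < absval (of_nat p :: 'k) ^ ?n" "absval (of_nat p :: 'k) ^ ?n \<le> 1"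
    using p0 p(2) by (auto intro: power_le_one)
  have z0: "0 < enorm ?z0" "enorm ?z0 < absval (of_nat p :: 'k) ^ ?n"
    unfolding z0n using pn by auto
  have z01: "enorm ?z0 < 1"
    using z0(2) pn(2) by linarith
  define z where "z = mpow (mat 1 + ?z0) (p ^ R) - mat 1"
  have zE: "z \<in> EE"
    unfolding z_def by (intro EE_diff EE_mpow EE_add EE_mat z0E)
  obtain j where j: "absval (of_nat p :: 'k) = rabs TYPE('k) powi j"
    using absval_discrete[OF p0] .
  have j0: "j \<ge> 0"
  proof -
    have "rabs TYPE('k) powi j < rabs TYPE('k) powi 0"
      using p(2) j by simp
    then show ?thesis
      unfolding rabs_powi_less_iff by simp
  qed
  \<comment> \<open>The valuation of \<open>z\<close> in E: R + 1 factors \<open>p\<close>, each of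
    valuation n j, and one factor \<Pi>.\<close>
  define b where "b = int ?n * (int R + 1) * j + 1"
  have zn: "enorm z = rabs TYPE('k) powi b"
  proof -
    have "enorm z = absval (of_nat p :: 'k) ^ (?n * R) * enorm ?z0"
      unfolding z_def by (rule enorm_mpow_prime_power_eq[OF z0E z0])
    also have "\<dots> = absval (of_nat p :: 'k) ^ (?n * (R + 1)) * rabs TYPE('k)"
      unfolding z0n by (simp add: power_add)
    also have "\<dots> = (rabs TYPE('k) powi j) powi int (?n * (R + 1)) * rabs TYPE('k) powi 1"
      unfolding j by (simp only: power_int_of_nat power_int_1_right)
    also have "\<dots> = rabs TYPE('k) powi (j * int (?n * (R + 1)) + 1)"
      by (simp add: power_int_mult[symmetric] power_int_add)
    also have "j * int (?n * (R + 1)) + 1 = b"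
      by (simp add: b_def algebra_simps)
    finally show ?thesis .
  qed
  have bm: "b mod int ?n = 1 mod int ?n"
    unfolding b_def mult.assoc by (rule mod_mult_self4)
  have b0: "b \<ge> 0"
    unfolding b_def using j0 by simp
  let ?Z = "{a. absval (det a) = 1 \<and> mbound 1 (matrix_inv a ** z ** a)}"
  have finZ: "finite (?Q ` ?Z)"
    by (rule card_stable_lattices(1)[OF zE zn bm b0 p s])
  obtain N where N: "\<not> p dvd N" "card (?Q ` ?Z) = q * N"
    unfolding q_def using card_stable_lattices(2)[OF zE zn bm b0 p s] by blast
  have Zi: "invertible a" if "a \<in> ?Z" for a
    using that absval_det_1_invertible by blast
  have "\<forall>C\<in>?Q ` ?Z. \<exists>a. a \<in> ?Z \<and> ?Q a = C"
    by blast
  from bchoice[OF this] obtain r where r: "\<And>C. C \<in> ?Q ` ?Z \<Longrightarrow> r C \<in> ?Z" "\<And>C. C \<in> ?Q ` ?Z \<Longrightarrow> ?Q (r C) = C"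
    by blast
  define Rp where "Rp = r ` ?Q ` ?Z"
  have finR: "finite Rp"
    unfolding Rp_def using finZ by blast
  have RZ: "a \<in> ?Z" if "a \<in> Rp" for a
    using that r(1) unfolding Rp_def by blast
  have cardR: "card Rp = q * N"
    unfolding Rp_def N(2)[symmetric] using r(2) by (intro card_image inj_on_inverseI[of _ ?Q])
  have rQ: "r (?Q a) = a" if "a \<in> Rp" for a
    using that r(2) unfolding Rp_def by auto
  have rep: "\<exists>x\<in>Rp. x \<in> ?Q a" if "absval (det a) = 1" "mbound 1 (matrix_inv a ** z ** a)" for a
  proof -
    have a: "?Q a \<in> ?Q ` ?Z"
      using that by blast
    have "?Q (r (?Q a)) = ?Q a"
      by (rule r(2)[OF a])
    moreover have "invertible (r (?Q a))" "invertible a"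
      using Zi[OF r(1)[OF a]] Zi that by blast+
    ultimately have "r (?Q a) \<in> ?Q a"
      using gcos_eq_iff[OF G s, of a "r (?Q a)"] by simp
    then show ?thesis
      using a unfolding Rp_def by blast
  qed
  have uniq: "y = x" if "x \<in> Rp" "y \<in> Rp" "y \<in> ?Q x" for x y
  proof -
    have "?Q y = ?Q x"
      using gcos_eq_iff[OF G s, of x y] Zi[OF RZ[OF that(1)]] Zi[OF RZ[OF that(2)]] that(3) by simp
    then show ?thesis
      using rQ[OF that(1)] rQ[OF that(2)] by simp
  qed
  obtain J K :: int where J: "J \<ge> 1"
    and EJ: "\<And>c a j b. c \<ge> 1 \<Longrightarrow> a \<in> Rp \<Longrightarrow> b \<in> Rp \<Longrightarrow>
      \<Phi> (matrix_inv a ** mpowi ?P j ** b) (matrix_inv b ** mpowi ?P (c - j) ** a) \<noteq> 0 \<Longrightarrow> j \<in> {- J<..<c + J}"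
    and EK: "\<And>c. c \<ge> 2 * J \<Longrightarrow> (\<Sum>a\<in>Rp. \<Sum>b\<in>Rp. \<Sum>j\<in>{- J<..<c + J}.
      \<Phi> (matrix_inv a ** mpowi ?P j ** b) (matrix_inv b ** mpowi ?P (c - j) ** a)) = K + (c - 2 * J + 1) * (int (card Rp))\<^sup>2 * \<Phi> 0 0"
    using shifted_sum_affine[where \<Phi> = \<Phi>, OF M \<delta> bd small1 small2 finR Zi[OF RZ]] by blast
  have key: "int p ^ Suc R dvd K + (int (?n * k + 1) - 2 * J + 1) * (int (card Rp))\<^sup>2 * \<Phi> 0 0"
    if k: "int (?n * k + 1) \<ge> 2 * J" for k
  proof -
    let ?c = "int (?n * k + 1)"
    let ?S = "\<lambda>T. gcos H_points s ` {h \<in> DD. F k h \<noteq> 0 \<and> T h}"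
    let ?f = "\<lambda>C. F k (SOME h. h \<in> C)"
    have cm: "(?n * k + 1) mod ?n = 1 mod ?n"
      using mod_mult_self2[of 1 ?n k] by (simp only: add.commute)
    have fin: "finite (gcos H_points s ` {h \<in> DD. F k h \<noteq> 0})"
      by (rule finite_support_cosets[where \<Phi> = \<Phi>, OF bd M s cm _ F]) simp_all
    have FT: "F k (t ** h) = F k h" if "t \<in> TT" "h \<in> H_points" for t h
      by (rule torus_invariant[where \<Phi> = \<Phi>, OF F EE_mpowi_cyc that])
    have dvd: "int p ^ Suc R dvd sum ?f (?S (\<lambda>h. h \<notin> stable_pairs z))"
      unfolding z_def by (rule unstable_sum_dvd[OF z0E z01 p s FT FK fin])
    have Fm: "F k (block_diag a (mpowi ?P j ** b)) = \<Phi> (matrix_inv a ** mpowi ?P j ** b) (matrix_inv b ** mpowi ?P (?c - j) ** a)"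
      if ab: "a \<in> Rp" "b \<in> Rp" for a b j
    proof -
      have Pi: "invertible (mpowi ?P j)"
        by (rule invertible_mpowi[OF invertible_cyc_uniformizer])
      have ai: "invertible a" and bi: "invertible b"
        using Zi RZ ab by blast+
      have "mpowi ?P (- j) ** mpowi ?P ?c = mpowi ?P (?c - j)"
        using mpowi_add[OF invertible_cyc_uniformizer[where 'k='k and 'n='n], of "- j" ?c] by (simp add: add.commute)
      then have "matrix_inv (mpowi ?P j ** b) ** mpowi ?P ?c = matrix_inv b ** mpowi ?P (?c - j)"
        unfolding matrix_inv_mult[OF Pi bi] matrix_inv_mpowi[OF invertible_cyc_uniformizer]
        by (simp only: matrix_mul_assoc[symmetric])
      then show ?thesis
        unfolding F[OF ai invertible_mult[OF Pi bi]] by (simp add: matrix_mul_assoc)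
    qed
    have c1: "?c \<ge> 1"
      by simp
    have "sum ?f (?S (\<lambda>h. h \<in> stable_pairs z)) = (\<Sum>a\<in>Rp. \<Sum>b\<in>Rp. \<Sum>j\<in>{- J<..<?c + J}. F k (block_diag a (mpowi ?P j ** b)))"
    proof (rule stable_sum_eq[OF zE s FK finR _ rep uniq])
      show "j \<in> {- J<..<?c + J}" if "a \<in> Rp" "b \<in> Rp" "F k (block_diag a (mpowi ?P j ** b)) \<noteq> 0" for a b j
        using that(3) unfolding Fm[OF that(1,2)] by (rule EJ[OF c1 that(1,2)])
    qed (use RZ in auto)
    also have "\<dots> = K + (?c - 2 * J + 1) * (int (card Rp))\<^sup>2 * \<Phi> 0 0"
      unfolding EK[OF k, symmetric] by (intro sum.cong refl Fm)
    finally have st: "sum ?f (?S (\<lambda>h. h \<in> stable_pairs z)) = K + (?c - 2 * J + 1) * (int (card Rp))\<^sup>2 * \<Phi> 0 0" .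
    \<comment> \<open>Stability depends only on the two lattices, so it is constant on cosets, and
      the stable and unstable parts of the sum are disjoint.\<close>
    have stK: "x \<in> stable_pairs z" if h: "h \<in> H_points" "h \<in> stable_pairs z" and x: "x \<in> gcos H_points s h" for h x
    proof -
      obtain a b where ab: "h = block_diag a b" "invertible a" "invertible b"
        using h(1) H_points_cases by blast
      have "x \<in> H_points"
        using x by (simp add: gcos_def)
      then obtain a' b' where ab': "x = block_diag a' b'" "invertible a'" "invertible b'"
        using H_points_cases by blast
      have "a' \<in> ?Q a" "b' \<in> ?Q b"
        using x gcos_H_iff[OF ab(2,3) ab'(2,3), of s] unfolding ab(1) ab'(1) by auto
      then have k: "matrix_inv a ** a' \<in> GLO" "matrix_inv b ** b' \<in> GLO"
        using cong_sub_GLO[OF s(2)] gcos_iff_cong[OF G s, of a a'] gcos_iff_cong[OF G s, of b b'] ab by auto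
      show ?thesis
        using h(2) mbound_conj_GLO[OF ab(2) k(1), of z] mbound_conj_GLO[OF ab(3) k(2), of z] ab
        unfolding ab(1) ab'(1) block_diag_stable_pairs by simp
    qed
    have "0 = sum ?f (gcos H_points s ` {h \<in> DD. F k h \<noteq> 0})"
      using zero by simp
    also have "gcos H_points s ` {h \<in> DD. F k h \<noteq> 0} = ?S (\<lambda>h. h \<in> stable_pairs z) \<union> ?S (\<lambda>h. h \<notin> stable_pairs z)"
      unfolding image_Un[symmetric] by (intro arg_cong[where f = "\<lambda>A. gcos H_points s ` A"]) blast
    also have "sum ?f \<dots> = sum ?f (?S (\<lambda>h. h \<in> stable_pairs z)) + sum ?f (?S (\<lambda>h. h \<notin> stable_pairs z))"
    proof (rule sum.union_disjoint)
      show "finite (?S (\<lambda>h. h \<in> stable_pairs z))" "finite (?S (\<lambda>h. h \<notin> stable_pairs z))"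
        by (rule finite_subset[OF image_mono fin], blast)+
      show "?S (\<lambda>h. h \<in> stable_pairs z) \<inter> ?S (\<lambda>h. h \<notin> stable_pairs z) = {}"
      proof (rule ccontr)
        assume "?S (\<lambda>h. h \<in> stable_pairs z) \<inter> ?S (\<lambda>h. h \<notin> stable_pairs z) \<noteq> {}"
        then obtain h x where hx: "h \<in> DD" "h \<in> stable_pairs z" "x \<in> DD" "x \<notin> stable_pairs z"
            "gcos H_points s x = gcos H_points s h"
          by blast
        have H: "h \<in> H_points" "x \<in> H_points"
          using hx DD_sub by blast+
        have "x \<in> gcos H_points s h"
          using hx(5) gcos_eq_iff[OF HG s H] by blast
        then show False
          using stK[OF H(1) hx(2)] hx(4) by blast
      qed
    qed
    finally have "sum ?f (?S (\<lambda>h. h \<in> stable_pairs z)) = - sum ?f (?S (\<lambda>h. h \<notin> stable_pairs z))"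
      by linarith
    then show ?thesis
      using dvd unfolding st by (simp del: power_Suc)
  qed
  define k where "k = nat (2 * J)"
  have k1: "int (?n * k + 1) \<ge> 2 * J"
  proof -
    have "1 * k \<le> ?n * k"
      by (intro mult_right_mono) (simp_all add: Suc_leI)
    then have "int k \<le> int (?n * k)"
      by (simp only: of_nat_le_iff mult_1)
    moreover have "int k = 2 * J"
      using J by (simp add: k_def)
    ultimately show ?thesis
      by linarith
  qed
  moreover have "int (?n * Suc k + 1) \<ge> 2 * J"
    using k1 by simp
  \<comment> \<open>The constant \<open>K\<close> cancels, and the exponent grows by n from
    \<open>k\<close> to \<open>k + 1\<close>.\<close>
  ultimately have "int p ^ Suc R dvd (K + (int (?n * Suc k + 1) - 2 * J + 1) * (int (card Rp))\<^sup>2 * \<Phi> 0 0)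
      - (K + (int (?n * k + 1) - 2 * J + 1) * (int (card Rp))\<^sup>2 * \<Phi> 0 0)"
    by (intro dvd_diff key)
  also have "\<dots> = int ?n * (int (card Rp))\<^sup>2 * \<Phi> 0 0"
    by (simp add: algebra_simps)
  also have "\<dots> = D * (int N)\<^sup>2"
    unfolding cardR D_def by (simp add: power_mult_distrib algebra_simps)
  finally have dvd: "int p ^ Suc R dvd D * (int N)\<^sup>2" .
  have "coprime p N"
    using prime_imp_coprime[OF p(1)] N(1) by blast
  then have "coprime (int p ^ Suc R) ((int N)\<^sup>2)"
    by (simp add: coprime_power_left_iff coprime_power_right_iff del: power_Suc)
  then have "int p ^ Suc R dvd D"
    using dvd coprime_dvd_mult_left_iff by blast
  then have "\<bar>int p ^ Suc R\<bar> \<le> \<bar>D\<bar>"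
    by (rule dvd_imp_le_int[OF D])
  moreover have "int R < int p ^ R"
  proof -
    have "R < p ^ R"
      by (rule power_gt_expt[OF prime_gt_Suc_0_nat[OF p(1)]])
    then show ?thesis
      by (simp only: of_nat_power[symmetric] of_nat_less_iff)
  qed
  moreover have "int p ^ R \<le> int p ^ Suc R"
  proof (rule power_increasing)
    show "1 \<le> int p"
      using prime_gt_1_nat[OF p(1)] by linarith
  qed simp
  moreover have "int R = \<bar>D\<bar>"
    by (simp only: R_def int_nat_eq abs_ge_zero if_True)
  ultimately show False
    by linarith
qed

section \<open>The elliptic points y_k and the final contradiction\<close>

lemma mpow_mat: "mpow (mat c :: 'a::field ^ 'n::finite ^ 'n) k = mat (c ^ k)"
  by (induction k) (simp_all add: vec_eq_iff mat_def[of "_ * _"], simp add: mat_def)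

text \<open>As \<Pi>^n is scalar, exponents of the form nk + 1 give scalar multiples of \<Pi>; this
  makes ellipticity and the stabilizer uniform in \<open>k\<close>.\<close>

lemma mpowi_cyc_eq:
  "mpowi (cyc uniformizer :: 'k::nonarch_local_field ^ 'n::finite ^ 'n) (int (CARD('n) * k + 1)) = mat (uniformizer ^ k) ** cyc uniformizer"
proof -
  have "mpow (cyc uniformizer :: 'k ^ 'n ^ 'n) (CARD('n) * k + 1) = mpow (cyc uniformizer) (CARD('n) * k) ** mpow (cyc uniformizer) 1"
    by (rule mpow_add)
  also have "\<dots> = mat (uniformizer ^ k) ** cyc uniformizer"
    by (simp add: mpow_mult mpow_cyc_card mpow_mat)
  finally show ?thesis
    by (simp only: mpowi_of_nat)
qed

lemma stabilizer_cyc: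
  fixes X0 :: "'k::nonarch_local_field ^ 'n::finite ^ 'n"
  assumes "invertible (mat 1 - X0)" "X0 = mat c ** cyc uniformizer" "c \<noteq> 0"
  shows "stabilizer H_group X_action (coset (gmat (mat 1) X0)) = TT"
proof -
  have "h ** X0 = X0 ** h \<longleftrightarrow> h \<in> EE" for h :: "'k ^ 'n ^ 'n"
  proof -
    have "h ** X0 = mat c ** (h ** cyc uniformizer)"
      unfolding assms(2) by (simp only: matrix_mul_assoc mat_mult_commute[of c h])
    moreover have "X0 ** h = mat c ** (cyc uniformizer ** h)"
      unfolding assms(2) by (simp only: matrix_mul_assoc)
    moreover have "mat c ** A = mat c ** B \<longleftrightarrow> A = B" for A B :: "'k ^ 'n ^ 'n"
      using assms(3) by (auto simp: vec_eq_iff)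
    ultimately show ?thesis
      by (simp add: EE_def)
  qed
  moreover have "invertible h \<longleftrightarrow> h \<noteq> 0" if "h \<in> EE" for h :: "'k ^ 'n ^ 'n"
  proof -
    have "(0 :: 'k ^ 'n ^ 'n) = mat 0"
      by (simp add: vec_eq_iff mat_def)
    then have "det (0 :: 'k ^ 'n ^ 'n) = 0"
      by (metis det_0)
    then show ?thesis
      using EE_invertible[OF that] by (auto simp: invertible_det_nz)
  qed
  ultimately have "{block_diag h h | h. invertible h \<and> h ** X0 = X0 ** h} = TT"
    unfolding TT_def by blast
  then show ?thesis
    unfolding stabilizer_gmat[OF assms(1)] .
qed

lemma inv_H_group:
  assumes "h \<in> H_points"
  shows "inv\<^bsub>H_group\<^esub> h = matrix_inv h"
proof (rule group.inv_equality)
  show "group (H_group :: ('a, 'b) mat2n monoid)"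
    unfolding H_group_def by (rule subgroup.subgroup_is_group[OF subgroup_H_points group_GL])
qed (use assms H_points_inv[OF assms] H_points_invertible[OF assms] in \<open>auto simp: H_group_def GL_def\<close>)

theorem theoremA4:
  fixes f :: "('k::{nonarch_local_field, field_char_0}, 'n::finite) mat2n set \<Rightarrow> complex"
    and \<mu> :: "('k, 'n) mat2n measure"
    and \<tau> :: "('k, 'n) mat2n set \<Rightarrow> ('k, 'n) mat2n measure"
  assumes "haar_measure H_points \<mu>"
    and "\<And>y. H_regular_semisimple y \<Longrightarrow>
           haar_measure (stabilizer H_group X_action y) (\<tau> y)"
    and "f \<in> Cc_infty_X"
    and "f X_base \<noteq> 0"
  shows "\<exists>y\<in>X_points. H_regular_elliptic y \<and> orbital_integral \<mu> (\<tau> y) f y \<noteq> 0"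
proof (rule ccontr)
  assume contra: "\<not> ?thesis"
  note mu = assms(1)
  obtain s M \<delta> where s: "0 < s" "s < 1" and M: "M \<ge> 1" and \<delta>: "\<delta> > 0"
    and inv: "\<And>k x. k \<in> cong_sub s \<Longrightarrow> x \<in> X_points \<Longrightarrow> f (X_action k x) = f x"
    and bd: "\<And>A B. absval (det (mat 1 - A ** B)) = 1 \<Longrightarrow> f (coset (gmat A B)) \<noteq> 0 \<Longrightarrow> mbound M A \<and> mbound M B"
    and small1: "\<And>A B. mbound \<delta> A \<Longrightarrow> mbound M B \<Longrightarrow> f (coset (gmat A B)) = f (coset (gmat 0 B))"
    and small2: "\<And>A B. mbound M A \<Longrightarrow> mbound \<delta> B \<Longrightarrow> f (coset (gmat A B)) = f (coset (gmat A 0))"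
    and finf: "finite (f ` X_points)"
    by (rule test_function_gmat[OF assms(3)]) (rule that)
  note HG = mat_group_H_points[where 'a='k and 'b='n]
  have one: "gmat 0 0 = (mat 1 :: ('k, 'n) mat2n)"
    by (simp add: gmat_def mat_blk)
  have base: "f (coset (gmat 0 0)) = f X_base"
    unfolding one X_base_def ..
  have "X_base \<in> (X_points :: ('k, 'n) mat2n set set)"
    unfolding X_base_def by (rule coset_in_X_points) simp
  \<comment> \<open>Only finitely many values of \<open>f\<close> occur, so one functional makes
    them all integral and keeps the value at the base point nonzero.\<close>
  then obtain \<Lambda> :: "complex \<Rightarrow> int" where \<Lambda>: "\<Lambda> (f X_base) \<noteq> 0" "\<Lambda> 0 = 0"
    "\<And>(I :: ('k, 'n) mat2n set set) g. finite I \<Longrightarrow> (\<And>i. i \<in> I \<Longrightarrow> g i \<in> f ` X_points) \<Longrightarrow>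
      (\<Sum>i\<in>I. g i) = 0 \<Longrightarrow> (\<Sum>i\<in>I. \<Lambda> (g i)) = 0"
    using integer_valued_functional[OF finf assms(4), where 'i="('k, 'n) mat2n set"] by auto
  define Xk where "Xk k = (mpowi (cyc uniformizer) (int (CARD('n) * k + 1)) :: 'k ^ 'n ^ 'n)" for k
  define y where "y k = coset (gmat (mat 1) (Xk k))" for k
  define Fc where "Fc k h = f (X_action (m_inv H_group h) (y k))" for k h
  have Xi: "invertible (mat 1 - Xk k)" for k
    unfolding Xk_def by (rule absval_det_1_invertible[OF absval_det_one_minus_cyc]) simp
  have gi: "invertible (gmat (mat 1) (Xk k))" for k
    by (rule gmat_inverse(1)) (simp add: Xi)
  have yX: "y k \<in> X_points" for k
    unfolding y_def by (rule coset_in_X_points[OF gi])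
  have act: "X_action h (y k) \<in> X_points" if "invertible h" for h k
    unfolding y_def X_action_coset by (rule coset_in_X_points[OF invertible_mult[OF that gi]])
  have Xeq: "Xk k = mat (uniformizer ^ k) ** cyc uniformizer" for k
    unfolding Xk_def by (rule mpowi_cyc_eq)
  have ell: "H_regular_elliptic (y k)" for k
    using H_regular_elliptic_cyc[of "uniformizer ^ k", where 'n='n] Xi[of k] unfolding y_def Xeq by simp
  have stab: "stabilizer H_group X_action (y k) = TT" for k
    unfolding y_def by (rule stabilizer_cyc[OF Xi Xeq]) simp
  have tau: "haar_measure TT (\<tau> (y k))" for k
    using assms(2)[of "y k"] ell[of k] unfolding stab H_regular_elliptic_def by blast
  have orb: "(\<integral>R. Fc k (SOME h. h \<in> R) \<partial>(quotient_measure \<mu> TT (\<tau> (y k)))) = 0" for k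
  proof -
    have "orbital_integral \<mu> (\<tau> (y k)) f (y k) = 0"
      using contra yX[of k] ell[of k] by blast
    then show ?thesis
      unfolding orbital_integral_def stab orb_stab_fun_def Fc_def .
  qed
  have Fab: "Fc k (block_diag a b) = f (coset (gmat (matrix_inv a ** b) (matrix_inv b ** Xk k ** a)))"
    if ab: "invertible a" "invertible b" for k a b
  proof -
    have "inv\<^bsub>H_group\<^esub> (block_diag a b) = block_diag (matrix_inv a) (matrix_inv b)"
      using inv_H_group[of "block_diag a b"] ab by (simp add: block_diag_in_H block_diag_inverse)
    then show ?thesis
      unfolding Fc_def y_def using ab by (simp add: H_act_gmat)
  qed
  have FK: "Fc k x = Fc k h" if h: "h \<in> H_points" and x: "x \<in> gcos H_points s h" for k h x
  proof -
    have xH: "x \<in> H_points"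
      using x by (simp add: gcos_def)
    have hi: "invertible h" and xi: "invertible x"
      using h xH H_points_invertible by blast+
    let ?k = "matrix_inv h ** x"
    have kc: "?k \<in> cong_sub s"
      using gcos_iff_cong[OF HG s h] x by blast
    have ki: "invertible ?k"
      by (rule cong_sub_invertible[OF s(2) kc])
    have "matrix_inv ?k ** matrix_inv h = matrix_inv (h ** ?k)"
      by (rule matrix_inv_mult[OF hi ki, symmetric])
    also have "h ** ?k = x"
      using hi by simp
    finally have "X_action (matrix_inv x) (y k) = X_action (matrix_inv ?k) (X_action (matrix_inv h) (y k))"
      unfolding y_def X_action_coset by (simp only: matrix_mul_assoc)
    then show ?thesis
      unfolding Fc_def inv_H_group[OF h] inv_H_group[OF xH]
      using inv[OF cong_sub_inv[OF s(2) kc] act[OF invertible_matrix_inv[OF hi]]] by simp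
  qed
  have FT: "Fc k (t ** h) = Fc k h" if "t \<in> TT" "h \<in> H_points" for k t h
    by (rule torus_invariant[where \<Phi> = "\<lambda>A B. f (coset (gmat A B))", OF Fab _ that]) (simp_all add: Xk_def)
  have fin: "finite (gcos H_points s ` {h \<in> DD. Fc k h \<noteq> 0})" for k
  proof (rule finite_support_cosets[where \<Phi> = "\<lambda>A B. f (coset (gmat A B))", OF bd M s])
    show "(CARD('n) * k + 1) mod CARD('n) = 1 mod CARD('n)"
      using mod_mult_self2[of 1 "CARD('n)" k] by (simp only: add.commute)
  qed (use Fab in \<open>simp_all add: Xk_def\<close>)
  have Fsome: "Fc k (SOME x. x \<in> gcos H_points s h) = Fc k h" if "h \<in> H_points" for k h
    by (rule FK[OF that gcos_some_mem[OF s that]])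
  have sum0: "(\<Sum>C\<in>gcos H_points s ` {h \<in> DD. Fc k h \<noteq> 0}. Fc k (SOME h. h \<in> C)) = 0" for k
  proof -
    \<comment> \<open>A congruence subgroup of nonzero finite volume allows passing from the
      vanishing integral to the vanishing coset sum.\<close>
    have "measure \<mu> (gcos H_points s (mat 1)) \<noteq> 0"
      using haar_gcos(3,4)[OF mu s] by (simp add: measure_def enn2real_eq_0_iff)
    then show ?thesis
      using orbital_formula[where F = "Fc k", OF mu tau[of k] quotient_measure_exists[OF mu tau[of k]] s FT FK fin] orb[of k] by simp
  qed
  have zero: "(\<Sum>C\<in>gcos H_points s ` {h \<in> DD. \<Lambda> (Fc k h) \<noteq> 0}. \<Lambda> (Fc k (SOME h. h \<in> C))) = 0" for k
  proof -
    let ?S = "gcos H_points s ` {h \<in> DD. Fc k h \<noteq> 0}"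
    \<comment> \<open>Applying \<open>\<Lambda>\<close> may shrink the support; the cosets lost
      contribute 0, so the sum can be taken over the support of \<open>Fc k\<close>, where the
      complex relation holds.\<close>
    have "(\<Sum>C\<in>gcos H_points s ` {h \<in> DD. \<Lambda> (Fc k h) \<noteq> 0}. \<Lambda> (Fc k (SOME h. h \<in> C))) = (\<Sum>C\<in>?S. \<Lambda> (Fc k (SOME h. h \<in> C)))"
    proof (rule sum.mono_neutral_left[OF fin])
      show "gcos H_points s ` {h \<in> DD. \<Lambda> (Fc k h) \<noteq> 0} \<subseteq> ?S"
        using \<Lambda>(2) by (intro image_mono) auto
      show "\<forall>C\<in>?S - gcos H_points s ` {h \<in> DD. \<Lambda> (Fc k h) \<noteq> 0}. \<Lambda> (Fc k (SOME h. h \<in> C)) = 0"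
      proof
        fix C
        assume C: "C \<in> ?S - gcos H_points s ` {h \<in> DD. \<Lambda> (Fc k h) \<noteq> 0}"
        then obtain h where h: "h \<in> DD" "C = gcos H_points s h"
          by blast
        have hH: "h \<in> H_points"
          using h(1) DD_sub by blast
        show "\<Lambda> (Fc k (SOME h. h \<in> C)) = 0"
          unfolding h(2) Fsome[OF hH] using C h by blast
      qed
    qed
    also have "\<dots> = 0"
    proof (rule \<Lambda>(3)[OF fin _ sum0])
      fix C
      assume "C \<in> ?S"
      then obtain h where h: "h \<in> H_points" "C = gcos H_points s h"
        using DD_sub by blast
      show "Fc k (SOME h. h \<in> C) \<in> f ` X_points"
        unfolding h(2) Fsome[OF h(1)] unfolding Fc_def inv_H_group[OF h(1)]
        by (intro imageI act invertible_matrix_inv H_points_invertible h)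
    qed
    finally show ?thesis .
  qed
  \<comment> \<open>In coordinates the base point is (0, 0), whose value fills the middle range of
    exponents.\<close>
  have "\<Lambda> (f (coset (gmat 0 0))) = 0"
  proof (rule vanishing_sums_imp_zero[where \<Phi> = "\<lambda>A B. \<Lambda> (f (coset (gmat A B)))" and F = "\<lambda>k h. \<Lambda> (Fc k h)", OF M \<delta> _ _ _ s])
    show "mbound M A \<and> mbound M B" if "absval (det (mat 1 - A ** B)) = 1" "\<Lambda> (f (coset (gmat A B))) \<noteq> 0" for A B
      using that \<Lambda>(2) by (intro bd) auto
    show "\<Lambda> (f (coset (gmat A B))) = \<Lambda> (f (coset (gmat 0 B)))" if "mbound \<delta> A" "mbound M B" for A B
      using small1[OF that] by simp
    show "\<Lambda> (f (coset (gmat A B))) = \<Lambda> (f (coset (gmat A 0)))" if "mbound M A" "mbound \<delta> B" for A B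
      using small2[OF that] by simp
    show "\<Lambda> (Fc k (block_diag a b)) = \<Lambda> (f (coset (gmat (matrix_inv a ** b)
        (matrix_inv b ** mpowi (cyc uniformizer) (int (CARD('n) * k + 1)) ** a))))"
      if "invertible a" "invertible b" for k a b
      using Fab[OF that, of k] unfolding Xk_def by simp
    show "\<Lambda> (Fc k x) = \<Lambda> (Fc k h)" if "h \<in> H_points" "x \<in> gcos H_points s h" for k h x
      using FK[OF that] by simp
    show "(\<Sum>C\<in>gcos H_points s ` {h \<in> DD. \<Lambda> (Fc k h) \<noteq> 0}. \<Lambda> (Fc k (SOME h. h \<in> C))) = 0" for k
      by (rule zero)
  qed
  then show False
    using \<Lambda>(1) base by simp
qed

end
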